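(* Let $k\ge2$ and $n\ge 1$ be integers. If $A=\frac{\Bbbk Q}{J^k}$ is a truncated path algebra with $|Q_0|=n$, then $$\phi\dim(A)\le f_k(n).$$ Moreover, there exists a truncated path algebra $A=\frac{\Bbbk Q}{J^k}$ with $|Q_0|=n$ for which $\phi\dim(A)=f_k(n)$.
   Context: $\Bbbk$ is a field, quivers are finite and connected, $Q_0$ is the set of vertices of $Q$, $\Bbbk Q$ is the path algebra, and $J$ is the ideal generated by the arrows. A truncated path algebra is an algebra isomorphic to $\frac{\Bbbk Q}{J^k}$. For $k\ge2$ the function $f_k:\mathbb{N}\to\mathbb{N}$ is defined by $f_k(0)=0$ and, for $m\geq 1$, $$f_k(m)=\begin{cases}2\left(\frac{m-1}{k}\right)+1&\text{if } m\equiv1\pmod k,\\ 2\left(\frac{m-2}{k}\right)+2&\text{if } m\equiv2\pmod k,\\ 2\left\lceil\frac{m-2}{k}\right\rceil+1&\text{otherwise.}\end{cases}$$ Definition of $\phi\dim$. For a finite dimensional algebra $A$, modules are finitely generated right $A$-modules. $K_0(A)$ is the abelian group generated by symbols $[M]$, one for each finitely generated module $M$, modulo $[M]-[M']-[M'']$ whenever $M\cong M'\oplus M''$, and $[P]$ for each projective $P$. The syzygy $\Omega$ induces an endomorphism $\bar\Omega$ of $K_0(A)$. For a module $M$, $\langle\mathrm{add}\,M\rangle$ is the subgroup of $K_0(A)$ generated by the classes of the indecomposable direct summands of $M$, and $\phi(M)=\min\{l\in\mathbb{N}:\bar\Omega|_{\bar\Omega^{l+s}\langle\mathrm{add}\,M\rangle}\text{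 is a monomorphism for all }s\in\mathbb{N}\}$, with $0\in\mathbb{N}$. Finally $\phi\dim(A)=\sup\{\phi(M): M \text{ a finitely generated } A\text{-module}\}$. *)

theory Defs
  imports
    Complex_Main
    "HOL-Library.Extended_Nat"
    "Graph_Theory.Digraph_Component"
    "HOL-Algebra.Module"
    "HOL-Algebra.QuotRing"
    "HOL-Algebra.Ideal_Product"
    "HOL-Algebra.Generated_Groups"
    "HOL-Algebra.Free_Abelian_Groups"
begin

section \<open>Quivers and truncated path algebras\<close>

text \<open>Loops and parallel arrows are allowed; \<^const>\<open>Digraph_Component.connected\<close> refers to the
  underlying undirected graph and includes the existence of at least one vertex.\<close>

definition quiver :: "('v, 'e) pre_digraph \<Rightarrow> bool" where
  "quiver Q \<longleftrightarrow> fin_digraph Q \<and> Digraph_Component.connected Q"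

text \<open>A path is given by its start vertex and its list of arrows, in the order in which they are
  traversed; \<open>(u, [])\<close> is the trivial path at \<open>u\<close>.\<close>

definition qpaths :: "('v, 'e) pre_digraph \<Rightarrow> ('v \<times> 'e list) set" where
  "qpaths Q = {(u, p). \<exists>v. pre_digraph.awalk Q u p v}"

text \<open>Elements are finitely supported \<open>K\<close>-valued functions on paths. The product of two paths is
  their concatenation (first factor traversed first) if defined, and zero otherwise, so the
  coefficient of a path in a product is a sum over all ways to cut it in two.\<close>

definition path_algebra ::
  "('k, 'm) ring_scheme \<Rightarrow> ('v, 'e) pre_digraph \<Rightarrow> ('v \<times> 'e list \<Rightarrow> 'k) ring" where
  "path_algebra K Q =
    \<lparr>carrier = {f. (\<forall>x. f x \<in> carrier K) \<and> (\<forall>x. x \<notin> qpaths Q \<longrightarrow> f x = \<zero>\<^bsub>K\<^esub>)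
                  \<and> finite {x. f x \<noteq> \<zero>\<^bsub>K\<^esub>}},
     monoid.mult = (\<lambda>f g (u, p). \<Oplus>\<^bsub>K\<^esub>i\<in>{..length p}.
               f (u, take i p) \<otimes>\<^bsub>K\<^esub> g (last (pre_digraph.awalk_verts Q u (take i p)), drop i p)),
     monoid.one = (\<lambda>(u, p). if u \<in> verts Q \<and> p = [] then \<one>\<^bsub>K\<^esub> else \<zero>\<^bsub>K\<^esub>),
     ring.zero = (\<lambda>_. \<zero>\<^bsub>K\<^esub>),
     ring.add = (\<lambda>f g x. f x \<oplus>\<^bsub>K\<^esub> g x)\<rparr>"

definition arrow_elem ::
  "('k, 'm) ring_scheme \<Rightarrow> ('v, 'e) pre_digraph \<Rightarrow> 'e \<Rightarrow> ('v \<times> 'e list \<Rightarrow> 'k)" where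
  "arrow_elem K Q a = (\<lambda>x. if x = (tail Q a, [a]) then \<one>\<^bsub>K\<^esub> else \<zero>\<^bsub>K\<^esub>)"

definition arrow_ideal ::
  "('k, 'm) ring_scheme \<Rightarrow> ('v, 'e) pre_digraph \<Rightarrow> ('v \<times> 'e list \<Rightarrow> 'k) set" where
  "arrow_ideal K Q = genideal (path_algebra K Q) (arrow_elem K Q ` arcs Q)"

definition ideal_power :: "('a, 'm) ring_scheme \<Rightarrow> 'a set \<Rightarrow> nat \<Rightarrow> 'a set" where
  "ideal_power R I k = ((\<lambda>L. ideal_prod R L I) ^^ k) (carrier R)"

definition truncated_path_algebra ::
  "('k, 'm) ring_scheme \<Rightarrow> ('v, 'e) pre_digraph \<Rightarrow> nat \<Rightarrow> ('v \<times> 'e list \<Rightarrow> 'k) set ring" where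
  "truncated_path_algebra K Q k =
    path_algebra K Q Quot ideal_power (path_algebra K Q) (arrow_ideal K Q) k"


section \<open>Right modules\<close>

text \<open>The record of \<^theory>\<open>HOL-Algebra.Module\<close> is reused, but its locale is for commutative
  rings. Here \<open>r \<odot>\<^bsub>M\<^esub> x\<close> stands for \<open>x \<cdot> r\<close>, hence the order of the factors in \<open>smult_assoc\<close>.
  The multiplicative fields of the record play no role.\<close>

locale right_module = R?: ring R + M?: abelian_group M
  for R :: "('a, 'm) ring_scheme" (structure) and M :: "('a, 'b, 'n) module_scheme" (structure) +
  assumes smult_closed:
      "\<lbrakk>r \<in> carrier R; x \<in> carrier M\<rbrakk> \<Longrightarrow> r \<odot>\<^bsub>M\<^esub> x \<in> carrier M"
    and smult_l_distr:
      "\<lbrakk>r \<in> carrier R; s \<in> carrier R; x \<in> carrier M\<rbrakk> \<Longrightarrow>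
        (r \<oplus>\<^bsub>R\<^esub> s) \<odot>\<^bsub>M\<^esub> x = r \<odot>\<^bsub>M\<^esub> x \<oplus>\<^bsub>M\<^esub> s \<odot>\<^bsub>M\<^esub> x"
    and smult_r_distr:
      "\<lbrakk>r \<in> carrier R; x \<in> carrier M; y \<in> carrier M\<rbrakk> \<Longrightarrow>
        r \<odot>\<^bsub>M\<^esub> (x \<oplus>\<^bsub>M\<^esub> y) = r \<odot>\<^bsub>M\<^esub> x \<oplus>\<^bsub>M\<^esub> r \<odot>\<^bsub>M\<^esub> y"
    and smult_assoc:
      "\<lbrakk>r \<in> carrier R; s \<in> carrier R; x \<in> carrier M\<rbrakk> \<Longrightarrow>
        s \<odot>\<^bsub>M\<^esub> (r \<odot>\<^bsub>M\<^esub> x) = (r \<otimes>\<^bsub>R\<^esub> s) \<odot>\<^bsub>M\<^esub> x"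
    and smult_one:
      "x \<in> carrier M \<Longrightarrow> \<one>\<^bsub>R\<^esub> \<odot>\<^bsub>M\<^esub> x = x"

definition fin_gen :: "('a, 'm) ring_scheme \<Rightarrow> ('a, 'b, 'n) module_scheme \<Rightarrow> bool" where
  "fin_gen R M \<longleftrightarrow> (\<exists>S. finite S \<and> S \<subseteq> carrier M \<and>
      (\<forall>U. submodule U R M \<and> S \<subseteq> U \<longrightarrow> U = carrier M))"

text \<open>Modules are taken with carriers in \<^typ>\<open>'a list\<close>, where \<^typ>\<open>'a\<close> is the type of the ring
  elements. This loses nothing: a module with \<open>n\<close> generators is a quotient of \<open>R\<^sup>n\<close>, so choosing
  preimages embeds it into the lists of length \<open>n\<close>.\<close>

definition fg_modules :: "('a, 'm) ring_scheme \<Rightarrow> ('a, 'a list) module set" where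
  "fg_modules R = {M. right_module R M \<and> fin_gen R M}"

definition rmod_hom ::
  "('a, 'm) ring_scheme \<Rightarrow> ('a, 'b, 'n) module_scheme \<Rightarrow> ('a, 'c, 'p) module_scheme \<Rightarrow> ('b \<Rightarrow> 'c) set"
  where
  "rmod_hom R M N = {h. h \<in> hom (add_monoid M) (add_monoid N) \<and>
      (\<forall>r\<in>carrier R. \<forall>x\<in>carrier M. h (r \<odot>\<^bsub>M\<^esub> x) = r \<odot>\<^bsub>N\<^esub> h x)}"

definition rmod_iso ::
  "('a, 'm) ring_scheme \<Rightarrow> ('a, 'b, 'n) module_scheme \<Rightarrow> ('a, 'c, 'p) module_scheme \<Rightarrow> bool" where
  "rmod_iso R M N \<longleftrightarrow> (\<exists>h\<in>rmod_hom R M N. bij_betw h (carrier M) (carrier N))"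

definition direct_sum ::
  "('a, 'b, 'n) module_scheme \<Rightarrow> ('a, 'c, 'p) module_scheme \<Rightarrow> ('a, 'b \<times> 'c) module" where
  "direct_sum M N =
    \<lparr>carrier = carrier M \<times> carrier N, monoid.mult = (\<lambda>_ _. undefined), monoid.one = undefined,
     ring.zero = (\<zero>\<^bsub>M\<^esub>, \<zero>\<^bsub>N\<^esub>), ring.add = (\<lambda>(x, y) (x', y'). (x \<oplus>\<^bsub>M\<^esub> x', y \<oplus>\<^bsub>N\<^esub> y')),
     module.smult = (\<lambda>r (x, y). (r \<odot>\<^bsub>M\<^esub> x, r \<odot>\<^bsub>N\<^esub> y))\<rparr>"

definition indecomposable :: "('a, 'm) ring_scheme \<Rightarrow> ('a, 'a list) module \<Rightarrow> bool" where
  "indecomposable R M \<longleftrightarrow> carrier M \<noteq> {\<zero>\<^bsub>M\<^esub>} \<and>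
    (\<forall>(N :: ('a, 'a list) module) (N' :: ('a, 'a list) module).
        right_module R N \<and> right_module R N' \<and> rmod_iso R M (direct_sum N N') \<longrightarrow>
        carrier N = {\<zero>\<^bsub>N\<^esub>} \<or> carrier N' = {\<zero>\<^bsub>N'\<^esub>})"

text \<open>For finitely generated \<open>P\<close>, testing the lifting property on modules with carriers in
  \<^typ>\<open>'a list\<close> suffices, since these include the free modules \<open>R\<^sup>n\<close> up to isomorphism.\<close>

definition projective :: "('a, 'm) ring_scheme \<Rightarrow> ('a, 'a list) module \<Rightarrow> bool" where
  "projective R P \<longleftrightarrow>
    (\<forall>(N :: ('a, 'a list) module) (N' :: ('a, 'a list) module) g f.
        right_module R N \<and> right_module R N' \<and>
        g \<in> rmod_hom R N N' \<and> g ` carrier N = carrier N' \<and> f \<in> rmod_hom R P N' \<longrightarrow>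
        (\<exists>h\<in>rmod_hom R P N. \<forall>x\<in>carrier P. g (h x) = f x))"

definition rmod_ker ::
  "('a, 'b) module \<Rightarrow> ('a, 'c, 'p) module_scheme \<Rightarrow> ('b \<Rightarrow> 'c) \<Rightarrow> ('a, 'b) module" where
  "rmod_ker M N h = M\<lparr>carrier := {x \<in> carrier M. h x = \<zero>\<^bsub>N\<^esub>}\<rparr>"

text \<open>A projective cover: an epimorphism from a projective module whose kernel is superfluous.\<close>

definition projective_cover ::
  "('a, 'm) ring_scheme \<Rightarrow> ('a, 'a list) module \<Rightarrow> ('a, 'a list) module \<Rightarrow> ('a list \<Rightarrow> 'a list) \<Rightarrow> bool"
  where
  "projective_cover R M P p \<longleftrightarrow>
    P \<in> fg_modules R \<and> projective R P \<and> p \<in> rmod_hom R P M \<and> p ` carrier P = carrier M \<and>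
    (\<forall>U. submodule U R P \<and> U <+>\<^bsub>P\<^esub> carrier (rmod_ker P M p) = carrier P \<longrightarrow> U = carrier P)"

text \<open>Projective covers of finitely generated modules exist over a finite dimensional algebra and
  are unique up to isomorphism, so the syzygy is well defined up to isomorphism.\<close>

definition syzygy :: "('a, 'm) ring_scheme \<Rightarrow> ('a, 'a list) module \<Rightarrow> ('a, 'a list) module" where
  "syzygy R M = (let (P, p) = (SOME (P, p). projective_cover R M P p) in rmod_ker P M p)"


section \<open>The group \<open>K\<^sub>0\<close> and the Igusa-Todorov dimension\<close>

definition module_frags :: "('a, 'm) ring_scheme \<Rightarrow> (('a, 'a list) module \<Rightarrow>\<^sub>0 int) monoid" where
  "module_frags R = free_Abelian_group (fg_modules R)"

definition K0_relations :: "('a, 'm) ring_scheme \<Rightarrow> (('a, 'a list) module \<Rightarrow>\<^sub>0 int) set" where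
  "K0_relations R = generate (module_frags R)
     ({frag_of M - frag_of M' - frag_of M'' | M M' M''.
         M \<in> fg_modules R \<and> M' \<in> fg_modules R \<and> M'' \<in> fg_modules R \<and>
         rmod_iso R M (direct_sum M' M'')} \<union>
      {frag_of P | P. P \<in> fg_modules R \<and> projective R P})"

definition K0 :: "('a, 'm) ring_scheme \<Rightarrow> (('a, 'a list) module \<Rightarrow>\<^sub>0 int) set monoid" where
  "K0 R = module_frags R Mod K0_relations R"

definition K0_class ::
  "('a, 'm) ring_scheme \<Rightarrow> ('a, 'a list) module \<Rightarrow> (('a, 'a list) module \<Rightarrow>\<^sub>0 int) set" where
  "K0_class R M = K0_relations R #>\<^bsub>module_frags R\<^esub> frag_of M"

text \<open>The endomorphism of \<^term>\<open>K0 R\<close> induced by \<open>[M] \<mapsto> [\<Omega> M]\<close>: it sends the coset of a formal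
  combination of modules to the coset of the corresponding combination of their syzygies.
  For a finite dimensional algebra the image below is a singleton.\<close>

definition Omega_bar ::
  "('a, 'm) ring_scheme \<Rightarrow> (('a, 'a list) module \<Rightarrow>\<^sub>0 int) set \<Rightarrow> (('a, 'a list) module \<Rightarrow>\<^sub>0 int) set"
  where
  "Omega_bar R X = the_elem
     ((\<lambda>c. K0_relations R #>\<^bsub>module_frags R\<^esub> frag_extend (\<lambda>M. frag_of (syzygy R M)) c) ` X)"

definition add_span ::
  "('a, 'm) ring_scheme \<Rightarrow> ('a, 'a list) module \<Rightarrow> (('a, 'a list) module \<Rightarrow>\<^sub>0 int) set set" where
  "add_span R M = generate (K0 R)
     {K0_class R N | N. N \<in> fg_modules R \<and> indecomposable R N \<and>
        (\<exists>N'\<in>fg_modules R. rmod_iso R M (direct_sum N N'))}"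

definition phi :: "('a, 'm) ring_scheme \<Rightarrow> ('a, 'a list) module \<Rightarrow> nat" where
  "phi R M = (LEAST l. \<forall>s. inj_on (Omega_bar R) ((Omega_bar R ^^ (l + s)) ` add_span R M))"

definition phi_dim :: "('a, 'm) ring_scheme \<Rightarrow> enat" where
  "phi_dim R = (SUP M\<in>fg_modules R. enat (phi R M))"


section \<open>The bound\<close>

text \<open>The natural-number divisions in the first two cases are exact.\<close>

definition f_bound :: "nat \<Rightarrow> nat \<Rightarrow> nat" where
  "f_bound k m =
    (if m = 0 then 0
     else if m mod k = 1 mod k then 2 * ((m - 1) div k) + 1
     else if m mod k = 2 mod k then 2 * ((m - 2) div k) + 2
     else 2 * nat \<lceil>(real m - 2) / real k\<rceil> + 1)"

end

(*
  Write C(v,j) = e_v A / e_v J^j. Every submodule of a projective module is a direct sum of such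
  modules, so the classes in the image of the syzygy operator are combinations of the [C(v,j)] with
  0 < j < k. The syzygy of C(v,j) is the sum of the C(w,k-j) over all paths of length j from v to w,
  so the iterates of the operator on these classes are given by the powers N^(k*i) and N^(k*i+k-j)
  of the adjacency matrix N. The only relations between the classes are [C(v,j)] = 0 if no path of
  length j starts at v. The kernels of the powers of N are stationary from N^(n-1) on, unless N is
  nilpotent; then there are no paths of length n, and the relations have the same effect. Finally
  f_k(n) - 1 is the least d for which all exponents in the d-th iterate are at least n - 1.

  The bound is attained by the quiver with vertices 0, ..., n-1 and arrows i -> 0 and
  i -> min(i+1, n-1): there row i of N minus row i+1 is e_(i+1) - e_(i+2), so e_0 - e_1 survives
  as long as possible, and [C(0,1)] - [C(1,1)] is a syzygy of a difference of two local modules.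
*)
theory Submission
  imports Defs "HOL-Library.Function_Algebras"
begin

section \<open>Right modules, homomorphisms and direct sums\<close>

text \<open>Three difficulties shape the proof. \<open>syzygy\<close> takes a projective cover by
  choice, so its value is controlled only up to isomorphism; Schanuel's lemma turns this into a
  computation modulo \<open>K0_relations\<close> in which any projective presentation may replace
  the cover. Next, independence of the classes [C(v,j)] would usually be read off from
  Krull-Schmidt; here an additive invariant, the dimension of Hom(C(v,j), M) modulo the maps into
  the radical, recovers the coefficients. Dimensions are counted by flags of subspaces. Finally,
  kernels of powers of an n by n matrix are in general stationary only from the n-th power on. The
  gain of one rests on this: a vector that dies exactly at the n-th power generates a full Jordan
  block, so N is nilpotent.

  The three branches of f_k come from the least exponents 0, 1, k, k+1, 2k, ... of the iterates,
  which grow alternately by 1 and by k-1; one more step is spent because a syzygy must be taken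
  before the classes [C(v,j)] appear.

  All module theory is done over a ring whose elements are given by their coefficients on short
  paths; cosets of J^k enter only in the last section.\<close>

context right_module
begin

declare smult_closed [simp, intro] smult_one [simp]

lemma smult_l_null [simp]: "x \<in> carrier M \<Longrightarrow> \<zero> \<odot>\<^bsub>M\<^esub> x = \<zero>\<^bsub>M\<^esub>"
  using smult_l_distr[of \<zero> \<zero> x] smult_closed[of \<zero> x] M.add.r_cancel_one' by fastforce

lemma smult_r_null [simp]: "r \<in> carrier R \<Longrightarrow> r \<odot>\<^bsub>M\<^esub> \<zero>\<^bsub>M\<^esub> = \<zero>\<^bsub>M\<^esub>"
  using smult_r_distr[of r "\<zero>\<^bsub>M\<^esub>" "\<zero>\<^bsub>M\<^esub>"] smult_closed[of r "\<zero>\<^bsub>M\<^esub>"] M.add.r_cancel_one'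
  by fastforce

lemma smult_l_minus:
  "\<lbrakk>r \<in> carrier R; x \<in> carrier M\<rbrakk> \<Longrightarrow> (\<ominus> r) \<odot>\<^bsub>M\<^esub> x = \<ominus>\<^bsub>M\<^esub> (r \<odot>\<^bsub>M\<^esub> x)"
  using smult_l_distr[of "\<ominus> r" r x] smult_closed[of r x] smult_closed[of "\<ominus> r" x]
  by (simp add: R.l_neg smult_l_null M.minus_equality)

lemma smult_r_minus:
  "\<lbrakk>r \<in> carrier R; x \<in> carrier M\<rbrakk> \<Longrightarrow> r \<odot>\<^bsub>M\<^esub> (\<ominus>\<^bsub>M\<^esub> x) = \<ominus>\<^bsub>M\<^esub> (r \<odot>\<^bsub>M\<^esub> x)"
  using smult_r_distr[of r "\<ominus>\<^bsub>M\<^esub> x" x] smult_closed[of r x] smult_closed[of r "\<ominus>\<^bsub>M\<^esub> x"]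
  by (simp add: M.l_neg smult_r_null M.minus_equality)

text \<open>Negation is a scalar multiplication. Hence closure under sums and scalars suffices for a
  submodule, and additive maps that respect scalars also respect negation.\<close>

lemma neg_eq: "x \<in> carrier M \<Longrightarrow> \<ominus>\<^bsub>M\<^esub> x = (\<ominus> \<one>) \<odot>\<^bsub>M\<^esub> x"
  by (simp add: smult_l_minus smult_one)

lemma submoduleI:
  assumes "H \<subseteq> carrier M" "\<zero>\<^bsub>M\<^esub> \<in> H" "\<And>x y. x \<in> H \<Longrightarrow> y \<in> H \<Longrightarrow> x \<oplus>\<^bsub>M\<^esub> y \<in> H"
    "\<And>r x. r \<in> carrier R \<Longrightarrow> x \<in> H \<Longrightarrow> r \<odot>\<^bsub>M\<^esub> x \<in> H"
  shows "submodule H R M"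
proof (intro submodule.intro subgroup.intro submodule_axioms.intro)
  show "inv\<^bsub>add_monoid M\<^esub> x \<in> H" if "x \<in> H" for x
    using that assms(1) assms(4)[of "\<ominus> \<one>" x] neg_eq[of x] by (auto simp: a_inv_def)
qed (use assms in auto)

lemma submoduleD:
  assumes "submodule H R M"
  shows "H \<subseteq> carrier M" "\<zero>\<^bsub>M\<^esub> \<in> H" "\<And>x y. x \<in> H \<Longrightarrow> y \<in> H \<Longrightarrow> x \<oplus>\<^bsub>M\<^esub> y \<in> H"
    "\<And>r x. r \<in> carrier R \<Longrightarrow> x \<in> H \<Longrightarrow> r \<odot>\<^bsub>M\<^esub> x \<in> H"
    "\<And>x. x \<in> H \<Longrightarrow> \<ominus>\<^bsub>M\<^esub> x \<in> H" "\<And>x y. x \<in> H \<Longrightarrow> y \<in> H \<Longrightarrow> x \<ominus>\<^bsub>M\<^esub> y \<in> H"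
proof -
  interpret H: submodule H R M by fact
  show 1: "H \<subseteq> carrier M" "\<zero>\<^bsub>M\<^esub> \<in> H" "\<And>x y. x \<in> H \<Longrightarrow> y \<in> H \<Longrightarrow> x \<oplus>\<^bsub>M\<^esub> y \<in> H"
    "\<And>r x. r \<in> carrier R \<Longrightarrow> x \<in> H \<Longrightarrow> r \<odot>\<^bsub>M\<^esub> x \<in> H"
    using H.subset H.one_closed H.m_closed H.smult_closed by auto
  show 2: "\<And>x. x \<in> H \<Longrightarrow> \<ominus>\<^bsub>M\<^esub> x \<in> H" using H.m_inv_closed by (simp add: a_inv_def)
  show "\<And>x y. x \<in> H \<Longrightarrow> y \<in> H \<Longrightarrow> x \<ominus>\<^bsub>M\<^esub> y \<in> H" using 1 2 by (simp add: a_minus_def)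
qed

end

lemma right_moduleI:
  fixes R :: "('a, 'm) ring_scheme" and M :: "('a, 'b, 'n) module_scheme"
  assumes "ring R"
    and "\<zero>\<^bsub>M\<^esub> \<in> carrier M"
    and "\<And>x y. \<lbrakk>x \<in> carrier M; y \<in> carrier M\<rbrakk> \<Longrightarrow> x \<oplus>\<^bsub>M\<^esub> y \<in> carrier M"
    and "\<And>x y z. \<lbrakk>x \<in> carrier M; y \<in> carrier M; z \<in> carrier M\<rbrakk> \<Longrightarrow>
           (x \<oplus>\<^bsub>M\<^esub> y) \<oplus>\<^bsub>M\<^esub> z = x \<oplus>\<^bsub>M\<^esub> (y \<oplus>\<^bsub>M\<^esub> z)"
    and "\<And>x y. \<lbrakk>x \<in> carrier M; y \<in> carrier M\<rbrakk> \<Longrightarrow> x \<oplus>\<^bsub>M\<^esub> y = y \<oplus>\<^bsub>M\<^esub> x"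
    and "\<And>x. x \<in> carrier M \<Longrightarrow> \<zero>\<^bsub>M\<^esub> \<oplus>\<^bsub>M\<^esub> x = x"
    and "\<And>x. x \<in> carrier M \<Longrightarrow> \<exists>y\<in>carrier M. y \<oplus>\<^bsub>M\<^esub> x = \<zero>\<^bsub>M\<^esub>"
    and "\<And>r x. \<lbrakk>r \<in> carrier R; x \<in> carrier M\<rbrakk> \<Longrightarrow> r \<odot>\<^bsub>M\<^esub> x \<in> carrier M"
    and "\<And>r s x. \<lbrakk>r \<in> carrier R; s \<in> carrier R; x \<in> carrier M\<rbrakk> \<Longrightarrow>
        (r \<oplus>\<^bsub>R\<^esub> s) \<odot>\<^bsub>M\<^esub> x = r \<odot>\<^bsub>M\<^esub> x \<oplus>\<^bsub>M\<^esub> s \<odot>\<^bsub>M\<^esub> x"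
    and "\<And>r x y. \<lbrakk>r \<in> carrier R; x \<in> carrier M; y \<in> carrier M\<rbrakk> \<Longrightarrow>
        r \<odot>\<^bsub>M\<^esub> (x \<oplus>\<^bsub>M\<^esub> y) = r \<odot>\<^bsub>M\<^esub> x \<oplus>\<^bsub>M\<^esub> r \<odot>\<^bsub>M\<^esub> y"
    and "\<And>r s x. \<lbrakk>r \<in> carrier R; s \<in> carrier R; x \<in> carrier M\<rbrakk> \<Longrightarrow>
        s \<odot>\<^bsub>M\<^esub> (r \<odot>\<^bsub>M\<^esub> x) = (r \<otimes>\<^bsub>R\<^esub> s) \<odot>\<^bsub>M\<^esub> x"
    and "\<And>x. x \<in> carrier M \<Longrightarrow> \<one>\<^bsub>R\<^esub> \<odot>\<^bsub>M\<^esub> x = x"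
  shows "right_module R M"
  by (intro right_module.intro abelian_groupI right_module_axioms.intro) (use assms in auto)

lemma (in right_module) submodule_right_module:
  assumes "submodule H R M"
  shows "right_module R (M\<lparr>carrier := H\<rparr>)"
proof (rule right_moduleI)
  note D = submoduleD[OF assms]
  fix x assume "x \<in> carrier (M\<lparr>carrier := H\<rparr>)"
  then show "\<exists>y\<in>carrier (M\<lparr>carrier := H\<rparr>). y \<oplus>\<^bsub>M\<lparr>carrier := H\<rparr>\<^esub> x = \<zero>\<^bsub>M\<lparr>carrier := H\<rparr>\<^esub>"
    using D(1,5) by (intro bexI[of _ "\<ominus>\<^bsub>M\<^esub> x"]) (auto simp: M.l_neg)
qed (use submoduleD[OF assms] in \<open>auto simp: R.ring_axioms M.a_ac subset_iff
    smult_l_distr smult_r_distr smult_assoc smult_one\<close>)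

lemma rmod_homI:
  assumes "\<And>x. x \<in> carrier M \<Longrightarrow> h x \<in> carrier N"
    and "\<And>x y. x \<in> carrier M \<Longrightarrow> y \<in> carrier M \<Longrightarrow> h (x \<oplus>\<^bsub>M\<^esub> y) = h x \<oplus>\<^bsub>N\<^esub> h y"
    and "\<And>r x. r \<in> carrier R \<Longrightarrow> x \<in> carrier M \<Longrightarrow> h (r \<odot>\<^bsub>M\<^esub> x) = r \<odot>\<^bsub>N\<^esub> h x"
  shows "h \<in> rmod_hom R M N"
  using assms by (auto simp: rmod_hom_def hom_def)

lemma rmod_homD:
  assumes "h \<in> rmod_hom R M N"
  shows "x \<in> carrier M \<Longrightarrow> h x \<in> carrier N"
    and "x \<in> carrier M \<Longrightarrow> y \<in> carrier M \<Longrightarrow> h (x \<oplus>\<^bsub>M\<^esub> y) = h x \<oplus>\<^bsub>N\<^esub> h y"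
    and "r \<in> carrier R \<Longrightarrow> x \<in> carrier M \<Longrightarrow> h (r \<odot>\<^bsub>M\<^esub> x) = r \<odot>\<^bsub>N\<^esub> h x"
  using assms by (auto simp: rmod_hom_def hom_def)

lemma rmod_hom_zero:
  assumes "right_module R M" "right_module R N" "h \<in> rmod_hom R M N"
  shows "h \<zero>\<^bsub>M\<^esub> = \<zero>\<^bsub>N\<^esub>"
proof -
  interpret M: right_module R M by fact
  interpret N: right_module R N by fact
  have "h \<zero>\<^bsub>M\<^esub> = h (\<zero>\<^bsub>R\<^esub> \<odot>\<^bsub>M\<^esub> \<zero>\<^bsub>M\<^esub>)" by (simp add: M.smult_l_null)
  also have "\<dots> = \<zero>\<^bsub>N\<^esub>"
    using rmod_homD(3)[OF assms(3), of "\<zero>\<^bsub>R\<^esub>" "\<zero>\<^bsub>M\<^esub>"] rmod_homD(1)[OF assms(3), of "\<zero>\<^bsub>M\<^esub>"]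
    by (simp add: N.smult_l_null)
  finally show ?thesis .
qed

lemma rmod_hom_minus:
  assumes "right_module R M" "right_module R N" "h \<in> rmod_hom R M N" "x \<in> carrier M"
  shows "h (\<ominus>\<^bsub>M\<^esub> x) = \<ominus>\<^bsub>N\<^esub> (h x)"
proof -
  interpret M: right_module R M by fact
  interpret N: right_module R N by fact
  show ?thesis
    using rmod_homD[OF assms(3)] assms(4) by (simp add: M.neg_eq N.neg_eq)
qed

lemma rmod_hom_diff:
  assumes "right_module R M" "right_module R N" "h \<in> rmod_hom R M N" "x \<in> carrier M" "y \<in> carrier M"
  shows "h (x \<ominus>\<^bsub>M\<^esub> y) = h x \<ominus>\<^bsub>N\<^esub> h y"
proof -
  interpret M: right_module R M by fact
  show ?thesis
    using rmod_homD[OF assms(3)] rmod_hom_minus[OF assms(1-3)] assms(4,5) by (simp add: a_minus_def)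
qed

lemma rmod_hom_id: "(\<lambda>x. x) \<in> rmod_hom R M M"
  by (auto intro: rmod_homI)

lemma rmod_hom_comp:
  assumes "h \<in> rmod_hom R M N" "g \<in> rmod_hom R N L"
  shows "(\<lambda>x. g (h x)) \<in> rmod_hom R M L"
  using rmod_homD[OF assms(1)] rmod_homD[OF assms(2)] by (auto intro!: rmod_homI)

lemma submodule_vimage:
  assumes "right_module R M" "right_module R N" "h \<in> rmod_hom R M N" "submodule U R N"
  shows "submodule {x \<in> carrier M. h x \<in> U} R M"
proof -
  interpret M: right_module R M by fact
  interpret N: right_module R N by fact
  show ?thesis
    using rmod_homD[OF assms(3)] N.submoduleD[OF assms(4)] rmod_hom_zero[OF assms(1-3)]
    by (intro M.submoduleI) (auto simp: M.smult_closed)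
qed

lemma submodule_image:
  assumes "right_module R M" "right_module R N" "h \<in> rmod_hom R M N" "submodule U R M"
  shows "submodule (h ` U) R N"
proof -
  interpret M: right_module R M by fact
  interpret N: right_module R N by fact
  note D = M.submoduleD[OF assms(4)] rmod_homD[OF assms(3)]
  show ?thesis
  proof (rule N.submoduleI)
    show "\<zero>\<^bsub>N\<^esub> \<in> h ` U" using rmod_hom_zero[OF assms(1-3)] D(2) by (metis imageI)
    show "x \<oplus>\<^bsub>N\<^esub> y \<in> h ` U" if "x \<in> h ` U" "y \<in> h ` U" for x y
      using that D by (auto simp: subset_iff) (metis imageI)
    show "r \<odot>\<^bsub>N\<^esub> x \<in> h ` U" if "r \<in> carrier R" "x \<in> h ` U" for r x
      using that D by (auto simp: subset_iff) (metis imageI)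
  qed (use D in auto)
qed

lemma (in right_module) submodule_zero: "submodule {\<zero>\<^bsub>M\<^esub>} R M"
  by (rule submoduleI) (auto simp: smult_r_null)

lemma (in right_module) submodule_carrier: "submodule (carrier M) R M"
  by (rule submoduleI) (auto simp: smult_closed)

lemma rmod_ker_submodule:
  assumes "right_module R M" "right_module R N" "h \<in> rmod_hom R M N"
  shows "submodule {x \<in> carrier M. h x = \<zero>\<^bsub>N\<^esub>} R M"
  using submodule_vimage[OF assms right_module.submodule_zero[OF assms(2)]] by simp

lemma rmod_ker_right_module:
  assumes "right_module R M" "right_module R N" "h \<in> rmod_hom R M N"
  shows "right_module R (rmod_ker M N h)"
  unfolding rmod_ker_def
  by (rule right_module.submodule_right_module[OF assms(1) rmod_ker_submodule[OF assms]])

lemma carrier_rmod_ker: "carrier (rmod_ker M N h) = {x \<in> carrier M. h x = \<zero>\<^bsub>N\<^esub>}"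
  and rmod_ker_simps: "\<zero>\<^bsub>rmod_ker M N h\<^esub> = \<zero>\<^bsub>M\<^esub>" "x \<oplus>\<^bsub>rmod_ker M N h\<^esub> y = x \<oplus>\<^bsub>M\<^esub> y"
    "r \<odot>\<^bsub>rmod_ker M N h\<^esub> x = r \<odot>\<^bsub>M\<^esub> x"
  by (simp_all add: rmod_ker_def)

section \<open>Direct sums, isomorphisms and splittings\<close>

lemma direct_sum_simps:
  "carrier (direct_sum M N) = carrier M \<times> carrier N"
  "\<zero>\<^bsub>direct_sum M N\<^esub> = (\<zero>\<^bsub>M\<^esub>, \<zero>\<^bsub>N\<^esub>)"
  "(x, y) \<oplus>\<^bsub>direct_sum M N\<^esub> (x', y') = (x \<oplus>\<^bsub>M\<^esub> x', y \<oplus>\<^bsub>N\<^esub> y')"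
  "r \<odot>\<^bsub>direct_sum M N\<^esub> (x, y) = (r \<odot>\<^bsub>M\<^esub> x, r \<odot>\<^bsub>N\<^esub> y)"
  by (simp_all add: direct_sum_def)

lemma direct_sum_right_module:
  assumes "right_module R M" "right_module R N"
  shows "right_module R (direct_sum M N)"
proof -
  interpret M: right_module R M by fact
  interpret N: right_module R N by fact
  show ?thesis
  proof (rule right_moduleI)
    fix z assume "z \<in> carrier (direct_sum M N)"
    then obtain x y where z: "z = (x, y)" "x \<in> carrier M" "y \<in> carrier N"
      by (auto simp: direct_sum_simps)
    then show "\<exists>y\<in>carrier (direct_sum M N). y \<oplus>\<^bsub>direct_sum M N\<^esub> z = \<zero>\<^bsub>direct_sum M N\<^esub>"
      by (intro bexI[of _ "(\<ominus>\<^bsub>M\<^esub> x, \<ominus>\<^bsub>N\<^esub> y)"]) (auto simp: direct_sum_simps M.l_neg N.l_neg)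
  qed (auto simp: direct_sum_simps M.R.ring_axioms M.a_ac N.a_ac M.smult_closed N.smult_closed
      M.smult_l_distr N.smult_l_distr M.smult_r_distr N.smult_r_distr M.smult_assoc N.smult_assoc
      M.smult_one N.smult_one)
qed

lemma fst_hom: "fst \<in> rmod_hom R (direct_sum M N) M"
  and snd_hom: "snd \<in> rmod_hom R (direct_sum M N) N"
  by (auto intro!: rmod_homI simp: direct_sum_simps)

lemma inl_hom:
  assumes "right_module R N"
  shows "(\<lambda>x. (x, \<zero>\<^bsub>N\<^esub>)) \<in> rmod_hom R M (direct_sum M N)"
proof -
  interpret N: right_module R N by fact
  show ?thesis by (auto intro!: rmod_homI simp: direct_sum_simps N.smult_r_null)
qed

lemma inr_hom:
  assumes "right_module R M"
  shows "(\<lambda>y. (\<zero>\<^bsub>M\<^esub>, y)) \<in> rmod_hom R N (direct_sum M N)"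
proof -
  interpret M: right_module R M by fact
  show ?thesis by (auto intro!: rmod_homI simp: direct_sum_simps M.smult_r_null)
qed

lemma case_hom:
  assumes "right_module R L" "h \<in> rmod_hom R M L" "g \<in> rmod_hom R N L"
  shows "(\<lambda>(x, y). h x \<oplus>\<^bsub>L\<^esub> g y) \<in> rmod_hom R (direct_sum M N) L"
proof -
  interpret L: right_module R L by fact
  show ?thesis
    using rmod_homD[OF assms(2)] rmod_homD[OF assms(3)]
    by (auto intro!: rmod_homI simp: direct_sum_simps L.smult_r_distr L.M.a_ac)
qed

lemma rmod_isoE:
  assumes "rmod_iso R M N"
  obtains h where "h \<in> rmod_hom R M N" "bij_betw h (carrier M) (carrier N)"
  using assms unfolding rmod_iso_def by blast

lemma rmod_iso_refl: "rmod_iso R M M"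
  unfolding rmod_iso_def using rmod_hom_id[of R M] by (intro bexI[of _ "\<lambda>x. x"]) (auto simp: bij_betw_def)

lemma rmod_hom_inv_into:
  assumes "right_module R M" "h \<in> rmod_hom R M N" "bij_betw h (carrier M) (carrier N)"
  shows "inv_into (carrier M) h \<in> rmod_hom R N M"
proof -
  interpret M: right_module R M by fact
  let ?g = "inv_into (carrier M) h"
  have g: "?g y \<in> carrier M" "h (?g y) = y" if "y \<in> carrier N" for y
    using that assms(3) by (auto simp: bij_betw_def inv_into_into f_inv_into_f)
  have gh: "?g (h x) = x" if "x \<in> carrier M" for x
    using that assms(3) by (auto simp: bij_betw_def)
  note D = rmod_homD[OF assms(2)]
  show ?thesis
  proof (rule rmod_homI)
    show "?g (x \<oplus>\<^bsub>N\<^esub> y) = ?g x \<oplus>\<^bsub>M\<^esub> ?g y" if "x \<in> carrier N" "y \<in> carrier N" for x y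
      using gh[of "?g x \<oplus>\<^bsub>M\<^esub> ?g y"] g[OF that(1)] g[OF that(2)] D(2) by simp
    show "?g (r \<odot>\<^bsub>N\<^esub> x) = r \<odot>\<^bsub>M\<^esub> ?g x" if "r \<in> carrier R" "x \<in> carrier N" for r x
      using gh[of "r \<odot>\<^bsub>M\<^esub> ?g x"] g[OF that(2)] D(3) that M.smult_closed by simp
  qed (use g in auto)
qed

lemma rmod_iso_sym:
  assumes "right_module R M" "rmod_iso R M N"
  shows "rmod_iso R N M"
proof -
  obtain h where h: "h \<in> rmod_hom R M N" "bij_betw h (carrier M) (carrier N)"
    using assms(2) by (rule rmod_isoE)
  show ?thesis unfolding rmod_iso_def
    using rmod_hom_inv_into[OF assms(1) h] bij_betw_inv_into[OF h(2)] by blast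
qed

lemma rmod_iso_trans:
  assumes "rmod_iso R M N" "rmod_iso R N L"
  shows "rmod_iso R M L"
proof -
  obtain h where h: "h \<in> rmod_hom R M N" "bij_betw h (carrier M) (carrier N)"
    using assms(1) by (rule rmod_isoE)
  obtain g where g: "g \<in> rmod_hom R N L" "bij_betw g (carrier N) (carrier L)"
    using assms(2) by (rule rmod_isoE)
  show ?thesis unfolding rmod_iso_def
    using rmod_hom_comp[OF h(1) g(1)] bij_betw_trans[OF h(2) g(2)] by (auto simp: o_def)
qed

lemma rmod_iso_direct_sum:
  assumes "rmod_iso R M M'" "rmod_iso R N N'"
  shows "rmod_iso R (direct_sum M N) (direct_sum M' N')"
proof -
  obtain h where h: "h \<in> rmod_hom R M M'" "bij_betw h (carrier M) (carrier M')"
    using assms(1) by (rule rmod_isoE)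
  obtain g where g: "g \<in> rmod_hom R N N'" "bij_betw g (carrier N) (carrier N')"
    using assms(2) by (rule rmod_isoE)
  have "bij_betw (map_prod h g) (carrier M \<times> carrier N) (carrier M' \<times> carrier N')"
    using h(2) g(2) by (simp add: bij_betw_def map_prod_inj_on map_prod_surj_on)
  moreover have "map_prod h g \<in> rmod_hom R (direct_sum M N) (direct_sum M' N')"
    using rmod_homD[OF h(1)] rmod_homD[OF g(1)]
    by (auto intro!: rmod_homI simp: direct_sum_simps)
  ultimately show ?thesis unfolding rmod_iso_def by (auto simp: direct_sum_simps)
qed

text \<open>The section makes \<open>s o h\<close> an idempotent, so \<open>x\<close> is the sum of
  \<open>x - s (h x)\<close>, which lies in the kernel, and of \<open>s (h x)\<close>. Both
  Schanuel's argument and the decomposition of submodules of projective modules use this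
  form.\<close>

lemma rmod_split:
  assumes "right_module R W" "right_module R N" "h \<in> rmod_hom R W N" "s \<in> rmod_hom R N W"
    and hs: "\<And>x. x \<in> carrier N \<Longrightarrow> h (s x) = x"
  shows "rmod_iso R W (direct_sum (rmod_ker W N h) N)"
proof -
  interpret W: right_module R W by fact
  interpret N: right_module R N by fact
  note H = rmod_homD[OF assms(3)] and S = rmod_homD[OF assms(4)]
  let ?f = "\<lambda>x. (x \<ominus>\<^bsub>W\<^esub> s (h x), h x)"
  have d: "h (x \<ominus>\<^bsub>W\<^esub> s (h x)) = \<zero>\<^bsub>N\<^esub>" if "x \<in> carrier W" for x
    using that H S hs rmod_hom_diff[OF assms(1-3)] by (simp add: a_minus_def N.M.r_neg)
  have 1: "?f \<in> rmod_hom R W (direct_sum (rmod_ker W N h) N)"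
  proof (rule rmod_homI)
    fix x y assume xy: "x \<in> carrier W" "y \<in> carrier W"
    then show "?f (x \<oplus>\<^bsub>W\<^esub> y) = ?f x \<oplus>\<^bsub>direct_sum (rmod_ker W N h) N\<^esub> ?f y"
      using H S by (simp add: direct_sum_simps rmod_ker_simps a_minus_def W.minus_add W.M.a_ac)
  next
    fix r x assume "r \<in> carrier R" "x \<in> carrier W"
    then show "?f (r \<odot>\<^bsub>W\<^esub> x) = r \<odot>\<^bsub>direct_sum (rmod_ker W N h) N\<^esub> ?f x"
      using H S by (simp add: direct_sum_simps rmod_ker_simps a_minus_def W.smult_r_distr W.smult_r_minus)
  qed (use H S d in \<open>auto simp: direct_sum_simps carrier_rmod_ker\<close>)
  have 2: "bij_betw ?f (carrier W) (carrier (direct_sum (rmod_ker W N h) N))"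
  proof (rule bij_betwI[where g = "\<lambda>(k, y). k \<oplus>\<^bsub>W\<^esub> s y"])
    show "?f \<in> carrier W \<rightarrow> carrier (direct_sum (rmod_ker W N h) N)"
      by (rule funcsetI) (rule rmod_homD(1)[OF 1])
    show "(\<lambda>(k, y). k \<oplus>\<^bsub>W\<^esub> s y) \<in> carrier (direct_sum (rmod_ker W N h) N) \<rightarrow> carrier W"
      using S(1) by (auto simp: direct_sum_simps carrier_rmod_ker)
    show "(case ?f x of (k, y) \<Rightarrow> k \<oplus>\<^bsub>W\<^esub> s y) = x" if "x \<in> carrier W" for x
      using that H S by (simp add: a_minus_def W.M.a_assoc W.l_neg)
    fix z assume "z \<in> carrier (direct_sum (rmod_ker W N h) N)"
    then obtain k y where z: "z = (k, y)" "k \<in> carrier W" "h k = \<zero>\<^bsub>N\<^esub>" "y \<in> carrier N"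
      by (auto simp: direct_sum_simps carrier_rmod_ker)
    then have "h (k \<oplus>\<^bsub>W\<^esub> s y) = y" using H S hs by simp
    then show "?f (case z of (k, y) \<Rightarrow> k \<oplus>\<^bsub>W\<^esub> s y) = z"
      using z S by (simp add: a_minus_def W.M.a_assoc W.r_neg)
  qed
  show ?thesis unfolding rmod_iso_def by (rule bexI[of _ ?f]) (fact 2, fact 1)
qed

section \<open>Finitely generated modules with carriers in lists\<close>

lemma fin_genE:
  assumes "fin_gen R M"
  obtains S where "finite S" "S \<subseteq> carrier M"
    "\<And>U. submodule U R M \<Longrightarrow> S \<subseteq> U \<Longrightarrow> U = carrier M"
  using assms unfolding fin_gen_def by (elim exE conjE) (rule that, auto)

text \<open>\<open>fin_gen\<close> speaks of submodules rather than of linear combinations; so a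
  submodule containing the images of the generators is pulled back to \<open>M\<close>, where it
  must be everything.\<close>

lemma fin_gen_image:
  assumes "right_module R M" "right_module R N" "h \<in> rmod_hom R M N" "h ` carrier M = carrier N" "fin_gen R M"
  shows "fin_gen R N"
proof -
  obtain S where S: "finite S" "S \<subseteq> carrier M" "\<And>U. submodule U R M \<Longrightarrow> S \<subseteq> U \<Longrightarrow> U = carrier M"
    using assms(5) by (rule fin_genE) blast
  have "U = carrier N" if U: "submodule U R N" "h ` S \<subseteq> U" for U
  proof -
    have "{x \<in> carrier M. h x \<in> U} = carrier M"
      using S(2) U(2) by (intro S(3) submodule_vimage[OF assms(1-3) U(1)]) auto
    then have "carrier N \<subseteq> U" unfolding assms(4)[symmetric] by blast
    then show ?thesis using right_module.submoduleD(1)[OF assms(2) U(1)] by auto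
  qed
  then show ?thesis unfolding fin_gen_def using S(1,2) assms(4) by (intro exI[of _ "h ` S"]) auto
qed

lemma fin_gen_iso:
  assumes "right_module R M" "right_module R N" "rmod_iso R M N" "fin_gen R M"
  shows "fin_gen R N"
  using assms fin_gen_image[OF assms(1,2)] by (auto simp: rmod_iso_def bij_betw_def)

lemma fin_gen_direct_sum:
  assumes "right_module R M" "right_module R N" "fin_gen R M" "fin_gen R N"
  shows "fin_gen R (direct_sum M N)"
proof -
  interpret M: right_module R M by fact
  interpret N: right_module R N by fact
  interpret D: right_module R "direct_sum M N" by (rule direct_sum_right_module) fact+
  obtain S where S: "finite S" "S \<subseteq> carrier M" "\<And>U. submodule U R M \<Longrightarrow> S \<subseteq> U \<Longrightarrow> U = carrier M"
    using assms(3) by (rule fin_genE) blast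
  obtain T where T: "finite T" "T \<subseteq> carrier N" "\<And>U. submodule U R N \<Longrightarrow> T \<subseteq> U \<Longrightarrow> U = carrier N"
    using assms(4) by (rule fin_genE) blast
  let ?X = "(\<lambda>x. (x, \<zero>\<^bsub>N\<^esub>)) ` S \<union> (\<lambda>y. (\<zero>\<^bsub>M\<^esub>, y)) ` T"
  have "U = carrier (direct_sum M N)" if U: "submodule U R (direct_sum M N)" "?X \<subseteq> U" for U
  proof -
    have 1: "{x \<in> carrier M. (x, \<zero>\<^bsub>N\<^esub>) \<in> U} = carrier M"
      using S(2) U(2)
      by (intro S(3) submodule_vimage[OF assms(1) D.right_module_axioms inl_hom[OF assms(2)] U(1)]) auto
    have 2: "{y \<in> carrier N. (\<zero>\<^bsub>M\<^esub>, y) \<in> U} = carrier N"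
      using T(2) U(2)
      by (intro T(3) submodule_vimage[OF assms(2) D.right_module_axioms inr_hom[OF assms(1)] U(1)]) auto
    have "(x, y) \<in> U" if "x \<in> carrier M" "y \<in> carrier N" for x y
      using D.submoduleD(3)[OF U(1), of "(x, \<zero>\<^bsub>N\<^esub>)" "(\<zero>\<^bsub>M\<^esub>, y)"] 1 2 that
      by (auto simp: direct_sum_simps)
    then show ?thesis using D.submoduleD(1)[OF U(1)] by (auto simp: direct_sum_simps)
  qed
  then show ?thesis unfolding fin_gen_def using S(1,2) T(1,2)
    by (intro exI[of _ ?X]) (auto simp: direct_sum_simps)
qed

text \<open>Members of \<open>fg_modules\<close> have lists as elements. A module built on another
  type is moved there along an injection \<open>f\<close>, and \<open>inv_into\<close> decodes the
  arguments of its operations.\<close>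

definition transport :: "('b \<Rightarrow> 'a list) \<Rightarrow> ('a, 'b) module \<Rightarrow> ('a, 'a list) module" where
  "transport f N = \<lparr>carrier = f ` carrier N, monoid.mult = (\<lambda>_ _. undefined), monoid.one = undefined,
     ring.zero = f \<zero>\<^bsub>N\<^esub>,
     ring.add = (\<lambda>x y. f (inv_into (carrier N) f x \<oplus>\<^bsub>N\<^esub> inv_into (carrier N) f y)),
     module.smult = (\<lambda>r x. f (r \<odot>\<^bsub>N\<^esub> inv_into (carrier N) f x))\<rparr>"

lemma transport_hom: "inj_on f (carrier N) \<Longrightarrow> f \<in> rmod_hom R N (transport f N)"
  by (rule rmod_homI) (auto simp: transport_def)

lemma transport_iso: "inj_on f (carrier N) \<Longrightarrow> rmod_iso R N (transport f N)"
  unfolding rmod_iso_def using transport_hom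
  by (intro bexI[of _ f]) (auto simp: transport_def bij_betw_def)

lemma transport_right_module:
  assumes "right_module R N" "inj_on f (carrier N)"
  shows "right_module R (transport f N)"
proof -
  interpret N: right_module R N by fact
  note [simp] = inv_into_f_f[OF assms(2)]
  show ?thesis
  proof (rule right_moduleI)
    fix x assume "x \<in> carrier (transport f N)"
    then obtain y where "y \<in> carrier N" "x = f y" by (auto simp: transport_def)
    then show "\<exists>y\<in>carrier (transport f N). y \<oplus>\<^bsub>transport f N\<^esub> x = \<zero>\<^bsub>transport f N\<^esub>"
      by (intro bexI[of _ "f (\<ominus>\<^bsub>N\<^esub> y)"]) (auto simp: transport_def N.l_neg)
  qed (auto simp: transport_def N.R.ring_axioms N.M.a_ac N.smult_closed N.smult_l_distr
      N.smult_r_distr N.smult_assoc N.smult_one)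
qed

lemma right_module_if_fg: "M \<in> fg_modules R \<Longrightarrow> right_module R M"
  and fin_gen_if_fg: "M \<in> fg_modules R \<Longrightarrow> fin_gen R M"
  by (auto simp: fg_modules_def)

lemma fg_modulesI: "right_module R M \<Longrightarrow> fin_gen R M \<Longrightarrow> M \<in> fg_modules R"
  by (auto simp: fg_modules_def)

text \<open>An injection of pairs of lists into lists, which moves direct sums back to carriers in lists: the
  length of the first list is recorded in unary, with the symbols \<open>1\<close> and \<open>0\<close> of the ring.\<close>

definition pair_code :: "('a, 'm) ring_scheme \<Rightarrow> 'a list \<times> 'a list \<Rightarrow> 'a list" where
  "pair_code R = (\<lambda>(xs, ys). replicate (length xs) \<one>\<^bsub>R\<^esub> @ \<zero>\<^bsub>R\<^esub> # xs @ ys)"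

lemma inj_pair_code:
  assumes "\<one>\<^bsub>R\<^esub> \<noteq> \<zero>\<^bsub>R\<^esub>"
  shows "inj_on (pair_code R) S"
proof -
  \<comment> \<open>The unary prefix is ended by the first symbol different from 1. Its length tells
    where \<open>xs @ ys\<close> has to be cut.\<close>
  have tw: "takeWhile (\<lambda>x. x = \<one>\<^bsub>R\<^esub>) (replicate n \<one>\<^bsub>R\<^esub> @ \<zero>\<^bsub>R\<^esub> # w) = replicate n \<one>\<^bsub>R\<^esub>" for n w
    using assms by (subst takeWhile_append2) auto
  show ?thesis
  proof (rule inj_onI)
    fix p q assume eq: "pair_code R p = pair_code R q"
    obtain xs ys xs' ys' where pq: "p = (xs, ys)" "q = (xs', ys')" by fastforce
    have eq': "replicate (length xs) \<one>\<^bsub>R\<^esub> @ \<zero>\<^bsub>R\<^esub> # xs @ ys = replicate (length xs') \<one>\<^bsub>R\<^esub> @ \<zero>\<^bsub>R\<^esub> # xs' @ ys'"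
      using eq by (simp add: pq pair_code_def)
    have "length xs = length xs'"
      using arg_cong[OF eq', of "\<lambda>l. length (takeWhile (\<lambda>x. x = \<one>\<^bsub>R\<^esub>) l)"] by (simp only: tw length_replicate)
    then show "p = q" using eq' by (simp add: pq)
  qed
qed

definition dsum :: "('a, 'm) ring_scheme \<Rightarrow> ('a, 'a list) module \<Rightarrow> ('a, 'a list) module \<Rightarrow> ('a, 'a list) module"
  where "dsum R M N = transport (pair_code R) (direct_sum M N)"

text \<open>\<open>pair_code\<close> needs two different symbols, and 0 and 1 serve as such.\<close>

locale nontrivial_ring = ring R for R :: "('a, 'm) ring_scheme" (structure) +
  assumes one_neq_zero: "\<one> \<noteq> \<zero>"
begin

lemma dsum_iso: "rmod_iso R (direct_sum M N) (dsum R M N)"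
  unfolding dsum_def by (rule transport_iso[OF inj_pair_code[OF one_neq_zero]])

lemma dsum_right_module:
  "right_module R M \<Longrightarrow> right_module R N \<Longrightarrow> right_module R (dsum R M N)"
  unfolding dsum_def
  by (rule transport_right_module[OF direct_sum_right_module inj_pair_code[OF one_neq_zero]])

lemma dsum_iso': 
  "right_module R M \<Longrightarrow> right_module R N \<Longrightarrow> rmod_iso R (dsum R M N) (direct_sum M N)"
  by (rule rmod_iso_sym[OF direct_sum_right_module dsum_iso])

lemma dsum_fg: "M \<in> fg_modules R \<Longrightarrow> N \<in> fg_modules R \<Longrightarrow> dsum R M N \<in> fg_modules R"
  by (rule fg_modulesI[OF dsum_right_module fin_gen_iso[OF _ _ dsum_iso fin_gen_direct_sum]])
    (simp_all add: right_module_if_fg fin_gen_if_fg direct_sum_right_module dsum_right_module)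

end

section \<open>Projective modules\<close>

lemma projectiveD:
  fixes N N' :: "('a, 'a list) module"
  assumes "projective R P" "right_module R N" "right_module R N'" "g \<in> rmod_hom R N N'"
    "g ` carrier N = carrier N'" "f \<in> rmod_hom R P N'"
  obtains h where "h \<in> rmod_hom R P N" "\<And>x. x \<in> carrier P \<Longrightarrow> g (h x) = f x"
  using assms(1)[unfolded projective_def, rule_format, of N N' g f] assms(2-6) by auto

text \<open>A lift of \<open>f o p\<close>, restricted along \<open>s\<close>, is a lift of
  \<open>f\<close>, because \<open>p o s\<close> is the identity.\<close>

lemma projective_retract:
  assumes "projective R P" "s \<in> rmod_hom R P' P" "p \<in> rmod_hom R P P'"
    and ps: "\<And>x. x \<in> carrier P' \<Longrightarrow> p (s x) = x"
  shows "projective R P'"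
  unfolding projective_def
proof (intro allI impI, elim conjE)
  fix N N' :: "('a, 'a list) module" and g f
  assume N: "right_module R N" "right_module R N'" "g \<in> rmod_hom R N N'" "g ` carrier N = carrier N'"
    and f: "f \<in> rmod_hom R P' N'"
  obtain h where h: "h \<in> rmod_hom R P N" "\<And>x. x \<in> carrier P \<Longrightarrow> g (h x) = f (p x)"
    using projectiveD[OF assms(1) N rmod_hom_comp[OF assms(3) f]] by blast
  show "\<exists>h\<in>rmod_hom R P' N. \<forall>x\<in>carrier P'. g (h x) = f x"
    using rmod_hom_comp[OF assms(2) h(1)] h(2) rmod_homD(1)[OF assms(2)] ps
    by (intro bexI[of _ "\<lambda>x. h (s x)"]) auto
qed

lemma projective_iso:
  assumes "right_module R P" "rmod_iso R P P'" "projective R P"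
  shows "projective R P'"
proof -
  obtain h where h: "h \<in> rmod_hom R P P'" "bij_betw h (carrier P) (carrier P')"
    using assms(2) by (rule rmod_isoE)
  show ?thesis
    by (rule projective_retract[OF assms(3) rmod_hom_inv_into[OF assms(1) h] h(1)])
      (use h(2) in \<open>auto simp: bij_betw_def f_inv_into_f\<close>)
qed

text \<open>A homomorphism out of the sum is lifted on each summand and the lifts are added. The
  maps \<open>e\<close> and \<open>?i\<close> translate between pairs and their codes.\<close>

lemma (in nontrivial_ring) projective_dsum:
  assumes P: "projective R P" "projective R P'" and m: "right_module R P" "right_module R P'"
  shows "projective R (dsum R P P')"
  unfolding projective_def
proof (intro allI impI, elim conjE)
  fix N N' :: "('a, 'a list) module" and g f
  assume N: "right_module R N" "right_module R N'" "g \<in> rmod_hom R N N'" "g ` carrier N = carrier N'"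
    and f: "f \<in> rmod_hom R (dsum R P P') N'"
  interpret N: right_module R N by fact
  interpret N': right_module R N' by fact
  interpret P: right_module R P by fact
  interpret P': right_module R P' by fact
  obtain e where e: "e \<in> rmod_hom R (dsum R P P') (direct_sum P P')"
     "bij_betw e (carrier (dsum R P P')) (carrier (direct_sum P P'))"
    using dsum_iso'[OF m] by (rule rmod_isoE)
  let ?i = "inv_into (carrier (dsum R P P')) e"
  have i: "?i \<in> rmod_hom R (direct_sum P P') (dsum R P P')"
    by (rule rmod_hom_inv_into[OF dsum_right_module[OF m] e])
  have fi: "(\<lambda>x. f (?i x)) \<in> rmod_hom R (direct_sum P P') N'"
    using rmod_hom_comp[OF i f] .
  obtain h1 where h1: "h1 \<in> rmod_hom R P N" "\<And>x. x \<in> carrier P \<Longrightarrow> g (h1 x) = f (?i (x, \<zero>\<^bsub>P'\<^esub>))"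
    using projectiveD[OF P(1) N rmod_hom_comp[OF inl_hom[OF m(2)] fi]] by blast
  obtain h2 where h2: "h2 \<in> rmod_hom R P' N" "\<And>x. x \<in> carrier P' \<Longrightarrow> g (h2 x) = f (?i (\<zero>\<^bsub>P\<^esub>, x))"
    using projectiveD[OF P(2) N rmod_hom_comp[OF inr_hom[OF m(1)] fi]] by blast
  note h = rmod_hom_comp[OF e(1) case_hom[OF N(1) h1(1) h2(1)]]
  have "g (case e x of (x, y) \<Rightarrow> h1 x \<oplus>\<^bsub>N\<^esub> h2 y) = f x" if x: "x \<in> carrier (dsum R P P')" for x
  proof -
    obtain a b where ab: "e x = (a, b)" "a \<in> carrier P" "b \<in> carrier P'"
      using rmod_homD(1)[OF e(1) x] by (auto simp: direct_sum_simps)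
    have "g (h1 a \<oplus>\<^bsub>N\<^esub> h2 b) = f (?i (a, \<zero>\<^bsub>P'\<^esub>)) \<oplus>\<^bsub>N'\<^esub> f (?i (\<zero>\<^bsub>P\<^esub>, b))"
      using rmod_homD[OF N(3)] rmod_homD(1)[OF h1(1)] rmod_homD(1)[OF h2(1)] ab h1(2) h2(2) by simp
    also have "\<dots> = f (?i ((a, \<zero>\<^bsub>P'\<^esub>) \<oplus>\<^bsub>direct_sum P P'\<^esub> (\<zero>\<^bsub>P\<^esub>, b)))"
      using rmod_homD(2)[OF fi, of "(a, \<zero>\<^bsub>P'\<^esub>)" "(\<zero>\<^bsub>P\<^esub>, b)"] ab by (simp add: direct_sum_simps)
    also have "\<dots> = f (?i (e x))" using ab by (simp add: direct_sum_simps)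
    finally show ?thesis using bij_betw_inv_into_left[OF e(2) x] ab(1) by simp
  qed
  then show "\<exists>h\<in>rmod_hom R (dsum R P P') N. \<forall>x\<in>carrier (dsum R P P'). g (h x) = f x"
    using h by (intro bexI[of _ "\<lambda>x. case e x of (x, y) \<Rightarrow> h1 x \<oplus>\<^bsub>N\<^esub> h2 y"]) auto
qed

section \<open>Calculations modulo the relations of \<open>K\<^sub>0\<close>\<close>

text \<open>Calculating with formal combinations modulo the relations postpones the cosets that make
  up \<open>K0\<close> until the bounds for \<open>phi\<close> are derived.\<close>

definition K0_eq :: "('a, 'm) ring_scheme \<Rightarrow> (('a, 'a list) module \<Rightarrow>\<^sub>0 int) \<Rightarrow> (('a, 'a list) module \<Rightarrow>\<^sub>0 int) \<Rightarrow> bool"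
  where "K0_eq R c d \<longleftrightarrow> c - d \<in> K0_relations R"

lemma K0_relations_subgroup: "subgroup (K0_relations R) (module_frags R)"
  unfolding K0_relations_def module_frags_def
proof (rule group.generate_is_subgroup[OF group_free_Abelian_group], rule subsetI)
  have k: "Poly_Mapping.keys (frag_of M - frag_of M' - frag_of M'') \<subseteq> {M, M', M''}"
    for M M' M'' :: "('a, 'a list) module"
    using keys_diff[of "frag_of M - frag_of M'" "frag_of M''"] keys_diff[of "frag_of M" "frag_of M'"]
    by (auto simp: keys_single)
  fix x assume "x \<in> {frag_of M - frag_of M' - frag_of M'' | M M' M''.
         M \<in> fg_modules R \<and> M' \<in> fg_modules R \<and> M'' \<in> fg_modules R \<and>
         rmod_iso R M (direct_sum M' M'')} \<union>
      {frag_of P | P. P \<in> fg_modules R \<and> projective R P}"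
  then show "x \<in> carrier (free_Abelian_group (fg_modules R))"
    using k by fastforce
qed

lemma
  shows K0_relations_zero: "0 \<in> K0_relations R"
    and K0_relations_add: "x \<in> K0_relations R \<Longrightarrow> y \<in> K0_relations R \<Longrightarrow> x + y \<in> K0_relations R"
    and K0_relations_minus: "x \<in> K0_relations R \<Longrightarrow> - x \<in> K0_relations R"
    and K0_relations_keys: "x \<in> K0_relations R \<Longrightarrow> Poly_Mapping.keys x \<subseteq> fg_modules R"
proof -
  interpret subgroup "K0_relations R" "module_frags R" by (rule K0_relations_subgroup)
  show "0 \<in> K0_relations R" using one_closed by (simp add: module_frags_def)
  show "x \<in> K0_relations R \<Longrightarrow> y \<in> K0_relations R \<Longrightarrow> x + y \<in> K0_relations R"
    using m_closed[of x y] by (simp add: module_frags_def)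
  show k: "x \<in> K0_relations R \<Longrightarrow> Poly_Mapping.keys x \<subseteq> fg_modules R"
    using mem_carrier[of x] by (simp add: module_frags_def)
  show "x \<in> K0_relations R \<Longrightarrow> - x \<in> K0_relations R"
    using m_inv_closed[of x] k by (simp add: module_frags_def)
qed

lemma K0_relations_diff: "x \<in> K0_relations R \<Longrightarrow> y \<in> K0_relations R \<Longrightarrow> x - y \<in> K0_relations R"
  using K0_relations_add[of x R "- y"] K0_relations_minus[of y R] by simp

lemma K0_eq_refl [simp]: "K0_eq R c c"
  by (simp add: K0_eq_def K0_relations_zero)

lemma K0_eq_sym: "K0_eq R c d \<Longrightarrow> K0_eq R d c"
  unfolding K0_eq_def using K0_relations_minus[of "c - d" R] by simp

lemma K0_eq_trans [trans]: "K0_eq R c d \<Longrightarrow> K0_eq R d e \<Longrightarrow> K0_eq R c e"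
  unfolding K0_eq_def using K0_relations_add[of "c - d" R "d - e"] by simp

lemma K0_eq_eq_trans [trans]: "K0_eq R c d \<Longrightarrow> d = e \<Longrightarrow> K0_eq R c e"
  and eq_K0_eq_trans [trans]: "c = d \<Longrightarrow> K0_eq R d e \<Longrightarrow> K0_eq R c e"
  by simp_all

lemma K0_eq_add: "K0_eq R c d \<Longrightarrow> K0_eq R c' d' \<Longrightarrow> K0_eq R (c + c') (d + d')"
  unfolding K0_eq_def using K0_relations_add[of "c - d" R "c' - d'"] by (simp add: algebra_simps)

lemma K0_eq_diff: "K0_eq R c d \<Longrightarrow> K0_eq R c' d' \<Longrightarrow> K0_eq R (c - c') (d - d')"
  unfolding K0_eq_def using K0_relations_diff[of "c - d" R "c' - d'"] by (simp add: algebra_simps)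

lemma K0_eq_sum: "(\<And>i. i \<in> I \<Longrightarrow> K0_eq R (f i) (g i)) \<Longrightarrow> K0_eq R (sum f I) (sum g I)"
  by (induction I rule: infinite_finite_induct) (auto intro: K0_eq_add)

lemma K0_eq_cmul:
  assumes "K0_eq R c d"
  shows "K0_eq R (frag_cmul z c) (frag_cmul z d)"
proof -
  have n: "frag_cmul (int n) x \<in> K0_relations R" if "x \<in> K0_relations R" for x n
    by (induction n) (use that in \<open>auto simp: K0_relations_zero frag_cmul_distrib intro: K0_relations_add\<close>)
  have "frag_cmul z x \<in> K0_relations R" if "x \<in> K0_relations R" for x
    using n[OF that, of "nat z"] K0_relations_minus[OF n[OF that, of "nat (- z)"]]
    by (cases "z \<ge> 0") simp_all
  then show ?thesis using assms
    using frag_cmul_distrib2[of z "c - d" d] by (metis K0_eq_def add_diff_cancel_right' diff_add_cancel)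
qed

lemma K0_eq_direct_sum:
  assumes "M \<in> fg_modules R" "M' \<in> fg_modules R" "M'' \<in> fg_modules R" "rmod_iso R M (direct_sum M' M'')"
  shows "K0_eq R (frag_of M) (frag_of M' + frag_of M'')"
  unfolding K0_eq_def K0_relations_def diff_diff_eq[symmetric] using assms
  by (intro generate.incl UnI1) blast

lemma K0_eq_projective:
  assumes "P \<in> fg_modules R" "projective R P"
  shows "K0_eq R (frag_of P) 0"
  unfolding K0_eq_def K0_relations_def diff_0_right using assms by (intro generate.incl UnI2) blast

lemma trivial_module_projective:
  assumes "carrier P = {\<zero>\<^bsub>P\<^esub>}" "right_module R P"
  shows "projective R P"
  unfolding projective_def
proof (intro allI impI, elim conjE)
  fix N N' :: "('a, 'a list) module" and g f
  assume *: "right_module R N" "right_module R N'" "g \<in> rmod_hom R N N'" "g ` carrier N = carrier N'"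
    and f: "f \<in> rmod_hom R P N'"
  interpret N: right_module R N by fact
  interpret P: right_module R P by fact
  have "(\<lambda>_. \<zero>\<^bsub>N\<^esub>) \<in> rmod_hom R P N" by (rule rmod_homI) auto
  moreover have "g \<zero>\<^bsub>N\<^esub> = f \<zero>\<^bsub>P\<^esub>"
    using rmod_hom_zero[OF *(1-3)] rmod_hom_zero[OF assms(2) *(2) f] by simp
  ultimately show "\<exists>h\<in>rmod_hom R P N. \<forall>x\<in>carrier P. g (h x) = f x"
    using assms(1) by auto
qed

lemma K0_eq_trivial:
  assumes "P \<in> fg_modules R" "carrier P = {\<zero>\<^bsub>P\<^esub>}"
  shows "K0_eq R (frag_of P) 0"
  by (rule K0_eq_projective[OF assms(1) trivial_module_projective[OF assms(2) right_module_if_fg[OF assms(1)]]])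

lemma K0_eq_split:
  assumes "W \<in> fg_modules R" "N \<in> fg_modules R" "h \<in> rmod_hom R W N" "s \<in> rmod_hom R N W"
    and "\<And>x. x \<in> carrier N \<Longrightarrow> h (s x) = x" and "rmod_ker W N h \<in> fg_modules R"
  shows "K0_eq R (frag_of W) (frag_of (rmod_ker W N h) + frag_of N)"
  by (rule K0_eq_direct_sum[OF assms(1,6,2) rmod_split[OF right_module_if_fg[OF assms(1)] right_module_if_fg[OF assms(2)] assms(3-5)]])

text \<open>The module over the fibre product of \<open>P\<close> and \<open>P'\<close> over \<open>M\<close> splits over both factors.\<close>

lemma (in nontrivial_ring) schanuel:
  assumes P: "P \<in> fg_modules R" "projective R P" and P': "P' \<in> fg_modules R" "projective R P'"
    and M: "right_module R M"
    and p: "p \<in> rmod_hom R P M" "p ` carrier P = carrier M"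
    and p': "p' \<in> rmod_hom R P' M" "p' ` carrier P' = carrier M"
    and k: "rmod_ker P M p \<in> fg_modules R" "rmod_ker P' M p' \<in> fg_modules R"
  shows "K0_eq R (frag_of (rmod_ker P M p)) (frag_of (rmod_ker P' M p'))"
proof -
  interpret M: right_module R M by fact
  interpret P: right_module R P using P(1) by (rule right_module_if_fg)
  interpret P': right_module R P' using P'(1) by (rule right_module_if_fg)
  interpret PP: right_module R "direct_sum P P'"
    by (rule direct_sum_right_module) (rule P.right_module_axioms, rule P'.right_module_axioms)
  \<comment> \<open>The fibre product consists of pairs, so it must be recoded before it can count
    as a module on lists.\<close>
  define W0 where "W0 = (direct_sum P P')\<lparr>carrier := {(x, y). x \<in> carrier P \<and> y \<in> carrier P' \<and> p x = p' y}\<rparr>"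
  have "submodule {(x, y). x \<in> carrier P \<and> y \<in> carrier P' \<and> p x = p' y} R (direct_sum P P')"
    using rmod_homD[OF p(1)] rmod_homD[OF p'(1)]
      rmod_hom_zero[OF P.right_module_axioms M p(1)] rmod_hom_zero[OF P'.right_module_axioms M p'(1)]
    by (intro PP.submoduleI) (auto simp: direct_sum_simps)
  then interpret W0: right_module R W0
    unfolding W0_def by (rule PP.submodule_right_module)
  define W where "W = transport (pair_code R) W0"
  interpret W: right_module R W
    unfolding W_def by (rule transport_right_module[OF W0.right_module_axioms inj_pair_code[OF one_neq_zero]])
  have "rmod_iso R W0 W" unfolding W_def by (rule transport_iso[OF inj_pair_code[OF one_neq_zero]])
  then have "rmod_iso R W W0" by (rule rmod_iso_sym[OF W0.right_module_axioms])
  then obtain e where e: "e \<in> rmod_hom R W W0" "bij_betw e (carrier W) (carrier W0)" by (rule rmod_isoE)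
  have W0c: "carrier W0 = {(x, y). x \<in> carrier P \<and> y \<in> carrier P' \<and> p x = p' y}" by (simp add: W0_def)
  have f0: "fst \<in> rmod_hom R W0 P" "snd \<in> rmod_hom R W0 P'"
    by (auto intro!: rmod_homI simp: W0_def direct_sum_simps)
  have f: "(\<lambda>w. fst (e w)) \<in> rmod_hom R W P" "(\<lambda>w. snd (e w)) \<in> rmod_hom R W P'"
    using rmod_hom_comp[OF e(1) f0(1)] rmod_hom_comp[OF e(1) f0(2)] .
  \<comment> \<open>One argument for both projections: a surjection of \<open>W\<close> onto a
    projective \<open>X\<close> splits, so \<open>W\<close> is the sum of \<open>X\<close> and a
    copy \<open>C\<close> of the kernel. This also shows that \<open>W\<close> is finitely
    generated.\<close>
  have main: "W \<in> fg_modules R \<and> K0_eq R (frag_of W) (frag_of C + frag_of X)"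
    if X: "X \<in> fg_modules R" "projective R X" "g \<in> rmod_hom R W X" "g ` carrier W = carrier X"
      and C: "C \<in> fg_modules R" "h \<in> rmod_hom R (rmod_ker W X g) C"
        "bij_betw h (carrier (rmod_ker W X g)) (carrier C)" for X g C h
  proof -
    have Xm: "right_module R X" using X(1) by (rule right_module_if_fg)
    have Cm: "right_module R C" using C(1) by (rule right_module_if_fg)
    have km: "right_module R (rmod_ker W X g)" by (rule rmod_ker_right_module[OF W.right_module_axioms Xm X(3)])
    have i: "rmod_iso R (rmod_ker W X g) C" unfolding rmod_iso_def by (rule bexI[of _ h]) (rule C(3), rule C(2))
    obtain s where s: "s \<in> rmod_hom R X W" "\<And>x. x \<in> carrier X \<Longrightarrow> g (s x) = x"
      using projectiveD[OF X(2) W.right_module_axioms Xm X(3,4) rmod_hom_id] by blast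
    have "rmod_iso R W (direct_sum (rmod_ker W X g) X)"
      by (rule rmod_split[OF W.right_module_axioms Xm X(3) s])
    then have i2: "rmod_iso R W (direct_sum C X)"
      using rmod_iso_trans[OF _ rmod_iso_direct_sum[OF i rmod_iso_refl]] by blast
    have "fin_gen R W"
      by (rule fin_gen_iso[OF direct_sum_right_module[OF Cm Xm] W.right_module_axioms
            rmod_iso_sym[OF W.right_module_axioms i2]
            fin_gen_direct_sum[OF Cm Xm fin_gen_if_fg[OF C(1)] fin_gen_if_fg[OF X(1)]]])
    then have Wf: "W \<in> fg_modules R" using W.right_module_axioms by (rule fg_modulesI[rotated])
    then show ?thesis using K0_eq_direct_sum[OF Wf C(1) X(1) i2] by blast
  qed
  have We: "e ` carrier W = carrier W0" "inj_on e (carrier W)" using e(2) by (auto simp: bij_betw_def)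
  have s1: "(\<lambda>w. fst (e w)) ` carrier W = carrier P"
  proof -
    have "fst ` carrier W0 = carrier P"
    proof (intro equalityI subsetI)
      fix x assume x: "x \<in> carrier P"
      then have "p x \<in> p' ` carrier P'" using p p' by auto
      then show "x \<in> fst ` carrier W0" using x unfolding W0c by (force simp: image_iff)
    qed (auto simp: W0c)
    then show ?thesis unfolding We(1)[symmetric] by (simp add: image_image)
  qed
  have s2: "(\<lambda>w. snd (e w)) ` carrier W = carrier P'"
  proof -
    have "snd ` carrier W0 = carrier P'"
    proof (intro equalityI subsetI)
      fix x assume x: "x \<in> carrier P'"
      then have "p' x \<in> p ` carrier P" using p p' by auto
      then show "x \<in> snd ` carrier W0" using x unfolding W0c by (force simp: image_iff)
    qed (auto simp: W0c)
    then show ?thesis unfolding We(1)[symmetric] by (simp add: image_image)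
  qed
  have ez: "p \<zero>\<^bsub>P\<^esub> = \<zero>\<^bsub>M\<^esub>" "p' \<zero>\<^bsub>P'\<^esub> = \<zero>\<^bsub>M\<^esub>"
    using rmod_hom_zero[OF P.right_module_axioms M p(1)] rmod_hom_zero[OF P'.right_module_axioms M p'(1)] .
  have W0: "fst (e w) \<in> carrier P" "snd (e w) \<in> carrier P'" "p (fst (e w)) = p' (snd (e w))" if "w \<in> carrier W" for w
    using rmod_homD(1)[OF e(1) that] by (auto simp: W0c)
  \<comment> \<open>The kernel of the first projection consists of the pairs \<open>(0, y)\<close>
    with \<open>p' y = 0\<close>, so it is a copy of the kernel of \<open>p'\<close>.\<close>
  have 1: "W \<in> fg_modules R \<and> K0_eq R (frag_of W) (frag_of (rmod_ker P' M p') + frag_of P)"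
  proof (rule main[OF P f(1) s1 k(2), where h = "\<lambda>w. snd (e w)"])
    show "(\<lambda>w. snd (e w)) \<in> rmod_hom R (rmod_ker W P (\<lambda>w. fst (e w))) (rmod_ker P' M p')"
      using rmod_homD[OF f(2)] W0 ez by (intro rmod_homI) (simp_all add: carrier_rmod_ker rmod_ker_simps, metis)
    show "bij_betw (\<lambda>w. snd (e w)) (carrier (rmod_ker W P (\<lambda>w. fst (e w)))) (carrier (rmod_ker P' M p'))"
      unfolding bij_betw_def
    proof
      show "inj_on (\<lambda>w. snd (e w)) (carrier (rmod_ker W P (\<lambda>w. fst (e w))))"
        using We(2) by (auto simp: inj_on_def carrier_rmod_ker prod_eq_iff)
      have "y \<in> (\<lambda>w. snd (e w)) ` carrier (rmod_ker W P (\<lambda>w. fst (e w)))"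
        if y: "y \<in> carrier P'" "p' y = \<zero>\<^bsub>M\<^esub>" for y
      proof -
        have "(\<zero>\<^bsub>P\<^esub>, y) \<in> e ` carrier W" unfolding We(1) W0c using y ez by simp
        then obtain w where "w \<in> carrier W" "e w = (\<zero>\<^bsub>P\<^esub>, y)" by (metis imageE)
        then show ?thesis by (intro image_eqI[of _ _ w]) (auto simp: carrier_rmod_ker)
      qed
      then show "(\<lambda>w. snd (e w)) ` carrier (rmod_ker W P (\<lambda>w. fst (e w))) = carrier (rmod_ker P' M p')"
        using W0 ez by (auto simp: carrier_rmod_ker) (metis)
    qed
  qed
  have 2: "W \<in> fg_modules R \<and> K0_eq R (frag_of W) (frag_of (rmod_ker P M p) + frag_of P')"
  proof (rule main[OF P' f(2) s2 k(1), where h = "\<lambda>w. fst (e w)"])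
    show "(\<lambda>w. fst (e w)) \<in> rmod_hom R (rmod_ker W P' (\<lambda>w. snd (e w))) (rmod_ker P M p)"
      using rmod_homD[OF f(1)] W0 ez by (intro rmod_homI) (simp_all add: carrier_rmod_ker rmod_ker_simps)
    show "bij_betw (\<lambda>w. fst (e w)) (carrier (rmod_ker W P' (\<lambda>w. snd (e w)))) (carrier (rmod_ker P M p))"
      unfolding bij_betw_def
    proof
      show "inj_on (\<lambda>w. fst (e w)) (carrier (rmod_ker W P' (\<lambda>w. snd (e w))))"
        using We(2) by (auto simp: inj_on_def carrier_rmod_ker prod_eq_iff)
      have "y \<in> (\<lambda>w. fst (e w)) ` carrier (rmod_ker W P' (\<lambda>w. snd (e w)))"
        if y: "y \<in> carrier P" "p y = \<zero>\<^bsub>M\<^esub>" for y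
      proof -
        have "(y, \<zero>\<^bsub>P'\<^esub>) \<in> e ` carrier W" unfolding We(1) W0c using y ez by simp
        then obtain w where "w \<in> carrier W" "e w = (y, \<zero>\<^bsub>P'\<^esub>)" by (metis imageE)
        then show ?thesis by (intro image_eqI[of _ _ w]) (auto simp: carrier_rmod_ker)
      qed
      then show "(\<lambda>w. fst (e w)) ` carrier (rmod_ker W P' (\<lambda>w. snd (e w))) = carrier (rmod_ker P M p)"
        using W0 ez by (auto simp: carrier_rmod_ker)
    qed
  qed
  have "K0_eq R (frag_of (rmod_ker P M p) + 0) (frag_of (rmod_ker P M p) + frag_of P')"
    by (intro K0_eq_add K0_eq_refl K0_eq_sym[OF K0_eq_projective[OF P']])
  also have "K0_eq R (frag_of (rmod_ker P M p) + frag_of P') (frag_of W)"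
    using 2 K0_eq_sym by blast
  also have "K0_eq R (frag_of W) (frag_of (rmod_ker P' M p') + frag_of P)" using 1 by blast
  also have "K0_eq R (frag_of (rmod_ker P' M p') + frag_of P) (frag_of (rmod_ker P' M p') + 0)"
    by (intro K0_eq_add K0_eq_refl K0_eq_projective[OF P])
  finally show ?thesis by simp
qed

section \<open>Algebras with coefficients on the paths of length less than \<open>k\<close>\<close>

lemma (in abelian_monoid) finsum_single:
  assumes "finite S" "i \<in> S" "f i \<in> carrier G" "\<And>j. j \<in> S \<Longrightarrow> j \<noteq> i \<Longrightarrow> f j = \<zero>"
  shows "finsum G f S = f i"
proof -
  have "finsum G f S = finsum G (\<lambda>j. if i = j then f j else \<zero>) S"
    using assms by (intro finsum_cong') (auto simp: Pi_def)
  also have "\<dots> = finsum G (\<lambda>j. if i = j then f i else \<zero>) S"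
    using assms by (intro finsum_cong') (auto simp: Pi_def)
  also have "\<dots> = f i" using assms by (subst finsum_singleton) (auto simp: Pi_def)
  finally show ?thesis .
qed

lemma (in abelian_monoid) finsum_shift:
  assumes "\<And>i. f i \<in> carrier G" "\<And>i. i < m \<Longrightarrow> f i = \<zero>"
  shows "finsum G f {..m + n :: nat} = finsum G (\<lambda>i. f (m + i)) {..n}"
  using assms
proof (induction m arbitrary: f)
  case (Suc m)
  have "finsum G f {..Suc (m + n)} = finsum G (\<lambda>i. f (Suc i)) {..m + n} \<oplus> f 0"
    using Suc.prems by (intro finsum_Suc2) auto
  also have "\<dots> = finsum G (\<lambda>i. f (Suc i)) {..m + n}" using Suc.prems by simp
  also have "\<dots> = finsum G (\<lambda>i. f (Suc (m + i))) {..n}" using Suc.prems by (intro Suc.IH) auto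
  finally show ?case by simp
qed simp

lemma (in abelian_monoid) finsum_all_zero: "(\<And>i. i \<in> S \<Longrightarrow> f i = \<zero>) \<Longrightarrow> finsum G f S = \<zero>"
  by (rule add.finprod_one_eqI)

text \<open>The interface to the truncated path algebra: elements are determined by their
  coefficients on the finitely many paths of length below \<open>k\<close>, every choice of
  coefficients occurs, and products are convolutions along the cuts of a path.\<close>

locale coeff_algebra = A?: nontrivial_ring A + K: field K + fin_digraph Q
  for A :: "('a, 'm) ring_scheme" (structure) and K :: "('k, 'l) ring_scheme"
    and Q :: "('v, 'e) pre_digraph" +
  fixes k :: nat and cf :: "'a \<Rightarrow> 'v \<times> 'e list \<Rightarrow> 'k"
  assumes cf_bij: "bij_betw cf (carrier A) {f. (\<forall>x. f x \<in> carrier K) \<and>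
          (\<forall>x. x \<notin> {x \<in> qpaths Q. length (snd x) < k} \<longrightarrow> f x = \<zero>\<^bsub>K\<^esub>)}"
    and cf_add: "\<lbrakk>a \<in> carrier A; b \<in> carrier A\<rbrakk> \<Longrightarrow> cf (a \<oplus> b) x = cf a x \<oplus>\<^bsub>K\<^esub> cf b x"
    and cf_mult: "\<lbrakk>a \<in> carrier A; b \<in> carrier A; (u, p) \<in> qpaths Q; length p < k\<rbrakk> \<Longrightarrow>
      cf (a \<otimes> b) (u, p) =
        (\<Oplus>\<^bsub>K\<^esub>i\<in>{..length p}. cf a (u, take i p) \<otimes>\<^bsub>K\<^esub> cf b (awlast u (take i p), drop i p))"
    and cf_one: "cf \<one> (u, p) = (if u \<in> verts Q \<and> p = [] then \<one>\<^bsub>K\<^esub> else \<zero>\<^bsub>K\<^esub>)"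
    and k_ge: "2 \<le> k"
begin

definition "paths = {x \<in> qpaths Q. length (snd x) < k}"

lemma paths_iff: "(u, p) \<in> paths \<longleftrightarrow> (\<exists>v. awalk u p v) \<and> length p < k"
  by (simp add: paths_def qpaths_def)

lemma paths_append: "(u, p @ q) \<in> paths \<longleftrightarrow>
   (u, p) \<in> paths \<and> (awlast u p, q) \<in> paths \<and> length p + length q < k"
  unfolding paths_iff by auto

lemma paths_Nil: "(u, []) \<in> paths \<longleftrightarrow> u \<in> verts Q"
  using k_ge by (auto simp: paths_iff awalk_Nil_iff)

lemma paths_end: "(u, p) \<in> paths \<Longrightarrow> awlast u p \<in> verts Q"
  unfolding paths_iff by auto

lemma paths_start: "(u, p) \<in> paths \<Longrightarrow> u \<in> verts Q"
  unfolding paths_iff by auto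

lemma paths_take_drop: "(u, p) \<in> paths \<Longrightarrow> (u, take i p) \<in> paths \<and> (awlast u (take i p), drop i p) \<in> paths"
  using paths_append[of u "take i p" "drop i p"] by simp

lemma finite_paths: "finite paths"
proof (rule finite_subset)
  show "paths \<subseteq> verts Q \<times> {p. set p \<subseteq> arcs Q \<and> length p \<le> k}"
    by (auto simp: paths_iff awalk_def)
  show "finite (verts Q \<times> {p. set p \<subseteq> arcs Q \<and> length p \<le> k})"
    by (intro finite_cartesian_product finite_verts finite_lists_length_le finite_arcs)
qed

lemma cf_space: "cf ` carrier A = {f. (\<forall>x. f x \<in> carrier K) \<and> (\<forall>x. x \<notin> paths \<longrightarrow> f x = \<zero>\<^bsub>K\<^esub>)}"
  using cf_bij by (simp add: bij_betw_def paths_def)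

lemma cf_closed [simp, intro]: "a \<in> carrier A \<Longrightarrow> cf a x \<in> carrier K"
  using cf_space by blast

lemma cf_outside: "a \<in> carrier A \<Longrightarrow> x \<notin> paths \<Longrightarrow> cf a x = \<zero>\<^bsub>K\<^esub>"
  using cf_space by blast

lemma eqI:
  assumes "a \<in> carrier A" "b \<in> carrier A" "\<And>u p. (u, p) \<in> paths \<Longrightarrow> cf a (u, p) = cf b (u, p)"
  shows "a = b"
proof -
  have "cf a = cf b" using assms cf_outside by (auto simp: fun_eq_iff) (metis)
  then show ?thesis using cf_bij assms by (auto simp: bij_betw_def inj_on_def)
qed

definition mk :: "('v \<times> 'e list \<Rightarrow> 'k) \<Rightarrow> 'a" where
  "mk f = inv_into (carrier A) cf (\<lambda>x. if x \<in> paths then f x else \<zero>\<^bsub>K\<^esub>)"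

lemma
  assumes "\<And>u p. (u, p) \<in> paths \<Longrightarrow> f (u, p) \<in> carrier K"
  shows mk_closed: "mk f \<in> carrier A"
    and cf_mk: "cf (mk f) x = (if x \<in> paths then f x else \<zero>\<^bsub>K\<^esub>)"
proof -
  have "(\<lambda>x. if x \<in> paths then f x else \<zero>\<^bsub>K\<^esub>) \<in> cf ` carrier A"
    using assms by (auto simp: cf_space)
  from inv_into_into[OF this] f_inv_into_f[OF this]
  show "mk f \<in> carrier A" "cf (mk f) x = (if x \<in> paths then f x else \<zero>\<^bsub>K\<^esub>)" by (simp_all add: mk_def)
qed

lemma cf_zero [simp]: "cf \<zero> x = \<zero>\<^bsub>K\<^esub>"
  using cf_add[of \<zero> \<zero> x] K.add.r_cancel_one'[of "cf \<zero> x" "cf \<zero> x"] by simp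

lemma cf_minus: "a \<in> carrier A \<Longrightarrow> cf (\<ominus> a) x = \<ominus>\<^bsub>K\<^esub> cf a x"
  using cf_add[of "\<ominus> a" a x] by (simp add: A.l_neg K.minus_equality)

lemma cf_diff: "a \<in> carrier A \<Longrightarrow> b \<in> carrier A \<Longrightarrow> cf (a \<ominus> b) x = cf a x \<ominus>\<^bsub>K\<^esub> cf b x"
  by (simp add: a_minus_def cf_add cf_minus)

lemma cf_mult': "\<lbrakk>a \<in> carrier A; b \<in> carrier A; (u, p) \<in> paths\<rbrakk> \<Longrightarrow>
      cf (a \<otimes> b) (u, p) =
        (\<Oplus>\<^bsub>K\<^esub>i\<in>{..length p}. cf a (u, take i p) \<otimes>\<^bsub>K\<^esub> cf b (awlast u (take i p), drop i p))"
  by (intro cf_mult) (auto simp: paths_def)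

lemma cf_mult_eqI:
  assumes "a \<in> carrier A" "b \<in> carrier A" "(u, p) \<in> paths" "i \<le> length p"
    and "\<And>j. j \<le> length p \<Longrightarrow> j \<noteq> i \<Longrightarrow> cf a (u, take j p) = \<zero>\<^bsub>K\<^esub> \<or> cf b (awlast u (take j p), drop j p) = \<zero>\<^bsub>K\<^esub>"
  shows "cf (a \<otimes> b) (u, p) = cf a (u, take i p) \<otimes>\<^bsub>K\<^esub> cf b (awlast u (take i p), drop i p)"
  unfolding cf_mult'[OF assms(1-3)] using assms by (subst K.finsum_single[of _ i]) fastforce+

lemma cf_mult_zeroI:
  assumes "a \<in> carrier A" "b \<in> carrier A"
    and "\<And>j. (u, p) \<in> paths \<Longrightarrow> j \<le> length p \<Longrightarrow> cf a (u, take j p) = \<zero>\<^bsub>K\<^esub> \<or> cf b (awlast u (take j p), drop j p) = \<zero>\<^bsub>K\<^esub>"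
  shows "cf (a \<otimes> b) (u, p) = \<zero>\<^bsub>K\<^esub>"
proof (cases "(u, p) \<in> paths")
  case True
  show ?thesis unfolding cf_mult'[OF assms(1,2) True] using assms True by (intro K.finsum_all_zero) fastforce
qed (use cf_outside assms in auto)

text \<open>The path \<open>x\<close> as an element of \<open>A\<close>; it is zero if
  \<open>x\<close> is not a path of length below \<open>k\<close>.\<close>

definition pe :: "'v \<times> 'e list \<Rightarrow> 'a" where
  "pe x = mk (\<lambda>y. if y = x then \<one>\<^bsub>K\<^esub> else \<zero>\<^bsub>K\<^esub>)"

lemma pe_closed [simp, intro]: "pe x \<in> carrier A"
  unfolding pe_def by (rule mk_closed) auto

lemma cf_pe: "cf (pe x) y = (if y = x \<and> x \<in> paths then \<one>\<^bsub>K\<^esub> else \<zero>\<^bsub>K\<^esub>)"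
  unfolding pe_def by (subst cf_mk) auto

abbreviation "ev v \<equiv> pe (v, [])"

text \<open>The scalar multiples of the unit. They are central, and through them every module
  becomes a vector space over \<open>K\<close>.\<close>

definition sc :: "'k \<Rightarrow> 'a" where
  "sc c = mk (\<lambda>(u, p). if p = [] then c else \<zero>\<^bsub>K\<^esub>)"

lemma sc_closed [simp, intro]: "c \<in> carrier K \<Longrightarrow> sc c \<in> carrier A"
  unfolding sc_def by (rule mk_closed) auto

lemma cf_sc: "c \<in> carrier K \<Longrightarrow> cf (sc c) (u, p) = (if p = [] \<and> u \<in> verts Q then c else \<zero>\<^bsub>K\<^esub>)"
  unfolding sc_def by (subst cf_mk) (auto simp: paths_Nil)

lemma cf_sc_mult: "c \<in> carrier K \<Longrightarrow> b \<in> carrier A \<Longrightarrow> cf (sc c \<otimes> b) x = c \<otimes>\<^bsub>K\<^esub> cf b x"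
proof (cases x)
  case [simp]: (Pair u p)
  assume *: "c \<in> carrier K" "b \<in> carrier A"
  show ?thesis
  proof (cases "x \<in> paths")
    case True
    then show ?thesis using * paths_start[of u p]
      by (simp, subst cf_mult_eqI[of _ _ _ _ 0]) (auto simp: cf_sc)
  qed (use * cf_outside in auto)
qed

lemma cf_mult_sc: "c \<in> carrier K \<Longrightarrow> b \<in> carrier A \<Longrightarrow> cf (b \<otimes> sc c) x = c \<otimes>\<^bsub>K\<^esub> cf b x"
proof (cases x)
  case [simp]: (Pair u p)
  assume *: "c \<in> carrier K" "b \<in> carrier A"
  show ?thesis
  proof (cases "x \<in> paths")
    case True
    then show ?thesis using * paths_end[of u p]
      by (simp, subst cf_mult_eqI[of _ _ _ _ "length p"]) (auto simp: cf_sc K.m_comm)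
  qed (use * cf_outside in auto)
qed

lemma sc_central: "c \<in> carrier K \<Longrightarrow> b \<in> carrier A \<Longrightarrow> sc c \<otimes> b = b \<otimes> sc c"
  by (rule eqI) (auto simp: cf_sc_mult cf_mult_sc)

lemma sc_add: "c \<in> carrier K \<Longrightarrow> d \<in> carrier K \<Longrightarrow> sc (c \<oplus>\<^bsub>K\<^esub> d) = sc c \<oplus> sc d"
  by (rule eqI) (auto simp: cf_sc cf_add)

lemma sc_mult: "c \<in> carrier K \<Longrightarrow> d \<in> carrier K \<Longrightarrow> sc (c \<otimes>\<^bsub>K\<^esub> d) = sc c \<otimes> sc d"
  by (rule eqI) (auto simp: cf_sc cf_sc_mult)

lemma sc_one: "sc \<one>\<^bsub>K\<^esub> = \<one>"
  by (rule eqI) (auto simp: cf_sc cf_one)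

lemma sc_zero: "sc \<zero>\<^bsub>K\<^esub> = \<zero>"
  by (rule eqI) (auto simp: cf_sc)

text \<open>\<open>E v\<close> is the right ideal \<open>e\<^sub>v A\<close>, and \<open>F t\<close> the \<open>t\<close>-th power of the arrow ideal.\<close>

definition E :: "'v \<Rightarrow> 'a set" where
  "E v = {a \<in> carrier A. \<forall>u p. u \<noteq> v \<longrightarrow> cf a (u, p) = \<zero>\<^bsub>K\<^esub>}"

definition F :: "nat \<Rightarrow> 'a set" where
  "F t = {a \<in> carrier A. \<forall>u p. length p < t \<longrightarrow> cf a (u, p) = \<zero>\<^bsub>K\<^esub>}"

lemma EI: "a \<in> carrier A \<Longrightarrow> (\<And>u p. u \<noteq> v \<Longrightarrow> (u, p) \<in> paths \<Longrightarrow> cf a (u, p) = \<zero>\<^bsub>K\<^esub>) \<Longrightarrow> a \<in> E v"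
  using cf_outside[of a] by (simp add: E_def) metis

lemma FI: "a \<in> carrier A \<Longrightarrow> (\<And>u p. length p < t \<Longrightarrow> (u, p) \<in> paths \<Longrightarrow> cf a (u, p) = \<zero>\<^bsub>K\<^esub>) \<Longrightarrow> a \<in> F t"
  using cf_outside[of a] by (simp add: F_def) metis

lemma E_cf: "a \<in> E v \<Longrightarrow> u \<noteq> v \<Longrightarrow> cf a (u, p) = \<zero>\<^bsub>K\<^esub>"
  and F_cf: "a \<in> F t \<Longrightarrow> length p < t \<Longrightarrow> cf a (u, p) = \<zero>\<^bsub>K\<^esub>"
  by (auto simp: E_def F_def)

lemma E_zero [simp]: "\<zero> \<in> E v" and F_zero [simp]: "\<zero> \<in> F t"
  by (auto simp: E_def F_def)

lemma E_add [intro]: "a \<in> E v \<Longrightarrow> b \<in> E v \<Longrightarrow> a \<oplus> b \<in> E v"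
  and E_minus [intro]: "a \<in> E v \<Longrightarrow> \<ominus> a \<in> E v"
  and E_diff [intro]: "a \<in> E v \<Longrightarrow> b \<in> E v \<Longrightarrow> a \<ominus> b \<in> E v"
  and F_add [intro]: "a \<in> F t \<Longrightarrow> b \<in> F t \<Longrightarrow> a \<oplus> b \<in> F t"
  and F_minus [intro]: "a \<in> F t \<Longrightarrow> \<ominus> a \<in> F t"
  and F_diff [intro]: "a \<in> F t \<Longrightarrow> b \<in> F t \<Longrightarrow> a \<ominus> b \<in> F t"
  by (auto simp: E_def F_def cf_add cf_minus cf_diff a_minus_def)

lemma F_0: "F 0 = carrier A" by (auto simp: F_def)

lemma F_k: "t \<ge> k \<Longrightarrow> a \<in> F t \<Longrightarrow> a = \<zero>"
  by (rule eqI) (auto simp: F_def paths_iff)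

lemma ev_E: "ev v \<in> E v"
  by (auto simp: E_def cf_pe)

lemma pe_E: "pe (v, p) \<in> E v"
  by (auto simp: E_def cf_pe)

lemma pe_F: "pe (v, p) \<in> F (length p)"
  by (auto simp: F_def cf_pe)

lemma E_carrier [simp]: "a \<in> E v \<Longrightarrow> a \<in> carrier A"
  and F_carrier [simp]: "a \<in> F t \<Longrightarrow> a \<in> carrier A"
  by (auto simp: E_def F_def)

lemma E_mult [intro]:
  assumes "a \<in> E v" "b \<in> carrier A"
  shows "a \<otimes> b \<in> E v"
  using assms by (intro EI cf_mult_zeroI) (auto simp: E_cf)

lemma F_mult:
  assumes "a \<in> F s" "b \<in> F t"
  shows "a \<otimes> b \<in> F (s + t)"
proof (intro FI cf_mult_zeroI)
  fix u :: 'v and p :: "'e list" and j assume "length p < s + t" "j \<le> length p"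
  then have "length (take j p) < s \<or> length (drop j p) < t" by auto
  then show "cf a (u, take j p) = \<zero>\<^bsub>K\<^esub> \<or> cf b (awlast u (take j p), drop j p) = \<zero>\<^bsub>K\<^esub>"
    using assms F_cf by blast
qed (use assms in auto)

lemma F_mult_r [intro]: "a \<in> F t \<Longrightarrow> b \<in> carrier A \<Longrightarrow> a \<otimes> b \<in> F t"
  using F_mult[of a t b 0] by (simp add: F_0)

lemma F_mult_l: "a \<in> F t \<Longrightarrow> b \<in> carrier A \<Longrightarrow> b \<otimes> a \<in> F t"
  using F_mult[of b 0 a t] by (simp add: F_0)

lemma F_SucI:
  assumes "a \<in> F t" "\<And>u p. length p = t \<Longrightarrow> (u, p) \<in> paths \<Longrightarrow> cf a (u, p) = \<zero>\<^bsub>K\<^esub>"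
  shows "a \<in> F (Suc t)"
  using assms by (intro FI) (auto simp: less_Suc_eq F_cf)

lemma cf_ev_mult:
  assumes "b \<in> carrier A" "v \<in> verts Q"
  shows "cf (ev v \<otimes> b) (u, p) = (if u = v then cf b (u, p) else \<zero>\<^bsub>K\<^esub>)"
proof (cases "(u, p) \<in> paths")
  case True
  show ?thesis
  proof (cases "u = v")
    case [simp]: True
    show ?thesis using assms \<open>(u, p) \<in> paths\<close>
      by (subst cf_mult_eqI[of _ _ _ _ 0]) (auto simp: cf_pe paths_Nil)
  qed (use assms in \<open>auto intro!: cf_mult_zeroI simp: cf_pe\<close>)
qed (use assms cf_outside in auto)

lemma cf_mult_ev:
  assumes "b \<in> carrier A" "v \<in> verts Q"
  shows "cf (b \<otimes> ev v) (u, p) = (if awlast u p = v then cf b (u, p) else \<zero>\<^bsub>K\<^esub>)"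
proof (cases "(u, p) \<in> paths")
  case True
  show ?thesis
  proof (cases "awlast u p = v")
    case [simp]: True
    show ?thesis using assms \<open>(u, p) \<in> paths\<close>
      by (subst cf_mult_eqI[of _ _ _ _ "length p"]) (auto simp: cf_pe paths_Nil)
  next
    case False
    have "cf b (u, take j p) = \<zero>\<^bsub>K\<^esub> \<or> cf (ev v) (awlast u (take j p), drop j p) = \<zero>\<^bsub>K\<^esub>" if "j \<le> length p" for j
      using False that by (cases "j = length p") (auto simp: cf_pe)
    then have "cf (b \<otimes> ev v) (u, p) = \<zero>\<^bsub>K\<^esub>" using assms(1) by (intro cf_mult_zeroI) auto
    then show ?thesis using False by simp
  qed
qed (use assms cf_outside in auto)

lemma ev_mult: "a \<in> E v \<Longrightarrow> v \<in> verts Q \<Longrightarrow> ev v \<otimes> a = a"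
  by (rule eqI) (auto simp: cf_ev_mult E_cf)

text \<open>By length, only the cut before the first arrow contributes. Thus an element with nonzero
  constant term at \<open>v\<close> is not annihilated by a path starting at
  \<open>v\<close>.\<close>

lemma cf_mult_pe_lowest:
  assumes "a \<in> carrier A" "(v, p) \<in> paths"
  shows "cf (a \<otimes> pe (v, p)) (v, p) = cf a (v, [])"
proof -
  have "cf (a \<otimes> pe (v, p)) (v, p) = cf a (v, take 0 p) \<otimes>\<^bsub>K\<^esub> cf (pe (v, p)) (awlast v (take 0 p), drop 0 p)"
    by (rule cf_mult_eqI) (use assms in \<open>auto simp: cf_pe dest: arg_cong[of _ _ length]\<close>)
  then show ?thesis using assms by (simp add: cf_pe)
qed

text \<open>\<open>lq q\<close> cancels the path \<open>q\<close> on the left.\<close>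

definition lq :: "'v \<times> 'e list \<Rightarrow> 'a \<Rightarrow> 'a" where
  "lq q a = mk (\<lambda>(w, p). if w = awlast (fst q) (snd q) then cf a (fst q, snd q @ p) else \<zero>\<^bsub>K\<^esub>)"

text \<open>Normal form modulo the span of the paths in \<open>Z\<close>.\<close>

definition kz :: "('v \<times> 'e list) set \<Rightarrow> 'a \<Rightarrow> 'a" where
  "kz Z a = mk (\<lambda>x. if x \<in> Z then \<zero>\<^bsub>K\<^esub> else cf a x)"

end

section \<open>Cancelling a path, normal forms, and successive approximation\<close>

context coeff_algebra
begin

lemma lq_closed [simp]: "a \<in> carrier A \<Longrightarrow> lq q a \<in> carrier A"
  unfolding lq_def by (rule mk_closed) auto

lemma cf_lq:
  assumes "a \<in> carrier A" "(v, q) \<in> paths"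
  shows "cf (lq (v, q) a) (w, p) = (if w = awlast v q then cf a (v, q @ p) else \<zero>\<^bsub>K\<^esub>)"
proof (cases "(w, p) \<in> paths")
  case True
  then show ?thesis using assms unfolding lq_def by (subst cf_mk) auto
next
  case False
  then have "w = awlast v q \<Longrightarrow> (v, q @ p) \<notin> paths" using paths_append by blast
  then show ?thesis using assms False cf_outside[OF lq_closed[OF assms(1)]] cf_outside[OF assms(1)] by auto
qed

lemma lq_E: "a \<in> carrier A \<Longrightarrow> (v, q) \<in> paths \<Longrightarrow> lq (v, q) a \<in> E (awlast v q)"
  by (rule EI) (auto simp: cf_lq)

lemma lq_add: "a \<in> carrier A \<Longrightarrow> b \<in> carrier A \<Longrightarrow> (v, q) \<in> paths \<Longrightarrow>
    lq (v, q) (a \<oplus> b) = lq (v, q) a \<oplus> lq (v, q) b"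
  by (rule eqI) (auto simp: cf_lq cf_add)

lemma lq_high:
  assumes "a \<in> carrier A" "(v, q) \<in> paths" "k - length q \<le> length p"
  shows "cf (lq (v, q) a) (w, p) = \<zero>\<^bsub>K\<^esub>"
proof -
  have "(v, q @ p) \<notin> paths" using assms(3) by (auto simp: paths_append)
  then show ?thesis using assms(1,2) cf_outside by (simp add: cf_lq)
qed

lemma lq_pe: "(v, q) \<in> paths \<Longrightarrow> lq (v, q) (pe (v, q)) = ev (awlast v q)"
  by (rule eqI) (auto simp: cf_lq cf_pe paths_Nil paths_end)

lemma kz_closed [simp]: "a \<in> carrier A \<Longrightarrow> kz Z a \<in> carrier A"
  unfolding kz_def by (rule mk_closed) auto

lemma cf_kz: "a \<in> carrier A \<Longrightarrow> cf (kz Z a) x = (if x \<in> Z then \<zero>\<^bsub>K\<^esub> else cf a x)"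
  unfolding kz_def by (subst cf_mk) (auto simp: cf_outside)

lemma kz_add: "a \<in> carrier A \<Longrightarrow> b \<in> carrier A \<Longrightarrow> kz Z (a \<oplus> b) = kz Z a \<oplus> kz Z b"
  by (rule eqI) (auto simp: cf_kz cf_add)

lemma kz_E: "a \<in> E v \<Longrightarrow> kz Z a \<in> E v"
  by (rule EI) (auto simp: cf_kz E_cf)

lemma kz_F: "a \<in> F t \<Longrightarrow> kz Z a \<in> F t"
  by (rule FI) (auto simp: cf_kz F_cf)

lemma kz_id: "a \<in> carrier A \<Longrightarrow> (\<And>x. x \<in> Z \<Longrightarrow> cf a x = \<zero>\<^bsub>K\<^esub>) \<Longrightarrow> kz Z a = a"
  by (rule eqI) (auto simp: cf_kz)

text \<open>This makes the span of the paths in \<open>Z\<close> a right ideal, so that normal forms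
  represent the elements of a quotient module.\<close>

definition rclosed :: "('v \<times> 'e list) set \<Rightarrow> bool" where
  "rclosed Z \<longleftrightarrow> (\<forall>u p q. (u, p) \<in> Z \<longrightarrow> (u, p @ q) \<in> Z)"

lemma rclosed_long [simp]: "rclosed {x. t \<le> length (snd x)}"
  by (auto simp: rclosed_def)

lemma rclosed_append: "rclosed Z \<Longrightarrow> (u, p) \<in> Z \<Longrightarrow> (u, p @ q) \<in> Z"
  unfolding rclosed_def by blast

lemma rclosed_take: "rclosed Z \<Longrightarrow> (u, take i p) \<in> Z \<Longrightarrow> (u, p) \<in> Z"
  using rclosed_append[of Z u "take i p" "drop i p"] by simp

text \<open>A coefficient of a product at a path outside \<open>Z\<close> involves the left factor
  only at prefixes of that path, and these lie outside \<open>Z\<close> as well.\<close>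

lemma kz_mult:
  assumes "rclosed Z" "a \<in> carrier A" "r \<in> carrier A"
  shows "kz Z (kz Z a \<otimes> r) = kz Z (a \<otimes> r)"
proof (rule eqI)
  fix u p assume p: "(u, p) \<in> paths"
  show "cf (kz Z (kz Z a \<otimes> r)) (u, p) = cf (kz Z (a \<otimes> r)) (u, p)"
  proof (cases "(u, p) \<in> Z")
    case False
    then have "cf (kz Z a) (u, take i p) = cf a (u, take i p)" for i
      using rclosed_take[OF assms(1), of u i p] False by (simp add: cf_kz[OF assms(2)]) blast
    then show ?thesis using assms p False by (simp add: cf_kz cf_mult')
  qed (use assms in \<open>simp add: cf_kz\<close>)
qed (use assms in auto)

text \<open>Since \<open>a\<close> has order at least \<open>length q\<close>, cuts of
  \<open>q @ p\<close> inside \<open>q\<close> contribute nothing. The truncation is needed because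
  \<open>q @ p\<close> vanishes in \<open>A\<close> once its length reaches \<open>k\<close>, while
  \<open>p\<close> alone may still occur in the product on the right.\<close>

lemma lq_mult:
  assumes "a \<in> F (length q)" "r \<in> carrier A" "(v, q) \<in> paths"
  shows "lq (v, q) (a \<otimes> r) = kz {x. k - length q \<le> length (snd x)} (lq (v, q) a \<otimes> r)"
proof (rule eqI)
  have a: "a \<in> carrier A" using assms(1) by simp
  fix w p assume wp: "(w, p) \<in> paths"
  consider "w \<noteq> awlast v q" | "k - length q \<le> length p" | "w = awlast v q" "length q + length p < k"
    by linarith
  then show "cf (lq (v, q) (a \<otimes> r)) (w, p) = cf (kz {x. k - length q \<le> length (snd x)} (lq (v, q) a \<otimes> r)) (w, p)"
  proof cases
    case 1
    then show ?thesis
      using E_cf[OF E_mult[OF lq_E[OF a assms(3)] assms(2)]] a assms by (simp add: cf_lq cf_kz)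
  next
    case 2
    then show ?thesis using a assms by (simp add: lq_high cf_kz)
  next
    case 3
    then have vqp: "(v, q @ p) \<in> paths" using assms(3) wp paths_append by blast
    let ?f = "\<lambda>i. cf a (v, take i (q @ p)) \<otimes>\<^bsub>K\<^esub> cf r (awlast v (take i (q @ p)), drop i (q @ p))"
    have "cf (lq (v, q) (a \<otimes> r)) (w, p) = finsum K ?f {..length q + length p}"
      using a assms 3 vqp by (simp add: cf_lq cf_mult')
    also have "\<dots> = finsum K (\<lambda>i. ?f (length q + i)) {..length p}"
      using a assms by (intro K.finsum_shift) (auto simp: F_cf)
    also have "\<dots> = cf (lq (v, q) a \<otimes> r) (w, p)"
      using a assms wp 3 by (simp add: cf_mult' cf_lq awlast_append)
    finally have "cf (lq (v, q) (a \<otimes> r)) (w, p) = cf (lq (v, q) a \<otimes> r) (w, p)" .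
    moreover have "\<not> k - length q \<le> length p" using 3 by simp
    ultimately show ?thesis using a assms(2) by (simp add: cf_kz)
  qed
qed (use assms in auto)

text \<open>If \<open>c\<close> is the constant term of \<open>a\<close> at \<open>v\<close>, then
  \<open>a\<close> times \<open>inv c * b\<close> agrees with \<open>b\<close> in the lowest order.
  Iterating the correction does the work of a geometric series for the inverse of
  \<open>a\<close>.\<close>

lemma approx_unit:
  assumes "v \<in> verts Q" "a \<in> E v" "cf a (v, []) \<noteq> \<zero>\<^bsub>K\<^esub>" "b \<in> E v" "b \<in> F t"
  shows "b \<ominus> a \<otimes> (sc (inv\<^bsub>K\<^esub> (cf a (v, []))) \<otimes> b) \<in> E v"
    and "b \<ominus> a \<otimes> (sc (inv\<^bsub>K\<^esub> (cf a (v, []))) \<otimes> b) \<in> F (Suc t)"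
proof -
  let ?c = "cf a (v, [])" and ?b = "sc (inv\<^bsub>K\<^esub> (cf a (v, []))) \<otimes> b"
  have a: "a \<in> carrier A" and b: "b \<in> carrier A" using assms by simp_all
  have c: "?c \<in> Units K" using a assms(3) by (simp add: K.field_Units)
  have i: "inv\<^bsub>K\<^esub> ?c \<in> carrier K" using c by (rule K.Units_inv_closed)
  have b': "?b \<in> F t" by (rule F_mult_l[OF assms(5) sc_closed[OF i]])
  then have b'': "?b \<in> carrier A" by (rule F_carrier)
  show 1: "b \<ominus> a \<otimes> ?b \<in> E v" using assms b'' by blast
  show "b \<ominus> a \<otimes> ?b \<in> F (Suc t)"
  proof (rule F_SucI)
    show "b \<ominus> a \<otimes> ?b \<in> F t" using assms(5) F_mult_l[OF b' a] by (rule F_diff)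
    fix u p assume p: "length p = t" "(u, p) \<in> paths"
    show "cf (b \<ominus> a \<otimes> ?b) (u, p) = \<zero>\<^bsub>K\<^esub>"
    proof (cases "u = v")
      case True
      have "cf (a \<otimes> ?b) (v, p) = cf a (v, take 0 p) \<otimes>\<^bsub>K\<^esub> cf ?b (awlast v (take 0 p), drop 0 p)"
        by (rule cf_mult_eqI) (use a b'' p True F_cf[OF b'] in auto)
      also have "\<dots> = (?c \<otimes>\<^bsub>K\<^esub> inv\<^bsub>K\<^esub> ?c) \<otimes>\<^bsub>K\<^esub> cf b (v, p)" using i a b
        by (simp add: cf_sc_mult K.m_assoc)
      also have "\<dots> = cf b (v, p)" using K.Units_r_inv[OF c] b by simp
      finally show ?thesis using True a b b'' by (simp add: cf_diff K.minus_eq K.r_neg)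
    qed (use 1 E_cf in auto)
  qed
qed

text \<open>Descending induction along the powers of the arrow ideal, which ends because
  \<open>F k\<close> contains only zero. Together with \<open>approx_unit\<close> it solves
  equations by successive approximation.\<close>

lemma F_induct:
  assumes "P \<zero>" "\<And>t a. a \<in> S \<Longrightarrow> a \<in> F t \<Longrightarrow> (\<And>b. b \<in> S \<Longrightarrow> b \<in> F (Suc t) \<Longrightarrow> P b) \<Longrightarrow> P a"
    and "a \<in> S" "a \<in> F t"
  shows "P a"
  using assms(3,4)
proof (induction "k - t" arbitrary: t a)
  case 0
  then show ?case using F_k[of t a] assms(1) by simp
next
  case (Suc n)
  show ?case
    by (rule assms(2)[OF Suc.prems], rule Suc.hyps(1)) (use Suc.hyps(2) in auto)
qed

section \<open>Projective and monomial modules\<close>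

text \<open>The direct sum of the projective modules \<open>e_v A\<close> over the entries
  \<open>v\<close> of \<open>vs\<close>, with tuples as elements.\<close>

definition PM :: "'v list \<Rightarrow> ('a, 'a list) module" where
  "PM vs = \<lparr>carrier = {as. length as = length vs \<and> (\<forall>i<length vs. as ! i \<in> E (vs ! i))},
     monoid.mult = (\<lambda>_ _. undefined), monoid.one = undefined,
     ring.zero = map (\<lambda>_. \<zero>) vs, ring.add = map2 (\<oplus>), module.smult = (\<lambda>r. map (\<lambda>a. a \<otimes> r))\<rparr>"

lemma PM_simps:
  "carrier (PM vs) = {as. length as = length vs \<and> (\<forall>i<length vs. as ! i \<in> E (vs ! i))}"
  "\<zero>\<^bsub>PM vs\<^esub> = map (\<lambda>_. \<zero>) vs" "x \<oplus>\<^bsub>PM vs\<^esub> y = map2 (\<oplus>) x y" "r \<odot>\<^bsub>PM vs\<^esub> x = map (\<lambda>a. a \<otimes> r) x"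
  by (simp_all add: PM_def)

lemma PM_nth_carrier:
  "\<lbrakk>length x = length vs; \<forall>i<length vs. x ! i \<in> E (vs ! i); i < length vs\<rbrakk> \<Longrightarrow> x ! i \<in> carrier A"
  by (rule E_carrier) blast

lemma PM_set_carrier:
  "\<lbrakk>a \<in> set x; length x = length vs; \<forall>i<length vs. x ! i \<in> E (vs ! i)\<rbrakk> \<Longrightarrow> a \<in> carrier A"
  by (metis E_carrier in_set_conv_nth)

lemma PM_right_module: "right_module A (PM vs)"
proof -
  note [simp] = PM_nth_carrier[where vs = vs] PM_set_carrier[where vs = vs]
  show ?thesis
  proof (rule right_moduleI)
    fix x assume "x \<in> carrier (PM vs)"
    then show "\<exists>y\<in>carrier (PM vs). y \<oplus>\<^bsub>PM vs\<^esub> x = \<zero>\<^bsub>PM vs\<^esub>"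
      by (intro bexI[of _ "map (\<lambda>a. \<ominus> a) x"]) (auto simp: PM_simps A.l_neg intro!: nth_equalityI E_minus)
  qed (auto simp: PM_simps A.ring_axioms A.a_assoc A.l_distr A.r_distr A.m_assoc
      intro!: nth_equalityI A.a_comm)
qed

lemma PM_nth:
  "i < length vs \<Longrightarrow> \<zero>\<^bsub>PM vs\<^esub> ! i = \<zero>"
  "i < length vs \<Longrightarrow> x \<in> carrier (PM vs) \<Longrightarrow> y \<in> carrier (PM vs) \<Longrightarrow> (x \<oplus>\<^bsub>PM vs\<^esub> y) ! i = x ! i \<oplus> y ! i"
  "i < length vs \<Longrightarrow> x \<in> carrier (PM vs) \<Longrightarrow> (r \<odot>\<^bsub>PM vs\<^esub> x) ! i = x ! i \<otimes> r"
  "i < length vs \<Longrightarrow> x \<in> carrier (PM vs) \<Longrightarrow> x ! i \<in> E (vs ! i)"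
  by (auto simp: PM_simps)

lemma PM_eqI:
  "\<lbrakk>x \<in> carrier (PM vs); y \<in> carrier (PM vs); \<And>i. i < length vs \<Longrightarrow> x ! i = y ! i\<rbrakk> \<Longrightarrow> x = y"
  by (auto simp: PM_simps intro!: nth_equalityI)

lemma PM_Cons_iso: "rmod_iso A (PM (v # vs)) (direct_sum (PM [v]) (PM vs))"
proof -
  let ?h = "\<lambda>as. ([hd as], tl as)"
  have "?h \<in> rmod_hom A (PM (v # vs)) (direct_sum (PM [v]) (PM vs))"
    by (rule rmod_homI)
      (auto simp: PM_simps direct_sum_simps All_less_Suc2 length_Suc_conv)
  moreover have "bij_betw ?h (carrier (PM (v # vs))) (carrier (direct_sum (PM [v]) (PM vs)))"
    by (rule bij_betwI[where g = "\<lambda>(x, y). hd x # y"])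
      (auto simp: PM_simps direct_sum_simps All_less_Suc2 length_Suc_conv)
  ultimately show ?thesis unfolding rmod_iso_def by (intro bexI[of _ ?h])
qed

text \<open>The idempotent \<open>ev v\<close> generates the module. A lift sends \<open>[a]\<close>
  to \<open>y a\<close>, where \<open>y\<close> is any preimage of the value at \<open>ev v\<close>;
  this lifts the given map because \<open>ev v \<otimes> a = a\<close> on
  \<open>E v\<close>.\<close>

lemma PM_single:
  assumes "v \<in> verts Q"
  shows "PM [v] \<in> fg_modules A" "projective A (PM [v])"
proof -
  interpret P: right_module A "PM [v]" by (rule PM_right_module)
  have gen: "x = hd x \<odot>\<^bsub>PM [v]\<^esub> [ev v]" "hd x \<in> carrier A" if "x \<in> carrier (PM [v])" for x
    using that assms by (auto simp: PM_simps length_Suc_conv ev_mult)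
  have e: "[ev v] \<in> carrier (PM [v])" by (auto simp: PM_simps ev_E)
  have "fin_gen A (PM [v])"
    unfolding fin_gen_def
  proof (rule exI[of _ "{[ev v]}"], intro conjI allI impI)
    fix U assume "submodule U A (PM [v]) \<and> {[ev v]} \<subseteq> U"
    then show "U = carrier (PM [v])" using gen P.submoduleD(1,4)[of U] by (auto) (metis)
  qed (use e in auto)
  then show "PM [v] \<in> fg_modules A" by (rule fg_modulesI[OF P.right_module_axioms])
  show "projective A (PM [v])"
    unfolding projective_def
  proof (intro allI impI, elim conjE)
    fix N N' :: "('a, 'a list) module" and g f
    assume N: "right_module A N" "right_module A N'" "g \<in> rmod_hom A N N'" "g ` carrier N = carrier N'"
      and f: "f \<in> rmod_hom A (PM [v]) N'"
    interpret N: right_module A N by fact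
    obtain y where y: "y \<in> carrier N" "g y = f [ev v]"
      using rmod_homD(1)[OF f e] N(4) by (metis imageE)
    have "(\<lambda>x. hd x \<odot>\<^bsub>N\<^esub> y) \<in> rmod_hom A (PM [v]) N"
      using y by (intro rmod_homI)
        (auto simp: PM_simps length_Suc_conv N.smult_l_distr N.smult_assoc)
    moreover have "g (hd x \<odot>\<^bsub>N\<^esub> y) = f x" if "x \<in> carrier (PM [v])" for x
      using gen[OF that] y rmod_homD(3)[OF f _ e, of "hd x"] rmod_homD(3)[OF N(3), of "hd x" y] by simp
    ultimately show "\<exists>h\<in>rmod_hom A (PM [v]) N. \<forall>x\<in>carrier (PM [v]). g (h x) = f x"
      by (intro bexI[of _ "\<lambda>x. hd x \<odot>\<^bsub>N\<^esub> y"]) auto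
  qed
qed

lemma PM_fg_projective: "set vs \<subseteq> verts Q \<Longrightarrow> PM vs \<in> fg_modules A \<and> projective A (PM vs)"
proof (induction vs)
  case Nil
  interpret P: right_module A "PM []" by (rule PM_right_module)
  have c: "carrier (PM []) = {\<zero>\<^bsub>PM []\<^esub>}" by (auto simp: PM_simps)
  have "fin_gen A (PM [])"
    unfolding fin_gen_def by (rule exI[of _ "{}"]) (use c P.submoduleD(1,2) in auto)
  then show ?case
    using trivial_module_projective[OF c P.right_module_axioms] fg_modulesI[OF P.right_module_axioms] by blast
next
  case (Cons v vs)
  interpret P: right_module A "PM (v # vs)" by (rule PM_right_module)
  have 1: "PM [v] \<in> fg_modules A" "projective A (PM [v])" "PM vs \<in> fg_modules A" "projective A (PM vs)"
    using Cons PM_single by auto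
  have "rmod_iso A (PM (v # vs)) (dsum A (PM [v]) (PM vs))"
    by (rule rmod_iso_trans[OF PM_Cons_iso dsum_iso])
  then have i: "rmod_iso A (dsum A (PM [v]) (PM vs)) (PM (v # vs))"
    by (rule rmod_iso_sym[OF P.right_module_axioms])
  have d: "dsum A (PM [v]) (PM vs) \<in> fg_modules A" by (rule dsum_fg[OF 1(1,3)])
  show ?case
    using projective_iso[OF right_module_if_fg[OF d] i projective_dsum[OF 1(2,4) PM_right_module PM_right_module]]
      fg_modulesI[OF P.right_module_axioms fin_gen_iso[OF right_module_if_fg[OF d] P.right_module_axioms i fin_gen_if_fg[OF d]]]
    by blast
qed

text \<open>The quotient of \<open>e\<^sub>v A\<close> by the span of the paths in \<open>Z\<close>, carried by the normal forms.\<close>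

definition XM :: "'v \<Rightarrow> ('v \<times> 'e list) set \<Rightarrow> ('a, 'a list) module" where
  "XM v Z = \<lparr>carrier = {[b] | b. b \<in> E v \<and> (\<forall>x\<in>Z. cf b x = \<zero>\<^bsub>K\<^esub>)},
     monoid.mult = (\<lambda>_ _. undefined), monoid.one = undefined,
     ring.zero = [\<zero>], ring.add = (\<lambda>x y. [hd x \<oplus> hd y]), module.smult = (\<lambda>r x. [kz Z (hd x \<otimes> r)])\<rparr>"

lemma XM_simps:
  "carrier (XM v Z) = {[b] | b. b \<in> E v \<and> (\<forall>x\<in>Z. cf b x = \<zero>\<^bsub>K\<^esub>)}"
  "\<zero>\<^bsub>XM v Z\<^esub> = [\<zero>]" "x \<oplus>\<^bsub>XM v Z\<^esub> y = [hd x \<oplus> hd y]" "r \<odot>\<^bsub>XM v Z\<^esub> x = [kz Z (hd x \<otimes> r)]"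
  by (simp_all add: XM_def)

lemma XM_right_module:
  assumes "rclosed Z"
  shows "right_module A (XM v Z)"
proof (rule right_moduleI)
  fix x assume "x \<in> carrier (XM v Z)"
  then show "\<exists>y\<in>carrier (XM v Z). y \<oplus>\<^bsub>XM v Z\<^esub> x = \<zero>\<^bsub>XM v Z\<^esub>"
    by (intro bexI[of _ "[\<ominus> hd x]"]) (auto simp: XM_simps A.l_neg cf_minus)
qed (auto simp: XM_simps A.ring_axioms A.a_ac A.l_distr A.r_distr A.m_assoc kz_add kz_mult[OF assms]
      kz_id cf_add cf_kz intro!: kz_E)

lemma XM_hom:
  assumes "rclosed Z"
  shows "(\<lambda>x. [kz Z (hd x)]) \<in> rmod_hom A (PM [v]) (XM v Z)"
    and "(\<lambda>x. [kz Z (hd x)]) ` carrier (PM [v]) = carrier (XM v Z)"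
proof -
  show 1: "(\<lambda>x. [kz Z (hd x)]) \<in> rmod_hom A (PM [v]) (XM v Z)"
    by (rule rmod_homI)
      (auto simp: PM_simps XM_simps length_Suc_conv kz_E kz_add kz_mult[OF assms] cf_kz)
  show "(\<lambda>x. [kz Z (hd x)]) ` carrier (PM [v]) = carrier (XM v Z)"
  proof (intro equalityI subsetI)
    fix x assume "x \<in> carrier (XM v Z)"
    then show "x \<in> (\<lambda>x. [kz Z (hd x)]) ` carrier (PM [v])"
      by (intro image_eqI[of _ _ x]) (auto simp: XM_simps PM_simps kz_id)
  qed (use rmod_homD(1)[OF 1] in auto)
qed

lemma XM_fg:
  assumes "v \<in> verts Q" "rclosed Z"
  shows "XM v Z \<in> fg_modules A"
  by (rule fg_modulesI[OF XM_right_module[OF assms(2)] fin_gen_image[OF PM_right_module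
        XM_right_module[OF assms(2)] XM_hom[OF assms(2)] fin_gen_if_fg[OF PM_single(1)[OF assms(1)]]]])

end

context coeff_algebra
begin

text \<open>The module \<open>e\<^sub>w A / e\<^sub>w J\<^sup>j\<close>.\<close>

definition "CM w j = XM w {x. j \<le> length (snd x)}"

lemma CM_fg: "w \<in> verts Q \<Longrightarrow> CM w j \<in> fg_modules A"
  unfolding CM_def by (rule XM_fg) simp_all

lemma CM_right_module: "right_module A (CM w j)"
  unfolding CM_def by (rule XM_right_module) simp

text \<open>One summand is split off: cancelling \<open>q\<close> in coordinate \<open>i\<close>
  maps \<open>C\<close> to the local module at the end of \<open>q\<close>, and the multiples of
  \<open>y\<close> form a section. The section respects the truncation because all coordinates of
  \<open>y\<close> have order at least \<open>length q\<close>, so \<open>y\<close> is annihilated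
  by \<open>F (k - length q)\<close>.\<close>

lemma PM_split:
  assumes C: "submodule C A (PM vs)" and i: "i < length vs" and q: "(vs ! i, q) \<in> paths"
    and low: "\<And>x. x \<in> C \<Longrightarrow> x ! i \<in> F (length q)"
    and y: "y \<in> C" "\<And>j. j < length vs \<Longrightarrow> y ! j \<in> F (length q)"
    and yq: "lq (vs ! i, q) (y ! i) = ev (awlast (vs ! i) q)"
  shows "(\<lambda>x. [lq (vs ! i, q) (x ! i)]) \<in> rmod_hom A ((PM vs)\<lparr>carrier := C\<rparr>) (CM (awlast (vs ! i) q) (k - length q))"
    and "(\<lambda>b. hd b \<odot>\<^bsub>PM vs\<^esub> y) \<in> rmod_hom A (CM (awlast (vs ! i) q) (k - length q)) ((PM vs)\<lparr>carrier := C\<rparr>)"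
    and "b \<in> carrier (CM (awlast (vs ! i) q) (k - length q)) \<Longrightarrow> [lq (vs ! i, q) ((hd b \<odot>\<^bsub>PM vs\<^esub> y) ! i)] = b"
proof -
  interpret P: right_module A "PM vs" by (rule PM_right_module)
  note D = P.submoduleD[OF C]
  have Cc: "x \<in> carrier (PM vs)" if "x \<in> C" for x using D(1) that by blast
  have xi: "x ! i \<in> carrier A" if "x \<in> C" for x using low[OF that] by simp
  let ?w = "awlast (vs ! i) q" and ?Z = "{x :: 'v \<times> 'e list. k - length q \<le> length (snd x)}"
  have w: "?w \<in> verts Q" using q by (rule paths_end)
  show "(\<lambda>x. [lq (vs ! i, q) (x ! i)]) \<in> rmod_hom A ((PM vs)\<lparr>carrier := C\<rparr>) (CM ?w (k - length q))"
  proof (rule rmod_homI)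
    fix x assume "x \<in> carrier ((PM vs)\<lparr>carrier := C\<rparr>)"
    then show "[lq (vs ! i, q) (x ! i)] \<in> carrier (CM ?w (k - length q))"
      using xi q by (auto simp: CM_def XM_simps intro!: lq_E lq_high)
  next
    fix x z assume "x \<in> carrier ((PM vs)\<lparr>carrier := C\<rparr>)" "z \<in> carrier ((PM vs)\<lparr>carrier := C\<rparr>)"
    then show "[lq (vs ! i, q) ((x \<oplus>\<^bsub>(PM vs)\<lparr>carrier := C\<rparr>\<^esub> z) ! i)] =
        [lq (vs ! i, q) (x ! i)] \<oplus>\<^bsub>CM ?w (k - length q)\<^esub> [lq (vs ! i, q) (z ! i)]"
      using xi q PM_nth(2)[OF i Cc Cc] by (simp add: CM_def XM_simps lq_add)
  next
    fix r x assume "r \<in> carrier A" "x \<in> carrier ((PM vs)\<lparr>carrier := C\<rparr>)"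
    then show "[lq (vs ! i, q) ((r \<odot>\<^bsub>(PM vs)\<lparr>carrier := C\<rparr>\<^esub> x) ! i)] =
        r \<odot>\<^bsub>CM ?w (k - length q)\<^esub> [lq (vs ! i, q) (x ! i)]"
      using low q PM_nth(3)[OF i Cc] by (simp add: CM_def XM_simps lq_mult)
  qed
  have long: "b \<in> F (k - length q) \<Longrightarrow> b \<odot>\<^bsub>PM vs\<^esub> y = \<zero>\<^bsub>PM vs\<^esub>" for b
  proof (rule PM_eqI)
    fix j assume b: "b \<in> F (k - length q)" and j: "j < length vs"
    have "y ! j \<otimes> b \<in> F (length q + (k - length q))" using y(2)[OF j] b by (rule F_mult)
    then show "(b \<odot>\<^bsub>PM vs\<^esub> y) ! j = \<zero>\<^bsub>PM vs\<^esub> ! j"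
      using F_k[of "length q + (k - length q)"] j PM_nth(1,3)[OF j] Cc[OF y(1)] by simp
  qed (use y Cc in auto)
  show "(\<lambda>b. hd b \<odot>\<^bsub>PM vs\<^esub> y) \<in> rmod_hom A (CM ?w (k - length q)) ((PM vs)\<lparr>carrier := C\<rparr>)"
  proof (rule rmod_homI)
    fix r b assume r: "r \<in> carrier A" and "b \<in> carrier (CM ?w (k - length q))"
    then have b: "hd b \<in> carrier A" by (auto simp: CM_def XM_simps)
    \<comment> \<open>The scalar multiplication of \<open>CM\<close> drops the long paths; what it
      drops annihilates \<open>y\<close> by \<open>long\<close>.\<close>
    have "hd b \<otimes> r \<ominus> kz ?Z (hd b \<otimes> r) \<in> F (k - length q)"
      using r b by (intro FI) (auto simp: cf_diff cf_kz K.minus_eq K.r_neg)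
    from long[OF this] have "(hd b \<otimes> r) \<odot>\<^bsub>PM vs\<^esub> y = kz ?Z (hd b \<otimes> r) \<odot>\<^bsub>PM vs\<^esub> y"
      using r b Cc[OF y(1)] by (simp add: A.minus_eq P.smult_l_distr P.smult_l_minus P.r_neg)
         (metis P.M.minus_equality P.M.minus_minus P.smult_closed A.m_closed kz_closed P.M.a_inv_closed)
    then show "hd (r \<odot>\<^bsub>CM ?w (k - length q)\<^esub> b) \<odot>\<^bsub>PM vs\<^esub> y = r \<odot>\<^bsub>(PM vs)\<lparr>carrier := C\<rparr>\<^esub> (hd b \<odot>\<^bsub>PM vs\<^esub> y)"
      using r b Cc[OF y(1)] by (simp add: CM_def XM_simps P.smult_assoc)
  qed (use y Cc D in \<open>auto simp: CM_def XM_simps P.smult_l_distr\<close>)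
  assume "b \<in> carrier (CM ?w (k - length q))"
  then obtain a where b: "b = [a]" "a \<in> E ?w" "\<And>x. k - length q \<le> length (snd x) \<Longrightarrow> cf a x = \<zero>\<^bsub>K\<^esub>"
    by (auto simp: CM_def XM_simps)
  have "lq (vs ! i, q) (y ! i \<otimes> a) = kz ?Z (lq (vs ! i, q) (y ! i) \<otimes> a)"
    using b(2) q low[OF y(1)] by (intro lq_mult) auto
  also have "\<dots> = kz ?Z a" using b w by (simp add: yq ev_mult)
  also have "\<dots> = a" using b(2,3) by (intro kz_id) auto
  finally show "[lq (vs ! i, q) ((hd b \<odot>\<^bsub>PM vs\<^esub> y) ! i)] = b"
    using b PM_nth(3)[OF i Cc[OF y(1)]] by simp
qed

text \<open>The quotient of \<open>c ! i\<close> by \<open>q\<close> has a nonzero constant term, so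
  modulo long paths it generates \<open>e_w A\<close>, with \<open>w\<close> the end of
  \<open>q\<close>. Multiplying \<open>c\<close> by a suitable \<open>r\<close> turns the quotient
  into the idempotent itself.\<close>

lemma ex_lq_unit:
  assumes C: "submodule C A (PM vs)" and i: "i < length vs" and q: "(vs ! i, q) \<in> paths"
    and low: "\<And>x. x \<in> C \<Longrightarrow> x ! i \<in> F (length q)"
    and c: "c \<in> C" "cf (c ! i) (vs ! i, q) \<noteq> \<zero>\<^bsub>K\<^esub>"
  obtains y where "y \<in> C" "lq (vs ! i, q) (y ! i) = ev (awlast (vs ! i) q)"
proof -
  interpret P: right_module A "PM vs" by (rule PM_right_module)
  note D = P.submoduleD[OF C]
  let ?w = "awlast (vs ! i) q" and ?Z = "{x :: 'v \<times> 'e list. k - length q \<le> length (snd x)}"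
  let ?a = "lq (vs ! i, q) (c ! i)"
  have w: "?w \<in> verts Q" using q by (rule paths_end)
  have ci: "c ! i \<in> carrier A" using low[OF c(1)] by simp
  have aE: "?a \<in> E ?w" by (rule lq_E[OF ci q])
  have a: "?a \<in> carrier A" using aE by simp
  have a0: "cf ?a (?w, []) \<noteq> \<zero>\<^bsub>K\<^esub>" using c(2) ci q by (simp add: cf_lq)
  have i': "inv\<^bsub>K\<^esub> (cf ?a (?w, [])) \<in> carrier K" using a0 a by (simp add: K.field_Units)
  have "\<exists>r\<in>carrier A. kz ?Z (?a \<otimes> r) = kz ?Z b" if "b \<in> E ?w" for b
  proof (rule F_induct[where S = "E ?w" and t = 0 and a = b])
    show "\<exists>r\<in>carrier A. kz ?Z (?a \<otimes> r) = kz ?Z \<zero>" using a by (intro bexI[of _ \<zero>]) auto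
    fix t b assume b: "b \<in> E ?w" "b \<in> F t"
      and IH: "\<And>b. b \<in> E ?w \<Longrightarrow> b \<in> F (Suc t) \<Longrightarrow> \<exists>r\<in>carrier A. kz ?Z (?a \<otimes> r) = kz ?Z b"
    let ?b = "sc (inv\<^bsub>K\<^esub> (cf ?a (?w, []))) \<otimes> b"
    have bA: "b \<in> carrier A" "?b \<in> carrier A" using b i' by auto
    obtain r where r: "r \<in> carrier A" "kz ?Z (?a \<otimes> r) = kz ?Z (b \<ominus> ?a \<otimes> ?b)"
      using IH[OF approx_unit[OF w aE a0 b]] by blast
    have "kz ?Z (?a \<otimes> (r \<oplus> ?b)) = kz ?Z (b \<ominus> ?a \<otimes> ?b) \<oplus> kz ?Z (?a \<otimes> ?b)"
      using r a bA by (simp add: A.r_distr kz_add)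
    also have "\<dots> = kz ?Z (b \<ominus> ?a \<otimes> ?b \<oplus> ?a \<otimes> ?b)" using a bA by (simp add: kz_add)
    also have "b \<ominus> ?a \<otimes> ?b \<oplus> ?a \<otimes> ?b = b" using a bA by (simp add: A.minus_eq A.a_assoc A.l_neg)
    finally show "\<exists>r\<in>carrier A. kz ?Z (?a \<otimes> r) = kz ?Z b" using r bA by blast
  qed (use that in \<open>auto simp: F_0\<close>)
  then obtain r where r: "r \<in> carrier A" "kz ?Z (?a \<otimes> r) = kz ?Z (ev ?w)" using ev_E by blast
  have "length q < k" using q by (simp add: paths_iff)
  then have "kz ?Z (ev ?w) = ev ?w" by (intro kz_id) (auto simp: cf_pe)
  moreover have "lq (vs ! i, q) ((r \<odot>\<^bsub>PM vs\<^esub> c) ! i) = kz ?Z (?a \<otimes> r)"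
    using r(1) q low[OF c(1)] PM_nth(3)[OF i, of c] D(1) c(1) by (auto simp: lq_mult)
  ultimately show ?thesis using r D(4)[OF r(1) c(1)] that by metis
qed

text \<open>A shortest path \<open>q\<close> among all those occurring in any coordinate of
  \<open>C\<close> gives the order bounds that \<open>PM_split\<close> requires. The complement no
  longer involves \<open>q\<close> in coordinate \<open>i\<close>, so the induction runs over the
  number of occurring positions. A trivial \<open>q\<close> accounts for \<open>j = k\<close>, the
  projective summands.\<close>

lemma PM_submodule_decomp:
  assumes "set vs \<subseteq> verts Q" "submodule C A (PM vs)"
  shows "(PM vs)\<lparr>carrier := C\<rparr> \<in> fg_modules A \<and>
    (\<exists>L. set L \<subseteq> verts Q \<times> {1..k} \<and>
      K0_eq A (frag_of ((PM vs)\<lparr>carrier := C\<rparr>)) (\<Sum>(v, j)\<leftarrow>L. frag_of (CM v j)))"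
  using assms(2)
proof (induction "card {(i, x). i < length vs \<and> x \<in> paths \<and> (\<exists>c\<in>C. cf (c ! i) x \<noteq> \<zero>\<^bsub>K\<^esub>)}"
    arbitrary: C rule: less_induct)
  case less
  interpret P: right_module A "PM vs" by (rule PM_right_module)
  note D = P.submoduleD[OF less.prems]
  let ?supp = "\<lambda>C. {(i, x). i < length vs \<and> x \<in> paths \<and> (\<exists>c\<in>C. cf (c ! i) x \<noteq> \<zero>\<^bsub>K\<^esub>)}"
  let ?W = "(PM vs)\<lparr>carrier := C\<rparr>"
  interpret W: right_module A ?W by (rule P.submodule_right_module[OF less.prems])
  have Cc: "x \<in> carrier (PM vs)" if "x \<in> C" for x using D(1) that by blast
  have xi: "x ! i \<in> E (vs ! i)" if "x \<in> C" "i < length vs" for x i using PM_nth(4)[OF that(2) Cc[OF that(1)]] .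
  show ?case
  proof (cases "?supp C = {}")
    case True
    have "x = \<zero>\<^bsub>PM vs\<^esub>" if x: "x \<in> C" for x
    proof (rule PM_eqI[OF Cc[OF x]])
      fix i assume i: "i < length vs"
      have "cf (x ! i) z = \<zero>\<^bsub>K\<^esub>" if "z \<in> paths" for z
      proof -
        have "(i, z) \<notin> ?supp C" unfolding True by simp
        then show ?thesis using that x i by blast
      qed
      then have "x ! i = \<zero>" using E_carrier[OF xi[OF x i]] by (intro eqI) auto
      then show "x ! i = \<zero>\<^bsub>PM vs\<^esub> ! i" using PM_nth(1)[OF i] by simp
    qed simp
    then have "C = {\<zero>\<^bsub>PM vs\<^esub>}" using D(2) by blast
    then have c: "carrier ?W = {\<zero>\<^bsub>?W\<^esub>}" by simp
    have "fin_gen A ?W" unfolding fin_gen_def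
      by (rule exI[of _ "{}"]) (use c W.submoduleD(1,2) in auto)
    then have "?W \<in> fg_modules A" by (rule fg_modulesI[OF W.right_module_axioms])
    then show ?thesis using K0_eq_trivial[OF _ c] by (intro conjI exI[of _ "[]"]) auto
  next
    case False
    obtain z where z: "z \<in> ?supp C" "\<And>z'. z' \<in> ?supp C \<Longrightarrow> length (snd (snd z)) \<le> length (snd (snd z'))"
      using ex_has_least_nat[of "\<lambda>z. z \<in> ?supp C" _ "\<lambda>z. length (snd (snd z))"] False by blast
    obtain i u q where zz: "z = (i, (u, q))" by (metis prod.collapse)
    obtain c where c: "c \<in> C" "cf (c ! i) (u, q) \<noteq> \<zero>\<^bsub>K\<^esub>" and i: "i < length vs" and uq: "(u, q) \<in> paths"
      using z(1) by (auto simp: zz)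
    have u: "u = vs ! i" using xi[OF c(1) i] c(2) E_cf by blast
    have low: "x ! j \<in> F (length q)" if "x \<in> C" "j < length vs" for x j
      using z(2)[of "(j, _)"] that xi[OF that] by (intro FI) (auto simp: zz, metis not_le)
    obtain y where y: "y \<in> C" "lq (vs ! i, q) (y ! i) = ev (awlast (vs ! i) q)"
      using ex_lq_unit[OF less.prems i _ _ c(1)] uq c(2) low i unfolding u by blast
    let ?w = "awlast (vs ! i) q" and ?N = "CM (awlast (vs ! i) q) (k - length q)"
    let ?h = "\<lambda>x. [lq (vs ! i, q) (x ! i)]"
    have w: "?w \<in> verts Q" using uq u paths_end by blast
    have q: "(vs ! i, q) \<in> paths" using uq u by simp
    note S = PM_split[OF less.prems i q low[OF _ i] y(1) low[OF y(1)] y(2)]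
    define C' where "C' = {x \<in> C. ?h x = \<zero>\<^bsub>?N\<^esub>}"
    have ker: "rmod_ker ?W ?N ?h = (PM vs)\<lparr>carrier := C'\<rparr>"
      by (simp add: rmod_ker_def C'_def)
    have C': "submodule C' A (PM vs)"
      using W.submoduleD[OF rmod_ker_submodule[OF W.right_module_axioms CM_right_module S(1)]] D(1)
      unfolding C'_def[symmetric, simplified] by (intro P.submoduleI) (auto simp: C'_def)
    have Nf: "?N \<in> fg_modules A" by (rule CM_fg[OF w])
    have "?supp C' \<subset> ?supp C"
    proof (rule psubsetI)
      show "?supp C' \<subseteq> ?supp C" by (auto simp: C'_def)
      \<comment> \<open>The coefficient at \<open>q\<close> is the constant term of the quotient by
        \<open>q\<close>, which is zero on the kernel.\<close>
      have "cf (x ! i) (vs ! i, q) = \<zero>\<^bsub>K\<^esub>" if "x \<in> C'" for x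
      proof -
        have "x ! i \<in> carrier A" using E_carrier[OF xi[OF _ i], of x] that by (simp add: C'_def)
        then have "cf (x ! i) (vs ! i, q) = cf (lq (vs ! i, q) (x ! i)) (?w, [])" using q by (simp add: cf_lq)
        also have "lq (vs ! i, q) (x ! i) = \<zero>" using that by (simp add: C'_def CM_def XM_simps)
        finally show ?thesis by simp
      qed
      then have "(i, (u, q)) \<notin> ?supp C'" using u by auto
      then have zn: "z \<notin> ?supp C'" unfolding zz .
      show "?supp C' \<noteq> ?supp C"
      proof
        assume eq: "?supp C' = ?supp C"
        show False using zn z(1) unfolding eq by (rule notE)
      qed
    qed
    moreover have "finite (?supp C)"
      by (rule finite_subset[of _ "{..<length vs} \<times> paths"]) (auto simp: finite_paths)
    ultimately have "card (?supp C') < card (?supp C)" by (rule psubset_card_mono[rotated])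
    from less.hyps[OF this C'] obtain L where
      IH: "(PM vs)\<lparr>carrier := C'\<rparr> \<in> fg_modules A" "set L \<subseteq> verts Q \<times> {1..k}"
        "K0_eq A (frag_of ((PM vs)\<lparr>carrier := C'\<rparr>)) (\<Sum>(v, j)\<leftarrow>L. frag_of (CM v j))" by blast
    have iso: "rmod_iso A ?W (direct_sum ((PM vs)\<lparr>carrier := C'\<rparr>) ?N)"
      using rmod_split[OF W.right_module_axioms CM_right_module S] unfolding ker by blast
    have "fin_gen A ?W"
      by (rule fin_gen_iso[OF direct_sum_right_module[OF right_module_if_fg[OF IH(1)] CM_right_module]
          W.right_module_axioms rmod_iso_sym[OF W.right_module_axioms iso]
          fin_gen_direct_sum[OF right_module_if_fg[OF IH(1)] CM_right_module fin_gen_if_fg[OF IH(1)] fin_gen_if_fg[OF Nf]]])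
    then have Wf: "?W \<in> fg_modules A" by (rule fg_modulesI[OF W.right_module_axioms])
    have "K0_eq A (frag_of ?W) (frag_of ((PM vs)\<lparr>carrier := C'\<rparr>) + frag_of ?N)"
      by (rule K0_eq_direct_sum[OF Wf IH(1) Nf iso])
    also have "K0_eq A (frag_of ((PM vs)\<lparr>carrier := C'\<rparr>) + frag_of ?N)
       ((\<Sum>(v, j)\<leftarrow>L. frag_of (CM v j)) + frag_of ?N)"
      by (rule K0_eq_add[OF IH(3) K0_eq_refl])
    also have "\<dots> = (\<Sum>(v, j)\<leftarrow>(?w, k - length q) # L. frag_of (CM v j))" by simp
    finally have "K0_eq A (frag_of ?W) (\<Sum>(v, j)\<leftarrow>(?w, k - length q) # L. frag_of (CM v j))" .
    moreover have "set ((?w, k - length q) # L) \<subseteq> verts Q \<times> {1..k}"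
      using IH(2) w uq by (auto simp: paths_iff)
    ultimately show ?thesis using Wf by blast
  qed
qed

end

section \<open>Projective covers and syzygies\<close>

fun lc :: "('a, 'b, 'n) module_scheme \<Rightarrow> 'b list \<Rightarrow> 'a list \<Rightarrow> 'b" where
  "lc M [] as = \<zero>\<^bsub>M\<^esub>"
| "lc M (x # xs) as = hd as \<odot>\<^bsub>M\<^esub> x \<oplus>\<^bsub>M\<^esub> lc M xs (tl as)"

context coeff_algebra
begin

lemma PM_Cons_carrier:
  "as \<in> carrier (PM (v # vs)) \<longleftrightarrow> (\<exists>a bs. as = a # bs \<and> a \<in> E v \<and> bs \<in> carrier (PM vs))"
  by (cases as) (auto simp: PM_simps All_less_Suc2)

lemma PM_update: "as \<in> carrier (PM vs) \<Longrightarrow> a \<in> E (vs ! i) \<Longrightarrow> as[i := a] \<in> carrier (PM vs)"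
  by (cases "i < length as") (auto simp: PM_simps nth_list_update)

lemma PM_zero_update: "a \<in> E (vs ! i) \<Longrightarrow> \<zero>\<^bsub>PM vs\<^esub>[i := a] \<in> carrier (PM vs)"
  by (rule PM_update) (auto simp: PM_simps)

lemma lc_hom:
  assumes "right_module A M"
  shows "set xs \<subseteq> carrier M \<Longrightarrow> length xs = length vs \<Longrightarrow> lc M xs \<in> rmod_hom A (PM vs) M"
proof (induction xs arbitrary: vs)
  interpret M: right_module A M by fact
  case Nil
  show ?case by (rule rmod_homI) auto
next
  interpret M: right_module A M by fact
  case (Cons x xs)
  then obtain v ws where vs: "vs = v # ws" "length xs = length ws" by (cases vs) auto
  note H = rmod_homD[OF Cons.IH[of ws]]
  show ?case
  proof (rule rmod_homI)
    show "lc M (x # xs) as \<in> carrier M" if "as \<in> carrier (PM vs)" for as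
      using that H(1) Cons.prems vs by (auto simp: PM_Cons_carrier)
    show "lc M (x # xs) (as \<oplus>\<^bsub>PM vs\<^esub> bs) = lc M (x # xs) as \<oplus>\<^bsub>M\<^esub> lc M (x # xs) bs"
      if ab: "as \<in> carrier (PM vs)" "bs \<in> carrier (PM vs)" for as bs
    proof -
      obtain a as' b bs' where e: "as = a # as'" "a \<in> E v" "as' \<in> carrier (PM ws)"
          "bs = b # bs'" "b \<in> E v" "bs' \<in> carrier (PM ws)"
        using ab unfolding vs PM_Cons_carrier by blast
      then have "lc M xs (map2 (\<oplus>) as' bs') = lc M xs as' \<oplus>\<^bsub>M\<^esub> lc M xs bs'"
        using H(2) Cons.prems vs by (simp add: PM_simps)
      moreover have "a \<in> carrier A" "b \<in> carrier A" using e by auto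
      moreover have "lc M xs as' \<in> carrier M" "lc M xs bs' \<in> carrier M"
        using H(1) e Cons.prems vs by auto
      ultimately show ?thesis using e Cons.prems
        by (simp add: PM_simps M.smult_l_distr M.M.a_ac)
    qed
    show "lc M (x # xs) (r \<odot>\<^bsub>PM vs\<^esub> as) = r \<odot>\<^bsub>M\<^esub> lc M (x # xs) as"
      if r: "r \<in> carrier A" and as: "as \<in> carrier (PM vs)" for r as
    proof -
      obtain a as' where e: "as = a # as'" "a \<in> E v" "as' \<in> carrier (PM ws)"
        using as unfolding vs PM_Cons_carrier by blast
      then have "lc M xs (map (\<lambda>a. a \<otimes> r) as') = r \<odot>\<^bsub>M\<^esub> lc M xs as'"
        using H(3) r Cons.prems vs by (simp add: PM_simps)
      moreover have "a \<in> carrier A" using e by auto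
      moreover have "lc M xs as' \<in> carrier M" using H(1) e Cons.prems vs by auto
      ultimately show ?thesis using e r Cons.prems
        by (simp add: PM_simps M.smult_r_distr M.smult_assoc)
    qed
  qed
qed

lemma lc_in_submodule:
  assumes "right_module A M" "submodule U A M"
  shows "as \<in> carrier (PM vs) \<Longrightarrow> length xs = length vs \<Longrightarrow>
    (\<And>i. i < length vs \<Longrightarrow> as ! i \<odot>\<^bsub>M\<^esub> xs ! i \<in> U) \<Longrightarrow> lc M xs as \<in> U"
proof (induction xs arbitrary: vs as)
  case Nil
  then show ?case using right_module.submoduleD(2)[OF assms] by simp
next
  case (Cons x xs)
  then obtain v ws where vs: "vs = v # ws" "length xs = length ws" by (cases vs) auto
  obtain a as' where e: "as = a # as'" "a \<in> E v" "as' \<in> carrier (PM ws)"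
    using Cons.prems(1) unfolding vs PM_Cons_carrier by blast
  have "lc M xs as' \<in> U"
    using Cons.prems(3)[of "Suc i" for i] e vs by (intro Cons.IH[of _ ws]) auto
  moreover have "a \<odot>\<^bsub>M\<^esub> x \<in> U" using Cons.prems(3)[of 0] e vs by simp
  ultimately show ?case using e right_module.submoduleD(3)[OF assms] by simp
qed

lemma lc_split:
  assumes "right_module A M"
  shows "as \<in> carrier (PM vs) \<Longrightarrow> length xs = length vs \<Longrightarrow> set xs \<subseteq> carrier M \<Longrightarrow> i < length vs \<Longrightarrow>
    lc M xs as = as ! i \<odot>\<^bsub>M\<^esub> xs ! i \<oplus>\<^bsub>M\<^esub> lc M xs (as[i := \<zero>])"
proof (induction xs arbitrary: vs as i)
  interpret M: right_module A M by fact
  case (Cons x xs)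
  then obtain v ws where vs: "vs = v # ws" "length xs = length ws" by (cases vs) auto
  obtain a as' where e: "as = a # as'" "a \<in> E v" "as' \<in> carrier (PM ws)"
    using Cons.prems(1) unfolding vs PM_Cons_carrier by blast
  have a: "a \<in> carrier A" using e by auto
  have h: "lc M xs \<in> rmod_hom A (PM ws) M"
    using lc_hom[OF assms, of xs ws] Cons.prems vs by simp
  have l: "lc M xs as' \<in> carrier M" using rmod_homD(1)[OF h e(3)] .
  show ?case
  proof (cases i)
    case 0
    then show ?thesis using e a l Cons.prems by simp
  next
    case (Suc j)
    have j: "j < length ws" using Suc Cons.prems vs by simp
    have IH: "lc M xs as' = as' ! j \<odot>\<^bsub>M\<^esub> xs ! j \<oplus>\<^bsub>M\<^esub> lc M xs (as'[j := \<zero>])"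
      using Cons.IH[OF e(3) vs(2) _ j] Cons.prems by simp
    have "as'[j := \<zero>] \<in> carrier (PM ws)"
      by (rule PM_update[OF e(3) E_zero])
    then have "lc M xs (as'[j := \<zero>]) \<in> carrier M" by (rule rmod_homD(1)[OF h])
    moreover have "as' ! j \<in> carrier A" using PM_nth(4)[OF j e(3)] by simp
    moreover have "xs ! j \<in> carrier M" using Cons.prems vs j by (auto simp: subset_iff)
    ultimately show ?thesis using Suc e a IH Cons.prems by (simp add: M.M.a_ac)
  qed
qed simp

text \<open>For pairs over vertices of \<open>Q\<close> this is the submodule generated by the
  elements \<open>x e_v\<close>. Recording the vertex allows a generator to be covered by
  \<open>e_v A\<close> instead of the whole of \<open>A\<close>.\<close>

definition img :: "('a, 'b) module \<Rightarrow> ('v \<times> 'b) list \<Rightarrow> 'b set" where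
  "img M L = lc M (map snd L) ` carrier (PM (map fst L))"

lemma img_hom:
  assumes "right_module A M" "set L \<subseteq> verts Q \<times> carrier M"
  shows "lc M (map snd L) \<in> rmod_hom A (PM (map fst L)) M"
  using assms by (intro lc_hom) auto

lemma img_submodule:
  assumes "right_module A M" "set L \<subseteq> verts Q \<times> carrier M"
  shows "submodule (img M L) A M"
  unfolding img_def
  by (rule submodule_image[OF PM_right_module assms(1) img_hom[OF assms]
        right_module.submodule_carrier[OF PM_right_module]])

lemma img_mem:
  assumes "right_module A M" "set L \<subseteq> verts Q \<times> carrier M" "(v, x) \<in> set L" "a \<in> E v"
  shows "a \<odot>\<^bsub>M\<^esub> x \<in> img M L"
proof -
  interpret M: right_module A M by fact
  obtain i where i: "i < length L" "L ! i = (v, x)" using assms(3) by (metis in_set_conv_nth)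
  let ?as = "\<zero>\<^bsub>PM (map fst L)\<^esub>[i := a]"
  have as: "?as \<in> carrier (PM (map fst L))"
    using assms(4) i by (intro PM_zero_update) simp
  have "lc M (map snd L) ?as = ?as ! i \<odot>\<^bsub>M\<^esub> map snd L ! i \<oplus>\<^bsub>M\<^esub> lc M (map snd L) (?as[i := \<zero>])"
    using i assms(2) by (intro lc_split[OF assms(1) as]) auto
  also have "?as[i := \<zero>] = \<zero>\<^bsub>PM (map fst L)\<^esub>"
    using i by (auto simp: PM_simps intro!: nth_equalityI simp: nth_list_update)
  also have "lc M (map snd L) \<zero>\<^bsub>PM (map fst L)\<^esub> = \<zero>\<^bsub>M\<^esub>"
    by (rule rmod_hom_zero[OF PM_right_module assms(1) img_hom[OF assms(1,2)]])
  also have "?as ! i = a" using i by (simp add: PM_simps)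
  finally have "lc M (map snd L) ?as = a \<odot>\<^bsub>M\<^esub> x"
    using i assms(2,3) E_carrier[OF assms(4)] by auto
  then show ?thesis unfolding img_def using as by (metis imageI)
qed

lemma img_least:
  assumes "right_module A M" "submodule U A M" "\<And>v x a. (v, x) \<in> set L \<Longrightarrow> a \<in> E v \<Longrightarrow> a \<odot>\<^bsub>M\<^esub> x \<in> U"
  shows "img M L \<subseteq> U"
proof -
  have "lc M (map snd L) as \<in> U" if as: "as \<in> carrier (PM (map fst L))" for as
  proof (rule lc_in_submodule[OF assms(1,2) as])
    fix i assume i: "i < length (map fst L)"
    then show "as ! i \<odot>\<^bsub>M\<^esub> map snd L ! i \<in> U"
      using assms(3)[of "fst (L ! i)" "snd (L ! i)"] PM_nth(4)[OF i as] by auto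
  qed simp
  then show ?thesis by (auto simp: img_def)
qed

text \<open>The unit is the sum of the vertex idempotents; its partial sums \<open>s V\<close> are
  given directly by their coefficients.\<close>

lemma submodule_mem_by_vertices:
  assumes "right_module A M" "submodule U A M" "x \<in> carrier M"
    and "\<And>v a. v \<in> verts Q \<Longrightarrow> a \<in> E v \<Longrightarrow> a \<odot>\<^bsub>M\<^esub> x \<in> U"
  shows "x \<in> U"
proof -
  interpret M: right_module A M by fact
  note D = M.submoduleD[OF assms(2)]
  define s where "s V = mk (\<lambda>(u, p). if u \<in> V then cf \<one> (u, p) else \<zero>\<^bsub>K\<^esub>)" for V
  have s: "s V \<in> carrier A" "cf (s V) (u, p) = (if u \<in> V then cf \<one> (u, p) else \<zero>\<^bsub>K\<^esub>)" for V u p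
    unfolding s_def by (rule mk_closed, simp) (subst cf_mk, auto simp: cf_outside)
  have "finite V \<Longrightarrow> V \<subseteq> verts Q \<Longrightarrow> s V \<odot>\<^bsub>M\<^esub> x \<in> U" for V
  proof (induction V rule: finite_induct)
    case empty
    have "s {} = \<zero>" by (rule eqI) (auto simp: s)
    then show ?case using assms(3) D(2) by simp
  next
    case (insert v V)
    have 1: "s (insert v V) = s {v} \<oplus> s V"
      using insert by (intro eqI) (auto simp: s cf_add)
    have "s {v} \<in> E v" by (rule EI) (auto simp: s)
    then have "s {v} \<odot>\<^bsub>M\<^esub> x \<in> U" using assms(4) insert by blast
    then show ?case unfolding 1 using insert s assms(3) D(3) by (simp add: M.smult_l_distr)
  qed
  from this[OF finite_verts] have "s (verts Q) \<odot>\<^bsub>M\<^esub> x \<in> U" by simp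
  moreover have "s (verts Q) = \<one>"
    by (rule eqI) (auto simp: s paths_start)
  ultimately show ?thesis using assms(3) by simp
qed

lemma ex_generators:
  assumes "M \<in> fg_modules A"
  obtains L where "set L \<subseteq> verts Q \<times> carrier M" "img M L = carrier M"
proof -
  interpret M: right_module A M using assms by (rule right_module_if_fg)
  obtain S where S: "finite S" "S \<subseteq> carrier M" "\<And>U. submodule U A M \<Longrightarrow> S \<subseteq> U \<Longrightarrow> U = carrier M"
    using fin_gen_if_fg[OF assms] by (rule fin_genE) blast
  obtain L where L: "set L = verts Q \<times> S"
    using finite_list[OF finite_cartesian_product[OF finite_verts S(1)]] by (elim exE) (rule that)
  have Ls: "set L \<subseteq> verts Q \<times> carrier M" unfolding L using S(2) by (intro Sigma_mono) auto
  note U = img_submodule[OF M.right_module_axioms Ls]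
  have "S \<subseteq> img M L"
  proof
    fix x assume x: "x \<in> S"
    show "x \<in> img M L"
    proof (rule submodule_mem_by_vertices[OF M.right_module_axioms U])
      show "a \<odot>\<^bsub>M\<^esub> x \<in> img M L" if "v \<in> verts Q" "a \<in> E v" for v a
        using that x L by (intro img_mem[OF M.right_module_axioms Ls]) auto
    qed (use x S in blast)
  qed
  then show ?thesis by (intro that[OF Ls] S(3)[OF U])
qed

text \<open>In a generating list of least length no entry is redundant. A relation with a nonzero
  constant term at the generator \<open>x\<close> would express \<open>x a\<close> through the other
  generators, and successive approximation then does the same for \<open>x b\<close> with any
  \<open>b\<close> in \<open>E v\<close>.\<close>

lemma minimal_generators:
  assumes "M \<in> fg_modules A"
  obtains L where "set L \<subseteq> verts Q \<times> carrier M" "img M L = carrier M"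
    "\<And>as i. as \<in> carrier (PM (map fst L)) \<Longrightarrow> lc M (map snd L) as = \<zero>\<^bsub>M\<^esub> \<Longrightarrow> i < length L \<Longrightarrow> as ! i \<in> F 1"
proof -
  interpret M: right_module A M using assms by (rule right_module_if_fg)
  define G where "G L \<longleftrightarrow> set L \<subseteq> verts Q \<times> carrier M \<and> img M L = carrier M" for L
  obtain L0 where L0: "G L0" unfolding G_def by (rule ex_generators[OF assms]) simp
  obtain L where GL: "G L" "\<forall>L'. G L' \<longrightarrow> length L \<le> length L'"
    using ex_has_least_nat[of G L0 length, OF L0] by (elim exE conjE) (rule that)
  have L: "set L \<subseteq> verts Q \<times> carrier M" "img M L = carrier M" using GL(1) by (simp_all add: G_def)
  have min: "length L \<le> length L'" if "set L' \<subseteq> verts Q \<times> carrier M" "img M L' = carrier M" for L'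
    using GL(2) that by (simp add: G_def)
  have "as ! i \<in> F 1" if as: "as \<in> carrier (PM (map fst L))" "lc M (map snd L) as = \<zero>\<^bsub>M\<^esub>" "i < length L" for as i
  proof (rule ccontr)
    assume nF: "as ! i \<notin> F 1"
    obtain v x where vx: "L ! i = (v, x)" by fastforce
    have "L ! i \<in> verts Q \<times> carrier M" using L(1) nth_mem[OF as(3)] by (rule subsetD)
    then have v: "v \<in> verts Q" "x \<in> carrier M" by (simp_all add: vx)
    let ?a = "as ! i"
    have aE: "?a \<in> E v" using PM_nth(4)[OF _ as(1), of i] as(3) vx by simp
    have a0: "cf ?a (v, []) \<noteq> \<zero>\<^bsub>K\<^esub>"
    proof
      assume "cf ?a (v, []) = \<zero>\<^bsub>K\<^esub>"
      then have "cf ?a (u, p) = \<zero>\<^bsub>K\<^esub>" if "length p < 1" for u p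
        using that E_cf[OF aE, of u p] by (cases "u = v") auto
      then show False using nF FI[OF E_carrier[OF aE]] by blast
    qed
    have aA: "?a \<in> carrier A" using aE by simp
    have i': "inv\<^bsub>K\<^esub> (cf ?a (v, [])) \<in> carrier K" using a0 aA by (simp add: K.field_Units)
    let ?L = "take i L @ drop (Suc i) L"
    have Ls: "set ?L \<subseteq> verts Q \<times> carrier M"
      using L(1) set_take_subset[of i L] set_drop_subset[of "Suc i" L] by auto
    have Lj: "L ! j \<in> set ?L" if jl: "j < length L" "j \<noteq> i" for j
    proof -
      consider "j < i" | "Suc i \<le> j" using jl by linarith
      then show ?thesis
      proof cases
        case 1
        then have "L ! j \<in> set (take i L)" using jl by (auto simp: in_set_conv_nth intro!: exI[of _ j])
        then show ?thesis by simp
      next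
        case 2
        then have "L ! j \<in> set (drop (Suc i) L)" using jl
          by (auto simp: in_set_conv_nth intro!: exI[of _ "j - Suc i"])
        then show ?thesis by simp
      qed
    qed
    note U = img_submodule[OF M.right_module_axioms Ls]
    note D = M.submoduleD[OF U]
    have as0: "as[i := \<zero>] \<in> carrier (PM (map fst L))" by (rule PM_update[OF as(1) E_zero])
    have rest: "lc M (map snd L) (as[i := \<zero>]) \<in> img M ?L"
    proof (rule lc_in_submodule[OF M.right_module_axioms U as0])
      fix j assume j: "j < length (map fst L)"
      show "as[i := \<zero>] ! j \<odot>\<^bsub>M\<^esub> map snd L ! j \<in> img M ?L"
      proof (cases "j = i")
        case True
        then show ?thesis using D(2) as vx v by (simp add: PM_simps)
      next
        case False
        then show ?thesis
          using PM_nth(4)[OF j as(1)] Lj[of j] j img_mem[OF M.right_module_axioms Ls, of "fst (L ! j)" "snd (L ! j)"] by simp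
      qed
    qed simp
    have "\<zero>\<^bsub>M\<^esub> = ?a \<odot>\<^bsub>M\<^esub> x \<oplus>\<^bsub>M\<^esub> lc M (map snd L) (as[i := \<zero>])"
    proof -
      have "snd ` set L \<subseteq> carrier M" using L(1) by auto
      then show ?thesis using lc_split[OF M.right_module_axioms as(1), of "map snd L" i] as(2,3) vx by simp
    qed
    then have "?a \<odot>\<^bsub>M\<^esub> x = \<ominus>\<^bsub>M\<^esub> lc M (map snd L) (as[i := \<zero>])"
      using M.M.minus_equality[of "?a \<odot>\<^bsub>M\<^esub> x" "lc M (map snd L) (as[i := \<zero>])"]
        subsetD[OF D(1) rest] aA v by simp
    then have ax: "?a \<odot>\<^bsub>M\<^esub> x \<in> img M ?L" using rest D(5) by simp
    have all: "b \<odot>\<^bsub>M\<^esub> x \<in> img M ?L" if "b \<in> E v" for b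
    proof (rule F_induct[where S = "E v" and t = 0 and a = b])
      show "\<zero> \<odot>\<^bsub>M\<^esub> x \<in> img M ?L" using v D(2) by simp
      fix t b assume b: "b \<in> E v" "b \<in> F t"
        and IH: "\<And>b. b \<in> E v \<Longrightarrow> b \<in> F (Suc t) \<Longrightarrow> b \<odot>\<^bsub>M\<^esub> x \<in> img M ?L"
      let ?b = "sc (inv\<^bsub>K\<^esub> (cf ?a (v, []))) \<otimes> b"
      have bA: "b \<in> carrier A" "?b \<in> carrier A" using b i' by auto
      have "b = (b \<ominus> ?a \<otimes> ?b) \<oplus> ?a \<otimes> ?b" using aA bA by (simp add: A.minus_eq A.a_assoc A.l_neg)
      then have "b \<odot>\<^bsub>M\<^esub> x = (b \<ominus> ?a \<otimes> ?b) \<odot>\<^bsub>M\<^esub> x \<oplus>\<^bsub>M\<^esub> ?b \<odot>\<^bsub>M\<^esub> (?a \<odot>\<^bsub>M\<^esub> x)"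
        using aA bA v by (metis M.smult_l_distr M.smult_assoc A.minus_closed A.m_closed)
      then show "b \<odot>\<^bsub>M\<^esub> x \<in> img M ?L"
        using IH[OF approx_unit[OF v(1) aE a0 b]] D(3,4) ax bA by simp
    qed (use that in \<open>auto simp: F_0\<close>)
    have "img M L \<subseteq> img M ?L"
    proof (rule img_least[OF M.right_module_axioms U])
      fix w z a assume "(w, z) \<in> set L" "a \<in> E w"
      then obtain j where "j < length L" "L ! j = (w, z)" by (metis in_set_conv_nth)
      then show "a \<odot>\<^bsub>M\<^esub> z \<in> img M ?L"
        using all vx Lj[of j] img_mem[OF M.right_module_axioms Ls] \<open>a \<in> E w\<close> by (cases "j = i") auto
    qed
    then have "img M ?L = carrier M" using L(2) D(1) by blast
    from min[OF Ls this] as(3) show False by simp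
  qed
  then show ?thesis by (rule that[OF L])
qed

lemma PM_mem_by_coordinates:
  assumes U: "submodule U A (PM vs)" and x: "x \<in> carrier (PM vs)"
    and i: "\<And>i. i < length vs \<Longrightarrow> \<zero>\<^bsub>PM vs\<^esub>[i := x ! i] \<in> U"
  shows "x \<in> U"
proof -
  interpret P: right_module A "PM vs" by (rule PM_right_module)
  note D = P.submoduleD[OF U]
  define y where "y n = map (\<lambda>i. if i < n then x ! i else \<zero>) [0..<length vs]" for n
  have "n \<le> length vs \<Longrightarrow> y n \<in> U" for n
  proof (induction n)
    case 0
    have "y 0 = \<zero>\<^bsub>PM vs\<^esub>" by (auto simp: y_def PM_simps intro!: nth_equalityI)
    then show ?case using D(2) by simp
  next
    case (Suc n)
    have c: "y n \<in> carrier (PM vs)" "y (Suc n) \<in> carrier (PM vs)" "\<zero>\<^bsub>PM vs\<^esub>[n := x ! n] \<in> carrier (PM vs)"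
      using x Suc.prems by (auto simp: y_def PM_simps nth_list_update)
    have "y (Suc n) = y n \<oplus>\<^bsub>PM vs\<^esub> \<zero>\<^bsub>PM vs\<^esub>[n := x ! n]"
    proof (rule PM_eqI)
      fix i assume i: "i < length vs"
      have xi: "x ! i \<in> carrier A" using PM_nth(4)[OF i x] by simp
      show "y (Suc n) ! i = (y n \<oplus>\<^bsub>PM vs\<^esub> \<zero>\<^bsub>PM vs\<^esub>[n := x ! n]) ! i"
        unfolding PM_nth(2)[OF i c(1,3)] using i xi Suc.prems
        by (auto simp: y_def PM_simps nth_list_update less_Suc_eq)
    qed (use c in auto)
    then show ?case using Suc D(3) i by simp
  qed
  moreover have "y (length vs) = x" using x by (auto simp: y_def PM_simps intro!: nth_equalityI)
  ultimately show ?thesis by (metis order_refl)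
qed

lemma PM_single_smult:
  assumes "i < length vs" "vs ! i \<in> verts Q" "a \<in> E (vs ! i)"
  shows "\<zero>\<^bsub>PM vs\<^esub>[i := a] = a \<odot>\<^bsub>PM vs\<^esub> \<zero>\<^bsub>PM vs\<^esub>[i := ev (vs ! i)]"
proof (rule PM_eqI)
  interpret P: right_module A "PM vs" by (rule PM_right_module)
  have e: "\<zero>\<^bsub>PM vs\<^esub>[i := ev (vs ! i)] \<in> carrier (PM vs)" by (rule PM_zero_update[OF ev_E])
  have a: "a \<in> carrier A" using assms(3) by simp
  show "\<zero>\<^bsub>PM vs\<^esub>[i := a] \<in> carrier (PM vs)" by (rule PM_zero_update[OF assms(3)])
  show "a \<odot>\<^bsub>PM vs\<^esub> \<zero>\<^bsub>PM vs\<^esub>[i := ev (vs ! i)] \<in> carrier (PM vs)" using a e by simp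
  fix j assume j: "j < length vs"
  show "\<zero>\<^bsub>PM vs\<^esub>[i := a] ! j = (a \<odot>\<^bsub>PM vs\<^esub> \<zero>\<^bsub>PM vs\<^esub>[i := ev (vs ! i)]) ! j"
    unfolding PM_nth(3)[OF j e] using j assms(1) a ev_mult[OF assms(3,2)] by (auto simp: PM_simps nth_list_update)
qed

text \<open>Nakayama's argument: for minimal generators the kernel has all coordinates in
  \<open>F 1\<close>. If \<open>U\<close> and the kernel span everything, each basis element lies in
  \<open>U\<close> up to an error of order 1, and the error is pushed up to order \<open>k\<close>,
  where it vanishes.\<close>

lemma projective_cover_exists:
  assumes "M \<in> fg_modules A"
  shows "\<exists>P p. projective_cover A M P p"
proof -
  interpret M: right_module A M using assms by (rule right_module_if_fg)
  obtain L where L: "set L \<subseteq> verts Q \<times> carrier M" "img M L = carrier M"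
    "\<And>as i. as \<in> carrier (PM (map fst L)) \<Longrightarrow> lc M (map snd L) as = \<zero>\<^bsub>M\<^esub> \<Longrightarrow> i < length L \<Longrightarrow> as ! i \<in> F 1"
    using minimal_generators[OF assms] by blast
  let ?vs = "map fst L" and ?p = "lc M (map snd L)"
  interpret P: right_module A "PM ?vs" by (rule PM_right_module)
  have vs: "set ?vs \<subseteq> verts Q" using L(1) by auto
  have sup: "U = carrier (PM ?vs)"
    if U: "submodule U A (PM ?vs)" and sum: "U <+>\<^bsub>PM ?vs\<^esub> carrier (rmod_ker (PM ?vs) M ?p) = carrier (PM ?vs)" for U
  proof -
    note D = P.submoduleD[OF U]
    have dec: "\<exists>u\<in>U. \<exists>z\<in>carrier (PM ?vs). ?p z = \<zero>\<^bsub>M\<^esub> \<and> e = u \<oplus>\<^bsub>PM ?vs\<^esub> z" if "e \<in> carrier (PM ?vs)" for e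
    proof -
      have "e \<in> U <+>\<^bsub>PM ?vs\<^esub> carrier (rmod_ker (PM ?vs) M ?p)" using that by (simp only: sum)
      then show ?thesis by (auto simp: set_add_def set_mult_def carrier_rmod_ker)
    qed
    \<comment> \<open>Elements all of whose coordinates have order \<open>k - n\<close> lie in
      \<open>U\<close>. In the induction step the multiplier \<open>?a\<close> has order
      \<open>k - Suc n\<close>, and multiplying it by the error \<open>z\<close> of order 1 reaches
      \<open>k - n\<close>.\<close>
    have "n \<le> k \<Longrightarrow> x \<in> carrier (PM ?vs) \<Longrightarrow> (\<And>i. i < length ?vs \<Longrightarrow> x ! i \<in> F (k - n)) \<Longrightarrow> x \<in> U" for n x
    proof (induction n arbitrary: x)
      case 0
      have "x = \<zero>\<^bsub>PM ?vs\<^esub>"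
        by (rule PM_eqI[OF 0(2)]) (use 0(3) F_k[of k] PM_nth(1)[of _ ?vs] in auto)
      then show ?case using D(2) by simp
    next
      case (Suc n)
      show ?case
      proof (rule PM_mem_by_coordinates[OF U Suc.prems(2)])
        fix i assume i: "i < length ?vs"
        let ?e = "\<zero>\<^bsub>PM ?vs\<^esub>[i := ev (?vs ! i)]"
        have e: "?e \<in> carrier (PM ?vs)" by (rule PM_zero_update[OF ev_E])
        obtain u z where uz: "u \<in> U" "z \<in> carrier (PM ?vs)" "?p z = \<zero>\<^bsub>M\<^esub>" "?e = u \<oplus>\<^bsub>PM ?vs\<^esub> z"
          using dec[OF e] by blast
        let ?a = "x ! i"
        have aE: "?a \<in> E (?vs ! i)" using PM_nth(4)[OF i Suc.prems(2)] .
        have aA: "?a \<in> carrier A" using aE by simp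
        have vi: "?vs ! i \<in> verts Q" using vs i nth_mem[OF i] by blast
        have uP: "u \<in> carrier (PM ?vs)" using D(1) uz(1) by blast
        have "\<zero>\<^bsub>PM ?vs\<^esub>[i := ?a] = ?a \<odot>\<^bsub>PM ?vs\<^esub> ?e" by (rule PM_single_smult[OF i vi aE])
        also have "\<dots> = ?a \<odot>\<^bsub>PM ?vs\<^esub> u \<oplus>\<^bsub>PM ?vs\<^esub> ?a \<odot>\<^bsub>PM ?vs\<^esub> z"
          unfolding uz(4) using P.smult_r_distr aA uP uz(2) by simp
        also have "\<dots> \<in> U"
        proof (rule D(3)[OF D(4)[OF aA uz(1)] Suc.IH])
          fix j assume j: "j < length ?vs"
          have "z ! j \<in> F 1" using L(3)[OF uz(2,3)] j by simp
          then have "z ! j \<otimes> ?a \<in> F (1 + (k - Suc n))" using Suc.prems(3)[OF i] by (rule F_mult)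
          moreover have "1 + (k - Suc n) = k - n" using Suc.prems(1) by simp
          ultimately show "(?a \<odot>\<^bsub>PM ?vs\<^esub> z) ! j \<in> F (k - n)" using PM_nth(3)[OF j uz(2)] by simp
        qed (use Suc.prems aA uz in auto)
        finally show "\<zero>\<^bsub>PM ?vs\<^esub>[i := ?a] \<in> U" .
      qed
    qed
    note all = this[of k]
    have "carrier (PM ?vs) \<subseteq> U"
    proof
      fix x assume x: "x \<in> carrier (PM ?vs)"
      have "x ! i \<in> F (k - k)" if "i < length ?vs" for i using E_carrier[OF PM_nth(4)[OF that x]] by (simp add: F_0)
      then show "x \<in> U" by (rule all[OF order_refl x])
    qed
    then show ?thesis using D(1) by blast
  qed
  have "projective_cover A M (PM ?vs) ?p"
    unfolding projective_cover_def
    using PM_fg_projective[OF vs] img_hom[OF M.right_module_axioms L(1)] L(2)[unfolded img_def]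
    by (intro conjI allI impI) (elim conjE, assumption | rule sup)+
  then show ?thesis by blast
qed

text \<open>The preimage of \<open>D\<close> under a surjection from some \<open>PM vs\<close> is
  finitely generated by \<open>PM_submodule_decomp\<close>, and it maps onto
  \<open>D\<close>.\<close>

lemma fg_submodule:
  assumes "P \<in> fg_modules A" "submodule D A P"
  shows "P\<lparr>carrier := D\<rparr> \<in> fg_modules A"
proof -
  interpret P: right_module A P using assms(1) by (rule right_module_if_fg)
  obtain L where L: "set L \<subseteq> verts Q \<times> carrier P" "img P L = carrier P" using ex_generators[OF assms(1)] by blast
  let ?vs = "map fst L" and ?p = "lc P (map snd L)"
  note h = img_hom[OF P.right_module_axioms L(1)]
  let ?C = "{x \<in> carrier (PM ?vs). ?p x \<in> D}"
  have C: "submodule ?C A (PM ?vs)" by (rule submodule_vimage[OF PM_right_module P.right_module_axioms h assms(2)])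
  have vs: "set ?vs \<subseteq> verts Q" using L(1) by auto
  have Cf: "(PM ?vs)\<lparr>carrier := ?C\<rparr> \<in> fg_modules A" using PM_submodule_decomp[OF vs C] by blast
  have Dm: "right_module A (P\<lparr>carrier := D\<rparr>)" by (rule P.submodule_right_module[OF assms(2)])
  have "?p ` ?C = D" 
  proof -
    have "D \<subseteq> ?p ` carrier (PM ?vs)" using L(2) P.submoduleD(1)[OF assms(2)] by (simp add: img_def)
    then show ?thesis by auto
  qed
  moreover have "?p \<in> rmod_hom A ((PM ?vs)\<lparr>carrier := ?C\<rparr>) (P\<lparr>carrier := D\<rparr>)"
    using rmod_homD[OF h] by (intro rmod_homI) auto
  ultimately show ?thesis
    using fin_gen_image[OF right_module_if_fg[OF Cf] Dm _ _ fin_gen_if_fg[OF Cf], of ?p] fg_modulesI[OF Dm] by simp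
qed

lemma rmod_ker_fg:
  assumes "P \<in> fg_modules A" "right_module A M" "p \<in> rmod_hom A P M"
  shows "rmod_ker P M p \<in> fg_modules A"
  unfolding rmod_ker_def
  by (rule fg_submodule[OF assms(1) rmod_ker_submodule[OF right_module_if_fg[OF assms(1)] assms(2,3)]])

lemma syzygy_cover:
  assumes "M \<in> fg_modules A"
  obtains P p where "P \<in> fg_modules A" "projective A P" "p \<in> rmod_hom A P M"
    "p ` carrier P = carrier M" "syzygy A M = rmod_ker P M p"
proof -
  obtain P p where "(case (P, p) of (P, p) \<Rightarrow> projective_cover A M P p)"
    using projective_cover_exists[OF assms] by auto
  then have "case (SOME (P, p). projective_cover A M P p) of (P, p) \<Rightarrow> projective_cover A M P p"
    by (rule someI)
  moreover obtain P' p' where e: "(SOME (P, p). projective_cover A M P p) = (P', p')" by fastforce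
  ultimately have "projective_cover A M P' p'" by simp
  moreover have "syzygy A M = rmod_ker P' M p'" by (simp add: syzygy_def e)
  ultimately show ?thesis using that unfolding projective_cover_def by blast
qed

lemma syzygy_fg: "M \<in> fg_modules A \<Longrightarrow> syzygy A M \<in> fg_modules A"
  by (metis syzygy_cover rmod_ker_fg right_module_if_fg)

text \<open>By Schanuel's lemma every projective presentation computes the class of the syzygy, so
  later presentations may be chosen by convenience rather than by minimality.\<close>

lemma syzygy_K0_eq:
  assumes "M \<in> fg_modules A" "P \<in> fg_modules A" "projective A P" "p \<in> rmod_hom A P M" "p ` carrier P = carrier M"
  shows "K0_eq A (frag_of (syzygy A M)) (frag_of (rmod_ker P M p))"
proof -
  have M: "right_module A M" using assms(1) by (rule right_module_if_fg)
  obtain P' p' where P': "P' \<in> fg_modules A" "projective A P'" "p' \<in> rmod_hom A P' M"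
    "p' ` carrier P' = carrier M" "syzygy A M = rmod_ker P' M p'" using syzygy_cover[OF assms(1)] by blast
  show ?thesis unfolding P'(5)
    by (rule schanuel[OF P'(1,2) assms(2,3) M P'(3,4) assms(4,5) rmod_ker_fg[OF P'(1) M P'(3)] rmod_ker_fg[OF assms(2) M assms(4)]])
qed

section \<open>The syzygy operator on formal combinations\<close>

definition Syz :: "(('a, 'a list) module \<Rightarrow>\<^sub>0 int) \<Rightarrow> (('a, 'a list) module \<Rightarrow>\<^sub>0 int)" where
  "Syz = frag_extend (\<lambda>M. frag_of (syzygy A M))"

lemma Syz_add: "Syz (c + d) = Syz c + Syz d"
  and Syz_diff: "Syz (c - d) = Syz c - Syz d"
  and Syz_cmul: "Syz (frag_cmul z c) = frag_cmul z (Syz c)"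
  and Syz_zero: "Syz 0 = 0"
  and Syz_of: "Syz (frag_of M) = frag_of (syzygy A M)"
  by (simp_all add: Syz_def frag_extend_add frag_extend_diff frag_extend_cmul)

text \<open>The direct sum of the two covers presents the direct sum of the modules, and its kernel
  is the direct sum of the syzygies. A projective module is presented by its identity map, with zero
  kernel.\<close>

lemma Syz_generator:
  assumes "h \<in> {frag_of M - frag_of M' - frag_of M'' | M M' M''.
         M \<in> fg_modules A \<and> M' \<in> fg_modules A \<and> M'' \<in> fg_modules A \<and> rmod_iso A M (direct_sum M' M'')} \<union>
      {frag_of P | P. P \<in> fg_modules A \<and> projective A P}"
  shows "Syz h \<in> K0_relations A"
proof -
  have "K0_eq A (Syz h) 0"
    using assms
  proof (elim UnE CollectE exE conjE)
    fix M M' M''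
    assume h: "h = frag_of M - frag_of M' - frag_of M''"
      and M: "M \<in> fg_modules A" "M' \<in> fg_modules A" "M'' \<in> fg_modules A" and i: "rmod_iso A M (direct_sum M' M'')"
    note Mm = M[THEN right_module_if_fg]
    obtain P' p' where P': "P' \<in> fg_modules A" "projective A P'" "p' \<in> rmod_hom A P' M'"
      "p' ` carrier P' = carrier M'" "syzygy A M' = rmod_ker P' M' p'" using syzygy_cover[OF M(2)] by blast
    obtain P'' p'' where P'': "P'' \<in> fg_modules A" "projective A P''" "p'' \<in> rmod_hom A P'' M''"
      "p'' ` carrier P'' = carrier M''" "syzygy A M'' = rmod_ker P'' M'' p''" using syzygy_cover[OF M(3)] by blast
    note Pm = right_module_if_fg[OF P'(1)] right_module_if_fg[OF P''(1)]
    have "rmod_iso A (direct_sum M' M'') M" by (rule rmod_iso_sym[OF Mm(1) i])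
    then obtain g where g: "g \<in> rmod_hom A (direct_sum M' M'') M" "bij_betw g (carrier (direct_sum M' M'')) (carrier M)"
      by (rule rmod_isoE)
    obtain e where e: "e \<in> rmod_hom A (dsum A P' P'') (direct_sum P' P'')"
      "bij_betw e (carrier (dsum A P' P'')) (carrier (direct_sum P' P''))" using dsum_iso'[OF Pm] by (rule rmod_isoE)
    let ?P = "dsum A P' P''"
    have Pf: "?P \<in> fg_modules A" by (rule dsum_fg[OF P'(1) P''(1)])
    have Pp: "projective A ?P" by (rule projective_dsum[OF P'(2) P''(2) Pm])
    define m where "m = map_prod p' p''"
    have m: "m \<in> rmod_hom A (direct_sum P' P'') (direct_sum M' M'')"
      using rmod_homD[OF P'(3)] rmod_homD[OF P''(3)] by (auto intro!: rmod_homI simp: direct_sum_simps m_def)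
    have ms: "m ` carrier (direct_sum P' P'') = carrier (direct_sum M' M'')"
      using P'(4) P''(4) by (simp add: direct_sum_simps m_def map_prod_surj_on)
    define q where "q = (\<lambda>x. g (m (e x)))"
    have q: "q \<in> rmod_hom A ?P M" unfolding q_def by (intro rmod_hom_comp[OF _ g(1)] rmod_hom_comp[OF e(1) m])
    have qs: "q ` carrier ?P = carrier M"
    proof -
      have "q ` carrier ?P = g ` m ` e ` carrier ?P" by (simp add: q_def image_image)
      then show ?thesis using e(2) g(2) ms by (simp add: bij_betw_def)
    qed
    let ?N = "rmod_ker ?P M q"
    have Nf: "?N \<in> fg_modules A" by (rule rmod_ker_fg[OF Pf Mm(1) q])
    have q0: "q x = \<zero>\<^bsub>M\<^esub> \<longleftrightarrow> p' (fst (e x)) = \<zero>\<^bsub>M'\<^esub> \<and> p'' (snd (e x)) = \<zero>\<^bsub>M''\<^esub>" if x: "x \<in> carrier ?P" for x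
    proof -
      have mm: "m (e x) \<in> carrier (direct_sum M' M'')" using rmod_homD(1)[OF m] rmod_homD(1)[OF e(1) x] by blast
      have "g \<zero>\<^bsub>direct_sum M' M''\<^esub> = \<zero>\<^bsub>M\<^esub>" by (rule rmod_hom_zero[OF direct_sum_right_module[OF Mm(2,3)] Mm(1) g(1)])
      moreover have "\<zero>\<^bsub>direct_sum M' M''\<^esub> \<in> carrier (direct_sum M' M'')"
      proof -
        interpret D: right_module A "direct_sum M' M''" by (rule direct_sum_right_module[OF Mm(2,3)])
        show ?thesis by simp
      qed
      ultimately have "q x = \<zero>\<^bsub>M\<^esub> \<longleftrightarrow> m (e x) = \<zero>\<^bsub>direct_sum M' M''\<^esub>"
        using g(2) mm unfolding q_def bij_betw_def inj_on_def by metis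
      then show ?thesis by (cases "e x") (simp add: m_def direct_sum_simps)
    qed
    have iN: "rmod_iso A ?N (direct_sum (rmod_ker P' M' p') (rmod_ker P'' M'' p''))"
      unfolding rmod_iso_def
    proof (rule bexI[of _ e])
      show "e \<in> rmod_hom A ?N (direct_sum (rmod_ker P' M' p') (rmod_ker P'' M'' p''))"
      proof (rule rmod_homI)
        fix x assume "x \<in> carrier ?N"
        then have x: "x \<in> carrier ?P" "q x = \<zero>\<^bsub>M\<^esub>" by (simp_all add: carrier_rmod_ker)
        show "e x \<in> carrier (direct_sum (rmod_ker P' M' p') (rmod_ker P'' M'' p''))"
          using q0[OF x(1)] x(2) rmod_homD(1)[OF e(1) x(1)] by (cases "e x") (simp add: direct_sum_simps carrier_rmod_ker)
      qed (use rmod_homD(2,3)[OF e(1)] in \<open>simp_all add: direct_sum_def rmod_ker_def\<close>)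
      show "bij_betw e (carrier ?N) (carrier (direct_sum (rmod_ker P' M' p') (rmod_ker P'' M'' p'')))"
        unfolding bij_betw_def
      proof
        show "inj_on e (carrier ?N)" using e(2) by (auto simp: bij_betw_def inj_on_def carrier_rmod_ker)
        have "z \<in> e ` carrier ?N" if z: "z \<in> carrier (direct_sum (rmod_ker P' M' p') (rmod_ker P'' M'' p''))" for z
        proof -
          have zd: "fst z \<in> carrier P'" "snd z \<in> carrier P''" "p' (fst z) = \<zero>\<^bsub>M'\<^esub>" "p'' (snd z) = \<zero>\<^bsub>M''\<^esub>"
            using z by (auto simp: direct_sum_simps carrier_rmod_ker)
          then have "z \<in> e ` carrier ?P" using e(2) by (cases z) (simp add: bij_betw_def direct_sum_simps)
          then obtain x where x: "x \<in> carrier ?P" "z = e x" by blast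
          then show ?thesis using q0[OF x(1)] zd by (intro image_eqI[of _ _ x]) (auto simp: carrier_rmod_ker)
        qed
        then show "e ` carrier ?N = carrier (direct_sum (rmod_ker P' M' p') (rmod_ker P'' M'' p''))"
          using rmod_homD(1)[OF \<open>e \<in> rmod_hom A ?N _\<close>] by blast
      qed
    qed
    have "K0_eq A (frag_of (syzygy A M)) (frag_of ?N)" by (rule syzygy_K0_eq[OF M(1) Pf Pp q qs])
    also have "K0_eq A (frag_of ?N) (frag_of (syzygy A M') + frag_of (syzygy A M''))"
      using K0_eq_direct_sum[OF Nf _ _ iN] syzygy_fg[OF M(2)] syzygy_fg[OF M(3)] unfolding P'(5) P''(5) by blast
    finally show ?thesis by (simp add: h Syz_add Syz_diff Syz_of K0_eq_def diff_diff_eq)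
  next
    fix P assume h: "h = frag_of P" and P: "P \<in> fg_modules A" "projective A P"
    have "K0_eq A (frag_of (syzygy A P)) (frag_of (rmod_ker P P (\<lambda>x. x)))"
      by (rule syzygy_K0_eq[OF P(1) P rmod_hom_id]) simp
    moreover have "rmod_ker P P (\<lambda>x. x) \<in> fg_modules A" by (rule rmod_ker_fg[OF P(1) right_module_if_fg[OF P(1)] rmod_hom_id])
    moreover have "carrier (rmod_ker P P (\<lambda>x. x)) = {\<zero>\<^bsub>rmod_ker P P (\<lambda>x. x)\<^esub>}"
    proof -
      interpret P: right_module A P using P(1) by (rule right_module_if_fg)
      show ?thesis by (auto simp: carrier_rmod_ker rmod_ker_simps)
    qed
    ultimately show ?thesis unfolding h Syz_of by (metis K0_eq_trivial K0_eq_trans)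
  qed
  then show ?thesis by (simp add: K0_eq_def)
qed

lemma Syz_relations: "c \<in> K0_relations A \<Longrightarrow> Syz c \<in> K0_relations A"
  unfolding K0_relations_def
proof (induction rule: generate.induct)
  case one
  show ?case unfolding K0_relations_def[symmetric] by (simp add: Syz_zero module_frags_def K0_relations_zero)
next
  case (incl h)
  then show ?case using Syz_generator unfolding K0_relations_def[symmetric] by blast
next
  case (inv h)
  have "h \<in> K0_relations A" unfolding K0_relations_def by (rule generate.incl[OF inv])
  from K0_relations_keys[OF this] show ?case
    using K0_relations_minus[OF Syz_generator[OF inv]] unfolding K0_relations_def[symmetric]
    by (simp add: module_frags_def Syz_def frag_extend_minus)
next
  case (eng h1 h2)
  then show ?case using K0_relations_add unfolding K0_relations_def[symmetric]
    by (simp add: module_frags_def Syz_add)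
qed

lemma Syz_cong: "K0_eq A c d \<Longrightarrow> K0_eq A (Syz c) (Syz d)"
  using Syz_relations[of "c - d"] by (simp add: K0_eq_def Syz_diff)

end

section \<open>Syzygies of monomial modules\<close>

context coeff_algebra
begin

text \<open>Closure under extension to the right. Dividing \<open>e_u A\<close> by the right ideal
  generated by the paths in \<open>S\<close> that start at \<open>u\<close> gives
  \<open>XM u (ext S)\<close>.\<close>

definition ext :: "('v \<times> 'e list) set \<Rightarrow> ('v \<times> 'e list) set" where
  "ext S = {(u, q @ r) | u q r. (u, q) \<in> S}"

lemma ext_iff: "(u, p) \<in> ext S \<longleftrightarrow> (\<exists>q r. (u, q) \<in> S \<and> p = q @ r)"
  by (auto simp: ext_def)

lemma rclosed_ext [simp]: "rclosed (ext S)"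
  unfolding rclosed_def ext_def by (auto, metis append_assoc)

text \<open>The right ideal inside \<open>e_u A\<close> that is divided out in
  \<open>XM u Z\<close>, hence the kernel of its standard presentation.\<close>

definition "supported u Z = {x \<in> carrier (PM [u]). \<forall>y. y \<notin> Z \<longrightarrow> cf (hd x) y = \<zero>\<^bsub>K\<^esub>}"

lemma XM_ker: "rmod_ker (PM [u]) (XM u Z) (\<lambda>x. [kz Z (hd x)]) = (PM [u])\<lparr>carrier := supported u Z\<rparr>"
proof -
  have "kz Z a = \<zero> \<longleftrightarrow> (\<forall>y. y \<notin> Z \<longrightarrow> cf a y = \<zero>\<^bsub>K\<^esub>)" if "a \<in> carrier A" for a
  proof
    assume 0: "kz Z a = \<zero>"
    show "\<forall>y. y \<notin> Z \<longrightarrow> cf a y = \<zero>\<^bsub>K\<^esub>"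
    proof (intro allI impI)
      fix y assume "y \<notin> Z"
      then show "cf a y = \<zero>\<^bsub>K\<^esub>" using cf_kz[OF that, of Z y] 0 by simp
    qed
  next
    assume "\<forall>y. y \<notin> Z \<longrightarrow> cf a y = \<zero>\<^bsub>K\<^esub>"
    then show "kz Z a = \<zero>" using that by (intro eqI) (auto simp: cf_kz)
  qed
  moreover have "hd x \<in> carrier A" if "x \<in> carrier (PM [u])" for x
    using that by (auto simp: PM_Cons_carrier)
  ultimately have "{x \<in> carrier (PM [u]). kz Z (hd x) = \<zero>} = supported u Z"
    unfolding supported_def by (intro Collect_cong conj_cong refl) simp
  then show ?thesis by (simp add: rmod_ker_def XM_simps)
qed

lemma supported_submodule:
  assumes "rclosed Z"
  shows "submodule (supported u Z) A (PM [u])"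
proof -
  have "{x \<in> carrier (PM [u]). [kz Z (hd x)] = \<zero>\<^bsub>XM u Z\<^esub>} = supported u Z"
    using arg_cong[OF XM_ker[of u Z], of carrier] by (simp add: carrier_rmod_ker)
  then show ?thesis
    using rmod_ker_submodule[OF PM_right_module XM_right_module[OF assms] XM_hom(1)[OF assms], of u] by simp
qed

lemma supported_fg:
  assumes "rclosed Z" "u \<in> verts Q"
  shows "(PM [u])\<lparr>carrier := supported u Z\<rparr> \<in> fg_modules A"
  using PM_submodule_decomp[OF _ supported_submodule[OF assms(1)]] assms(2) by auto

lemma syzygy_XM:
  assumes "rclosed Z" "u \<in> verts Q"
  shows "K0_eq A (frag_of (syzygy A (XM u Z))) (frag_of ((PM [u])\<lparr>carrier := supported u Z\<rparr>))"
  using syzygy_K0_eq[OF XM_fg[OF assms(2,1)] PM_single[OF assms(2)] XM_hom[OF assms(1)]]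
  unfolding XM_ker .

text \<open>Different paths of equal length are not prefixes of each other, so the right ideals they
  generate form a direct sum, and \<open>q\<close> contributes a copy of the local module at its
  end, truncated at \<open>k - t\<close>. Each insertion splits off one summand by
  \<open>PM_split\<close>, with the path itself as \<open>y\<close>.\<close>

lemma supported_ext:
  assumes u: "u \<in> verts Q" and fin: "finite S"
  shows "(\<And>v q. (v, q) \<in> S \<Longrightarrow> v = u \<and> (u, q) \<in> paths \<and> length q = t) \<Longrightarrow>
    K0_eq A (frag_of ((PM [u])\<lparr>carrier := supported u (ext S)\<rparr>)) (\<Sum>(v, q)\<in>S. frag_of (CM (awlast u q) (k - t)))"
  using fin
proof (induction S rule: finite_induct)
  case empty
  have e: "ext {} = {}" by (auto simp: ext_def)
  have "supported u {} = {\<zero>\<^bsub>PM [u]\<^esub>}"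
  proof (intro equalityI subsetI)
    fix x assume "x \<in> supported u {}"
    then obtain a where "x = [a]" "a \<in> carrier A" "\<And>y. cf a y = \<zero>\<^bsub>K\<^esub>"
      by (auto simp: supported_def PM_Cons_carrier PM_simps(1)[of "[]"])
    then show "x \<in> {\<zero>\<^bsub>PM [u]\<^esub>}" by (auto simp: PM_simps intro: eqI)
  qed (auto simp: supported_def PM_simps)
  then have "carrier ((PM [u])\<lparr>carrier := supported u (ext {})\<rparr>) = {\<zero>\<^bsub>(PM [u])\<lparr>carrier := supported u (ext {})\<rparr>\<^esub>}"
    by (simp add: e)
  then show ?case using K0_eq_trivial[OF supported_fg[OF rclosed_ext u]] by simp
next
  case (insert x S)
  obtain v q where "x = (v, q)" by fastforce
  then have x: "x = (u, q)" and q: "(u, q) \<in> paths" "length q = t" using insert.prems[of v q] by simp_all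
  have S: "v = u \<and> (u, q) \<in> paths \<and> length q = t" if "(v, q) \<in> S" for v q using insert.prems[of v q] that by simp
  let ?C = "supported u (ext (insert x S))" and ?N = "CM (awlast u q) (k - t)"
  let ?W = "(PM [u])\<lparr>carrier := ?C\<rparr>" and ?h = "\<lambda>x. [lq (u, q) (x ! 0)]"
  have C: "z = [hd z] \<and> hd z \<in> E u \<and> hd z \<in> carrier A" if "z \<in> ?C" for z
    using that by (auto simp: supported_def PM_Cons_carrier PM_simps(1)[of "[]"])
  have Ccf: "cf (hd z) (v, p) = \<zero>\<^bsub>K\<^esub>" if "z \<in> ?C" "(v, p) \<notin> ext (insert x S)" for z v p
    using that by (auto simp: supported_def)
  have long: "length p \<ge> t" if l: "(v, p) \<in> ext (insert x S)" for v p
  proof -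
    obtain q' r where "(v, q') \<in> insert x S" "p = q' @ r" using l unfolding ext_iff by (elim exE conjE) (rule that)
    then show ?thesis using insert.prems[of v q'] by simp
  qed
  have low: "z ! 0 \<in> F t" if z: "z \<in> ?C" for z
  proof -
    have "z ! 0 = hd z" using C[OF z] by (metis nth_Cons_0)
    moreover have "hd z \<in> F t"
    proof (rule FI)
      fix v and p :: "'e list" assume "length p < t"
      then have "(v, p) \<notin> ext (insert x S)" using long[of v p] by auto
      then show "cf (hd z) (v, p) = \<zero>\<^bsub>K\<^esub>" by (rule Ccf[OF z])
    qed (use C[OF z] in simp)
    ultimately show ?thesis by simp
  qed
  have y: "[pe (u, q)] \<in> ?C"
  proof -
    have "(u, q) \<in> ext (insert x S)" unfolding ext_iff x by (intro exI[of _ q] exI[of _ "[]"]) simp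
    then show ?thesis by (auto simp: supported_def PM_simps cf_pe pe_E)
  qed
  have h: "submodule ?C A (PM [u])" "0 < length [u]" "([u] ! 0, q) \<in> paths"
    "\<And>x. x \<in> ?C \<Longrightarrow> x ! 0 \<in> F (length q)" "[pe (u, q)] \<in> ?C"
    "\<And>j. j < length [u] \<Longrightarrow> [pe (u, q)] ! j \<in> F (length q)"
    "lq ([u] ! 0, q) ([pe (u, q)] ! 0) = ev (awlast ([u] ! 0) q)"
    using low y q lq_pe[OF q(1)] pe_F[of u q] by (simp_all add: supported_submodule)
  note s = PM_split[OF h, unfolded q(2) nth_Cons_0]
  have "{z \<in> ?C. ?h z = \<zero>\<^bsub>?N\<^esub>} = supported u (ext S)"
  proof (intro equalityI subsetI)
    fix z assume "z \<in> {z \<in> ?C. ?h z = \<zero>\<^bsub>?N\<^esub>}"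
    then have z: "z \<in> ?C" "lq (u, q) (hd z) = \<zero>" using C[of z] by (auto simp: CM_def XM_simps) (metis nth_Cons_0)
    have "cf (hd z) (v, p) = \<zero>\<^bsub>K\<^esub>" if n: "(v, p) \<notin> ext S" for v p
    proof (cases "(v, p) \<in> ext (insert x S)")
      case True
      obtain r where "v = u" "p = q @ r" using True n unfolding ext_iff x by auto
      then show ?thesis using cf_lq[OF _ q(1), of "hd z" "awlast u q" r] C[OF z(1)] z(2) by simp
    qed (use Ccf z in auto)
    then show "z \<in> supported u (ext S)" using z by (auto simp: supported_def)
  next
    fix z assume z: "z \<in> supported u (ext S)"
    have sub: "ext S \<subseteq> ext (insert x S)" by (auto simp: ext_def)
    have zC: "z \<in> ?C" using z sub by (auto simp: supported_def)
    have "lq (u, q) (hd z) = \<zero>"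
    proof (rule eqI)
      fix w p
      \<comment> \<open>A prefix of \<open>q @ p\<close> of length \<open>t\<close> can only be
        \<open>q\<close>, which is not in \<open>S\<close>.\<close>
      have "(u, q @ p) \<notin> ext S"
      proof
        assume e: "(u, q @ p) \<in> ext S"
        obtain q' r where "(u, q') \<in> S" "q @ p = q' @ r" using e unfolding ext_iff by (elim exE conjE) (rule that)
        moreover from this S q(2) have "q = q'" by (metis append_eq_append_conv)
        ultimately show False using insert.hyps x by simp
      qed
      then show "cf (lq (u, q) (hd z)) (w, p) = cf \<zero> (w, p)"
        using z C[OF zC] q by (simp add: cf_lq supported_def)
    qed (use C[OF zC] in auto)
    then show "z \<in> {z \<in> ?C. ?h z = \<zero>\<^bsub>?N\<^esub>}" using zC C[OF zC] by (simp add: CM_def XM_simps) (metis nth_Cons_0)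
  qed
  then have ker: "rmod_ker ?W ?N ?h = (PM [u])\<lparr>carrier := supported u (ext S)\<rparr>"
    by (simp add: rmod_ker_def)
  have "K0_eq A (frag_of ?W) (frag_of (rmod_ker ?W ?N ?h) + frag_of ?N)"
    by (rule K0_eq_split[OF supported_fg[OF rclosed_ext u] CM_fg[OF paths_end[OF q(1)]] s])
      (simp_all add: ker supported_fg u)
  also have "K0_eq A (frag_of (rmod_ker ?W ?N ?h) + frag_of ?N)
      ((\<Sum>(v, q)\<in>S. frag_of (CM (awlast u q) (k - t))) + frag_of ?N)"
    unfolding ker using S by (intro K0_eq_add insert.IH K0_eq_refl)
  also have "\<dots> = (\<Sum>(v, q)\<in>insert x S. frag_of (CM (awlast u q) (k - t)))"
    using insert.hyps by (simp add: x add.commute)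
  finally show ?case .
qed

lemma syzygy_XM_ext:
  assumes "u \<in> verts Q" "finite S" "\<And>v q. (v, q) \<in> S \<Longrightarrow> v = u \<and> (u, q) \<in> paths \<and> length q = t"
  shows "K0_eq A (frag_of (syzygy A (XM u (ext S)))) (\<Sum>(v, q)\<in>S. frag_of (CM (awlast u q) (k - t)))"
  using K0_eq_trans[OF syzygy_XM[OF rclosed_ext assms(1)] supported_ext[OF assms(1,2,3)]] .

text \<open>The kernel of the projection from \<open>e_u A\<close> is spanned by the paths of length
  at least \<open>j\<close>, so it is generated by those of length exactly \<open>j\<close>.\<close>

lemma syzygy_CM:
  assumes "u \<in> verts Q"
  shows "K0_eq A (frag_of (syzygy A (CM u j))) (\<Sum>q | (u, q) \<in> paths \<and> length q = j. frag_of (CM (awlast u q) (k - j)))"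
proof -
  let ?S = "{(v, q). v = u \<and> (u, q) \<in> paths \<and> length q = j}"
  have "supported u (ext ?S) = supported u {x. j \<le> length (snd x)}"
  proof -
    have 1: "(u, p) \<in> ext ?S" if "(u, p) \<in> paths" "j \<le> length p" for p
      unfolding ext_iff using that paths_take_drop[of u p j]
      by (intro exI[of _ "take j p"] exI[of _ "drop j p"]) auto
    have 2: "j \<le> length p" if "(v, p) \<in> ext ?S" for v p
      using that unfolding ext_iff by auto
    have "(\<forall>y. y \<notin> ext ?S \<longrightarrow> cf a y = \<zero>\<^bsub>K\<^esub>) \<longleftrightarrow> (\<forall>y. y \<notin> {x. j \<le> length (snd x)} \<longrightarrow> cf a y = \<zero>\<^bsub>K\<^esub>)"
      if a: "a \<in> E u" for a
    proof (intro iffI allI impI)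
      fix y :: "'v \<times> 'e list" assume *: "\<forall>y. y \<notin> ext ?S \<longrightarrow> cf a y = \<zero>\<^bsub>K\<^esub>" "y \<notin> {x. j \<le> length (snd x)}"
      obtain v p where "y = (v, p)" by fastforce
      then show "cf a y = \<zero>\<^bsub>K\<^esub>" using * 2[of v p] by auto
    next
      fix y :: "'v \<times> 'e list" assume *: "\<forall>y. y \<notin> {x. j \<le> length (snd x)} \<longrightarrow> cf a y = \<zero>\<^bsub>K\<^esub>" "y \<notin> ext ?S"
      obtain v p where y: "y = (v, p)" by fastforce
      consider "v \<noteq> u" | "y \<notin> paths" | "y \<notin> {x. j \<le> length (snd x)}" using 1[of p] *(2) y by auto
      then show "cf a y = \<zero>\<^bsub>K\<^esub>"
      proof cases
        case 1
        then show ?thesis using E_cf[OF a] y by simp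
      next
        case 2
        then show ?thesis using cf_outside[OF E_carrier[OF a]] by simp
      next
        case 3
        then show ?thesis using *(1) by blast
      qed
    qed
    moreover have "hd x \<in> E u" if "x \<in> carrier (PM [u])" for x using that by (auto simp: PM_Cons_carrier)
    ultimately show ?thesis unfolding supported_def by (intro Collect_cong conj_cong refl) simp
  qed
  moreover have fin: "finite ?S" by (rule finite_subset[OF _ finite_paths]) auto
  ultimately have "K0_eq A (frag_of (syzygy A (CM u j))) (\<Sum>(v, q)\<in>?S. frag_of (CM (awlast u q) (k - j)))"
    using K0_eq_trans[OF syzygy_XM[OF rclosed_long assms, of j]] supported_ext[OF assms fin, of j] unfolding CM_def by simp
  also have "(\<Sum>(v, q)\<in>?S. frag_of (CM (awlast u q) (k - j))) = (\<Sum>q | (u, q) \<in> paths \<and> length q = j. frag_of (CM (awlast u q) (k - j)))"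
    by (rule sum.reindex_bij_witness[of _ "\<lambda>q. (u, q)" snd]) auto
  finally show ?thesis .
qed

text \<open>Nothing is divided out, so the module is the projective \<open>e_u A\<close>.\<close>

lemma CM_zero:
  assumes "u \<in> verts Q" "\<And>q. (u, q) \<in> paths \<Longrightarrow> length q < j"
  shows "K0_eq A (frag_of (CM u j)) 0"
proof -
  have id: "kz {x. j \<le> length (snd x)} a = a" if "a \<in> E u" for a
  proof (rule kz_id)
    fix x :: "'v \<times> 'e list" assume x: "x \<in> {x. j \<le> length (snd x)}"
    obtain v p where vp: "x = (v, p)" by fastforce
    show "cf a x = \<zero>\<^bsub>K\<^esub>"
    proof (cases "v = u")
      case True
      then have "x \<notin> paths" using assms(2)[of p] x vp by auto
      then show ?thesis using cf_outside that by simp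
    qed (use E_cf[OF that] vp in simp)
  qed (use that in simp)
  have cc: "carrier (PM [u]) = {[a] | a. a \<in> E u}"
    by (auto simp: PM_Cons_carrier PM_simps(1)[of "[]"])
  have "rmod_iso A (PM [u]) (CM u j)"
    unfolding rmod_iso_def
  proof (rule bexI)
    show "(\<lambda>x. [kz {x. j \<le> length (snd x)} (hd x)]) \<in> rmod_hom A (PM [u]) (CM u j)"
      unfolding CM_def by (rule XM_hom) simp
    show "bij_betw (\<lambda>x. [kz {x. j \<le> length (snd x)} (hd x)]) (carrier (PM [u])) (carrier (CM u j))"
      using XM_hom(2)[OF rclosed_long, of j u] id
      by (auto simp: bij_betw_def inj_on_def CM_def cc)
  qed
  from projective_iso[OF PM_right_module this PM_single(2)[OF assms(1)]] CM_fg[OF assms(1)]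
  show ?thesis by (intro K0_eq_projective)
qed

section \<open>Combinations of the modules C(v,j), and the matrix of the syzygy operator\<close>

definition npaths :: "'v \<Rightarrow> nat \<Rightarrow> 'v \<Rightarrow> int" where
  "npaths v j w = int (card {q. awalk v q w \<and> length q = j})"

text \<open>The excluded slots carry no information: \<open>CM v 0\<close> is zero and
  \<open>CM v k\<close> is projective.\<close>

definition comb :: "('v \<Rightarrow> nat \<Rightarrow> int) \<Rightarrow> (('a, 'a list) module \<Rightarrow>\<^sub>0 int)" where
  "comb y = (\<Sum>v\<in>verts Q. \<Sum>j\<in>{1..<k}. frag_cmul (y v j) (frag_of (CM v j)))"

text \<open>The syzygy operator on coefficients. The slot \<open>j\<close> is fed by
  \<open>k - j\<close>, since the syzygy of \<open>CM v (k - j)\<close> contains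
  \<open>npaths v (k - j) w\<close> copies of \<open>CM w j\<close>.\<close>

definition tr :: "('v \<Rightarrow> nat \<Rightarrow> int) \<Rightarrow> 'v \<Rightarrow> nat \<Rightarrow> int" where
  "tr y w j = (\<Sum>v\<in>verts Q. y v (k - j) * npaths v (k - j) w)"

lemma comb_add: "comb (\<lambda>v j. y v j + z v j) = comb y + comb z"
  by (simp add: comb_def frag_cmul_distrib sum.distrib)

lemma comb_cmul: "comb (\<lambda>v j. c * y v j) = frag_cmul c (comb y)"
  by (simp add: comb_def frag_cmul_sum)

lemma comb_unit:
  assumes "v \<in> verts Q" "j \<in> {1..<k}"
  shows "comb (\<lambda>w i. if w = v \<and> i = j then 1 else 0) = frag_of (CM v j)"
proof -
  have "comb (\<lambda>w i. if w = v \<and> i = j then 1 else 0) =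
     (\<Sum>w\<in>verts Q. \<Sum>i\<in>{1..<k}. if i = j then (if w = v then frag_of (CM v j) else 0) else 0)"
    unfolding comb_def by (intro sum.cong refl) auto
  also have "\<dots> = (\<Sum>w\<in>verts Q. if w = v then frag_of (CM v j) else 0)"
    by (subst sum.delta[OF finite_atLeastLessThan]) (simp only: assms(2) if_True)
  also have "\<dots> = frag_of (CM v j)" using assms(1) by (simp add: sum.delta[OF finite_verts])
  finally show ?thesis .
qed

lemma finite_walks: "finite {q. awalk v q w \<and> length q = j}"
  by (rule finite_subset[OF _ finite_lists_length_eq[OF finite_arcs, of j]]) (auto simp: awalk_def)

lemma syzygy_CM_npaths:
  assumes "v \<in> verts Q" "j < k"
  shows "K0_eq A (frag_of (syzygy A (CM v j))) (\<Sum>w\<in>verts Q. frag_cmul (npaths v j w) (frag_of (CM w (k - j))))"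
proof -
  let ?P = "{q. (v, q) \<in> paths \<and> length q = j}"
  have fin: "finite ?P" by (rule finite_subset[OF _ finite_imageI[OF finite_paths, of snd]]) force
  have "(\<Sum>q\<in>?P. frag_of (CM (awlast v q) (k - j))) =
      (\<Sum>w\<in>verts Q. \<Sum>q\<in>{q \<in> ?P. awlast v q = w}. frag_of (CM (awlast v q) (k - j)))"
    using fin paths_end by (subst sum.group[of ?P "verts Q" "awlast v"]) auto
  also have "\<dots> = (\<Sum>w\<in>verts Q. frag_cmul (npaths v j w) (frag_of (CM w (k - j))))"
  proof (rule sum.cong[OF refl])
    fix w
    have e: "{q \<in> ?P. awlast v q = w} = {q. awalk v q w \<and> length q = j}"
      using assms(2) by (auto simp: paths_iff)
    have c: "(\<Sum>q\<in>B. x) = frag_cmul (int (card B)) x" if "finite B" for B :: "'e list set" and x :: "('a, 'a list) module \<Rightarrow>\<^sub>0 int"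
      using that by (induction B rule: finite_induct) (auto simp: frag_cmul_distrib add.commute)
    have "(\<Sum>q\<in>{q \<in> ?P. awlast v q = w}. frag_of (CM (awlast v q) (k - j))) = (\<Sum>q\<in>{q \<in> ?P. awlast v q = w}. frag_of (CM w (k - j)))"
      by (rule sum.cong) auto
    also have "\<dots> = frag_cmul (npaths v j w) (frag_of (CM w (k - j)))"
      unfolding e c[OF finite_walks] npaths_def ..
    finally show "(\<Sum>q\<in>{q \<in> ?P. awlast v q = w}. frag_of (CM (awlast v q) (k - j))) = frag_cmul (npaths v j w) (frag_of (CM w (k - j)))" .
  qed
  finally show ?thesis using syzygy_CM[OF assms(1), of j] by simp
qed

lemma Syz_sum: "finite I \<Longrightarrow> Syz (sum f I) = (\<Sum>i\<in>I. Syz (f i))"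
  by (simp add: Syz_def frag_extend_sum o_def)

lemma Syz_comb: "K0_eq A (Syz (comb y)) (comb (tr y))"
proof -
  let ?f = "\<lambda>v j w. frag_cmul (y v j * npaths v j w) (frag_of (CM w (k - j)))"
  have "Syz (comb y) = (\<Sum>v\<in>verts Q. \<Sum>j\<in>{1..<k}. frag_cmul (y v j) (frag_of (syzygy A (CM v j))))"
    by (simp add: comb_def Syz_sum Syz_cmul Syz_of)
  also have "K0_eq A \<dots> (\<Sum>v\<in>verts Q. \<Sum>j\<in>{1..<k}. frag_cmul (y v j) (\<Sum>w\<in>verts Q. frag_cmul (npaths v j w) (frag_of (CM w (k - j)))))"
    by (intro K0_eq_sum K0_eq_cmul syzygy_CM_npaths) auto
  also have "\<dots> = (\<Sum>v\<in>verts Q. \<Sum>j\<in>{1..<k}. \<Sum>w\<in>verts Q. ?f v j w)"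
    by (simp add: frag_cmul_sum)
  also have "\<dots> = (\<Sum>j\<in>{1..<k}. \<Sum>w\<in>verts Q. \<Sum>v\<in>verts Q. ?f v j w)"
    by (subst sum.swap, intro sum.cong refl sum.swap)
  \<comment> \<open>Replacing \<open>j\<close> by \<open>k - j\<close> collects the terms according
    to the module \<open>CM w j\<close>.\<close>
  also have "\<dots> = (\<Sum>j\<in>{1..<k}. \<Sum>w\<in>verts Q. \<Sum>v\<in>verts Q. ?f v (k - j) w)"
    by (rule sum.reindex_bij_witness[of _ "\<lambda>j. k - j" "\<lambda>j. k - j"]) auto
  also have "\<dots> = (\<Sum>j\<in>{1..<k}. \<Sum>w\<in>verts Q. frag_cmul (tr y w j) (frag_of (CM w j)))"
  proof (intro sum.cong refl)
    fix j w assume j: "j \<in> {1..<k}"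
    have "frag_cmul (\<Sum>v\<in>V. g v) x = (\<Sum>v\<in>V. frag_cmul (g v) x)" for V :: "'v set" and g and x :: "('a, 'a list) module \<Rightarrow>\<^sub>0 int"
      by (induction V rule: infinite_finite_induct) (auto simp: frag_cmul_distrib)
    then show "(\<Sum>v\<in>verts Q. ?f v (k - j) w) = frag_cmul (tr y w j) (frag_of (CM w j))"
      using j by (simp add: tr_def)
  qed
  also have "\<dots> = comb (tr y)" unfolding comb_def by (rule sum.swap)
  finally show ?thesis .
qed

lemma ex_comb_list: "set L \<subseteq> verts Q \<times> {1..k} \<Longrightarrow> \<exists>y. K0_eq A (\<Sum>(v, j)\<leftarrow>L. frag_of (CM v j)) (comb y)"
proof (induction L)
  case Nil
  show ?case by (intro exI[of _ "\<lambda>_ _. 0"]) (simp add: comb_def)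
next
  case (Cons x L)
  obtain v j where x: "x = (v, j)" "v \<in> verts Q" "1 \<le> j" "j \<le> k" using Cons.prems by (cases x) auto
  obtain y where y: "K0_eq A (\<Sum>(v, j)\<leftarrow>L. frag_of (CM v j)) (comb y)" using Cons by auto
  obtain z where z: "K0_eq A (frag_of (CM v j)) (comb z)"
  proof (cases "j < k")
    case True
    then show ?thesis using that comb_unit[OF x(2), of j] x by (metis K0_eq_refl atLeastLessThan_iff)
  next
    case False
    then have "K0_eq A (frag_of (CM v j)) 0" using x by (intro CM_zero) (auto simp: paths_iff)
    then show ?thesis by (intro that[of "\<lambda>_ _. 0"]) (simp add: comb_def)
  qed
  show ?case using K0_eq_add[OF z y] by (intro exI[of _ "\<lambda>v j. z v j + y v j"]) (simp add: x comb_add)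
qed

text \<open>Modulo the relations the syzygy is the kernel of a surjection from some
  \<open>PM vs\<close>, and submodules of \<open>PM vs\<close> have been decomposed.\<close>

lemma ex_comb_syzygy:
  assumes "M \<in> fg_modules A"
  shows "\<exists>y. K0_eq A (frag_of (syzygy A M)) (comb y)"
proof -
  have M: "right_module A M" by (rule right_module_if_fg[OF assms])
  obtain L where L: "set L \<subseteq> verts Q \<times> carrier M" "img M L = carrier M" using ex_generators[OF assms] by blast
  have vs: "set (map fst L) \<subseteq> verts Q" using L(1) by auto
  note h = img_hom[OF M L(1)]
  obtain L' where L': "set L' \<subseteq> verts Q \<times> {1..k}"
    "K0_eq A (frag_of (rmod_ker (PM (map fst L)) M (lc M (map snd L)))) (\<Sum>(v, j)\<leftarrow>L'. frag_of (CM v j))"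
    using PM_submodule_decomp[OF vs rmod_ker_submodule[OF PM_right_module M h], folded rmod_ker_def]
    by (elim conjE exE) (rule that)
  obtain y where y: "K0_eq A (\<Sum>(v, j)\<leftarrow>L'. frag_of (CM v j)) (comb y)" using ex_comb_list[OF L'(1)] by blast
  have "K0_eq A (frag_of (syzygy A M)) (frag_of (rmod_ker (PM (map fst L)) M (lc M (map snd L))))"
    by (rule syzygy_K0_eq[OF assms conjunct1[OF PM_fg_projective[OF vs]] conjunct2[OF PM_fg_projective[OF vs]]
          h L(2)[unfolded img_def]])
  from K0_eq_trans[OF K0_eq_trans[OF this L'(2)] y] show ?thesis by (rule exI[of _ y])
qed

lemma ex_comb_Syz:
  assumes "Poly_Mapping.keys c \<subseteq> fg_modules A"
  shows "\<exists>y. K0_eq A (Syz c) (comb y)"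
proof -
  obtain y where y: "\<And>M. M \<in> fg_modules A \<Longrightarrow> K0_eq A (frag_of (syzygy A M)) (comb (y M))"
    using ex_comb_syzygy by metis
  have "K0_eq A (Syz c) (\<Sum>M\<in>Poly_Mapping.keys c. frag_cmul (Poly_Mapping.lookup c M) (comb (y M)))"
    unfolding Syz_def frag_extend_def using assms y by (intro K0_eq_sum K0_eq_cmul) auto
  moreover have comb: "\<exists>z. (\<Sum>M\<in>S. frag_cmul (Poly_Mapping.lookup c M) (comb (y M))) = comb z" if "finite S" for S
    using that
  proof (induction S rule: finite_induct)
    case empty
    show ?case by (intro exI[of _ "\<lambda>_ _. 0"]) (simp add: comb_def)
  next
    case (insert M S)
    then obtain z where "(\<Sum>M\<in>S. frag_cmul (Poly_Mapping.lookup c M) (comb (y M))) = comb z" by blast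
    then show ?case using insert
      by (intro exI[of _ "\<lambda>v j. Poly_Mapping.lookup c M * y M v j + z v j"]) (simp add: comb_add comb_cmul)
  qed
  moreover obtain z where "(\<Sum>M\<in>Poly_Mapping.keys c. frag_cmul (Poly_Mapping.lookup c M) (comb (y M))) = comb z"
    using comb[OF finite_keys[of c]] by (rule exE)
  ultimately show ?thesis by (intro exI[of _ z]) simp
qed

end

section \<open>Numerical invariants of \<open>K\<^sub>0\<close>\<close>

text \<open>Linear algebra over \<open>K\<close> inside a module, with scalars acting through
  \<open>sc\<close>: \<open>ksub\<close> singles out the subspaces, and \<open>adj U x\<close> is
  \<open>U + K x\<close>.\<close>

locale coeff_module = coeff_algebra A K Q k cf + M: right_module A M
  for A :: "('a, 'm) ring_scheme" (structure) and K :: "('k, 'l) ring_scheme"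
    and Q :: "('v, 'e) pre_digraph" and k cf and M :: "('a, 'x) module"
begin

definition ksub :: "'x set \<Rightarrow> bool" where
  "ksub U \<longleftrightarrow> U \<subseteq> carrier M \<and> \<zero>\<^bsub>M\<^esub> \<in> U \<and> (\<forall>x\<in>U. \<forall>y\<in>U. x \<oplus>\<^bsub>M\<^esub> y \<in> U) \<and>
     (\<forall>c\<in>carrier K. \<forall>x\<in>U. sc c \<odot>\<^bsub>M\<^esub> x \<in> U)"

definition adj :: "'x set \<Rightarrow> 'x \<Rightarrow> 'x set" where
  "adj U x = {u \<oplus>\<^bsub>M\<^esub> sc c \<odot>\<^bsub>M\<^esub> x | u c. u \<in> U \<and> c \<in> carrier K}"

lemma ksubD:
  assumes "ksub U"
  shows "x \<in> U \<Longrightarrow> x \<in> carrier M" "\<zero>\<^bsub>M\<^esub> \<in> U" "x \<in> U \<Longrightarrow> y \<in> U \<Longrightarrow> x \<oplus>\<^bsub>M\<^esub> y \<in> U"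
    "c \<in> carrier K \<Longrightarrow> x \<in> U \<Longrightarrow> sc c \<odot>\<^bsub>M\<^esub> x \<in> U"
  using assms by (auto simp: ksub_def)

lemma sc_smult:
  "c \<in> carrier K \<Longrightarrow> d \<in> carrier K \<Longrightarrow> x \<in> carrier M \<Longrightarrow> sc c \<odot>\<^bsub>M\<^esub> (sc d \<odot>\<^bsub>M\<^esub> x) = sc (c \<otimes>\<^bsub>K\<^esub> d) \<odot>\<^bsub>M\<^esub> x"
  by (simp add: M.smult_assoc sc_mult[symmetric] K.m_comm)

lemma ksub_minus:
  assumes "ksub U" "x \<in> U"
  shows "\<ominus>\<^bsub>M\<^esub> x \<in> U"
proof -
  have x: "x \<in> carrier M" using ksubD(1)[OF assms] .
  have "sc (\<ominus>\<^bsub>K\<^esub> \<one>\<^bsub>K\<^esub>) \<oplus> \<one> = \<zero>"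
    using sc_add[of "\<ominus>\<^bsub>K\<^esub> \<one>\<^bsub>K\<^esub>" "\<one>\<^bsub>K\<^esub>"] by (simp add: sc_one K.l_neg sc_zero)
  then have "sc (\<ominus>\<^bsub>K\<^esub> \<one>\<^bsub>K\<^esub>) = \<ominus> \<one>" by (simp add: A.minus_equality)
  then show ?thesis using ksubD(4)[OF assms(1) _ assms(2), of "\<ominus>\<^bsub>K\<^esub> \<one>\<^bsub>K\<^esub>"] M.neg_eq[OF x] by simp
qed

lemma adj_ksub:
  assumes U: "ksub U" and x: "x \<in> carrier M"
  shows "ksub (adj U x)"
  unfolding ksub_def
proof (intro conjI ballI)
  note D = ksubD[OF U]
  show "adj U x \<subseteq> carrier M" using D x by (auto simp: adj_def)
  show "\<zero>\<^bsub>M\<^esub> \<in> adj U x" unfolding adj_def using D(2) x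
    by (intro CollectI exI[of _ "\<zero>\<^bsub>M\<^esub>"] exI[of _ "\<zero>\<^bsub>K\<^esub>"]) (simp add: sc_zero)
  fix y assume "y \<in> adj U x"
  then obtain u c where y: "y = u \<oplus>\<^bsub>M\<^esub> sc c \<odot>\<^bsub>M\<^esub> x" "u \<in> U" "c \<in> carrier K" by (auto simp: adj_def)
  note u = D(1)[OF y(2)]
  {
    fix z assume "z \<in> adj U x"
    then obtain v d where z: "z = v \<oplus>\<^bsub>M\<^esub> sc d \<odot>\<^bsub>M\<^esub> x" "v \<in> U" "d \<in> carrier K" by (auto simp: adj_def)
    note v = D(1)[OF z(2)]
    have "y \<oplus>\<^bsub>M\<^esub> z = (u \<oplus>\<^bsub>M\<^esub> v) \<oplus>\<^bsub>M\<^esub> sc (c \<oplus>\<^bsub>K\<^esub> d) \<odot>\<^bsub>M\<^esub> x"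
      using y z u v x by (simp add: sc_add M.smult_l_distr M.M.a_ac)
    then show "y \<oplus>\<^bsub>M\<^esub> z \<in> adj U x" unfolding adj_def using D(3)[OF y(2) z(2)] y(3) z(3) by blast
  next
    fix d assume d: "d \<in> carrier K"
    have "sc d \<odot>\<^bsub>M\<^esub> y = (sc d \<odot>\<^bsub>M\<^esub> u) \<oplus>\<^bsub>M\<^esub> sc (d \<otimes>\<^bsub>K\<^esub> c) \<odot>\<^bsub>M\<^esub> x"
      using y d u x by (simp add: M.smult_r_distr sc_smult)
    then show "sc d \<odot>\<^bsub>M\<^esub> y \<in> adj U x" unfolding adj_def using D(4)[OF d y(2)] y(3) d by blast
  }
qed

lemma adj_upper:
  assumes "ksub U" "x \<in> carrier M"
  shows "U \<subseteq> adj U x" "x \<in> adj U x"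
proof -
  show "U \<subseteq> adj U x"
  proof
    fix u assume u: "u \<in> U"
    then have "u = u \<oplus>\<^bsub>M\<^esub> sc \<zero>\<^bsub>K\<^esub> \<odot>\<^bsub>M\<^esub> x" using ksubD(1)[OF assms(1) u] assms(2) by (simp add: sc_zero)
    then show "u \<in> adj U x" unfolding adj_def using u by blast
  qed
  have "x = \<zero>\<^bsub>M\<^esub> \<oplus>\<^bsub>M\<^esub> sc \<one>\<^bsub>K\<^esub> \<odot>\<^bsub>M\<^esub> x" using assms(2) by (simp add: sc_one)
  then show "x \<in> adj U x" unfolding adj_def using ksubD(2)[OF assms(1)] by blast
qed

lemma adj_least: "ksub W \<Longrightarrow> U \<subseteq> W \<Longrightarrow> x \<in> W \<Longrightarrow> adj U x \<subseteq> W"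
  using ksubD(3,4) by (fastforce simp: adj_def)

lemma adj_commute:
  assumes U: "ksub U" and xy: "x \<in> carrier M" "y \<in> carrier M"
  shows "adj (adj U x) y = adj (adj U y) x"
proof -
  have "adj (adj U x) y \<subseteq> adj (adj U y) x" if xy: "x \<in> carrier M" "y \<in> carrier M" for x y
  proof -
    note U' = adj_ksub[OF U xy(2)]
    have k: "ksub (adj (adj U y) x)" by (rule adj_ksub[OF U' xy(1)])
    have "U \<subseteq> adj (adj U y) x" using adj_upper(1)[OF U xy(2)] adj_upper(1)[OF U' xy(1)] by blast
    moreover have "x \<in> adj (adj U y) x" by (rule adj_upper(2)[OF U' xy(1)])
    moreover have "y \<in> adj (adj U y) x" using adj_upper(2)[OF U xy(2)] adj_upper(1)[OF U' xy(1)] by blast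
    ultimately show ?thesis by (intro adj_least[OF k] adj_least[OF k])
  qed
  then show ?thesis using xy by blast
qed

text \<open>Steinitz exchange: \<open>x\<close> has a nonzero coefficient in \<open>y\<close>, as
  \<open>y\<close> is not in \<open>U\<close>, and this coefficient can be inverted in
  \<open>K\<close>.\<close>

lemma adj_exchange:
  assumes U: "ksub U" and x: "x \<in> carrier M" and y: "y \<in> adj U x" "y \<notin> U"
  shows "adj U y = adj U x"
proof
  note kx = adj_ksub[OF U x]
  have yM: "y \<in> carrier M" using ksubD(1)[OF kx y(1)] .
  note ky = adj_ksub[OF U yM]
  show "adj U y \<subseteq> adj U x" by (rule adj_least[OF kx adj_upper(1)[OF U x] y(1)])
  obtain u c where uc: "y = u \<oplus>\<^bsub>M\<^esub> sc c \<odot>\<^bsub>M\<^esub> x" "u \<in> U" "c \<in> carrier K" using y(1) by (auto simp: adj_def)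
  have u: "u \<in> carrier M" using ksubD(1)[OF U uc(2)] .
  have "c \<noteq> \<zero>\<^bsub>K\<^esub>" using uc y(2) x u by (auto simp: sc_zero)
  then have cU: "c \<in> Units K" using uc(3) by (simp add: K.field_Units)
  have i: "inv\<^bsub>K\<^esub> c \<in> carrier K" "inv\<^bsub>K\<^esub> c \<otimes>\<^bsub>K\<^esub> c = \<one>\<^bsub>K\<^esub>" using cU by auto
  have "sc c \<odot>\<^bsub>M\<^esub> x = (\<ominus>\<^bsub>M\<^esub> u) \<oplus>\<^bsub>M\<^esub> y"
    using uc x u by (simp add: M.r_neg1)
  then have "sc c \<odot>\<^bsub>M\<^esub> x \<in> adj U y"
    using ksubD(3)[OF ky, of "\<ominus>\<^bsub>M\<^esub> u" y] ksub_minus[OF U uc(2)] adj_upper[OF U yM] by auto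
  then have "sc (inv\<^bsub>K\<^esub> c) \<odot>\<^bsub>M\<^esub> (sc c \<odot>\<^bsub>M\<^esub> x) \<in> adj U y" by (rule ksubD(4)[OF ky i(1)])
  then have "x \<in> adj U y" using x i uc(3) by (simp add: sc_smult sc_one)
  then show "adj U x \<subseteq> adj U y" by (rule adj_least[OF ky adj_upper(1)[OF U yM]])
qed

text \<open>\<open>flag U W d\<close>: the subspace \<open>W\<close> arises from \<open>U\<close> by adjoining \<open>d\<close> vectors, each not in
  the previous subspace, so that \<open>d\<close> is the dimension of \<open>W / U\<close>.\<close>

inductive flag :: "'x set \<Rightarrow> 'x set \<Rightarrow> nat \<Rightarrow> bool" where
  flag_refl: "ksub U \<Longrightarrow> flag U U 0"
| flag_step: "ksub U \<Longrightarrow> x \<in> carrier M \<Longrightarrow> x \<notin> U \<Longrightarrow> flag (adj U x) W d \<Longrightarrow> flag U W (Suc d)"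

lemma flag_ksub: "flag U W d \<Longrightarrow> ksub U \<and> ksub W \<and> U \<subseteq> W"
  by (induction rule: flag.induct) (use adj_upper(1) in blast)+

lemma flag_0: "flag U W 0 \<Longrightarrow> U = W"
  by (auto elim: flag.cases)

lemma flag_SucE:
  assumes "flag U W (Suc d)"
  obtains x where "ksub U" "x \<in> carrier M" "x \<notin> U" "flag (adj U x) W d"
  using assms by (auto elim: flag.cases)

text \<open>Any vector of \<open>W\<close> outside \<open>U\<close> may serve as the first step. If
  it lies in the first subspace of the flag, it replaces the vector \<open>y\<close> used there;
  otherwise it is inserted into the rest by induction and the two steps are interchanged.\<close>

lemma flag_exchange: "flag U W (Suc d) \<Longrightarrow> x \<in> W \<Longrightarrow> x \<notin> U \<Longrightarrow> flag (adj U x) W d"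
proof (induction d arbitrary: U x)
  case (0 U x)
  obtain y where y: "ksub U" "y \<in> carrier M" "y \<notin> U" "flag (adj U y) W 0" using 0(1) by (rule flag_SucE)
  have W: "adj U y = W" by (rule flag_0[OF y(4)])
  have "adj U x = adj U y" using 0(2,3) W by (intro adj_exchange[OF y(1,2)]) auto
  then show ?case using y(4) by simp
next
  case (Suc d U x)
  obtain y where y: "ksub U" "y \<in> carrier M" "y \<notin> U" "flag (adj U y) W (Suc d)" using Suc.prems(1) by (rule flag_SucE)
  have x: "x \<in> carrier M" using Suc.prems flag_ksub ksubD(1) by blast
  show ?case
  proof (cases "x \<in> adj U y")
    case True
    then show ?thesis using adj_exchange[OF y(1,2) True Suc.prems(3)] y(4) by simp
  next
    case False
    have "flag (adj (adj U y) x) W d" by (rule Suc.IH[OF y(4) Suc.prems(2) False])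
    then have f: "flag (adj (adj U x) y) W d" using adj_commute[OF y(1) x y(2)] by simp
    have "y \<notin> adj U x" using adj_exchange[OF y(1) x _ y(3)] adj_upper(2)[OF y(1) x] False by blast
    then show ?thesis by (rule flag_step[OF adj_ksub[OF y(1) x] y(2) _ f])
  qed
qed

lemma flag_unique: "flag U W d \<Longrightarrow> flag U W e \<Longrightarrow> d = e"
proof (induction d arbitrary: U e)
  case 0
  then have "U = W" using flag_0 by blast
  show ?case
  proof (cases e)
    case (Suc n)
    obtain x where "ksub U" "x \<in> carrier M" "x \<notin> U" "flag (adj U x) W n"
      using 0(2) unfolding Suc by (rule flag_SucE)
    then show ?thesis using flag_ksub adj_upper(2) \<open>U = W\<close> by blast
  qed simp
next
  case (Suc d)
  obtain x where x: "ksub U" "x \<in> carrier M" "x \<notin> U" "flag (adj U x) W d" using Suc.prems(1) by (rule flag_SucE)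
  have xW: "x \<in> W" using flag_ksub[OF x(4)] adj_upper(2)[OF x(1,2)] by blast
  have "e \<noteq> 0"
  proof
    assume "e = 0"
    then show False using flag_0[of U W] Suc.prems(2) x(3) xW by simp
  qed
  then obtain e' where e: "e = Suc e'" by (cases e) auto
  show ?case using Suc.IH[OF x(4), of e'] flag_exchange[of U W e' x] Suc.prems(2) xW x(3) e by simp
qed

lemma flag_trans: "flag U W d \<Longrightarrow> flag W X e \<Longrightarrow> flag U X (d + e)"
  by (induction rule: flag.induct) (auto intro: flag_step)

lemma flag_sub: "flag U X d \<Longrightarrow> ksub W \<Longrightarrow> U \<subseteq> W \<Longrightarrow> W \<subseteq> X \<Longrightarrow> \<exists>e. flag U W e"
proof (induction d arbitrary: U)
  case 0
  then have "U = W" using flag_0 by blast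
  then show ?case using flag_refl 0(2) by blast
next
  case (Suc d)
  have U: "ksub U" using flag_ksub[OF Suc.prems(1)] by blast
  show ?case
  proof (cases "W \<subseteq> U")
    case True
    then show ?thesis using flag_refl[OF U] Suc.prems(3) by (metis subset_antisym)
  next
    case False
    then obtain x where x: "x \<in> W" "x \<notin> U" by blast
    have xM: "x \<in> carrier M" using ksubD(1)[OF Suc.prems(2) x(1)] .
    have "flag (adj U x) X d" using flag_exchange[OF Suc.prems(1)] x Suc.prems(4) by blast
    moreover have "adj U x \<subseteq> W" by (rule adj_least[OF Suc.prems(2,3) x(1)])
    ultimately obtain e where "flag (adj U x) W e" using Suc.IH Suc.prems by blast
    then show ?thesis using flag_step[OF U xM x(2)] by blast
  qed
qed

lemma flag_list: "set xs \<subseteq> carrier M \<Longrightarrow> ksub U \<Longrightarrow> \<exists>W d. flag U W d \<and> set xs \<subseteq> W"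
proof (induction xs arbitrary: U)
  case Nil
  then show ?case using flag_refl by auto
next
  case (Cons x xs)
  show ?case
  proof (cases "x \<in> U")
    case True
    have "set xs \<subseteq> carrier M" using Cons.prems(1) by simp
    then obtain W d where W: "flag U W d" "set xs \<subseteq> W" using Cons.IH[OF _ Cons.prems(2)] by blast
    then show ?thesis using True flag_ksub[OF W(1)] by (intro exI[of _ W] exI[of _ d]) auto
  next
    case False
    have x: "x \<in> carrier M" "set xs \<subseteq> carrier M" using Cons.prems by simp_all
    obtain W d where W: "flag (adj U x) W d" "set xs \<subseteq> W"
      using Cons.IH[OF x(2) adj_ksub[OF Cons.prems(2) x(1)]] by blast
    then show ?thesis using flag_step[OF Cons.prems(2) x(1) False W(1)] flag_ksub[OF W(1)] adj_upper(2)[OF Cons.prems(2) x(1)]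
      by (intro exI[of _ W] exI[of _ "Suc d"]) auto
  qed
qed

lemma ksub_mem_by_paths:
  assumes W: "ksub W" and g: "g \<in> carrier M" and p: "\<And>x. x \<in> paths \<Longrightarrow> pe x \<odot>\<^bsub>M\<^esub> g \<in> W" and a: "a \<in> carrier A"
  shows "a \<odot>\<^bsub>M\<^esub> g \<in> W"
proof -
  define s where "s S = mk (\<lambda>x. if x \<in> S then cf a x else \<zero>\<^bsub>K\<^esub>)" for S
  have c: "(if (u, p) \<in> S then cf a (u, p) else \<zero>\<^bsub>K\<^esub>) \<in> carrier K" for u p S
    using a by simp
  have s: "s S \<in> carrier A" "cf (s S) x = (if x \<in> S then cf a x else \<zero>\<^bsub>K\<^esub>)" for S x
    unfolding s_def using mk_closed[of "\<lambda>x. if x \<in> S then cf a x else \<zero>\<^bsub>K\<^esub>", OF c]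
      cf_mk[of "\<lambda>x. if x \<in> S then cf a x else \<zero>\<^bsub>K\<^esub>", OF c] a by (auto simp: cf_outside)
  have "finite S \<Longrightarrow> S \<subseteq> paths \<Longrightarrow> s S \<odot>\<^bsub>M\<^esub> g \<in> W" for S
  proof (induction S rule: finite_induct)
    case empty
    have "s {} = \<zero>" by (rule eqI) (auto simp: s)
    then show ?case using g ksubD(2)[OF W] by simp
  next
    case (insert x S)
    have 1: "s (insert x S) = (pe x \<otimes> sc (cf a x)) \<oplus> s S"
      using insert a by (intro eqI) (auto simp: s cf_add cf_mult_sc cf_pe)
    have "(pe x \<otimes> sc (cf a x)) \<odot>\<^bsub>M\<^esub> g = sc (cf a x) \<odot>\<^bsub>M\<^esub> (pe x \<odot>\<^bsub>M\<^esub> g)"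
      using g a by (simp add: M.smult_assoc)
    also have "\<dots> \<in> W" using insert.prems p a by (intro ksubD(4)[OF W]) auto
    finally show ?case unfolding 1 using insert s g a ksubD(3)[OF W] by (simp add: M.smult_l_distr)
  qed
  from this[OF finite_paths] have "s paths \<odot>\<^bsub>M\<^esub> g \<in> W" by simp
  moreover have "s paths = a" using a by (intro eqI) (auto simp: s)
  ultimately show ?thesis by simp
qed

text \<open>\<open>M\<close> is spanned over \<open>K\<close> by the finitely many products of
  generators with paths. Adjoining these to \<open>U\<close> gives a flag up to \<open>M\<close>,
  which \<open>flag_sub\<close> cuts down to \<open>W\<close>.\<close>

lemma flag_exists:
  assumes "fin_gen A M" "ksub U" "ksub W" "U \<subseteq> W"
  shows "\<exists>d. flag U W d"
proof -
  obtain S where S: "finite S" "S \<subseteq> carrier M" "\<And>U. submodule U A M \<Longrightarrow> S \<subseteq> U \<Longrightarrow> U = carrier M"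
    using assms(1) by (rule fin_genE) blast
  obtain xs where xs: "set xs = (\<lambda>(x, g). pe x \<odot>\<^bsub>M\<^esub> g) ` (paths \<times> S)"
    using finite_list[OF finite_imageI[OF finite_cartesian_product[OF finite_paths S(1)]]] by (rule exE)
  have xsM: "set xs \<subseteq> carrier M" unfolding xs using S(2) by auto
  obtain X d where X: "flag U X d" "set xs \<subseteq> X" using flag_list[OF xsM assms(2)] by (elim exE conjE) (rule that)
  have kX: "ksub X" using flag_ksub[OF X(1)] by simp
  have mem: "a \<odot>\<^bsub>M\<^esub> g \<in> X" if g: "g \<in> S" and a: "a \<in> carrier A" for a g
  proof (rule ksub_mem_by_paths[OF kX _ _ a])
    show "g \<in> carrier M" using g S(2) by (rule subsetD[rotated])
    fix x assume "x \<in> paths"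
    then have "pe x \<odot>\<^bsub>M\<^esub> g \<in> set xs" unfolding xs using g by (intro image_eqI[of _ _ "(x, g)"]) simp_all
    then show "pe x \<odot>\<^bsub>M\<^esub> g \<in> X" using X(2) by (rule subsetD[rotated])
  qed
  \<comment> \<open>This is the largest submodule inside \<open>X\<close>; it contains the
    generators and is therefore all of \<open>M\<close>.\<close>
  let ?U = "{z \<in> carrier M. \<forall>a\<in>carrier A. a \<odot>\<^bsub>M\<^esub> z \<in> X}"
  have "submodule ?U A M"
    using ksubD(2,3)[OF kX] by (intro M.submoduleI) (auto simp: M.smult_r_distr M.smult_assoc)
  moreover have "S \<subseteq> ?U" using mem subsetD[OF S(2)] by blast
  ultimately have U: "?U = carrier M" by (rule S(3))
  have "carrier M \<subseteq> X"
  proof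
    fix z assume z: "z \<in> carrier M"
    then have "z \<in> ?U" unfolding U .
    then have "\<one> \<odot>\<^bsub>M\<^esub> z \<in> X" by blast
    then show "z \<in> X" using z by simp
  qed
  then show ?thesis using flag_sub[OF X(1) assms(3,4)] ksubD(1)[OF assms(3)] by blast
qed

text \<open>The radical \<open>M J\<close>, with \<open>J\<close> the ideal \<open>F 1\<close>. One
  product is added at a time, so that rule induction follows the finite sums.\<close>

inductive_set rad :: "'x set" where
  rad_zero: "\<zero>\<^bsub>M\<^esub> \<in> rad"
| rad_add: "x \<in> rad \<Longrightarrow> y \<in> carrier M \<Longrightarrow> r \<in> F 1 \<Longrightarrow> x \<oplus>\<^bsub>M\<^esub> r \<odot>\<^bsub>M\<^esub> y \<in> rad"

lemma rad_carrier: "x \<in> rad \<Longrightarrow> x \<in> carrier M"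
  by (induction rule: rad.induct) auto

lemma rad_mult: "y \<in> carrier M \<Longrightarrow> r \<in> F 1 \<Longrightarrow> r \<odot>\<^bsub>M\<^esub> y \<in> rad"
  using rad_add[OF rad_zero, of y r] by simp

lemma rad_closed: "y \<in> rad \<Longrightarrow> x \<in> rad \<Longrightarrow> x \<oplus>\<^bsub>M\<^esub> y \<in> rad"
proof (induction y rule: rad.induct)
  case rad_zero
  then show ?case using rad_carrier by simp
next
  case (rad_add z y r)
  then have "x \<oplus>\<^bsub>M\<^esub> (z \<oplus>\<^bsub>M\<^esub> r \<odot>\<^bsub>M\<^esub> y) = (x \<oplus>\<^bsub>M\<^esub> z) \<oplus>\<^bsub>M\<^esub> r \<odot>\<^bsub>M\<^esub> y"
    using rad_carrier by (simp add: M.M.a_assoc)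
  then show ?case using rad.rad_add rad_add by simp
qed

lemma rad_submodule: "submodule rad A M"
proof (rule M.submoduleI)
  show "r \<odot>\<^bsub>M\<^esub> x \<in> rad" if r: "r \<in> carrier A" and x: "x \<in> rad" for r x
    using x
  proof (induction x rule: rad.induct)
    case rad_zero
    then show ?case using r rad.rad_zero by simp
  next
    case (rad_add z y s)
    have "r \<odot>\<^bsub>M\<^esub> (z \<oplus>\<^bsub>M\<^esub> s \<odot>\<^bsub>M\<^esub> y) = r \<odot>\<^bsub>M\<^esub> z \<oplus>\<^bsub>M\<^esub> (s \<otimes> r) \<odot>\<^bsub>M\<^esub> y"
      using rad_add r rad_carrier by (simp add: M.smult_r_distr M.smult_assoc)
    moreover have "s \<otimes> r \<in> F 1" using rad_add r by blast
    ultimately show ?case using rad.rad_add rad_add by simp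
  qed
qed (use rad_carrier rad_zero rad_closed in auto)

text \<open>A copy of Hom(C(v,j), M): the possible images of the generator \<open>e_v\<close>,
  namely the elements of \<open>M e_v\<close> annihilated by the \<open>j\<close>-th power of the
  arrow ideal.\<close>

definition Wk :: "'v \<Rightarrow> nat \<Rightarrow> 'x set" where
  "Wk v j = {x \<in> carrier M. ev v \<odot>\<^bsub>M\<^esub> x = x \<and> (\<forall>b\<in>F j. b \<odot>\<^bsub>M\<^esub> x = \<zero>\<^bsub>M\<^esub>)}"

lemma Wk_ksub: "ksub (Wk v j)"
  unfolding ksub_def
proof (intro conjI ballI)
  fix c x assume c: "c \<in> carrier K" and x: "x \<in> Wk v j"
  have swap: "b \<odot>\<^bsub>M\<^esub> (sc c \<odot>\<^bsub>M\<^esub> x) = sc c \<odot>\<^bsub>M\<^esub> (b \<odot>\<^bsub>M\<^esub> x)" if "b \<in> carrier A" for b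
    using that c x by (simp add: Wk_def M.smult_assoc sc_central)
  show "sc c \<odot>\<^bsub>M\<^esub> x \<in> Wk v j" using x c swap by (auto simp: Wk_def)
qed (auto simp: Wk_def M.smult_r_distr)

lemma rad_ksub: "ksub (Wk v j \<inter> rad)"
proof -
  note D = M.submoduleD[OF rad_submodule]
  show ?thesis using ksubD[OF Wk_ksub[of v j]] D unfolding ksub_def by auto
qed

text \<open>This dimension is additive on direct sums, it vanishes on projective modules if some path of length
  \<open>j\<close> starts at \<open>v\<close>, and it counts the modules \<open>e\<^sub>v A / e\<^sub>v J\<^sup>i\<close> with \<open>i \<le> j\<close>.\<close>

definition tau :: "'v \<Rightarrow> nat \<Rightarrow> nat" where
  "tau v j = (THE d. flag (Wk v j \<inter> rad) (Wk v j) d)"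

lemma tau_eq: "flag (Wk v j \<inter> rad) (Wk v j) d \<Longrightarrow> tau v j = d"
  unfolding tau_def using flag_unique by blast

lemma tau_flag: "fin_gen A M \<Longrightarrow> flag (Wk v j \<inter> rad) (Wk v j) (tau v j)"
  using flag_exists[OF _ rad_ksub Wk_ksub, of v j] tau_eq by blast

end

section \<open>Additivity of the invariant and its vanishing on projective modules\<close>

context coeff_algebra
begin

lemma coeff_module_if: "right_module A M \<Longrightarrow> coeff_module A K Q k cf M"
  by (rule coeff_module.intro[OF coeff_algebra_axioms])

definition tauM :: "('a, 'x) module \<Rightarrow> 'v \<Rightarrow> nat \<Rightarrow> nat" where
  "tauM M v j = coeff_module.tau A K Q k cf M v j"

lemma Wk_hom:
  assumes "right_module A M" "right_module A N" "h \<in> rmod_hom A M N"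
    and "x \<in> coeff_module.Wk A K Q k cf M v j"
  shows "h x \<in> coeff_module.Wk A K Q k cf N v j"
proof -
  interpret M: coeff_module A K Q k cf M by (rule coeff_module_if) fact
  interpret N: coeff_module A K Q k cf N by (rule coeff_module_if) fact
  have x: "x \<in> carrier M" "ev v \<odot>\<^bsub>M\<^esub> x = x" "\<And>b. b \<in> F j \<Longrightarrow> b \<odot>\<^bsub>M\<^esub> x = \<zero>\<^bsub>M\<^esub>"
    using assms(4) by (auto simp: M.Wk_def)
  note H = rmod_homD[OF assms(3)]
  have "ev v \<odot>\<^bsub>N\<^esub> h x = h x" using H(3)[OF _ x(1), of "ev v"] x(2) by simp
  moreover have "b \<odot>\<^bsub>N\<^esub> h x = \<zero>\<^bsub>N\<^esub>" if "b \<in> F j" for b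
    using H(3)[OF _ x(1), of b] x(3)[OF that] rmod_hom_zero[OF assms(1-3)] that by simp
  ultimately show ?thesis using H(1)[OF x(1)] by (simp add: N.Wk_def)
qed

lemma rad_hom:
  assumes "right_module A M" "right_module A N" "h \<in> rmod_hom A M N"
    and "x \<in> coeff_module.rad A K cf M"
  shows "h x \<in> coeff_module.rad A K cf N"
proof -
  interpret M: coeff_module A K Q k cf M by (rule coeff_module_if) fact
  interpret N: coeff_module A K Q k cf N by (rule coeff_module_if) fact
  note H = rmod_homD[OF assms(3)]
  show ?thesis using assms(4)
  proof (induction rule: M.rad.induct)
    case rad_zero
    then show ?case using rmod_hom_zero[OF assms(1-3)] N.rad_zero by simp
  next
    case (rad_add x y r)
    then have "h (x \<oplus>\<^bsub>M\<^esub> r \<odot>\<^bsub>M\<^esub> y) = h x \<oplus>\<^bsub>N\<^esub> r \<odot>\<^bsub>N\<^esub> h y"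
      using H(2)[OF M.rad_carrier[OF rad_add(1)], of "r \<odot>\<^bsub>M\<^esub> y"] H(3)[of r y] by simp
    then show ?case using N.rad_add[OF rad_add(4) H(1)[OF rad_add(2)] rad_add(3)] by simp
  qed
qed

lemma flag_image:
  assumes "right_module A M" "right_module A N" "h \<in> rmod_hom A M N" "inj_on h (carrier M)"
    and "coeff_module.flag A K Q k cf M U W d"
  shows "coeff_module.flag A K Q k cf N (h ` U) (h ` W) d"
proof -
  interpret M: coeff_module A K Q k cf M by (rule coeff_module_if) fact
  interpret N: coeff_module A K Q k cf N by (rule coeff_module_if) fact
  note H = rmod_homD[OF assms(3)]
  have ks: "N.ksub (h ` U)" if U: "M.ksub U" for U
    unfolding N.ksub_def
  proof (intro conjI ballI)
    note D = M.ksubD[OF U]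
    show "h ` U \<subseteq> carrier N" using H(1) D(1) by auto
    show "\<zero>\<^bsub>N\<^esub> \<in> h ` U" using rmod_hom_zero[OF assms(1-3)] D(2) by (metis imageI)
    fix y assume "y \<in> h ` U"
    then obtain x where x: "x \<in> U" "y = h x" by blast
    {
      fix z assume "z \<in> h ` U"
      then obtain w where w: "w \<in> U" "z = h w" by blast
      show "y \<oplus>\<^bsub>N\<^esub> z \<in> h ` U"
        using H(2)[OF D(1)[OF x(1)] D(1)[OF w(1)]] D(3)[OF x(1) w(1)] x(2) w(2) by (metis imageI)
    next
      fix c assume c: "c \<in> carrier K"
      show "sc c \<odot>\<^bsub>N\<^esub> y \<in> h ` U"
        using H(3)[OF sc_closed[OF c] D(1)[OF x(1)]] D(4)[OF c x(1)] x(2) by (metis imageI)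
    }
  qed
  show ?thesis using assms(5)
  proof (induction rule: M.flag.induct)
    case (flag_refl U)
    show ?case by (rule N.flag_refl[OF ks[OF flag_refl]])
  next
    case (flag_step U x W d)
    note D = M.ksubD(1)[OF flag_step(1)]
    have eq: "h (u \<oplus>\<^bsub>M\<^esub> sc c \<odot>\<^bsub>M\<^esub> x) = h u \<oplus>\<^bsub>N\<^esub> sc c \<odot>\<^bsub>N\<^esub> h x" if "u \<in> U" "c \<in> carrier K" for u c
      using H(2)[OF D[OF that(1)], of "sc c \<odot>\<^bsub>M\<^esub> x"] H(3)[of "sc c" x] flag_step(2) that(2) by simp
    have "h ` M.adj U x = N.adj (h ` U) (h x)"
    proof (intro equalityI subsetI)
      fix z assume "z \<in> h ` M.adj U x"
      then obtain u c where "u \<in> U" "c \<in> carrier K" "z = h (u \<oplus>\<^bsub>M\<^esub> sc c \<odot>\<^bsub>M\<^esub> x)" by (auto simp: M.adj_def)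
      then show "z \<in> N.adj (h ` U) (h x)" unfolding N.adj_def using eq by blast
    next
      fix z assume "z \<in> N.adj (h ` U) (h x)"
      then obtain u c where uc: "u \<in> U" "c \<in> carrier K" "z = h u \<oplus>\<^bsub>N\<^esub> sc c \<odot>\<^bsub>N\<^esub> h x" by (auto simp: N.adj_def)
      then have "z = h (u \<oplus>\<^bsub>M\<^esub> sc c \<odot>\<^bsub>M\<^esub> x)" using eq by simp
      then show "z \<in> h ` M.adj U x" unfolding M.adj_def using uc by blast
    qed
    moreover have "h x \<notin> h ` U"
    proof
      assume "h x \<in> h ` U"
      then obtain u where "u \<in> U" "h x = h u" by blast
      then show False using assms(4) D flag_step(2,3) by (auto dest: inj_onD)
    qed
    ultimately show ?case
      using N.flag_step[OF ks[OF flag_step(1)] H(1)[OF flag_step(2)]] flag_step(5) by simp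
  qed
qed

lemma flag_times:
  assumes M: "right_module A M" and N: "right_module A N"
    and V: "coeff_module.ksub A K Q k cf N V" and f: "coeff_module.flag A K Q k cf M U W d"
  shows "coeff_module.flag A K Q k cf (direct_sum M N) (U \<times> V) (W \<times> V) d"
    and "coeff_module.flag A K Q k cf (direct_sum N M) (V \<times> U) (V \<times> W) d"
proof -
  interpret M: coeff_module A K Q k cf M by (rule coeff_module_if) fact
  interpret N: coeff_module A K Q k cf N by (rule coeff_module_if) fact
  interpret D: coeff_module A K Q k cf "direct_sum M N"
    by (rule coeff_module_if[OF direct_sum_right_module[OF M N]])
  interpret D': coeff_module A K Q k cf "direct_sum N M"
    by (rule coeff_module_if[OF direct_sum_right_module[OF N M]])
  have ks: "D.ksub (U \<times> V)" "D'.ksub (V \<times> U)" if "M.ksub U" for U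
    using M.ksubD[OF that] N.ksubD[OF V] unfolding D.ksub_def D'.ksub_def
    by (auto simp: direct_sum_simps)
  show "D.flag (U \<times> V) (W \<times> V) d" using f
  proof (induction rule: M.flag.induct)
    case (flag_refl U)
    show ?case by (rule D.flag_refl[OF ks(1)[OF flag_refl]])
  next
    case (flag_step U x W d)
    have "D.adj (U \<times> V) (x, \<zero>\<^bsub>N\<^esub>) = M.adj U x \<times> V"

    proof -
      have eq: "(u, w) \<oplus>\<^bsub>direct_sum M N\<^esub> sc c \<odot>\<^bsub>direct_sum M N\<^esub> (x, \<zero>\<^bsub>N\<^esub>) = (u \<oplus>\<^bsub>M\<^esub> sc c \<odot>\<^bsub>M\<^esub> x, w)"
        if "w \<in> V" "c \<in> carrier K" for u w c
        using N.ksubD(1)[OF V that(1)] that(2) by (simp add: direct_sum_simps)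
      show ?thesis
      proof (intro equalityI subsetI)
        fix z assume "z \<in> D.adj (U \<times> V) (x, \<zero>\<^bsub>N\<^esub>)"
        then obtain u w c where "u \<in> U" "w \<in> V" "c \<in> carrier K"
          "z = (u, w) \<oplus>\<^bsub>direct_sum M N\<^esub> sc c \<odot>\<^bsub>direct_sum M N\<^esub> (x, \<zero>\<^bsub>N\<^esub>)" by (auto simp: D.adj_def)
        then show "z \<in> M.adj U x \<times> V" by (auto simp: M.adj_def eq)
      next
        fix z assume "z \<in> M.adj U x \<times> V"
        then obtain u w c where z: "u \<in> U" "w \<in> V" "c \<in> carrier K" "z = (u \<oplus>\<^bsub>M\<^esub> sc c \<odot>\<^bsub>M\<^esub> x, w)"
          by (auto simp: M.adj_def)
        show "z \<in> D.adj (U \<times> V) (x, \<zero>\<^bsub>N\<^esub>)" unfolding D.adj_def z(4) eq[OF z(2,3), symmetric]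
          using z(1-3) by blast
      qed
    qed
    then show ?case
      using D.flag_step[OF ks(1)[OF flag_step(1)], of "(x, \<zero>\<^bsub>N\<^esub>)"] flag_step(2,3,5) by (simp add: direct_sum_simps)
  qed
  show "D'.flag (V \<times> U) (V \<times> W) d" using f
  proof (induction rule: M.flag.induct)
    case (flag_refl U)
    show ?case by (rule D'.flag_refl[OF ks(2)[OF flag_refl]])
  next
    case (flag_step U x W d)
    have "D'.adj (V \<times> U) (\<zero>\<^bsub>N\<^esub>, x) = V \<times> M.adj U x"

    proof -
      have eq: "(w, u) \<oplus>\<^bsub>direct_sum N M\<^esub> sc c \<odot>\<^bsub>direct_sum N M\<^esub> (\<zero>\<^bsub>N\<^esub>, x) = (w, u \<oplus>\<^bsub>M\<^esub> sc c \<odot>\<^bsub>M\<^esub> x)"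
        if "w \<in> V" "c \<in> carrier K" for u w c
        using N.ksubD(1)[OF V that(1)] that(2) by (simp add: direct_sum_simps)
      show ?thesis
      proof (intro equalityI subsetI)
        fix z assume "z \<in> D'.adj (V \<times> U) (\<zero>\<^bsub>N\<^esub>, x)"
        then obtain u w c where "u \<in> U" "w \<in> V" "c \<in> carrier K"
          "z = (w, u) \<oplus>\<^bsub>direct_sum N M\<^esub> sc c \<odot>\<^bsub>direct_sum N M\<^esub> (\<zero>\<^bsub>N\<^esub>, x)" by (auto simp: D'.adj_def)
        then show "z \<in> V \<times> M.adj U x" by (auto simp: M.adj_def eq)
      next
        fix z assume "z \<in> V \<times> M.adj U x"
        then obtain u w c where z: "u \<in> U" "w \<in> V" "c \<in> carrier K" "z = (w, u \<oplus>\<^bsub>M\<^esub> sc c \<odot>\<^bsub>M\<^esub> x)"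
          by (auto simp: M.adj_def)
        show "z \<in> D'.adj (V \<times> U) (\<zero>\<^bsub>N\<^esub>, x)" unfolding D'.adj_def z(4) eq[OF z(2,3), symmetric]
          using z(1-3) by blast
      qed
    qed
    then show ?case
      using D'.flag_step[OF ks(2)[OF flag_step(1)], of "(\<zero>\<^bsub>N\<^esub>, x)"] flag_step(2,3,5) by (simp add: direct_sum_simps)
  qed
qed

text \<open>\<open>Wk\<close> and \<open>rad\<close> are preserved by homomorphisms and hence
  compatible with isomorphisms and products. The two dimensions add up along a flag that first
  enlarges the left factor and then the right one.\<close>

lemma tauM_direct_sum:
  assumes M: "right_module A M" "fin_gen A M" and N: "right_module A N" "fin_gen A N"
    and N': "right_module A N'" "fin_gen A N'" and i: "rmod_iso A M (direct_sum N N')"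
  shows "tauM M v j = tauM N v j + tauM N' v j"
proof -
  note Dm = direct_sum_right_module[OF N(1) N'(1)]
  interpret M: coeff_module A K Q k cf M by (rule coeff_module_if) fact
  interpret N: coeff_module A K Q k cf N by (rule coeff_module_if) fact
  interpret N': coeff_module A K Q k cf N' by (rule coeff_module_if) fact
  interpret D: coeff_module A K Q k cf "direct_sum N N'" by (rule coeff_module_if[OF Dm])
  obtain h where h: "h \<in> rmod_hom A M (direct_sum N N')" "bij_betw h (carrier M) (carrier (direct_sum N N'))"
    using i by (rule rmod_isoE)
  let ?g = "inv_into (carrier M) h"
  have g: "?g \<in> rmod_hom A (direct_sum N N') M" by (rule rmod_hom_inv_into[OF M(1) h])
  have hg: "h (?g z) = z" if "z \<in> carrier (direct_sum N N')" for z using bij_betw_inv_into_right[OF h(2) that] .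
  have W: "h ` M.Wk v j = D.Wk v j"
  proof (intro equalityI subsetI)
    fix z assume z: "z \<in> D.Wk v j"
    then have "z \<in> carrier (direct_sum N N')" by (simp add: D.Wk_def)
    then show "z \<in> h ` M.Wk v j" using Wk_hom[OF Dm M(1) g z] hg by (metis imageI)
  qed (use Wk_hom[OF M(1) Dm h(1)] in auto)
  have R: "h ` (M.Wk v j \<inter> M.rad) = D.Wk v j \<inter> D.rad"
  proof (intro equalityI subsetI)
    fix z assume z: "z \<in> D.Wk v j \<inter> D.rad"
    then have "z \<in> carrier (direct_sum N N')" by (simp add: D.Wk_def)
    moreover have "?g z \<in> M.Wk v j \<inter> M.rad" using Wk_hom[OF Dm M(1) g] rad_hom[OF Dm M(1) g] z by blast
    ultimately show "z \<in> h ` (M.Wk v j \<inter> M.rad)" using hg by (metis imageI)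
  qed (use Wk_hom[OF M(1) Dm h(1)] rad_hom[OF M(1) Dm h(1)] in auto)
  have DW: "D.Wk v j = N.Wk v j \<times> N'.Wk v j"
    by (auto simp: D.Wk_def N.Wk_def N'.Wk_def direct_sum_simps)
  have DR: "D.rad = N.rad \<times> N'.rad"
  proof (intro equalityI subsetI)
    fix z assume z: "z \<in> D.rad"
    show "z \<in> N.rad \<times> N'.rad"
      using rad_hom[OF Dm N(1) fst_hom z] rad_hom[OF Dm N'(1) snd_hom z] by (cases z) simp
  next
    fix z assume "z \<in> N.rad \<times> N'.rad"
    then obtain x y where z: "z = (x, y)" "x \<in> N.rad" "y \<in> N'.rad" by blast
    have "(x, \<zero>\<^bsub>N'\<^esub>) \<oplus>\<^bsub>direct_sum N N'\<^esub> (\<zero>\<^bsub>N\<^esub>, y) \<in> D.rad"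
      using rad_hom[OF N'(1) Dm inr_hom[OF N(1)] z(3)] rad_hom[OF N(1) Dm inl_hom[OF N'(1)] z(2)]
      by (rule D.rad_closed)
    then show "z \<in> D.rad" using z N.rad_carrier N'.rad_carrier by (simp add: direct_sum_simps)
  qed
  have "D.flag (h ` (M.Wk v j \<inter> M.rad)) (h ` M.Wk v j) (M.tau v j)"
    by (rule flag_image[OF M(1) Dm h(1) _ M.tau_flag[OF M(2)]]) (use h(2) in \<open>simp add: bij_betw_def\<close>)
  then have 1: "D.flag ((N.Wk v j \<inter> N.rad) \<times> (N'.Wk v j \<inter> N'.rad)) (N.Wk v j \<times> N'.Wk v j) (M.tau v j)"
    unfolding R W DW DR by (simp only: Times_Int_Times)
  have "D.flag ((N.Wk v j \<inter> N.rad) \<times> (N'.Wk v j \<inter> N'.rad)) (N.Wk v j \<times> (N'.Wk v j \<inter> N'.rad)) (N.tau v j)"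
    by (rule flag_times(1)[OF N(1) N'(1) N'.rad_ksub N.tau_flag[OF N(2)]])
  moreover have "D.flag (N.Wk v j \<times> (N'.Wk v j \<inter> N'.rad)) (N.Wk v j \<times> N'.Wk v j) (N'.tau v j)"
    by (rule flag_times(2)[OF N'(1) N(1) N.Wk_ksub N'.tau_flag[OF N'(2)]])
  ultimately have "D.flag ((N.Wk v j \<inter> N.rad) \<times> (N'.Wk v j \<inter> N'.rad)) (N.Wk v j \<times> N'.Wk v j) (N.tau v j + N'.tau v j)"
    by (rule D.flag_trans)
  from D.flag_unique[OF 1 this] show ?thesis by (simp add: tauM_def)
qed

lemma not_F1_D:
  assumes "a \<in> E w" "a \<notin> F 1"
  shows "cf a (w, []) \<noteq> \<zero>\<^bsub>K\<^esub>"
proof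
  assume 0: "cf a (w, []) = \<zero>\<^bsub>K\<^esub>"
  have "a \<in> F 1"
  proof (rule FI[OF E_carrier[OF assms(1)]])
    fix u and p :: "'e list" assume "length p < 1"
    then show "cf a (u, p) = \<zero>\<^bsub>K\<^esub>" using 0 E_cf[OF assms(1), of u p] by (cases "u = w") simp_all
  qed
  then show False using assms(2) by blast
qed

lemma PM_rad:
  assumes "set vs \<subseteq> verts Q" "x \<in> carrier (PM vs)" "\<And>i. i < length vs \<Longrightarrow> x ! i \<in> F 1"
  shows "x \<in> coeff_module.rad A K cf (PM vs)"
proof -
  interpret P: coeff_module A K Q k cf "PM vs" by (rule coeff_module_if[OF PM_right_module])
  show ?thesis
  proof (rule PM_mem_by_coordinates[OF P.rad_submodule assms(2)])
    fix i assume i: "i < length vs"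
    have v: "vs ! i \<in> verts Q" using assms(1) i nth_mem by blast
    have a: "x ! i \<in> E (vs ! i)" by (rule PM_nth(4)[OF i assms(2)])
    have e: "\<zero>\<^bsub>PM vs\<^esub>[i := ev (vs ! i)] \<in> carrier (PM vs)" by (rule PM_zero_update[OF ev_E])
    have "\<zero>\<^bsub>PM vs\<^esub>[i := x ! i] = x ! i \<odot>\<^bsub>PM vs\<^esub> \<zero>\<^bsub>PM vs\<^esub>[i := ev (vs ! i)]"
      by (rule PM_single_smult[OF i v a])
    then show "\<zero>\<^bsub>PM vs\<^esub>[i := x ! i] \<in> P.rad" using P.rad_mult[OF e assms(3)[OF i]] by simp
  qed
qed

text \<open>\<open>P\<close> is a retract of some \<open>PM vs\<close>. There an element outside the
  radical has a coordinate with nonzero constant term; being fixed by \<open>ev v\<close>, it can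
  have this only at a coordinate belonging to \<open>v\<close>, and then its product with
  \<open>q\<close> is nonzero.\<close>

lemma tauM_projective:
  assumes P: "P \<in> fg_modules A" "projective A P" and q: "(v, q) \<in> paths"
  shows "tauM P v (length q) = 0"
proof -
  have Pm: "right_module A P" by (rule right_module_if_fg[OF P(1)])
  interpret P: coeff_module A K Q k cf P by (rule coeff_module_if[OF Pm])
  obtain L where L: "set L \<subseteq> verts Q \<times> carrier P" "img P L = carrier P" by (rule ex_generators[OF P(1)])
  let ?vs = "map fst L" and ?p = "lc P (map snd L)"
  have vs: "set ?vs \<subseteq> verts Q" using L(1) by auto
  note h = img_hom[OF Pm L(1)]
  interpret S: coeff_module A K Q k cf "PM ?vs" by (rule coeff_module_if[OF PM_right_module])
  obtain s where s: "s \<in> rmod_hom A P (PM ?vs)" "\<And>x. x \<in> carrier P \<Longrightarrow> ?p (s x) = x"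
    using projectiveD[OF P(2) PM_right_module Pm h L(2)[unfolded img_def] rmod_hom_id] by blast
  have "P.Wk v (length q) \<subseteq> P.rad"
  proof
    fix x assume x: "x \<in> P.Wk v (length q)"
    have xP: "x \<in> carrier P" using x by (simp add: P.Wk_def)
    have sx: "s x \<in> S.Wk v (length q)" by (rule Wk_hom[OF Pm PM_right_module s(1) x])
    have sP: "s x \<in> carrier (PM ?vs)" by (rule rmod_homD(1)[OF s(1) xP])
    have "s x \<in> S.rad"
    proof (rule PM_rad[OF vs sP], rule ccontr)
      fix i assume i: "i < length ?vs" and n: "s x ! i \<notin> F 1"
      let ?a = "s x ! i"
      have a: "?a \<in> E (?vs ! i)" by (rule PM_nth(4)[OF i sP])
      have a0: "cf ?a (?vs ! i, []) \<noteq> \<zero>\<^bsub>K\<^esub>" by (rule not_F1_D[OF a n])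
      have v: "v \<in> verts Q" by (rule paths_start[OF q])
      have "?a \<otimes> ev v = ?a"
        using sx PM_nth(3)[OF i sP, of "ev v"] by (simp add: S.Wk_def)
      then have "?vs ! i = v"
        using cf_mult_ev[OF E_carrier[OF a] v, of "?vs ! i" "[]"] a0 by (auto split: if_splits)
      moreover have "?a \<otimes> pe (v, q) = \<zero>"
        using sx PM_nth(3)[OF i sP, of "pe (v, q)"] PM_nth(1)[OF i] pe_F[of v q] by (simp add: S.Wk_def)
      ultimately show False using cf_mult_pe_lowest[OF E_carrier[OF a] q] a0 by simp
    qed
    then have "?p (s x) \<in> P.rad" by (rule rad_hom[OF PM_right_module Pm h])
    then show "x \<in> P.rad" using s(2)[OF xP] by simp
  qed
  then have "P.Wk v (length q) \<inter> P.rad = P.Wk v (length q)" by blast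
  then have "P.flag (P.Wk v (length q) \<inter> P.rad) (P.Wk v (length q)) 0"
    using P.flag_refl[OF P.Wk_ksub] by simp
  then show ?thesis unfolding tauM_def by (rule P.tau_eq)
qed

end

section \<open>Values on local modules, and independence of the classes\<close>

context coeff_algebra
begin

lemma XM_local:
  assumes Z: "rclosed Z" "(w, []) \<notin> Z" and w: "w \<in> verts Q" and x: "x \<in> carrier (XM w Z)"
  shows "x \<in> coeff_module.rad A K cf (XM w Z) \<longleftrightarrow> hd x \<in> F 1"
proof -
  interpret X: coeff_module A K Q k cf "XM w Z" by (rule coeff_module_if[OF XM_right_module[OF Z(1)]])
  have ev: "[ev w] \<in> carrier (XM w Z)" using Z(2) ev_E by (auto simp: XM_simps cf_pe)
  have "hd y \<in> F 1" if "y \<in> X.rad" for y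
    using that
  proof (induction rule: X.rad.induct)
    case (rad_add y z r)
    have "hd z \<in> carrier A" using rad_add(2) by (auto simp: XM_simps)
    then have "kz Z (hd z \<otimes> r) \<in> F 1" by (intro kz_F F_mult_l rad_add(3))
    then show ?case using rad_add(4) by (auto simp: XM_simps)
  qed (simp add: XM_simps)
  moreover have "x \<in> X.rad" if h: "hd x \<in> F 1"
  proof -
    have a: "hd x \<in> E w" "\<And>z. z \<in> Z \<Longrightarrow> cf (hd x) z = \<zero>\<^bsub>K\<^esub>" "x = [hd x]" using x by (auto simp: XM_simps)
    have "hd x \<odot>\<^bsub>XM w Z\<^esub> [ev w] = [kz Z (hd x)]" using a w by (simp add: XM_simps ev_mult)
    also have "\<dots> = x" using a E_carrier[OF a(1)] by (simp add: kz_id)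
    finally show ?thesis using X.rad_mult[OF ev h] by simp
  qed
  ultimately show ?thesis by blast
qed

text \<open>Outside the radical only the constant term at \<open>w\<close> survives. So vertices
  other than \<open>w\<close> give 0, and \<open>w\<close> gives 1 or 0 according to whether the
  generator \<open>ev w\<close> is annihilated by \<open>F j\<close>.\<close>

lemma tauM_XM:
  assumes Z: "rclosed Z" "(w, []) \<notin> Z" and w: "w \<in> verts Q" and v: "v \<in> verts Q"
  shows "v \<noteq> w \<Longrightarrow> tauM (XM w Z) v j = 0"
    and "(w, q) \<in> paths \<Longrightarrow> (w, q) \<notin> Z \<Longrightarrow> tauM (XM w Z) w (length q) = 0"
    and "(\<And>p. (w, p) \<in> paths \<Longrightarrow> j \<le> length p \<Longrightarrow> (w, p) \<in> Z) \<Longrightarrow> tauM (XM w Z) w j = 1"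
proof -
  interpret X: coeff_module A K Q k cf "XM w Z" by (rule coeff_module_if[OF XM_right_module[OF Z(1)]])
  note loc = XM_local[OF Z w]
  have el: "hd x \<in> E w" "x = [hd x]" "z \<in> Z \<Longrightarrow> cf (hd x) z = \<zero>\<^bsub>K\<^esub>" if "x \<in> carrier (XM w Z)" for x z
    using that by (auto simp: XM_simps)
  have tau0: "tauM (XM w Z) u j = 0" if "\<And>x. x \<in> X.Wk u j \<Longrightarrow> cf (hd x) (w, []) = \<zero>\<^bsub>K\<^esub>" for u j
  proof -
    have "X.Wk u j \<subseteq> X.rad"
    proof
      fix x assume x: "x \<in> X.Wk u j"
      then have xc: "x \<in> carrier (XM w Z)" by (simp add: X.Wk_def)
      have "hd x \<in> F 1" using not_F1_D[OF el(1)[OF xc]] that[OF x] by blast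
      then show "x \<in> X.rad" using loc[OF xc] by simp
    qed
    then have "X.Wk u j \<inter> X.rad = X.Wk u j" by blast
    then have "X.flag (X.Wk u j \<inter> X.rad) (X.Wk u j) 0" using X.flag_refl[OF X.Wk_ksub] by simp
    then show ?thesis unfolding tauM_def by (rule X.tau_eq)
  qed
  show "tauM (XM w Z) v j = 0" if "v \<noteq> w"
  proof (rule tau0)
    fix x assume "x \<in> X.Wk v j"
    then have x: "x \<in> carrier (XM w Z)" "ev v \<odot>\<^bsub>XM w Z\<^esub> x = x" by (simp_all add: X.Wk_def)
    have "hd x = kz Z (hd x \<otimes> ev v)" using arg_cong[OF x(2), of hd] by (simp add: XM_simps)
    moreover have "cf (kz Z (hd x \<otimes> ev v)) (w, []) = \<zero>\<^bsub>K\<^esub>"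
      using that cf_mult_ev[OF E_carrier[OF el(1)[OF x(1)]] v, of w "[]"] E_carrier[OF el(1)[OF x(1)]] by (simp add: cf_kz)
    ultimately show "cf (hd x) (w, []) = \<zero>\<^bsub>K\<^esub>" by simp
  qed
  show "tauM (XM w Z) w (length q) = 0" if q: "(w, q) \<in> paths" "(w, q) \<notin> Z"
  proof (rule tau0)
    fix x assume "x \<in> X.Wk w (length q)"
    then have x: "x \<in> carrier (XM w Z)" "pe (w, q) \<odot>\<^bsub>XM w Z\<^esub> x = \<zero>\<^bsub>XM w Z\<^esub>" using pe_F by (simp_all add: X.Wk_def)
    have a: "hd x \<in> carrier A" using E_carrier[OF el(1)[OF x(1)]] .
    have "kz Z (hd x \<otimes> pe (w, q)) = \<zero>" using x(2) by (simp add: XM_simps)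
    then have "cf (kz Z (hd x \<otimes> pe (w, q))) (w, q) = \<zero>\<^bsub>K\<^esub>" by simp
    then show "cf (hd x) (w, []) = \<zero>\<^bsub>K\<^esub>" using a q by (simp add: cf_kz cf_mult_pe_lowest)
  qed
  show "tauM (XM w Z) w j = 1" if j: "\<And>p. (w, p) \<in> paths \<Longrightarrow> j \<le> length p \<Longrightarrow> (w, p) \<in> Z"
  proof -
    let ?e = "[ev w]" and ?R = "X.Wk w j \<inter> X.rad"
    have ec: "?e \<in> carrier (XM w Z)" using Z(2) ev_E by (auto simp: XM_simps cf_pe)
    have kze: "kz Z (ev w) = ev w" using Z(2) by (intro kz_id) (auto simp: cf_pe)
    have eW: "?e \<in> X.Wk w j"
    proof -
      have "ev w \<odot>\<^bsub>XM w Z\<^esub> ?e = ?e" using w by (simp add: XM_simps ev_mult[OF ev_E] kze)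
      moreover have "b \<odot>\<^bsub>XM w Z\<^esub> ?e = \<zero>\<^bsub>XM w Z\<^esub>" if b: "b \<in> F j" for b
      proof -
        have bA: "b \<in> carrier A" using b by simp
        have "kz Z (ev w \<otimes> b) = \<zero>"
        proof (rule eqI)
          fix u p assume p: "(u, p) \<in> paths"
          show "cf (kz Z (ev w \<otimes> b)) (u, p) = cf \<zero> (u, p)"
            using j[of p] p F_cf[OF b, of p u] bA w by (cases "j \<le> length p") (auto simp: cf_kz cf_ev_mult)
        qed (use bA in auto)
        then show ?thesis by (simp add: XM_simps)
      qed
      ultimately show ?thesis using ec by (simp add: X.Wk_def)
    qed
    have eR: "?e \<notin> ?R"
    proof
      assume "?e \<in> ?R"
      then have "ev w \<in> F 1" using loc[OF ec] by simp
      then have "cf (ev w) (w, []) = \<zero>\<^bsub>K\<^esub>" by (rule F_cf) simp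
      then show False using w by (simp add: cf_pe paths_Nil)
    qed
    have "X.adj ?R ?e = X.Wk w j"
    proof (rule equalityI)
      show "X.adj ?R ?e \<subseteq> X.Wk w j" by (rule X.adj_least[OF X.Wk_ksub _ eW]) simp
      show "X.Wk w j \<subseteq> X.adj ?R ?e"
      proof
        fix x assume x: "x \<in> X.Wk w j"
        then have xc: "x \<in> carrier (XM w Z)" by (simp add: X.Wk_def)
        have a: "hd x \<in> carrier A" using E_carrier[OF el(1)[OF xc]] .
        let ?c = "cf (hd x) (w, [])"
        have c: "?c \<in> carrier K" "\<ominus>\<^bsub>K\<^esub> ?c \<in> carrier K" using a by simp_all
        \<comment> \<open>Subtracting the constant term times the generator leaves an element of the
          radical.\<close>
        define u where "u = x \<oplus>\<^bsub>XM w Z\<^esub> sc (\<ominus>\<^bsub>K\<^esub> ?c) \<odot>\<^bsub>XM w Z\<^esub> ?e"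
        have uW: "u \<in> X.Wk w j" unfolding u_def
          by (rule X.ksubD(3)[OF X.Wk_ksub x X.ksubD(4)[OF X.Wk_ksub c(2) eW]])
        then have uc: "u \<in> carrier (XM w Z)" by (simp add: X.Wk_def)
        have "cf (hd u) (w, []) = \<zero>\<^bsub>K\<^esub>"
          using c a Z(2) w by (simp add: u_def XM_simps cf_add cf_kz cf_mult_sc cf_pe paths_Nil K.r_neg)
        then have "hd u \<in> F 1" using not_F1_D[OF el(1)[OF uc]] by blast
        then have uR: "u \<in> ?R" using loc[OF uc] uW by simp
        have "u \<oplus>\<^bsub>XM w Z\<^esub> sc ?c \<odot>\<^bsub>XM w Z\<^esub> ?e = x \<oplus>\<^bsub>XM w Z\<^esub> (sc (\<ominus>\<^bsub>K\<^esub> ?c) \<oplus> sc ?c) \<odot>\<^bsub>XM w Z\<^esub> ?e"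
          unfolding u_def using xc ec c by (simp add: X.M.M.a_assoc X.M.smult_l_distr)
        also have "sc (\<ominus>\<^bsub>K\<^esub> ?c) \<oplus> sc ?c = \<zero>" using c by (simp add: sc_add[symmetric] K.l_neg sc_zero)
        finally have "x = u \<oplus>\<^bsub>XM w Z\<^esub> sc ?c \<odot>\<^bsub>XM w Z\<^esub> ?e" using xc ec by simp
        then show "x \<in> X.adj ?R ?e" unfolding X.adj_def using uR c(1) by blast
      qed
    qed
    then have "X.flag ?R (X.Wk w j) (Suc 0)"
      using X.flag_step[OF X.rad_ksub ec eR] X.flag_refl[OF X.Wk_ksub] by simp
    then show ?thesis unfolding tauM_def using X.tau_eq by simp
  qed
qed

lemma tauM_CM:
  assumes q: "(v, q) \<in> paths" and w: "w \<in> verts Q" and i: "1 \<le> i"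
  shows "tauM (CM w i) v (length q) = (if w = v \<and> i \<le> length q then 1 else 0)"
proof -
  have Z: "rclosed {x :: 'v \<times> 'e list. i \<le> length (snd x)}" "(w, []) \<notin> {x. i \<le> length (snd x)}" using i by auto
  have v: "v \<in> verts Q" by (rule paths_start[OF q])
  note t = tauM_XM[OF Z w v]
  show ?thesis
  proof (cases "w = v")
    case False
    then show ?thesis using t(1)[of "length q"] by (simp add: CM_def)
  next
    case wv: True
    show ?thesis
    proof (cases "i \<le> length q")
      case True
      then show ?thesis using t(3)[of "length q"] wv by (simp add: CM_def)
    next
      case False
      then show ?thesis using t(2)[of q] q wv by (simp add: CM_def)
    qed
  qed
qed

text \<open>The linear extension of the invariant to formal combinations. \<open>frag_extend\<close>
  has values in a free abelian group, so the integers appear as the free group on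
  \<open>()\<close>.\<close>

definition tf :: "'v \<Rightarrow> nat \<Rightarrow> (('a, 'a list) module \<Rightarrow>\<^sub>0 int) \<Rightarrow> int" where
  "tf v j c = Poly_Mapping.lookup (frag_extend (\<lambda>M. frag_cmul (int (tauM M v j)) (frag_of ())) c) ()"

lemma tf_add: "tf v j (c + d) = tf v j c + tf v j d"
  and tf_diff: "tf v j (c - d) = tf v j c - tf v j d"
  and tf_minus: "tf v j (- c) = - tf v j c"
  and tf_cmul: "tf v j (frag_cmul z c) = z * tf v j c"
  and tf_zero: "tf v j 0 = 0"
  and tf_of: "tf v j (frag_of M) = int (tauM M v j)"
  by (simp_all add: tf_def frag_extend_add frag_extend_diff frag_extend_minus frag_extend_cmul lookup_add lookup_minus)

lemma tf_sum: "finite I \<Longrightarrow> tf v j (sum f I) = (\<Sum>i\<in>I. tf v j (f i))"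
  by (induction I rule: finite_induct) (simp_all add: tf_add tf_zero)

lemma tf_relations:
  assumes q: "(v, q) \<in> paths" and c: "c \<in> K0_relations A"
  shows "tf v (length q) c = 0"
proof -
  have gen: "tf v (length q) h = 0"
    if "h \<in> {frag_of M - frag_of M' - frag_of M'' | M M' M''.
         M \<in> fg_modules A \<and> M' \<in> fg_modules A \<and> M'' \<in> fg_modules A \<and> rmod_iso A M (direct_sum M' M'')} \<union>
      {frag_of P | P. P \<in> fg_modules A \<and> projective A P}" for h
    using that
  proof (elim UnE CollectE exE conjE)
    fix M M' M''
    assume h: "h = frag_of M - frag_of M' - frag_of M''"
      and M: "M \<in> fg_modules A" "M' \<in> fg_modules A" "M'' \<in> fg_modules A" and i: "rmod_iso A M (direct_sum M' M'')"
    have "tauM M v (length q) = tauM M' v (length q) + tauM M'' v (length q)"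
      using M i by (intro tauM_direct_sum right_module_if_fg fin_gen_if_fg)
    then show ?thesis by (simp add: h tf_diff tf_of)
  next
    fix P assume "h = frag_of P" "P \<in> fg_modules A" "projective A P"
    then show ?thesis using tauM_projective[OF _ _ q] by (simp add: tf_of)
  qed
  show ?thesis using c unfolding K0_relations_def
  proof (induction rule: generate.induct)
    case one
    show ?case by (simp add: module_frags_def tf_zero)
  next
    case (incl h)
    then show ?case by (rule gen)
  next
    case (inv h)
    have "h \<in> K0_relations A" unfolding K0_relations_def by (rule generate.incl[OF inv])
    from K0_relations_keys[OF this] show ?case using gen[OF inv] by (simp add: module_frags_def tf_minus)
  next
    case (eng h1 h2)
    then show ?case by (simp add: module_frags_def tf_add)
  qed
qed

lemma tf_K0_eq: "(v, q) \<in> paths \<Longrightarrow> K0_eq A c d \<Longrightarrow> tf v (length q) c = tf v (length q) d"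
  using tf_relations[of v q "c - d"] by (simp add: K0_eq_def tf_diff)

lemma tf_comb:
  assumes q: "(v, q) \<in> paths"
  shows "tf v (length q) (comb y) = (\<Sum>i\<in>{1..length q}. y v i)"
proof -
  have v: "v \<in> verts Q" by (rule paths_start[OF q])
  have "tf v (length q) (comb y) = (\<Sum>w\<in>verts Q. \<Sum>i\<in>{1..<k}. y w i * int (tauM (CM w i) v (length q)))"
    by (simp add: comb_def tf_sum tf_cmul tf_of)
  also have "\<dots> = (\<Sum>w\<in>verts Q. \<Sum>i\<in>{1..<k}. if w = v \<and> i \<le> length q then y w i else 0)"
    using tauM_CM[OF q] by (intro sum.cong refl) auto
  also have "\<dots> = (\<Sum>w\<in>verts Q. if w = v then (\<Sum>i\<in>{1..<k}. if i \<le> length q then y v i else 0) else 0)"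
    by (intro sum.cong refl) auto
  also have "\<dots> = (\<Sum>i\<in>{1..<k}. if i \<le> length q then y v i else 0)" using v by (simp add: sum.delta[OF finite_verts])
  also have "\<dots> = (\<Sum>i\<in>{1..length q}. y v i)"
    using q by (intro sum.mono_neutral_cong_right) (auto simp: paths_iff)
  finally show ?thesis .
qed

text \<open>If a path of length \<open>j\<close> starts at \<open>v\<close>, the invariants for
  \<open>j\<close> and \<open>j - 1\<close> are the sums of \<open>y v i\<close> up to
  \<open>j\<close> and up to \<open>j - 1\<close>, and their difference is \<open>y v j\<close>. If
  no such path exists, \<open>CM v j\<close> is projective.\<close>

lemma comb_K0_eq_zero:
  "K0_eq A (comb y) 0 \<longleftrightarrow> (\<forall>v\<in>verts Q. \<forall>j\<in>{1..<k}. y v j = 0 \<or> (\<forall>w. npaths v j w = 0))"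
proof
  assume 0: "K0_eq A (comb y) 0"
  show "\<forall>v\<in>verts Q. \<forall>j\<in>{1..<k}. y v j = 0 \<or> (\<forall>w. npaths v j w = 0)"
  proof (intro ballI disjCI)
    fix v j assume v: "v \<in> verts Q" and j: "j \<in> {1..<k}" and n: "\<not> (\<forall>w. npaths v j w = 0)"
    then obtain w where w: "npaths v j w \<noteq> 0" by blast
    have "{q. awalk v q w \<and> length q = j} \<noteq> {}"
    proof
      assume e: "{q. awalk v q w \<and> length q = j} = {}"
      show False using w unfolding npaths_def e by simp
    qed
    then obtain q where q: "(v, q) \<in> paths" "length q = j" using j by (auto simp: paths_iff)
    \<comment> \<open>The prefix of \<open>q\<close> of length \<open>j - 1\<close> makes the second
      invariant available.\<close>
    obtain i where i: "j = Suc i" using j by (cases j) auto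
    have q': "(v, take i q) \<in> paths" "length (take i q) = i" using paths_take_drop[OF q(1)] q(2) i by auto
    have "(\<Sum>i\<in>{1..j}. y v i) = 0" using tf_comb[OF q(1), of y] tf_K0_eq[OF q(1) 0] q(2) by (simp add: tf_zero)
    moreover have "(\<Sum>i\<in>{1..i}. y v i) = 0" using tf_comb[OF q'(1), of y] tf_K0_eq[OF q'(1) 0] q'(2) by (simp add: tf_zero)
    ultimately show "y v j = 0" by (simp add: i)
  qed
next
  assume *: "\<forall>v\<in>verts Q. \<forall>j\<in>{1..<k}. y v j = 0 \<or> (\<forall>w. npaths v j w = 0)"
  have "K0_eq A (comb y) (\<Sum>v\<in>verts Q. \<Sum>j\<in>{1..<k}. 0)"
    unfolding comb_def
  proof (intro K0_eq_sum)
    fix v j assume v: "v \<in> verts Q" and j: "j \<in> {1..<k}"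
    show "K0_eq A (frag_cmul (y v j) (frag_of (CM v j))) 0"
    proof (cases "y v j = 0")
      case False
      have "length q < j" if q: "(v, q) \<in> paths" for q
      proof (rule ccontr)
        assume "\<not> length q < j"
        then have "(v, take j q) \<in> paths" "length (take j q) = j" using paths_take_drop[OF q] by auto
        then obtain w where "take j q \<in> {q. awalk v q w \<and> length q = j}" by (auto simp: paths_iff)
        then have "npaths v j w \<noteq> 0" using finite_walks[of v w j] by (auto simp: npaths_def card_eq_0_iff)
        then show False using * v j False by blast
      qed
      then have "K0_eq A (frag_of (CM v j)) 0" by (rule CM_zero[OF v])
      then show ?thesis using K0_eq_cmul[of A _ 0] by fastforce
    qed simp
  qed
  then show "K0_eq A (comb y) 0" by simp
qed

end

section \<open>The kernels of powers of the adjacency matrix\<close>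

context coeff_algebra
begin

lemma npaths_0: "npaths v 0 w = (if v = w \<and> v \<in> verts Q then 1 else 0)"
proof -
  have e: "{q. awalk v q w \<and> length q = 0} = (if v = w \<and> v \<in> verts Q then {[]} else {})"
    by (auto simp: awalk_Nil_iff)
  show ?thesis unfolding npaths_def e by auto
qed

text \<open>Cutting a path after \<open>i\<close> arrows: powers of the adjacency matrix
  multiply.\<close>

lemma npaths_add: "npaths v (i + j) w = (\<Sum>x\<in>verts Q. npaths v i x * npaths x j w)"
proof -
  let ?P = "\<lambda>v j w. {q. awalk v q w \<and> length q = j}"
  have "bij_betw (\<lambda>q. (awlast v (take i q), take i q, drop i q)) (?P v (i + j) w) (SIGMA x:verts Q. ?P v i x \<times> ?P x j w)"
  proof (rule bij_betw_byWitness[where f' = "\<lambda>(x, p, r). p @ r"])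
    show "(\<lambda>q. (awlast v (take i q), take i q, drop i q)) ` ?P v (i + j) w \<subseteq> (SIGMA x:verts Q. ?P v i x \<times> ?P x j w)"
    proof
      fix z assume "z \<in> (\<lambda>q. (awlast v (take i q), take i q, drop i q)) ` ?P v (i + j) w"
      then obtain q where q: "awalk v q w" "length q = i + j" "z = (awlast v (take i q), take i q, drop i q)" by blast
      have "awalk v (take i q @ drop i q) w" using q(1) by simp
      then have "awalk v (take i q) (awlast v (take i q))" "awalk (awlast v (take i q)) (drop i q) w"
        unfolding awalk_append_iff by simp_all
      then show "z \<in> (SIGMA x:verts Q. ?P v i x \<times> ?P x j w)" using q by auto
    qed
    show "(\<lambda>(x, p, r). p @ r) ` (SIGMA x:verts Q. ?P v i x \<times> ?P x j w) \<subseteq> ?P v (i + j) w"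
      by auto
  qed auto
  then have "card (?P v (i + j) w) = card (SIGMA x:verts Q. ?P v i x \<times> ?P x j w)" by (rule bij_betw_same_card)
  also have "\<dots> = (\<Sum>x\<in>verts Q. card (?P v i x) * card (?P x j w))"
    using finite_walks by (subst card_SigmaI) (simp_all add: card_cartesian_product)
  finally show ?thesis by (simp add: npaths_def)
qed

lemma npaths_nonneg: "npaths v j w \<ge> 0"
  by (simp add: npaths_def)

lemma npaths_outside: "w \<notin> verts Q \<Longrightarrow> npaths v j w = 0"
proof -
  assume "w \<notin> verts Q"
  then have e: "{q. awalk v q w \<and> length q = j} = {}" by auto
  show ?thesis unfolding npaths_def e by simp
qed

text \<open>The row vector \<open>f\<close> times the \<open>j\<close>-th power of the adjacency
  matrix. The entries are integers in \<open>K0\<close>, while the dimension argument takes place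
  over the rationals, hence the general coefficient ring.\<close>

definition act :: "nat \<Rightarrow> ('v \<Rightarrow> 'r) \<Rightarrow> 'v \<Rightarrow> 'r::comm_ring_1" where
  "act j f w = (\<Sum>v\<in>verts Q. f v * of_int (npaths v j w))"

lemma act_0: "w \<in> verts Q \<Longrightarrow> act 0 f w = f w"
  unfolding act_def npaths_0 by (simp add: sum.delta[OF finite_verts] if_distrib cong: if_cong)

lemma act_act: "act j (act i f) w = act (i + j) f w"
proof -
  have "act j (act i f) w = (\<Sum>x\<in>verts Q. \<Sum>v\<in>verts Q. f v * of_int (npaths v i x * npaths x j w))"
    by (simp add: act_def sum_distrib_right mult.assoc)
  also have "\<dots> = (\<Sum>v\<in>verts Q. \<Sum>x\<in>verts Q. f v * of_int (npaths v i x * npaths x j w))" by (rule sum.swap)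
  also have "\<dots> = act (i + j) f w" by (simp only: act_def npaths_add of_int_sum sum_distrib_left)
  finally show ?thesis .
qed

lemma act_cong: "(\<And>v. v \<in> verts Q \<Longrightarrow> f v = g v) \<Longrightarrow> act j f w = act j g w"
  unfolding act_def by (rule sum.cong) auto

lemma act_zero: "(\<And>v. v \<in> verts Q \<Longrightarrow> f v = 0) \<Longrightarrow> act j f w = 0"
  unfolding act_def by (rule sum.neutral) auto

lemma act_of_int: "act j (\<lambda>v. of_int (f v)) w = of_int (act j f w)"
  by (simp add: act_def)

lemma act_outside: "w \<notin> verts Q \<Longrightarrow> act j f w = 0"
  by (simp add: act_def npaths_outside)

text \<open>A vector killed by the \<open>n\<close>-th but not by the \<open>(n - 1)\<close>-st power spans, together with its
  images, the whole space of dimension \<open>n\<close>.\<close>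

lemma act_nilpotent:
  fixes f :: "'v \<Rightarrow> rat"
  assumes i: "card (verts Q) \<le> Suc i" and 0: "\<And>w. act (Suc i) f w = 0" and nz: "act i f u \<noteq> 0"
  shows "npaths v (card (verts Q)) w = 0"
proof -
  interpret vs: vector_space "\<lambda>(c::rat) (g::'v \<Rightarrow> rat) x. c * g x"
    by unfold_locales (auto simp: fun_eq_iff algebra_simps)
  let ?n = "card (verts Q)"
  have u: "u \<in> verts Q" using nz act_outside by metis
  then have n: "?n \<noteq> 0" using finite_verts by auto
  \<comment> \<open>The shift makes \<open>g\<close> a vector that is killed by the
    \<open>n\<close>-th power but not by the one before.\<close>
  define g where "g = act (Suc i - ?n) f"
  have g0: "act ?n g x = 0" for x unfolding g_def act_act using i 0 by simp
  have g1: "act (?n - 1) g u \<noteq> 0"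
  proof -
    have "Suc i - ?n + (?n - 1) = i" using i n by linarith
    then have "act (?n - 1) g u = act i f u" unfolding g_def act_act by simp
    then show ?thesis using nz by simp
  qed
  have lin: "vs.subspace {x. \<forall>w. act j x w = 0}" for j
    unfolding vs.subspace_def
    by (auto simp: act_def distrib_right sum.distrib mult.assoc sum_distrib_left[symmetric])
  have gt0: "act ?n (act j g) x = 0" for j x
  proof -
    have "act ?n (act j g) x = act j (act ?n g) x" unfolding act_act by (simp add: add.commute)
    also have "\<dots> = 0" by (rule act_zero) (rule g0)
    finally show ?thesis .
  qed
  \<comment> \<open>The images of \<open>g\<close> are collected from the last one backwards: the
    \<open>t\<close>-th power kills the \<open>t\<close> vectors already present but not the new
    one, which is therefore outside their span.\<close>
  have ind: "t \<le> ?n \<Longrightarrow> vs.independent ((\<lambda>j. act j g) ` {?n - t..<?n}) \<and> card ((\<lambda>j. act j g) ` {?n - t..<?n}) = t" for t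
  proof (induction t)
    case 0
    then show ?case by (simp add: vs.independent_empty)
  next
    case (Suc t)
    let ?j = "?n - Suc t"
    let ?S = "(\<lambda>j. act j g) ` {?n - t..<?n}"
    have ins: "{?j..<?n} = insert ?j {?n - t..<?n}" using Suc.prems by auto
    have sub: "?S \<subseteq> {x. \<forall>w. act t x w = 0}"
    proof
      fix x assume "x \<in> ?S"
      then obtain j where j: "x = act j g" "?n - t \<le> j" by auto
      have "act t x w = 0" for w
      proof -
        have "act t x w = act (j + t - ?n) (act ?n g) w" unfolding j(1) act_act using j(2) by simp
        also have "\<dots> = 0" by (rule act_zero) (rule g0)
        finally show ?thesis .
      qed
      then show "x \<in> {x. \<forall>w. act t x w = 0}" by simp
    qed
    have ns: "act ?j g \<notin> vs.span ?S"
    proof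
      assume "act ?j g \<in> vs.span ?S"
      then have "act ?j g \<in> {x. \<forall>w. act t x w = 0}" using vs.span_minimal[OF sub lin] by blast
      then have "act (?j + t) g u = 0" by (simp add: act_act)
      moreover have "?j + t = ?n - 1" using Suc.prems by simp
      ultimately show False using g1 by simp
    qed
    have nS: "act ?j g \<notin> ?S"
    proof
      assume "act ?j g \<in> ?S"
      from vs.span_base[OF this] ns show False by simp
    qed
    have IH: "vs.independent ?S" "card ?S = t" using Suc by simp_all
    have im: "(\<lambda>j. act j g) ` {?j..<?n} = insert (act ?j g) ?S" unfolding ins by simp
    show ?case unfolding im using IH ns nS by (simp add: vs.independent_insert)
  qed
  let ?B = "(\<lambda>j. act j g) ` {0..<?n}"
  let ?d = "\<lambda>v x. if x = v then 1 else (0::rat)"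
  let ?D = "?d ` verts Q"
  have B: "vs.independent ?B" "card ?B = ?n" using ind[of ?n] by simp_all
  have inj: "inj_on ?d (verts Q)" by (auto simp: inj_on_def fun_eq_iff split: if_splits)
  have D: "finite ?D" "card ?D = ?n" using card_image[OF inj] by auto
  \<comment> \<open>All functions on the vertex type may form too large a space. Values of
    \<open>act\<close> vanish off the vertices, so the dimension is counted in the span of the unit
    vectors.\<close>
  have BD: "?B \<subseteq> vs.span ?D"
  proof
    fix x assume "x \<in> ?B"
    then have out: "x w = 0" if "w \<notin> verts Q" for w using act_outside that by auto
    have "(\<Sum>v\<in>verts Q. (\<lambda>y. x v * ?d v y)) \<in> vs.span ?D"
      by (intro vs.span_sum vs.span_scale vs.span_base) auto
    moreover have "(\<Sum>v\<in>verts Q. (\<lambda>y. x v * ?d v y)) = x"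
    proof
      fix y
      have "(\<Sum>v\<in>V. (\<lambda>y. x v * ?d v y)) y = (\<Sum>v\<in>V. x v * ?d v y)" for V
        by (induction V rule: infinite_finite_induct) auto
      then show "(\<Sum>v\<in>verts Q. (\<lambda>y. x v * ?d v y)) y = x y"
        using out by (simp add: if_distrib[of "(*) _"] sum.delta'[OF finite_verts] cong: if_cong)
    qed
    ultimately show "x \<in> vs.span ?D" by simp
  qed
  have sp: "d \<in> vs.span ?B" if d: "d \<in> ?D" for d
  proof (rule ccontr)
    assume nd: "d \<notin> vs.span ?B"
    then have dB: "d \<notin> ?B" using vs.span_base by metis
    have "vs.independent (insert d ?B)"
      using vs.independent_insert[of d ?B] dB nd B(1) by simp
    moreover have "insert d ?B \<subseteq> vs.span ?D" using BD vs.span_base[OF d] by simp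
    ultimately have "card (insert d ?B) \<le> card ?D" using vs.independent_span_bound[OF D(1)] by simp
    then show False using dB B(2) D(2) by simp
  qed
  \<comment> \<open>The \<open>n\<close> independent images of \<open>g\<close> span all unit
    vectors, and each of them is killed by the \<open>n\<close>-th power; so the matrix is
    nilpotent.\<close>
  have sub: "vs.span ?B \<subseteq> {x. \<forall>w. act ?n x w = 0}"
    by (rule vs.span_minimal[OF _ lin]) (use gt0 in auto)
  then have kill: "act ?n (?d v) w = 0" if "v \<in> verts Q" for v w
  proof -
    have "?d v \<in> vs.span ?B" by (rule sp) (use that in simp)
    then have "?d v \<in> {x. \<forall>w. act ?n x w = 0}" by (rule subsetD[OF sub])
    then show ?thesis by simp
  qed
  show ?thesis
  proof (cases "v \<in> verts Q")
    case True
    have "act ?n (?d v) w = (\<Sum>x\<in>verts Q. if x = v then of_int (npaths v ?n w) else 0)"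
      unfolding act_def by (intro sum.cong refl) auto
    then show ?thesis using kill[OF True, of w] True by (simp add: sum.delta[OF finite_verts])
  next
    case False
    then have e: "{q. awalk v q w \<and> length q = ?n} = {}" by auto
    show ?thesis unfolding npaths_def e by simp
  qed
qed

text \<open>The exponent is lowered one at a time. If some step failed, \<open>act_nilpotent\<close>
  would make the \<open>n\<close>-th power zero, against the existence of a path of length
  \<open>n\<close>.\<close>

lemma act_stable:
  fixes f :: "'v \<Rightarrow> int"
  assumes nn: "npaths v0 (card (verts Q)) w0 \<noteq> 0" and i: "card (verts Q) \<le> Suc i"
    and 0: "\<And>w. act (i + t) f w = 0"
  shows "act i f w = 0"
  using 0
proof (induction t)
  case (Suc t)
  have "act (i + t) f x = 0" for x
  proof (rule ccontr)
    assume nz: "act (i + t) f x \<noteq> 0"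
    have "act (Suc (i + t)) (\<lambda>v. rat_of_int (f v)) w = 0" for w using Suc.prems by (simp add: act_of_int)
    moreover have "act (i + t) (\<lambda>v. rat_of_int (f v)) x \<noteq> 0" using nz by (simp add: act_of_int)
    ultimately show False using act_nilpotent[of "i + t" "\<lambda>v. rat_of_int (f v)"] i nn by fastforce
  qed
  then show ?case by (rule Suc.IH)
qed simp

lemma npaths_prefix:
  assumes "npaths v (i + j) w \<noteq> 0"
  shows "\<exists>x. npaths v i x \<noteq> 0"
proof (rule ccontr)
  assume "\<not> ?thesis"
  then have "npaths v (i + j) w = 0" unfolding npaths_add by (intro sum.neutral) simp
  then show False using assms by simp
qed

section \<open>Iterates of the syzygy operator on coefficients\<close>

lemma tr_eq: "tr y w j = act (k - j) (\<lambda>v. y v (k - j)) w"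
  by (simp add: tr_def act_def)

text \<open>Two applications lead from slot \<open>j\<close> to \<open>k - j\<close> and back, and
  the path lengths \<open>j\<close> and \<open>k - j\<close> add up to \<open>k\<close>.\<close>

lemma tr_even:
  assumes "j \<in> {1..<k}"
  shows "w \<in> verts Q \<Longrightarrow> (tr ^^ (2 * a)) y w j = act (k * a) (\<lambda>v. y v j) w"
proof (induction a arbitrary: w)
  case 0
  then show ?case by (simp add: act_0)
next
  case (Suc a)
  have "(tr ^^ (2 * Suc a)) y w j = tr (tr ((tr ^^ (2 * a)) y)) w j" by simp
  also have "\<dots> = act (k - j) (\<lambda>v. act j (\<lambda>u. (tr ^^ (2 * a)) y u j) v) w"
    using assms by (simp add: tr_eq)
  also have "\<dots> = act (j + (k - j)) (\<lambda>u. (tr ^^ (2 * a)) y u j) w" by (rule act_act)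
  also have "\<dots> = act k (act (k * a) (\<lambda>v. y v j)) w"
  proof -
    have "j + (k - j) = k" using assms by simp
    then show ?thesis using act_cong[of "\<lambda>u. (tr ^^ (2 * a)) y u j" "act (k * a) (\<lambda>v. y v j)" k w] Suc.IH by simp
  qed
  also have "\<dots> = act (k * Suc a) (\<lambda>v. y v j) w" by (simp add: act_act add.commute)
  finally show ?case .
qed

lemma tr_odd:
  assumes "j \<in> {1..<k}"
  shows "(tr ^^ Suc (2 * a)) y w j = act (k * a + (k - j)) (\<lambda>v. y v (k - j)) w"
proof -
  have j: "k - j \<in> {1..<k}" using assms by auto
  have "(tr ^^ Suc (2 * a)) y w j = act (k - j) (\<lambda>v. (tr ^^ (2 * a)) y v (k - j)) w" by (simp add: tr_eq)
  also have "\<dots> = act (k - j) (act (k * a) (\<lambda>v. y v (k - j))) w"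
    by (rule act_cong) (rule tr_even[OF j])
  finally show ?thesis by (simp add: act_act)
qed

text \<open>The criterion of \<open>comb_K0_eq_zero\<close> for \<open>comb y\<close> to have class
  zero.\<close>

definition vanishing :: "('v \<Rightarrow> nat \<Rightarrow> int) \<Rightarrow> bool" where
  "vanishing y \<longleftrightarrow> (\<forall>v\<in>verts Q. \<forall>j\<in>{1..<k}. y v j = 0 \<or> (\<forall>w. npaths v j w = 0))"

lemma vanishing_act:
  assumes "vanishing y" "j \<in> {1..<k}"
  shows "act j (\<lambda>v. y v j) w = 0"
  unfolding act_def
proof (intro sum.neutral ballI)
  fix v assume "v \<in> verts Q"
  then have "y v j = 0 \<or> (\<forall>w. npaths v j w = 0)" using assms unfolding vanishing_def by simp
  then show "y v j * of_int (npaths v j w) = 0" by auto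
qed

text \<open>The least power of the adjacency matrix that occurs in the \<open>d\<close>-th iterate of \<^term>\<open>tr\<close>.\<close>

definition reach :: "nat \<Rightarrow> nat" where
  "reach d = (if even d then k * (d div 2) else k * (d div 2) + 1)"

text \<open>If no path has length \<open>n\<close>, a nonzero coefficient at \<open>x\<close> and a
  path of length \<open>j\<close> from \<open>x\<close> would together give a path of length at
  least \<open>n\<close>. Otherwise the vanishing of the next iterate shows that some power at least
  as large kills the source vector, and by \<open>act_stable\<close> so does the exponent
  \<open>e m j\<close>, which is at least \<open>n - 1\<close>.\<close>

lemma vanishing_prev:
  assumes r: "card (verts Q) \<le> Suc (reach m)" and v: "vanishing ((tr ^^ Suc m) y)"
  shows "vanishing ((tr ^^ m) y)"
proof -
  let ?n = "card (verts Q)"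
  \<comment> \<open>exponent and source slot of the \<open>j\<close>-th slot of the \<open>m\<close>-th iterate\<close>
  define e where "e m j = (if even m then k * (m div 2) else k * (m div 2) + (k - j))" for m j
  define s where "s m j = (if even m then j else k - j)" for m j :: nat
  have it: "(tr ^^ m) y w j = act (e m j) (\<lambda>v. y v (s m j)) w" if "j \<in> {1..<k}" "w \<in> verts Q" for m y w j
  proof (cases "even m")
    case True
    then obtain a where "m = 2 * a" by blast
    then show ?thesis using tr_even[OF that] by (simp add: e_def s_def)
  next
    case False
    then obtain a where "m = Suc (2 * a)" by (metis oddE Suc_eq_plus1)
    then show ?thesis using tr_odd[OF that(1)] by (simp add: e_def s_def)
  qed
  have ge: "reach m \<le> e m j" if "j \<in> {1..<k}" for j
    using that by (auto simp: reach_def e_def)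
  \<comment> \<open>The exponent alone is only known to be at least \<open>n - 1\<close>; the
    missing arrow comes from \<open>j \<ge> 1\<close>.\<close>
  have sum: "e m j + j \<ge> ?n" if j: "j \<in> {1..<k}" for j
    using r j k_ge by (auto simp: reach_def e_def)
  have src: "s (Suc m) (k - j) = s m j" if "j \<in> {1..<k}" for j
    using that by (auto simp: s_def)
  \<comment> \<open>The next iterate in slot \<open>k - j\<close>, followed by \<open>k - j\<close>
    further arrows, has passed through at least as many arrows as the present one.\<close>
  have e': "e m j \<le> e (Suc m) (k - j) + (k - j)" if j: "j \<in> {1..<k}" for j
    using j by (cases "even m") (auto simp: e_def elim!: evenE oddE)
  show ?thesis unfolding vanishing_def
  proof (intro ballI)
    fix x j assume x: "x \<in> verts Q" and j: "j \<in> {1..<k}"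
    show "(tr ^^ m) y x j = 0 \<or> (\<forall>w. npaths x j w = 0)"
    proof (cases "\<forall>v w. npaths v ?n w = 0")
      case True
      show ?thesis
      proof (rule ccontr)
        assume n: "\<not> ?thesis"
        then obtain w where w: "npaths x j w \<noteq> 0" by blast
        have "act (e m j) (\<lambda>v. y v (s m j)) x \<noteq> 0" using n it[OF j x] by simp
        then obtain u where u: "npaths u (e m j) x \<noteq> 0"
          unfolding act_def by (elim sum.not_neutral_contains_not_neutral) auto
        have "0 < npaths u (e m j) x * npaths x j w"
          using u w npaths_nonneg[of u "e m j" x] npaths_nonneg[of x j w] by simp
        also have "\<dots> \<le> npaths u (e m j + j) w" unfolding npaths_add
          using x by (intro member_le_sum) (auto simp: npaths_nonneg)
        finally have "npaths u (?n + (e m j + j - ?n)) w \<noteq> 0" using sum[OF j] by simp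
        then show False using npaths_prefix True by blast
      qed
    next
      case False
      then obtain v0 w0 where nn: "npaths v0 ?n w0 \<noteq> 0" by blast
      have kj: "k - j \<in> {1..<k}" using j by auto
      \<comment> \<open>A vanishing vector may have nonzero entries, but only at vertices where no
        path of the relevant length starts; so \<open>k - j\<close> further arrows turn it into
        zero.\<close>
      have "act (e m j + (e (Suc m) (k - j) + (k - j) - e m j)) (\<lambda>v. y v (s m j)) w = 0" for w
      proof -
        have "act (e m j + (e (Suc m) (k - j) + (k - j) - e m j)) (\<lambda>v. y v (s m j)) w
            = act (k - j) (act (e (Suc m) (k - j)) (\<lambda>v. y v (s (Suc m) (k - j)))) w"
          using e'[OF j] src[OF j] by (simp add: act_act)
        also have "\<dots> = act (k - j) (\<lambda>v. (tr ^^ Suc m) y v (k - j)) w"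
          by (rule act_cong) (simp only: it[OF kj])
        also have "\<dots> = 0" by (rule vanishing_act[OF v kj])
        finally show ?thesis .
      qed
      note z = this
      have "card (verts Q) \<le> Suc (e m j)" using ge[OF j] r by simp
      from act_stable[OF nn this z] have "act (e m j) (\<lambda>v. y v (s m j)) x = 0" .
      then show ?thesis using it[OF j x] by simp
    qed
  qed
qed

end

section \<open>Bounds for the Igusa-Todorov function\<close>

definition K0_coset where
  "K0_coset R c = K0_relations R #>\<^bsub>module_frags R\<^esub> c"

lemma K0_coset_eq: "K0_coset R c = {d. K0_eq R d c}"
proof -
  have "d \<in> K0_coset R c \<longleftrightarrow> d - c \<in> K0_relations R" for d
    unfolding K0_coset_def r_coset_def module_frags_def free_Abelian_group_def
    by (auto simp: algebra_simps) (metis add_diff_cancel_right' diff_add_cancel)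
  then show ?thesis by (auto simp: K0_eq_def)
qed

lemma K0_coset_eq_iff: "K0_coset R c = K0_coset R d \<longleftrightarrow> K0_eq R c d"
proof
  assume e: "K0_coset R c = K0_coset R d"
  have "c \<in> K0_coset R c" by (simp add: K0_coset_eq)
  then show "K0_eq R c d" unfolding e by (simp add: K0_coset_eq)
next
  assume "K0_eq R c d"
  then show "K0_coset R c = K0_coset R d"
    using K0_eq_trans[of R _ c d] K0_eq_trans[of R _ d c] K0_eq_sym[of R c d] unfolding K0_coset_eq by blast
qed

lemma K0_relations_normal: "K0_relations R \<lhd> module_frags R"
  by (rule comm_group.subgroup_imp_normal[OF _ K0_relations_subgroup])
    (simp add: module_frags_def abelian_free_Abelian_group)

lemma K0_group: "group (K0 R)"
  unfolding K0_def by (rule normal.factorgroup_is_group[OF K0_relations_normal])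

lemma K0_coset_carrier: "Poly_Mapping.keys c \<subseteq> fg_modules R \<Longrightarrow> K0_coset R c \<in> carrier (K0 R)"
  unfolding K0_def carrier_FactGroup K0_coset_def by (simp add: module_frags_def)

lemma K0_coset_mult:
  assumes "Poly_Mapping.keys c \<subseteq> fg_modules R" "Poly_Mapping.keys d \<subseteq> fg_modules R"
  shows "K0_coset R c \<otimes>\<^bsub>K0 R\<^esub> K0_coset R d = K0_coset R (c + d)"
  unfolding K0_def mult_FactGroup K0_coset_def
  by (subst normal.rcos_sum[OF K0_relations_normal]) (use assms in \<open>simp_all add: module_frags_def\<close>)

lemma K0_coset_one: "\<one>\<^bsub>K0 R\<^esub> = K0_coset R 0"
  unfolding K0_def one_FactGroup by (auto simp: K0_coset_eq K0_eq_def)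

lemma K0_coset_inv:
  assumes "Poly_Mapping.keys c \<subseteq> fg_modules R"
  shows "inv\<^bsub>K0 R\<^esub> K0_coset R c = K0_coset R (- c)"
proof (rule group.inv_equality[OF K0_group])
  show "K0_coset R (- c) \<otimes>\<^bsub>K0 R\<^esub> K0_coset R c = \<one>\<^bsub>K0 R\<^esub>"
    using K0_coset_mult[of "- c" R c] assms by (simp add: K0_coset_one)
qed (use assms K0_coset_carrier[of "- c" R] in \<open>simp_all add: K0_coset_carrier\<close>)

text \<open>All representatives of the classes in \<open>add_span\<close>, on which injectivity can
  be tested without cosets.\<close>

definition add_frags :: "('a, 'm) ring_scheme \<Rightarrow> ('a, 'a list) module \<Rightarrow> (('a, 'a list) module \<Rightarrow>\<^sub>0 int) set" where
  "add_frags R M = {c. Poly_Mapping.keys c \<subseteq> fg_modules R \<and> K0_coset R c \<in> add_span R M}"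

lemma add_span_subgroup: "subgroup (add_span R M) (K0 R)"
  unfolding add_span_def
  by (rule group.generate_is_subgroup[OF K0_group])
    (auto simp: K0_class_def K0_coset_def[symmetric] intro!: K0_coset_carrier)

lemma add_frags_zero: "0 \<in> add_frags R M"
  using subgroup.one_closed[OF add_span_subgroup[of R M]] by (simp add: add_frags_def K0_coset_one)

lemma add_frags_minus:
  assumes "c \<in> add_frags R M" shows "- c \<in> add_frags R M"
  using subgroup.m_inv_closed[OF add_span_subgroup, of "K0_coset R c" R M] assms
  by (simp add: add_frags_def K0_coset_inv)

lemma add_frags_add:
  assumes "c \<in> add_frags R M" "d \<in> add_frags R M" shows "c + d \<in> add_frags R M"
  using subgroup.m_closed[OF add_span_subgroup, of "K0_coset R c" R M "K0_coset R d"] assms keys_add[of c d]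
  by (auto simp add: add_frags_def K0_coset_mult)

lemma add_frags_diff:
  assumes "c \<in> add_frags R M" "d \<in> add_frags R M" shows "c - d \<in> add_frags R M"
  using add_frags_add[OF assms(1) add_frags_minus[OF assms(2)]] by simp

lemma add_frags_of:
  assumes "N \<in> fg_modules R" "indecomposable R N" "N' \<in> fg_modules R" "rmod_iso R M (direct_sum N N')"
  shows "frag_of N \<in> add_frags R M"
  unfolding add_frags_def add_span_def
  using assms by (auto simp: K0_class_def K0_coset_def intro!: generate.incl)

lemma add_span_eq: "add_span R M = K0_coset R ` add_frags R M"
proof
  show "add_span R M \<subseteq> K0_coset R ` add_frags R M"
  proof
    fix X assume X: "X \<in> add_span R M"
    then have "X \<in> carrier (K0 R)" using subgroup.mem_carrier[OF add_span_subgroup] by blast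
    then obtain c where "Poly_Mapping.keys c \<subseteq> fg_modules R" "X = K0_coset R c"
      unfolding K0_def carrier_FactGroup K0_coset_def by (auto simp: module_frags_def)
    then show "X \<in> K0_coset R ` add_frags R M" using X by (auto simp: add_frags_def)
  qed
qed (auto simp: add_frags_def)

section \<open>Injectivity of the syzygy operator and the bounds for \<open>phi\<close>\<close>

context coeff_algebra
begin

text \<open>The image under \<open>the_elem\<close> is a singleton because \<open>Syz\<close>
  respects the relations (\<open>Syz_cong\<close>).\<close>

lemma Omega_bar_coset: "Omega_bar A (K0_coset A c) = K0_coset A (Syz c)"
proof -
  have "(\<lambda>d. K0_coset A (Syz d)) ` K0_coset A c = {K0_coset A (Syz c)}"
  proof -
    have 1: "K0_coset A (Syz d) = K0_coset A (Syz c)" if "d \<in> K0_coset A c" for d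
      using that unfolding K0_coset_eq_iff by (intro Syz_cong) (simp add: K0_coset_eq)
    have 2: "c \<in> K0_coset A c" by (simp add: K0_coset_eq)
    have "(\<lambda>d. K0_coset A (Syz d)) ` K0_coset A c = (\<lambda>d. K0_coset A (Syz c)) ` K0_coset A c"
      using 1 by (rule image_cong[OF refl])
    also have "\<dots> = {K0_coset A (Syz c)}" using 2 by (rule image_constant)
    finally show ?thesis .
  qed
  then show ?thesis unfolding Omega_bar_def Syz_def[symmetric] K0_coset_def[symmetric] by simp
qed

lemma Omega_bar_iterate: "(Omega_bar A ^^ m) (K0_coset A c) = K0_coset A ((Syz ^^ m) c)"
  by (induction m) (simp_all add: Omega_bar_coset)

lemma Syz_iterate_diff: "(Syz ^^ m) (c - d) = (Syz ^^ m) c - (Syz ^^ m) d"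
  by (induction m) (simp_all add: Syz_diff)

lemma Syz_iterate_zero: "(Syz ^^ m) 0 = 0"
  by (induction m) (simp_all add: Syz_zero)

lemma Syz_iterate_cong: "K0_eq A c d \<Longrightarrow> K0_eq A ((Syz ^^ m) c) ((Syz ^^ m) d)"
  by (induction m) (simp_all add: Syz_cong)

lemma Syz_iterate_comb: "K0_eq A ((Syz ^^ m) (comb y)) (comb ((tr ^^ m) y))"
proof (induction m)
  case (Suc m)
  show ?case using K0_eq_trans[OF Syz_cong[OF Suc] Syz_comb] by simp
qed simp

text \<open>Additivity of \<open>Syz\<close> reduces injectivity to a trivial kernel, as
  \<open>add_frags\<close> is closed under differences.\<close>

lemma inj_on_Omega_bar:
  "inj_on (Omega_bar A) ((Omega_bar A ^^ m) ` add_span A M) \<longleftrightarrow>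
    (\<forall>c\<in>add_frags A M. K0_eq A ((Syz ^^ Suc m) c) 0 \<longrightarrow> K0_eq A ((Syz ^^ m) c) 0)"
    (is "?L \<longleftrightarrow> ?R")
proof
  assume L: ?L
  show ?R
  proof (intro ballI impI)
    fix c assume c: "c \<in> add_frags A M" and z: "K0_eq A ((Syz ^^ Suc m) c) 0"
    have "(Omega_bar A ^^ m) (K0_coset A c) = (Omega_bar A ^^ m) (K0_coset A 0)"
    proof (rule inj_onD[OF L])
      show "Omega_bar A ((Omega_bar A ^^ m) (K0_coset A c)) = Omega_bar A ((Omega_bar A ^^ m) (K0_coset A 0))"
        using z by (simp add: Omega_bar_iterate Omega_bar_coset Syz_iterate_zero K0_coset_eq_iff Syz_zero)
    qed (unfold add_span_eq, use c add_frags_zero in auto)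
    then show "K0_eq A ((Syz ^^ m) c) 0" by (simp add: Omega_bar_iterate Syz_iterate_zero K0_coset_eq_iff)
  qed
next
  assume R: ?R
  show ?L unfolding add_span_eq
  proof (rule inj_onI, elim imageE)
    fix X Y X' Y' c d assume *: "Omega_bar A X = Omega_bar A Y" "X = (Omega_bar A ^^ m) X'" "Y = (Omega_bar A ^^ m) Y'"
      "X' = K0_coset A c" "Y' = K0_coset A d" "c \<in> add_frags A M" "d \<in> add_frags A M"
    have "K0_eq A ((Syz ^^ Suc m) c) ((Syz ^^ Suc m) d)"
      using *(1) unfolding *(2-5) by (simp add: Omega_bar_iterate Omega_bar_coset K0_coset_eq_iff)
    then have "K0_eq A ((Syz ^^ Suc m) (c - d)) 0" unfolding Syz_iterate_diff by (simp add: K0_eq_def)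
    then have "K0_eq A ((Syz ^^ m) (c - d)) 0" using R add_frags_diff[OF *(6,7)] by blast
    then show "X = Y"
      unfolding *(2-5) Omega_bar_iterate K0_coset_eq_iff Syz_iterate_diff by (simp add: K0_eq_def)
  qed
qed

text \<open>One syzygy is spent to arrive at a combination \<open>comb y\<close>; only the remaining
  \<open>m - 1\<close> iterations are described by the matrix, whence
  \<open>reach (m - 1)\<close>.\<close>

lemma inj_on_Omega_bar_reach:
  assumes m: "0 < m" and r: "card (verts Q) \<le> Suc (reach (m - 1))"
  shows "inj_on (Omega_bar A) ((Omega_bar A ^^ m) ` add_span A M)"
  unfolding inj_on_Omega_bar
proof (intro ballI impI)
  fix c assume c: "c \<in> add_frags A M" and z: "K0_eq A ((Syz ^^ Suc m) c) 0"
  obtain y where "K0_eq A (Syz c) (comb y)" using ex_comb_Syz c by (auto simp: add_frags_def)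
  then have y: "K0_eq A ((Syz ^^ Suc i) c) (comb ((tr ^^ i) y))" for i
    unfolding funpow_Suc_right comp_apply by (rule K0_eq_trans[OF Syz_iterate_cong Syz_iterate_comb])
  obtain i where i: "m = Suc i" using m by (cases m) auto
  have "K0_eq A (comb ((tr ^^ Suc i) y)) 0" using K0_eq_trans[OF K0_eq_sym[OF y] z[unfolded i]] .
  then have "vanishing ((tr ^^ i) y)"
    using vanishing_prev[of i y] r i unfolding comb_K0_eq_zero vanishing_def[symmetric] by simp
  then have "K0_eq A (comb ((tr ^^ i) y)) 0" unfolding comb_K0_eq_zero vanishing_def[symmetric] .
  then show "K0_eq A ((Syz ^^ m) c) 0" using K0_eq_trans[OF y] unfolding i by blast
qed

lemma phi_le:
  assumes "\<And>m. b \<le> m \<Longrightarrow> 0 < m \<and> card (verts Q) \<le> Suc (reach (m - 1))"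
  shows "phi A M \<le> b"
  unfolding phi_def by (rule Least_le) (use assms in \<open>auto intro!: inj_on_Omega_bar_reach\<close>)

text \<open>The first hypothesis provides some \<open>l\<close> with the defining property, without
  which \<open>LEAST\<close> would be uninformative. Failure of injectivity at \<open>m\<close> then
  rules out every \<open>l \<le> m\<close>.\<close>

lemma phi_gt:
  assumes "\<And>m. b \<le> m \<Longrightarrow> 0 < m \<and> card (verts Q) \<le> Suc (reach (m - 1))"
    and c: "c \<in> add_frags A M" "K0_eq A ((Syz ^^ Suc m) c) 0" "\<not> K0_eq A ((Syz ^^ m) c) 0"
  shows "m < phi A M"
proof (rule ccontr)
  let ?P = "\<lambda>l. \<forall>s. inj_on (Omega_bar A) ((Omega_bar A ^^ (l + s)) ` add_span A M)"
  assume "\<not> m < phi A M"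
  moreover have "?P (phi A M)" unfolding phi_def
    by (rule LeastI[of ?P b]) (use assms(1) in \<open>auto intro!: inj_on_Omega_bar_reach\<close>)
  ultimately have "inj_on (Omega_bar A) ((Omega_bar A ^^ m) ` add_span A M)"
  proof -
    assume "\<not> m < phi A M" "?P (phi A M)"
    then show ?thesis using spec[of "\<lambda>s. inj_on (Omega_bar A) ((Omega_bar A ^^ (phi A M + s)) ` add_span A M)" "m - phi A M"] by simp
  qed
  then show False using c unfolding inj_on_Omega_bar by blast
qed

end

section \<open>Local modules\<close>

context coeff_algebra
begin

text \<open>Successive approximation once more: an element of \<open>e_v A\<close> with nonzero
  constant term generates \<open>e_v A\<close>.\<close>

lemma ex_right_quotient:
  assumes v: "v \<in> verts Q" and a: "a \<in> E v" "cf a (v, []) \<noteq> \<zero>\<^bsub>K\<^esub>" and b: "b \<in> E v"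
  shows "\<exists>r\<in>carrier A. b = a \<otimes> r"
proof -
  have aA: "a \<in> carrier A" using a by simp
  show ?thesis
  proof (rule F_induct[of "\<lambda>b. \<exists>r\<in>carrier A. b = a \<otimes> r" "E v" b 0])
    show "\<exists>r\<in>carrier A. \<zero> = a \<otimes> r" using aA by (intro bexI[of _ \<zero>]) simp_all
  next
    fix t b assume b: "b \<in> E v" "b \<in> F t" and IH: "\<And>b. b \<in> E v \<Longrightarrow> b \<in> F (Suc t) \<Longrightarrow> \<exists>r\<in>carrier A. b = a \<otimes> r"
    let ?s = "sc (inv\<^bsub>K\<^esub> (cf a (v, []))) \<otimes> b"
    have bA: "b \<in> carrier A" using b by simp
    have i: "inv\<^bsub>K\<^esub> (cf a (v, [])) \<in> carrier K" using a aA by (simp add: K.field_Units)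
    then have s: "?s \<in> carrier A" using bA by (intro A.m_closed sc_closed)
    obtain r where r: "r \<in> carrier A" "b \<ominus> a \<otimes> ?s = a \<otimes> r"
      using IH[OF approx_unit[OF v a b]] by blast
    have "b = a \<otimes> r \<oplus> a \<otimes> ?s" unfolding r(2)[symmetric] using aA bA s by (simp add: a_minus_def A.a_assoc A.l_neg)
    also have "\<dots> = a \<otimes> (r \<oplus> ?s)" using aA r s by (simp add: A.r_distr)
    finally show "\<exists>r\<in>carrier A. b = a \<otimes> r" using r s by blast
  qed (use b in \<open>auto simp: F_0\<close>)
qed

text \<open>In a decomposition the generator splits into two parts whose constant terms add up to 1.
  The part with nonzero constant term already generates the module, so the other summand is
  zero.\<close>

lemma XM_indecomposable:
  assumes Z: "rclosed Z" "(w, []) \<notin> Z" and w: "w \<in> verts Q"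
  shows "indecomposable A (XM w Z)"
proof -
  let ?M = "XM w Z"
  have e: "[ev w] \<in> carrier ?M" using Z(2) ev_E by (auto simp: XM_simps cf_pe)
  have gen: "\<exists>r\<in>carrier A. y = r \<odot>\<^bsub>?M\<^esub> x"
    if x: "x \<in> carrier ?M" "cf (hd x) (w, []) \<noteq> \<zero>\<^bsub>K\<^esub>" and y: "y \<in> carrier ?M" for x y
  proof -
    obtain b where b: "y = [b]" "b \<in> E w" "\<And>z. z \<in> Z \<Longrightarrow> cf b z = \<zero>\<^bsub>K\<^esub>" using y by (auto simp: XM_simps)
    have "hd x \<in> E w" using x by (auto simp: XM_simps)
    from ex_right_quotient[OF w this x(2) b(2)] obtain r where r: "r \<in> carrier A" "b = hd x \<otimes> r" by blast
    show ?thesis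
      using r(1) b kz_id[of b Z] by (intro bexI[of _ r]) (auto simp: XM_simps r(2)[symmetric])
  qed
  show ?thesis unfolding indecomposable_def
  proof (intro conjI allI impI; (elim conjE)?)
    have "ev w \<noteq> \<zero>" using cf_pe[of "(w, [])" "(w, [])"] w by (auto simp: paths_Nil)
    then show "carrier ?M \<noteq> {\<zero>\<^bsub>?M\<^esub>}" using e by (auto simp: XM_simps)
  next
    fix N N' :: "('a, 'a list) module"
    assume N: "right_module A N" and N': "right_module A N'" and "rmod_iso A ?M (direct_sum N N')"
    then obtain h where h: "h \<in> rmod_hom A ?M (direct_sum N N')" "bij_betw h (carrier ?M) (carrier (direct_sum N N'))"
      unfolding rmod_iso_def by blast
    interpret N: right_module A N by fact
    interpret N': right_module A N' by fact
    note hD = rmod_homD[OF h(1)]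
    have C: "carrier (direct_sum N N') = carrier N \<times> carrier N'"
      and add: "(x, y) \<oplus>\<^bsub>direct_sum N N'\<^esub> (x', y') = (x \<oplus>\<^bsub>N\<^esub> x', y \<oplus>\<^bsub>N'\<^esub> y')"
      and sm: "r \<odot>\<^bsub>direct_sum N N'\<^esub> (x, y) = (r \<odot>\<^bsub>N\<^esub> x, r \<odot>\<^bsub>N'\<^esub> y)" for x y x' y' r
      by (simp_all add: direct_sum_def)
    have him: "h ` carrier ?M = carrier N \<times> carrier N'" using h(2) C by (simp add: bij_betw_def)
    have inj: "inj_on h (carrier ?M)" using h(2) by (simp add: bij_betw_def)
    obtain n n' where n: "h [ev w] = (n, n')" "n \<in> carrier N" "n' \<in> carrier N'" using him e by blast
    obtain x where x: "x \<in> carrier ?M" "h x = (n, \<zero>\<^bsub>N'\<^esub>)"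
      using him n N'.M.zero_closed by (metis (no_types, lifting) SigmaI imageE)
    obtain x' where x': "x' \<in> carrier ?M" "h x' = (\<zero>\<^bsub>N\<^esub>, n')"
      using him n N.M.zero_closed by (metis (no_types, lifting) SigmaI imageE)
    interpret X: right_module A ?M by (rule XM_right_module[OF Z(1)])
    have "h (x \<oplus>\<^bsub>?M\<^esub> x') = h [ev w]"
      using hD(2)[OF x(1) x'(1)] x x' n by (simp add: add)
    then have "x \<oplus>\<^bsub>?M\<^esub> x' = [ev w]" by (rule inj_onD[OF inj]) (use x x' e in auto)
    then have "hd x \<oplus> hd x' = ev w" by (simp add: XM_simps)
    then have "cf (hd x) (w, []) \<oplus>\<^bsub>K\<^esub> cf (hd x') (w, []) = cf (ev w) (w, [])"
      using x x' cf_add[of "hd x" "hd x'" "(w, [])"] by (auto simp: XM_simps)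
    then have "cf (hd x) (w, []) \<oplus>\<^bsub>K\<^esub> cf (hd x') (w, []) = \<one>\<^bsub>K\<^esub>"
      using w by (simp add: cf_pe paths_Nil)
    then consider "cf (hd x) (w, []) \<noteq> \<zero>\<^bsub>K\<^esub>" | "cf (hd x') (w, []) \<noteq> \<zero>\<^bsub>K\<^esub>" by fastforce
    then show "carrier N = {\<zero>\<^bsub>N\<^esub>} \<or> carrier N' = {\<zero>\<^bsub>N'\<^esub>}"
    proof cases
      case 1
      have "y' = \<zero>\<^bsub>N'\<^esub>" if y': "y' \<in> carrier N'" for y'
      proof -
        have "(\<zero>\<^bsub>N\<^esub>, y') \<in> h ` carrier ?M" unfolding him using y' by simp
        then obtain y where y: "y \<in> carrier ?M" "h y = (\<zero>\<^bsub>N\<^esub>, y')" by (metis imageE)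
        obtain r where r: "r \<in> carrier A" "y = r \<odot>\<^bsub>?M\<^esub> x" using gen[OF x(1) 1 y(1)] by blast
        have "h y = (r \<odot>\<^bsub>N\<^esub> n, r \<odot>\<^bsub>N'\<^esub> \<zero>\<^bsub>N'\<^esub>)" using hD(3)[OF r(1) x(1)] x(2) r(2) by (simp add: sm)
        then show ?thesis using y(2) r(1) N'.smult_r_null by simp
      qed
      then show ?thesis using N'.M.zero_closed by blast
    next
      case 2
      have "y' = \<zero>\<^bsub>N\<^esub>" if y': "y' \<in> carrier N" for y'
      proof -
        have "(y', \<zero>\<^bsub>N'\<^esub>) \<in> h ` carrier ?M" unfolding him using y' by simp
        then obtain y where y: "y \<in> carrier ?M" "h y = (y', \<zero>\<^bsub>N'\<^esub>)" by (metis imageE)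
        obtain r where r: "r \<in> carrier A" "y = r \<odot>\<^bsub>?M\<^esub> x'" using gen[OF x'(1) 2 y(1)] by blast
        have "h y = (r \<odot>\<^bsub>N\<^esub> \<zero>\<^bsub>N\<^esub>, r \<odot>\<^bsub>N'\<^esub> n')" using hD(3)[OF r(1) x'(1)] x'(2) r(2) by (simp add: sm)
        then show ?thesis using y(2) r(1) N.smult_r_null by simp
      qed
      then show ?thesis using N.M.zero_closed by blast
    qed
  qed
qed

text \<open>\<open>add_span\<close> asks for the indecomposable summand in first position, so the
  second class is obtained after swapping. Having both classes in one module admits their
  differences as test elements for \<open>phi\<close>.\<close>

lemma XM_add_frags:
  assumes "rclosed Z" "(w, []) \<notin> Z" "w \<in> verts Q" "rclosed Z'" "(w', []) \<notin> Z'" "w' \<in> verts Q"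
  shows "frag_of (XM w Z) \<in> add_frags A (dsum A (XM w Z) (XM w' Z'))"
    and "frag_of (XM w' Z') \<in> add_frags A (dsum A (XM w Z) (XM w' Z'))"
proof -
  let ?X = "XM w Z" and ?Y = "XM w' Z'"
  have m: "right_module A ?X" "right_module A ?Y" using assms by (simp_all add: XM_right_module)
  have fg: "?X \<in> fg_modules A" "?Y \<in> fg_modules A" using assms by (simp_all add: XM_fg)
  have i: "rmod_iso A (dsum A ?X ?Y) (direct_sum ?X ?Y)" by (rule dsum_iso'[OF m])
  show "frag_of ?X \<in> add_frags A (dsum A ?X ?Y)"
    by (rule add_frags_of[OF fg(1) XM_indecomposable[OF assms(1-3)] fg(2) i])
  have "prod.swap \<in> rmod_hom A (direct_sum ?X ?Y) (direct_sum ?Y ?X)"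
    by (rule rmod_homI) (auto simp: direct_sum_def)
  moreover have "bij_betw prod.swap (carrier (direct_sum ?X ?Y)) (carrier (direct_sum ?Y ?X))"
    by (auto simp: bij_betw_def direct_sum_def)
  ultimately have "rmod_iso A (direct_sum ?X ?Y) (direct_sum ?Y ?X)" unfolding rmod_iso_def by blast
  from rmod_iso_trans[OF i this] have "rmod_iso A (dsum A ?X ?Y) (direct_sum ?Y ?X)" .
  then show "frag_of ?Y \<in> add_frags A (dsum A ?X ?Y)"
    by (rule add_frags_of[OF fg(2) XM_indecomposable[OF assms(4-6)] fg(1)])
qed

end

section \<open>The values of \<open>f\<^sub>k\<close>\<close>

text \<open>With the residue shifted to \<open>1 \<le> r \<le> k\<close>, the same \<open>a\<close>
  serves all branches of \<open>f_bound\<close>. For \<open>k \<ge> 3\<close> the multiples of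
  \<open>k\<close> join the last branch as \<open>r = k\<close>.\<close>

lemma f_bound_cases:
  assumes k: "2 \<le> k" and n: "1 \<le> n"
  obtains a where "n = k * a + 1" "f_bound k n = 2 * a + 1"
  | a where "n = k * a + 2" "f_bound k n = 2 * a + 2"
  | a r where "n = k * a + r" "3 \<le> r" "r \<le> k" "f_bound k n = 2 * a + 3"
proof -
  define a where "a = (n - 1) div k"
  define r where "r = Suc ((n - 1) mod k)"
  have nr: "n = k * a + r" using n by (simp add: a_def r_def)
  have r: "1 \<le> r" "r \<le> k" using k mod_less_divisor[of k "n - 1"] by (simp_all add: r_def Suc_leI)
  have nm: "n mod k = r mod k" unfolding nr by simp
  consider (1) "r = 1" | (2) "r = 2" | (3) "3 \<le> r" using r by linarith
  then show ?thesis
  proof cases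
    case 1
    have "(n - 1) div k = a" by (simp add: a_def)
    then have "f_bound k n = 2 * a + 1" unfolding f_bound_def nm 1 using n by simp
    then show ?thesis using that(1) nr 1 by simp
  next
    case 2
    \<comment> \<open>For \<open>k = 2\<close> the second residue class is that of 0, which still
      differs from that of 1.\<close>
    have "2 mod k \<noteq> 1 mod k" using k by (cases "k = 2") auto
    moreover have "(n - 2) div k = a" using nr 2 k by simp
    ultimately have "f_bound k n = 2 * a + 2" unfolding f_bound_def nm 2 using n by simp
    then show ?thesis using that(2) nr 2 by simp
  next
    case 3
    have "r mod k \<noteq> 1 mod k" using k r 3 by (cases "r = k") simp_all
    moreover have "r mod k \<noteq> 2 mod k" using k r 3 by (cases "r = k") simp_all
    \<comment> \<open>Since \<open>1 \<le> r - 2 < k\<close>, the quotient exceeds \<open>a\<close>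
      and is at most \<open>a + 1\<close>.\<close>
    moreover have "\<lceil>(real n - 2) / real k\<rceil> = int a + 1"
    proof (rule ceiling_unique)
      have "real n = real k * real a + real r" unfolding nr by simp
      then have e: "(real n - 2) / real k = real a + (real r - 2) / real k" using k by (simp add: field_simps)
      show "of_int (int a + 1) - 1 < (real n - 2) / real k" unfolding e using 3 k by simp
      have "(real r - 2) / real k \<le> 1" using r k by (simp add: divide_le_eq)
      then show "(real n - 2) / real k \<le> of_int (int a + 1)" unfolding e by simp
    qed
    ultimately have "f_bound k n = 2 * a + 3" unfolding f_bound_def nm using n by (simp add: nat_add_distrib)
    then show ?thesis using that(3) nr r 3 by simp
  qed
qed

context coeff_algebra
begin

lemma reach_mono: "i \<le> j \<Longrightarrow> reach i \<le> reach j"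
proof (rule lift_Suc_mono_le[of reach])
  show "reach d \<le> reach (Suc d)" for d
    using k_ge by (cases "even d") (auto simp: reach_def elim!: evenE oddE)
qed assumption

text \<open>\<open>reach\<close> takes the values 0, 1, k, k+1, 2k, ... and
  \<open>f_bound k n\<close> is one more than the first index at which \<open>n - 1\<close> is
  reached. For \<open>n = 1\<close> this index is 0, so nothing precedes it.\<close>

lemma reach_f_bound:
  assumes n: "1 \<le> n"
  shows "f_bound k n \<le> m \<Longrightarrow> 0 < m \<and> n \<le> Suc (reach (m - 1))"
    and "2 \<le> n \<Longrightarrow> 2 \<le> f_bound k n \<and> Suc (reach (f_bound k n - 2)) < n"
proof -
  define f where "f = f_bound k n"
  have "0 < f \<and> n \<le> Suc (reach (f - 1)) \<and> (2 \<le> n \<longrightarrow> 2 \<le> f \<and> Suc (reach (f - 2)) < n)"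
  proof (cases rule: f_bound_cases[OF k_ge n, folded f_def, case_names 1 2 3])
    case (1 a)
    have "2 * a - Suc 0 = Suc (2 * b)" if "a = Suc b" for b using that by simp
    then show ?thesis using k_ge unfolding 1 by (cases a) (simp_all add: reach_def)
  next
    case (2 a)
    show ?thesis unfolding 2 by (simp add: reach_def)
  next
    case (3 a r)
    have "2 * a + 3 - 1 = 2 * (a + 1)" "2 * a + 3 - 2 = Suc (2 * a)" by simp_all
    then show ?thesis using 3(2,3) unfolding 3(1,4) by (simp add: reach_def)
  qed
  note * = this[unfolded f_def]
  show "2 \<le> n \<Longrightarrow> 2 \<le> f_bound k n \<and> Suc (reach (f_bound k n - 2)) < n" using * by simp
  assume "f_bound k n \<le> m"
  then show "0 < m \<and> n \<le> Suc (reach (m - 1))"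
    using * reach_mono[OF diff_le_mono[of "f_bound k n" m 1]] by linarith
qed

lemma phi_dim_le:
  assumes "verts Q \<noteq> {}"
  shows "phi_dim A \<le> enat (f_bound k (card (verts Q)))"
proof -
  have "1 \<le> card (verts Q)" using assms finite_verts by (simp add: Suc_leI card_gt_0_iff)
  then show ?thesis
    unfolding phi_dim_def using reach_f_bound(1) by (intro SUP_least) (auto intro!: phi_le)
qed

lemma phi_dim_eq:
  assumes V: "verts Q \<noteq> {}" and M: "M \<in> fg_modules A" and c: "c \<in> add_frags A M"
    and m: "Suc m = f_bound k (card (verts Q))"
    and z: "K0_eq A ((Syz ^^ Suc m) c) 0" "\<not> K0_eq A ((Syz ^^ m) c) 0"
  shows "phi_dim A = enat (f_bound k (card (verts Q)))"
proof (rule antisym)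
  have "1 \<le> card (verts Q)" using V finite_verts by (simp add: Suc_leI card_gt_0_iff)
  have "m < phi A M"
    by (rule phi_gt[OF _ c z]) (rule reach_f_bound(1)[OF \<open>1 \<le> card (verts Q)\<close>])
  then have "f_bound k (card (verts Q)) \<le> phi A M" using m by simp
  then show "enat (f_bound k (card (verts Q))) \<le> phi_dim A"
    unfolding phi_dim_def using M by (intro SUP_upper2[of M]) simp_all
qed (rule phi_dim_le[OF V])

end

section \<open>A quiver attaining the bound\<close>

text \<open>Each vertex \<open>i\<close> has the arrows \<open>i \<rightarrow> 0\<close> (numbered \<open>i\<close>) and \<open>i \<rightarrow> min (i + 1) (n - 1)\<close> (numbered \<open>n + i\<close>).\<close>

definition back_quiver :: "nat \<Rightarrow> (nat, nat) pre_digraph" where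
  "back_quiver n = \<lparr>verts = {..<n}, arcs = {..<2 * n}, tail = (\<lambda>e. e mod n),
     head = (\<lambda>e. if e < n then 0 else min (Suc (e mod n)) (n - 1))\<rparr>"

lemma back_quiver_simps [simp]:
  "verts (back_quiver n) = {..<n}" "arcs (back_quiver n) = {..<2 * n}" "tail (back_quiver n) e = e mod n"
  "head (back_quiver n) e = (if e < n then 0 else min (Suc (e mod n)) (n - 1))"
  by (simp_all add: back_quiver_def)

lemma back_quiver_fin_digraph:
  assumes "0 < n" shows "fin_digraph (back_quiver n)"
  by unfold_locales (use assms in auto)

lemma back_quiver_quiver:
  assumes n: "0 < n" shows "quiver (back_quiver n)"
proof -
  interpret fin_digraph "back_quiver n" by (rule back_quiver_fin_digraph[OF n])
  interpret S: pair_wf_digraph "mk_symmetric (back_quiver n)" by (rule wellformed_mk_symmetric)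
  have arc: "(0, i) \<in> parcs (mk_symmetric (back_quiver n))" "(i, 0) \<in> parcs (mk_symmetric (back_quiver n))"
    if "i < n" for i
  proof -
    show "(0, i) \<in> parcs (mk_symmetric (back_quiver n))"
      unfolding parcs_mk_symmetric using that by (intro UN_I[of i]) simp_all
    show "(i, 0) \<in> parcs (mk_symmetric (back_quiver n))"
      unfolding parcs_mk_symmetric using that by (intro UN_I[of i]) simp_all
  qed
  have "u \<rightarrow>\<^sup>*\<^bsub>mk_symmetric (back_quiver n)\<^esub> v" if "u < n" "v < n" for u v
  proof -
    have "u \<rightarrow>\<^sup>*\<^bsub>mk_symmetric (back_quiver n)\<^esub> 0" "0 \<rightarrow>\<^sup>*\<^bsub>mk_symmetric (back_quiver n)\<^esub> v"
      using arc that by (auto intro!: S.reachable_adjI)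
    then show ?thesis by (rule S.reachable_trans)
  qed
  then have "Digraph_Component.connected (back_quiver n)"
    unfolding Digraph_Component.connected_def strongly_connected_def using n by (simp add: lessThan_empty_iff)
  then show ?thesis unfolding quiver_def using fin_digraph_axioms by simp
qed

lemma (in coeff_algebra) Syz_iterate_Suc_comb:
  assumes "K0_eq A (Syz c) (comb y)"
  shows "K0_eq A ((Syz ^^ Suc m) c) (comb ((tr ^^ m) y))"
  unfolding funpow_Suc_right comp_apply by (rule K0_eq_trans[OF Syz_iterate_cong[OF assms] Syz_iterate_comb])

section \<open>Iterates on the extremal quiver\<close>

locale back_quiver_algebra = coeff_algebra A K "back_quiver n" k cf
  for A :: "('a, 'm) ring_scheme" (structure) and K :: "('k, 'l) ring_scheme" and n k cf +
  assumes n: "0 < n"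
begin

lemma npaths_1: "v < n \<Longrightarrow> npaths v 1 w = (if w = 0 then 1 else 0) + (if w = min (Suc v) (n - 1) then 1 else 0)"
proof -
  assume v: "v < n"
  have "{q. awalk v q w \<and> length q = 1} =
      (if w = 0 then {[v]} else {}) \<union> (if w = min (Suc v) (n - 1) then {[n + v]} else {})"
    (is "?L = ?R")
  proof (intro equalityI subsetI)
    fix q assume "q \<in> ?L"
    then obtain e where q: "q = [e]" "awalk v [e] w" by (auto simp: length_Suc_conv)
    then have e: "e < 2 * n" "e mod n = v" "head (back_quiver n) e = w" by (auto simp: awalk_Cons_iff awalk_Nil_iff)
    have "e = v \<or> e = n + v"
    proof (cases "e < n")
      case False
      then show ?thesis using e(1,2) by (auto simp: mod_if[of e n])
    qed (use e in auto)
    then show "q \<in> ?R" using e(3) q(1) v by auto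
  next
    fix q assume "q \<in> ?R"
    then show "q \<in> ?L" using v by (auto simp: awalk_Cons_iff awalk_Nil_iff split: if_splits)
  qed
  then show ?thesis unfolding npaths_def using v by (auto simp: card_insert_if)
qed

text \<open>The row vector \<open>e_i - e_(i+1)\<close> with indices capped at \<open>n - 1\<close>,
  so that it becomes zero exactly from \<open>i = n - 1\<close> on.\<close>

definition jump :: "nat \<Rightarrow> nat \<Rightarrow> int" where
  "jump i w = (if w = min i (n - 1) then 1 else 0) - (if w = min (Suc i) (n - 1) then 1 else 0)"

text \<open>Consecutive rows of the adjacency matrix share the contribution of the arrows to 0. It
  cancels in the difference, and what remains is the shift to the next index.\<close>

lemma act_jump: "w < n \<Longrightarrow> act j (jump i) w = jump (i + j) w"
proof (induction j arbitrary: i w)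
  case 0
  then show ?case by (simp add: act_0)
next
  case (Suc j)
  have 1: "act 1 (jump i) w = jump (Suc i) w" for i w
  proof -
    have "act 1 (jump i) w = (\<Sum>v\<in>{..<n}. (if v = min i (n - 1) then npaths v 1 w else 0)) -
        (\<Sum>v\<in>{..<n}. if v = min (Suc i) (n - 1) then npaths v 1 w else 0)"
      unfolding act_def sum_subtractf[symmetric] by (intro sum.cong) (auto simp: jump_def)
    also have "\<dots> = npaths (min i (n - 1)) 1 w - npaths (min (Suc i) (n - 1)) 1 w"
    proof -
      have "min i (n - 1) \<in> {..<n}" for i using n by auto
      then show ?thesis by (simp only: sum.delta[OF finite_lessThan] if_True)
    qed
    also have "\<dots> = jump (Suc i) w"
    proof -
      have "min (Suc (min i (n - 1))) (n - 1) = min (Suc i) (n - 1)" for i by linarith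
      moreover have "min i (n - 1) < n" for i using n by linarith
      ultimately show ?thesis by (simp only: npaths_1 jump_def)
    qed
    finally show ?thesis by simp
  qed
  have "act (Suc j) (jump i) w = act j (act 1 (jump i)) w" by (simp add: act_act)
  also have "\<dots> = act j (jump (Suc i)) w" using 1 by (intro act_cong) simp
  also have "\<dots> = jump (i + Suc j) w" using Suc by simp
  finally show ?case .
qed

text \<open>The arrows back to 0 let every walk continue. Hence no class [C(v,j)] with
  \<open>0 < j < k\<close> vanishes, and a combination is zero only if its coefficients are.\<close>

lemma ex_walk: "v < n \<Longrightarrow> \<exists>q w. awalk v q w \<and> length q = j"
proof (induction j arbitrary: v)
  case 0
  then show ?case by (auto simp: awalk_Nil_iff)
next
  case (Suc j)
  obtain q w where "awalk 0 q w" "length q = j" using Suc.IH[of 0] n by blast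
  then have "awalk v (v # q) w \<and> length (v # q) = Suc j" using Suc.prems by (simp add: awalk_Cons_iff)
  then show ?case by blast
qed

text \<open>The coefficients of [C(0,1)] - [C(1,1)] when \<open>n \<ge> 2\<close>.\<close>

definition start :: "nat \<Rightarrow> nat \<Rightarrow> int" where
  "start v j = (if j = 1 then jump 0 v else 0)"

lemma tr_start:
  assumes "j \<in> {1..<k}" "v < n"
  shows "(tr ^^ m) start v j = (if j = (if even m then 1 else k - 1) then jump (reach m) v else 0)"
proof (cases "even m")
  case True
  then obtain a where a: "m = 2 * a" by blast
  have "(tr ^^ m) start v j = act (k * a) (\<lambda>u. start u j) v" unfolding a using assms by (intro tr_even) simp_all
  also have "\<dots> = (if j = 1 then act (k * a) (jump 0) v else 0)"
    by (simp add: start_def act_def)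
  finally show ?thesis using assms by (simp add: act_jump reach_def a)
next
  case False
  then obtain a where "m = 2 * a + 1" by (rule oddE)
  then have a: "m = Suc (2 * a)" by simp
  have "(tr ^^ m) start v j = act (k * a + (k - j)) (\<lambda>u. start u (k - j)) v"
    unfolding a by (rule tr_odd[OF assms(1)])
  also have "\<dots> = (if j = k - 1 then act (k * a + 1) (jump 0) v else 0)"
  proof -
    have "k - j = 1 \<longleftrightarrow> j = k - 1" using assms(1) by auto
    then show ?thesis by (cases "k - j = 1") (simp_all add: start_def act_def)
  qed
  finally show ?thesis using assms by (simp add: act_jump reach_def a)
qed

lemma comb_start: "K0_eq A (comb ((tr ^^ m) start)) 0 \<longleftrightarrow> n \<le> Suc (reach m)"
proof
  assume "n \<le> Suc (reach m)"
  then have "jump (reach m) v = 0" for v by (auto simp: jump_def)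
  then show "K0_eq A (comb ((tr ^^ m) start)) 0" unfolding comb_K0_eq_zero
    by (intro ballI disjI1) (subst tr_start, simp_all)
next
  assume z: "K0_eq A (comb ((tr ^^ m) start)) 0"
  show "n \<le> Suc (reach m)"
  proof (rule ccontr)
    assume l: "\<not> n \<le> Suc (reach m)"
    define v where "v = reach m"
    define j where "j = (if even m then 1 else k - 1)"
    have v: "v < n" and j: "j \<in> {1..<k}" using l k_ge by (auto simp: v_def j_def)
    have "jump v v = 1" using l by (auto simp: jump_def v_def)
    then have ne: "(tr ^^ m) start v j \<noteq> 0" using tr_start[OF j v] by (simp add: v_def j_def)
    obtain q w where q: "awalk v q w" "length q = j" using ex_walk[OF v] by blast
    have "{q. awalk v q w \<and> length q = j} \<noteq> {}" using q by blast
    with finite_walks have "card {q. awalk v q w \<and> length q = j} \<noteq> 0" by (simp only: card_eq_0_iff) simp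
    then have np: "npaths v j w \<noteq> 0" by (simp only: npaths_def of_nat_eq_0_iff) simp
    have "v \<in> verts (back_quiver n)" using v by simp
    from z[unfolded comb_K0_eq_zero, THEN bspec, OF this, THEN bspec, OF j]
    show False using ne spec[of "\<lambda>w. npaths v j w = 0" w] np by (elim disjE) simp_all
  qed
qed

lemma loops: "awalk 0 (replicate j 0) 0"
  by (induction j) (use n in \<open>auto simp: awalk_Nil_iff awalk_Cons_iff\<close>)

lemma attained_ge_2:
  assumes n2: "2 \<le> n"
  shows "phi_dim A = enat (f_bound k n)"
proof -
  \<comment> \<open>Two paths of length \<open>k - 1\<close> from 0: arrow 0 is a loop at 0 and
    arrow \<open>n\<close> leads from 0 to 1, so they end at 0 and 1. Dividing \<open>e_0 A\<close>
    by either path gives a local module with syzygy \<open>CM 0 1\<close> or \<open>CM 1 1\<close>,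
    as \<open>k - (k - 1) = 1\<close>.\<close>
  let ?p = "replicate (k - 1) (0 :: nat)" and ?q = "replicate (k - 2) (0 :: nat) @ [n]"
  let ?X = "\<lambda>p. XM 0 (ext {(0, p)})"
  have V: "0 \<in> verts (back_quiver n)" using n by simp
  have p: "awalk 0 ?p 0" by (rule loops)
  have q: "awalk 0 ?q 1" unfolding awalk_append_iff
    using loops[of "k - 2"] n2 awalkE'[OF loops[of "k - 2"]] by (auto simp: awalk_Cons_iff awalk_Nil_iff)
  have Syz_X: "K0_eq A (frag_of (syzygy A (?X p))) (frag_of (CM w 1))" if "awalk 0 p w" "length p = k - 1" for p w
  proof -
    have "(0, p) \<in> paths" "awlast 0 p = w" using that k_ge by (auto simp: paths_iff)
    then show ?thesis using syzygy_XM_ext[OF V, of "{(0, p)}" "k - 1"] that k_ge by simp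
  qed
  have Z: "rclosed (ext {(0, p)})" "(0, []) \<notin> ext {(0, p)}" if "length p = k - 1" for p :: "nat list"
    using that k_ge by (auto simp: ext_iff)
  define c where "c = frag_of (?X ?p) - frag_of (?X ?q)"
  have lp: "length ?p = k - 1" "length ?q = k - 1" using k_ge by auto
  let ?M = "dsum A (?X ?p) (?X ?q)"
  have c: "c \<in> add_frags A ?M"
    unfolding c_def using XM_add_frags[OF Z[OF lp(1)] V Z[OF lp(2)] V] by (intro add_frags_diff)
  have M: "?M \<in> fg_modules A" using V by (intro dsum_fg XM_fg) simp_all
  have one: "1 \<in> {1..<k}" using k_ge by simp
  have "K0_eq A (Syz c) (frag_of (CM 0 1) - frag_of (CM 1 1))"
    unfolding c_def Syz_diff Syz_of by (intro K0_eq_diff Syz_X p q lp)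
  also have "frag_of (CM 0 1) - frag_of (CM 1 1) = comb start"
  proof -
    have "frag_of (CM 0 1) + frag_cmul (- 1) (frag_of (CM 1 1)) =
        comb (\<lambda>v j. (if v = 0 \<and> j = 1 then 1 else 0) + (- 1) * (if v = 1 \<and> j = 1 then 1 else 0))"
      unfolding comb_add comb_cmul using n2 one by (subst (1 2) comb_unit) auto
    also have "(\<lambda>v j. (if v = 0 \<and> j = 1 then 1 else 0) + (- 1) * (if v = 1 \<and> j = 1 then 1 else 0)) = start"
      using n2 by (intro ext) (auto simp: start_def jump_def)
    finally show ?thesis by simp
  qed
  finally have S: "K0_eq A ((Syz ^^ Suc m) c) (comb ((tr ^^ m) start))" for m by (rule Syz_iterate_Suc_comb)
  have iff: "K0_eq A ((Syz ^^ Suc m) c) 0 \<longleftrightarrow> n \<le> Suc (reach m)" for m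
    unfolding comb_start[symmetric] using K0_eq_trans[OF S[of m], of 0] K0_eq_trans[OF K0_eq_sym[OF S[of m]], of 0]
    by (intro iffI) simp_all
  let ?f = "f_bound k n"
  have f: "2 \<le> ?f" "Suc (reach (?f - 2)) < n" "n \<le> Suc (reach (?f - 1))"
    using reach_f_bound(2)[of n] reach_f_bound(1)[of n ?f] n2 by simp_all
  \<comment> \<open>The power \<open>Suc (Suc m)\<close> of \<open>Syz\<close> corresponds to the
    power \<open>Suc m = ?f - 1\<close> of \<open>tr\<close>, the first one that kills
    \<open>start\<close>.\<close>
  obtain m where m: "?f = Suc (Suc m)" using le_Suc_ex[OF f(1)] by auto
  have "K0_eq A ((Syz ^^ Suc (Suc m)) c) 0" "\<not> K0_eq A ((Syz ^^ Suc m) c) 0"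
    unfolding iff using f m by simp_all
  from phi_dim_eq[OF _ M c _ this] show ?thesis using m n by (simp add: lessThan_empty_iff)
qed

text \<open>For one vertex \<open>start\<close> is zero, so another witness is needed. The two
  arrows are loops; the simple module has two copies of \<open>CM 0 (k - 1)\<close> as syzygy, while
  dividing \<open>e_0 A\<close> by one loop leaves a module whose syzygy is one copy. The simple
  class minus twice the other is thus killed by one syzygy, yet its invariant at
  \<open>j = 1\<close> is 1: the second loop acts nontrivially on the quotient.\<close>

lemma attained_1:
  assumes n1: "n = 1"
  shows "phi_dim A = enat (f_bound k n)"
proof -
  let ?S = "CM 0 1" and ?X = "XM 0 (ext {(0, [0])})"
  have V: "0 \<in> verts (back_quiver n)" using n by simp
  have walk1: "awalk 0 [e] w \<longleftrightarrow> (e = 0 \<or> e = 1) \<and> w = 0" for e w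
    unfolding awalk_Cons_iff awalk_Nil_iff using n1 by auto
  have paths1: "(0, q) \<in> paths \<and> length q = 1 \<longleftrightarrow> q = [0] \<or> q = [1]" for q
  proof
    assume q: "(0, q) \<in> paths \<and> length q = 1"
    then obtain e where "q = [e]" by (auto simp: length_Suc_conv)
    then show "q = [0] \<or> q = [1]" using q walk1[of e] by (auto simp only: paths_iff)
  next
    assume "q = [0] \<or> q = [1]"
    then show "(0, q) \<in> paths \<and> length q = 1"
      unfolding paths_iff using walk1[of 0 0] walk1[of 1 0] k_ge by (elim disjE) auto
  qed
  have end0: "awlast 0 q = 0" if "(0, q) \<in> paths" for q
    using paths_end[OF that] n1 by simp
  have p: "(0, [0]) \<in> paths" "(0, [1]) \<in> paths" using paths1 by auto
  have 1: "K0_eq A (frag_of (syzygy A ?S)) (frag_of (CM 0 (k - 1)) + frag_of (CM 0 (k - 1)))"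
  proof -
    have e: "{q. (0, q) \<in> paths \<and> length q = 1} = {[0], [1]}" using paths1 by auto
    have sum2: "(\<Sum>q\<in>{[0], [1]}. f q) = f [0] + f [1]" for f :: "nat list \<Rightarrow> ('a, 'a list) module \<Rightarrow>\<^sub>0 int"
      by simp
    show ?thesis using syzygy_CM[OF V, of 1] unfolding e sum2 end0[OF p(1)] end0[OF p(2)] .
  qed
  have 2: "K0_eq A (frag_of (syzygy A ?X)) (frag_of (CM 0 (k - 1)))"
    using syzygy_XM_ext[OF V, of "{(0, [0])}" 1] p(1) end0[OF p(1)] by (simp del: back_quiver_simps)
  have ZS: "rclosed {x :: nat \<times> nat list. 1 \<le> length (snd x)}" "(0, []) \<notin> {x :: nat \<times> nat list. 1 \<le> length (snd x)}"
    by auto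
  have ZX: "rclosed (ext {(0 :: nat, [0 :: nat])})" "(0, []) \<notin> ext {(0 :: nat, [0 :: nat])}"
    by (auto simp: ext_iff)
  define c where "c = frag_of ?S - (frag_of ?X + frag_of ?X)"
  let ?M = "dsum A ?S ?X"
  have c: "c \<in> add_frags A ?M"
    unfolding c_def CM_def using XM_add_frags[OF ZS V ZX V] by (intro add_frags_diff add_frags_add)
  have M: "?M \<in> fg_modules A" unfolding CM_def using V by (intro dsum_fg XM_fg) simp_all
  have "K0_eq A (Syz c) (frag_of (CM 0 (k - 1)) + frag_of (CM 0 (k - 1)) - (frag_of (CM 0 (k - 1)) + frag_of (CM 0 (k - 1))))"
    unfolding c_def Syz_diff Syz_add Syz_of by (intro K0_eq_diff K0_eq_add 1 2)
  then have z: "K0_eq A ((Syz ^^ Suc 0) c) 0" by simp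
  have "tauM ?S 0 1 = 1" using tauM_CM[OF p(2), of 0 1] n by simp
  moreover have "tauM ?X 0 1 = 0"
    using tauM_XM(2)[OF ZX V V p(2)] by (simp add: ext_iff)
  ultimately have "tf 0 1 c = 1" by (simp add: c_def tf_diff tf_add tf_of)
  then have nz: "\<not> K0_eq A ((Syz ^^ 0) c) 0"
    using tf_K0_eq[OF p(2), of c 0] by (auto simp: tf_zero)
  have "f_bound k n = 1" using n1 by (simp add: f_bound_def)
  with phi_dim_eq[OF _ M c _ z nz] show ?thesis using n by (simp add: lessThan_empty_iff)
qed

lemma attained: "phi_dim A = enat (f_bound k n)"
  using attained_1 attained_ge_2 n by (cases "n = 1") auto

end

section \<open>Truncated path algebras\<close>

locale path_alg = K: field K + fin_digraph Q
  for K :: "('k, 'l) ring_scheme" and Q :: "('v, 'e) pre_digraph"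
begin

definition conv :: "('v \<times> 'e list \<Rightarrow> 'k) \<Rightarrow> ('v \<times> 'e list \<Rightarrow> 'k) \<Rightarrow> 'v \<Rightarrow> 'e list \<Rightarrow> 'k" where
  "conv f g u p = (\<Oplus>\<^bsub>K\<^esub>i\<in>{..length p}. f (u, take i p) \<otimes>\<^bsub>K\<^esub> g (awlast u (take i p), drop i p))"

text \<open>Associativity is proved for all functions with values in \<open>K\<close>, since the
  shifted function in \<open>conv_Cons\<close> disregards its vertex and may therefore leave the
  carrier of the path algebra.\<close>

abbreviation kfun :: "('v \<times> 'e list \<Rightarrow> 'k) \<Rightarrow> bool" where
  "kfun f \<equiv> \<forall>x. f x \<in> carrier K"

lemma conv_closed [simp]: "kfun f \<Longrightarrow> kfun g \<Longrightarrow> conv f g u p \<in> carrier K"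
  unfolding conv_def by (rule K.finsum_closed) auto

lemma conv_Nil: "kfun f \<Longrightarrow> kfun g \<Longrightarrow> conv f g u [] = f (u, []) \<otimes>\<^bsub>K\<^esub> g (u, [])"
  by (simp add: conv_def)

lemma conv_Cons:
  assumes "kfun f" "kfun g"
  shows "conv f g u (e # p) = f (u, []) \<otimes>\<^bsub>K\<^esub> g (u, e # p) \<oplus>\<^bsub>K\<^esub> conv (\<lambda>(v, q). f (u, e # q)) g (head Q e) p"
proof -
  have "conv f g u (e # p) = (\<Oplus>\<^bsub>K\<^esub>i\<in>{..Suc (length p)}. f (u, take i (e # p)) \<otimes>\<^bsub>K\<^esub> g (awlast u (take i (e # p)), drop i (e # p)))"
    by (simp add: conv_def)
  also have "\<dots> = (\<Oplus>\<^bsub>K\<^esub>i\<in>{..length p}. f (u, take (Suc i) (e # p)) \<otimes>\<^bsub>K\<^esub> g (awlast u (take (Suc i) (e # p)), drop (Suc i) (e # p)))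
      \<oplus>\<^bsub>K\<^esub> f (u, take 0 (e # p)) \<otimes>\<^bsub>K\<^esub> g (awlast u (take 0 (e # p)), drop 0 (e # p))"
    using assms by (intro K.finsum_Suc2) auto
  also have "\<dots> = conv (\<lambda>(v, q). f (u, e # q)) g (head Q e) p \<oplus>\<^bsub>K\<^esub> f (u, []) \<otimes>\<^bsub>K\<^esub> g (u, e # p)"
    by (simp add: conv_def)
  finally show ?thesis using assms by (simp add: K.a_comm split_beta)
qed

lemma conv_add_left:
  assumes "kfun f" "kfun f'" "kfun g"
  shows "conv (\<lambda>x. f x \<oplus>\<^bsub>K\<^esub> f' x) g u p = conv f g u p \<oplus>\<^bsub>K\<^esub> conv f' g u p"
  unfolding conv_def using assms by (subst K.finsum_addf[symmetric]) (simp_all add: K.l_distr Pi_def)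

lemma conv_add_right:
  assumes "kfun f" "kfun g" "kfun g'"
  shows "conv f (\<lambda>x. g x \<oplus>\<^bsub>K\<^esub> g' x) u p = conv f g u p \<oplus>\<^bsub>K\<^esub> conv f g' u p"
  unfolding conv_def using assms by (subst K.finsum_addf[symmetric]) (simp_all add: K.r_distr Pi_def)

lemma conv_smult_left:
  assumes "kfun f" "kfun g" "c \<in> carrier K"
  shows "conv (\<lambda>x. c \<otimes>\<^bsub>K\<^esub> f x) g u p = c \<otimes>\<^bsub>K\<^esub> conv f g u p"
  unfolding conv_def using assms by (subst K.finsum_rdistr) (simp_all add: K.m_assoc Pi_def)

lemma conv_cong: "(\<And>q. f (u, q) = f' (u, q)) \<Longrightarrow> conv f g u p = conv f' g u p"
  by (simp add: conv_def)

text \<open>Removing the first arrow shortens the path and replaces \<open>f\<close> by a shifted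
  function, hence the induction on \<open>p\<close> with \<open>f\<close> and \<open>u\<close>
  arbitrary. The cut before the first arrow is treated by distributivity.\<close>

lemma conv_assoc:
  assumes "kfun f" "kfun g" "kfun h"
  shows "conv (\<lambda>(v, q). conv f g v q) h u p = conv f (\<lambda>(v, q). conv g h v q) u p"
  using assms(1)
proof (induction p arbitrary: f u)
  case Nil
  then show ?case using assms by (simp add: conv_Nil K.m_assoc split_beta)
next
  case (Cons e p)
  let ?f = "\<lambda>(v, q). f (u, e # q)" and ?g = "\<lambda>(v, q). g (u, e # q)"
  let ?c = "f (u, [])" and ?w = "head Q e"
  have f: "kfun f" "kfun ?f" and g: "kfun g" "kfun ?g" and h: "kfun h" using Cons.prems assms by auto
  have fg: "kfun (\<lambda>(v, q). conv f g v q)" "kfun (\<lambda>(v, q). conv ?f g v q)" "kfun (\<lambda>(v, q). conv f g u (e # q))"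
    and gh: "kfun (\<lambda>(v, q). conv g h v q)" using f g h by auto
  have "conv (\<lambda>(v, q). conv f g v q) h u (e # p) =
      conv f g u [] \<otimes>\<^bsub>K\<^esub> h (u, e # p) \<oplus>\<^bsub>K\<^esub> conv (\<lambda>(v, q). conv f g u (e # q)) h ?w p"
    using conv_Cons[OF fg(1) h] by simp
  also have "conv (\<lambda>(v, q). conv f g u (e # q)) h ?w p
      = conv (\<lambda>x. ?c \<otimes>\<^bsub>K\<^esub> ?g x \<oplus>\<^bsub>K\<^esub> (case x of (v, q) \<Rightarrow> conv ?f g v q)) h ?w p"
    by (rule conv_cong) (simp add: conv_Cons[OF f(1) g(1)])
  also have "\<dots> = ?c \<otimes>\<^bsub>K\<^esub> conv ?g h ?w p \<oplus>\<^bsub>K\<^esub> conv (\<lambda>(v, q). conv ?f g v q) h ?w p"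
    using conv_add_left[of "\<lambda>x. ?c \<otimes>\<^bsub>K\<^esub> ?g x" "\<lambda>(v, q). conv ?f g v q" h] conv_smult_left[OF g(2) h, of ?c] f g h fg
    by simp
  also have "conv (\<lambda>(v, q). conv ?f g v q) h ?w p = conv ?f (\<lambda>(v, q). conv g h v q) ?w p"
    by (rule Cons.IH[OF f(2)])
  also have "conv f g u [] = ?c \<otimes>\<^bsub>K\<^esub> g (u, [])" by (rule conv_Nil[OF f(1) g(1)])
  also have "?c \<otimes>\<^bsub>K\<^esub> g (u, []) \<otimes>\<^bsub>K\<^esub> h (u, e # p) \<oplus>\<^bsub>K\<^esub>
      (?c \<otimes>\<^bsub>K\<^esub> conv ?g h ?w p \<oplus>\<^bsub>K\<^esub> conv ?f (\<lambda>(v, q). conv g h v q) ?w p) =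
      ?c \<otimes>\<^bsub>K\<^esub> conv g h u (e # p) \<oplus>\<^bsub>K\<^esub> conv ?f (\<lambda>(v, q). conv g h v q) ?w p"
    unfolding conv_Cons[OF g(1) h] using f g h gh
    by (simp add: K.r_distr K.m_assoc K.a_assoc del: split_paired_All)
  also have "\<dots> = conv f (\<lambda>(v, q). conv g h v q) u (e # p)"
    using conv_Cons[OF f(1) gh] by simp
  finally show ?case .
qed

section \<open>The path algebra as a ring\<close>

abbreviation "P \<equiv> path_algebra K Q"

lemma P_carrier: "f \<in> carrier P \<longleftrightarrow> kfun f \<and> (\<forall>x. x \<notin> qpaths Q \<longrightarrow> f x = \<zero>\<^bsub>K\<^esub>) \<and> finite {x. f x \<noteq> \<zero>\<^bsub>K\<^esub>}"
  and P_mult: "f \<otimes>\<^bsub>P\<^esub> g = (\<lambda>(u, p). conv f g u p)"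
  and P_one: "\<one>\<^bsub>P\<^esub> = (\<lambda>(u, p). if u \<in> verts Q \<and> p = [] then \<one>\<^bsub>K\<^esub> else \<zero>\<^bsub>K\<^esub>)"
  and P_zero: "\<zero>\<^bsub>P\<^esub> = (\<lambda>_. \<zero>\<^bsub>K\<^esub>)"
  and P_add: "f \<oplus>\<^bsub>P\<^esub> g = (\<lambda>x. f x \<oplus>\<^bsub>K\<^esub> g x)"
  by (simp_all add: path_algebra_def conv_def)

lemma kfunI: "f \<in> carrier P \<Longrightarrow> kfun f"
  by (simp add: P_carrier)

lemma P_closed: "f \<in> carrier P \<Longrightarrow> f x \<in> carrier K"
  using kfunI by blast

lemma qpaths_append: "(u, p @ q) \<in> qpaths Q \<longleftrightarrow> (u, p) \<in> qpaths Q \<and> (awlast u p, q) \<in> qpaths Q"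
  unfolding qpaths_def by auto

text \<open>The support of a product lies among the concatenations of paths from the two supports,
  so it is finite.\<close>

lemma P_mult_closed:
  assumes f: "f \<in> carrier P" and g: "g \<in> carrier P"
  shows "f \<otimes>\<^bsub>P\<^esub> g \<in> carrier P"
proof -
  have nz: "\<exists>i. f (u, take i p) \<noteq> \<zero>\<^bsub>K\<^esub> \<and> g (awlast u (take i p), drop i p) \<noteq> \<zero>\<^bsub>K\<^esub>" if "conv f g u p \<noteq> \<zero>\<^bsub>K\<^esub>" for u p
  proof (rule ccontr)
    assume "\<not> ?thesis"
    then have z: "f (u, take i p) = \<zero>\<^bsub>K\<^esub> \<or> g (awlast u (take i p), drop i p) = \<zero>\<^bsub>K\<^esub>" for i by blast
    have "conv f g u p = \<zero>\<^bsub>K\<^esub>" unfolding conv_def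
    proof (rule K.finsum_all_zero)
      show "f (u, take i p) \<otimes>\<^bsub>K\<^esub> g (awlast u (take i p), drop i p) = \<zero>\<^bsub>K\<^esub>" for i
        using z[of i] kfunI[OF f] kfunI[OF g] by (elim disjE) simp_all
    qed
    then show False using that by simp
  qed
  have "(u, p) \<in> qpaths Q" if nz': "conv f g u p \<noteq> \<zero>\<^bsub>K\<^esub>" for u p
  proof -
    obtain i where i: "f (u, take i p) \<noteq> \<zero>\<^bsub>K\<^esub>" "g (awlast u (take i p), drop i p) \<noteq> \<zero>\<^bsub>K\<^esub>"
      using nz[OF nz'] by (elim exE conjE)
    have "(u, take i p) \<in> qpaths Q" "(awlast u (take i p), drop i p) \<in> qpaths Q"
      using i f g unfolding P_carrier by metis+
    then show ?thesis using qpaths_append[of u "take i p" "drop i p"] by simp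
  qed
  moreover have "finite {x. (case x of (u, p) \<Rightarrow> conv f g u p) \<noteq> \<zero>\<^bsub>K\<^esub>}"
  proof (rule finite_subset)
    show "{x. (case x of (u, p) \<Rightarrow> conv f g u p) \<noteq> \<zero>\<^bsub>K\<^esub>} \<subseteq>
        (\<lambda>((u, p), (v, q)). (u, p @ q)) ` ({x. f x \<noteq> \<zero>\<^bsub>K\<^esub>} \<times> {x. g x \<noteq> \<zero>\<^bsub>K\<^esub>})"
    proof (clarify)
      fix u p assume "conv f g u p \<noteq> \<zero>\<^bsub>K\<^esub>"
      then obtain i where "f (u, take i p) \<noteq> \<zero>\<^bsub>K\<^esub>" "g (awlast u (take i p), drop i p) \<noteq> \<zero>\<^bsub>K\<^esub>" using nz by blast
      then show "(u, p) \<in> (\<lambda>((u, p), (v, q)). (u, p @ q)) ` ({x. f x \<noteq> \<zero>\<^bsub>K\<^esub>} \<times> {x. g x \<noteq> \<zero>\<^bsub>K\<^esub>})"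
        by (intro image_eqI[of _ _ "((u, take i p), (awlast u (take i p), drop i p))"]) simp_all
    qed
    show "finite ((\<lambda>((u, p), (v, q)). (u, p @ q)) ` ({x. f x \<noteq> \<zero>\<^bsub>K\<^esub>} \<times> {x. g x \<noteq> \<zero>\<^bsub>K\<^esub>}))"
      using f g by (simp add: P_carrier)
  qed
  ultimately show ?thesis using f g by (auto simp: P_carrier P_mult)
qed

lemma P_one_closed: "\<one>\<^bsub>P\<^esub> \<in> carrier P"
proof -
  have "finite {x. \<one>\<^bsub>P\<^esub> x \<noteq> \<zero>\<^bsub>K\<^esub>}"
    by (rule finite_subset[of _ "(\<lambda>u. (u, [])) ` verts Q"]) (auto simp: P_one split: if_splits)
  moreover have "(u, []) \<in> qpaths Q" if "u \<in> verts Q" for u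
    using that by (auto simp: qpaths_def awalk_Nil_iff)
  ultimately show ?thesis unfolding P_carrier by (auto simp: P_one)
qed

lemma P_one_mult:
  assumes f: "f \<in> carrier P"
  shows "\<one>\<^bsub>P\<^esub> \<otimes>\<^bsub>P\<^esub> f = f" and "f \<otimes>\<^bsub>P\<^esub> \<one>\<^bsub>P\<^esub> = f"
proof -
  note k = kfunI[OF f] kfunI[OF P_one_closed]
  have out: "f (u, p) = \<zero>\<^bsub>K\<^esub>" if "(u, p) \<notin> qpaths Q" for u p using f that by (simp add: P_carrier)
  have "conv \<one>\<^bsub>P\<^esub> f u p = f (u, p)" for u p
  proof -
    have "conv \<one>\<^bsub>P\<^esub> f u p = \<one>\<^bsub>P\<^esub> (u, take 0 p) \<otimes>\<^bsub>K\<^esub> f (awlast u (take 0 p), drop 0 p)"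
      unfolding conv_def using k by (intro K.finsum_single) (auto simp: P_one)
    moreover have "f (u, p) = \<zero>\<^bsub>K\<^esub>" if "u \<notin> verts Q" using that by (intro out) (auto simp: qpaths_def)
    ultimately show ?thesis using k by (simp add: P_one)
  qed
  then show "\<one>\<^bsub>P\<^esub> \<otimes>\<^bsub>P\<^esub> f = f" by (simp add: P_mult)
  have "conv f \<one>\<^bsub>P\<^esub> u p = f (u, p)" for u p
  proof -
    have "conv f \<one>\<^bsub>P\<^esub> u p = f (u, take (length p) p) \<otimes>\<^bsub>K\<^esub> \<one>\<^bsub>P\<^esub> (awlast u (take (length p) p), drop (length p) p)"
      unfolding conv_def using k by (intro K.finsum_single) (auto simp: P_one)
    moreover have "f (u, p) = \<zero>\<^bsub>K\<^esub>" if "awlast u p \<notin> verts Q" using that by (intro out) (auto simp: qpaths_def)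
    ultimately show ?thesis using k by (simp add: P_one)
  qed
  then show "f \<otimes>\<^bsub>P\<^esub> \<one>\<^bsub>P\<^esub> = f" by (simp add: P_mult)
qed

lemma P_add_closed: "f \<in> carrier P \<Longrightarrow> g \<in> carrier P \<Longrightarrow> f \<oplus>\<^bsub>P\<^esub> g \<in> carrier P"
  unfolding P_carrier P_add
  by (auto intro: finite_subset[of _ "{x. f x \<noteq> \<zero>\<^bsub>K\<^esub>} \<union> {x. g x \<noteq> \<zero>\<^bsub>K\<^esub>}"])

lemma P_ring: "ring P"
proof (rule ringI)
  show "abelian_group P"
  proof (rule abelian_groupI)
    show "\<zero>\<^bsub>P\<^esub> \<in> carrier P" by (simp add: P_carrier P_zero)
  next
    fix f g h assume "f \<in> carrier P" "g \<in> carrier P" "h \<in> carrier P"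
    then show "f \<oplus>\<^bsub>P\<^esub> g \<oplus>\<^bsub>P\<^esub> h = f \<oplus>\<^bsub>P\<^esub> (g \<oplus>\<^bsub>P\<^esub> h)" by (simp add: P_add kfunI K.a_assoc)
  next
    fix f g assume "f \<in> carrier P" "g \<in> carrier P"
    then show "f \<oplus>\<^bsub>P\<^esub> g = g \<oplus>\<^bsub>P\<^esub> f" by (simp add: P_add kfunI K.a_comm)
  next
    fix f assume "f \<in> carrier P"
    then show "\<zero>\<^bsub>P\<^esub> \<oplus>\<^bsub>P\<^esub> f = f" by (simp add: P_add P_zero kfunI)
  next
    fix f assume f: "f \<in> carrier P"
    have "finite {x. \<ominus>\<^bsub>K\<^esub> f x \<noteq> \<zero>\<^bsub>K\<^esub>}"
      by (rule finite_subset[of _ "{x. f x \<noteq> \<zero>\<^bsub>K\<^esub>}"]) (use f in \<open>auto simp: P_carrier\<close>)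
    then have "(\<lambda>x. \<ominus>\<^bsub>K\<^esub> f x) \<in> carrier P" using f by (simp add: P_carrier)
    moreover have "(\<lambda>x. \<ominus>\<^bsub>K\<^esub> f x) \<oplus>\<^bsub>P\<^esub> f = \<zero>\<^bsub>P\<^esub>" 
      unfolding P_add P_zero using kfunI[OF f] K.l_neg by (simp add: fun_eq_iff)
    ultimately show "\<exists>g\<in>carrier P. g \<oplus>\<^bsub>P\<^esub> f = \<zero>\<^bsub>P\<^esub>" by (intro bexI)
  qed (rule P_add_closed)
  show "monoid P"
  proof (rule monoidI)
    fix f g h assume "f \<in> carrier P" "g \<in> carrier P" "h \<in> carrier P"
    from conv_assoc[OF this[THEN kfunI]]
    show "f \<otimes>\<^bsub>P\<^esub> g \<otimes>\<^bsub>P\<^esub> h = f \<otimes>\<^bsub>P\<^esub> (g \<otimes>\<^bsub>P\<^esub> h)" by (simp only: P_mult)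
  qed (rule P_mult_closed P_one_closed P_one_mult; assumption)+
next
  fix f g h assume "f \<in> carrier P" "g \<in> carrier P" "h \<in> carrier P"
  note * = this[THEN kfunI]
  show "(f \<oplus>\<^bsub>P\<^esub> g) \<otimes>\<^bsub>P\<^esub> h = f \<otimes>\<^bsub>P\<^esub> h \<oplus>\<^bsub>P\<^esub> g \<otimes>\<^bsub>P\<^esub> h"
    unfolding P_mult P_add conv_add_left[OF *] by (simp add: fun_eq_iff)
  show "h \<otimes>\<^bsub>P\<^esub> (f \<oplus>\<^bsub>P\<^esub> g) = h \<otimes>\<^bsub>P\<^esub> f \<oplus>\<^bsub>P\<^esub> h \<otimes>\<^bsub>P\<^esub> g"
    unfolding P_mult P_add conv_add_right[OF *(3,1,2)] by (simp add: fun_eq_iff)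
qed

definition single :: "'v \<times> 'e list \<Rightarrow> 'k \<Rightarrow> 'v \<times> 'e list \<Rightarrow> 'k" where
  "single x c = (\<lambda>y. if y = x then c else \<zero>\<^bsub>K\<^esub>)"

lemma single_closed: "x \<in> qpaths Q \<Longrightarrow> c \<in> carrier K \<Longrightarrow> single x c \<in> carrier P"
  unfolding P_carrier by (auto simp: single_def intro: finite_subset[of _ "{x}"])

lemma single_mult:
  assumes "c \<in> carrier K" "d \<in> carrier K"
  shows "single (u, p) c \<otimes>\<^bsub>P\<^esub> single (awlast u p, q) d = single (u, p @ q) (c \<otimes>\<^bsub>K\<^esub> d)"
proof -
  have "conv (single (u, p) c) (single (awlast u p, q) d) v r = single (u, p @ q) (c \<otimes>\<^bsub>K\<^esub> d) (v, r)" for v r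
  proof (cases "(v, r) = (u, p @ q)")
    case True
    have other: "single (u, p) c (v, take i r) = \<zero>\<^bsub>K\<^esub>" if "i \<le> length r" "i \<noteq> length p" for i
    proof -
      have "length (take i r) \<noteq> length p" using that by simp
      then have "take i r \<noteq> p" by blast
      then show ?thesis by (simp add: single_def)
    qed
    have cl: "kfun (single x c)" "kfun (single x d)" for x using assms by (simp_all add: single_def)
    have "conv (single (u, p) c) (single (awlast u p, q) d) v r =
        single (u, p) c (v, take (length p) r) \<otimes>\<^bsub>K\<^esub> single (awlast u p, q) d (awlast v (take (length p) r), drop (length p) r)"
      unfolding conv_def using True other cl by (intro K.finsum_single) auto
    then show ?thesis using True by (simp add: single_def)
  next
    case False
    have "single (u, p) c (v, take i r) \<otimes>\<^bsub>K\<^esub> single (awlast u p, q) d (awlast v (take i r), drop i r) = \<zero>\<^bsub>K\<^esub>" for i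
    proof (cases "v = u \<and> take i r = p \<and> drop i r = q")
      case True
      then show ?thesis using False append_take_drop_id[of i r] by simp
    qed (use assms in \<open>auto simp: single_def\<close>)
    then have "conv (single (u, p) c) (single (awlast u p, q) d) v r = \<zero>\<^bsub>K\<^esub>"
      unfolding conv_def by (intro K.finsum_all_zero) blast
    then show ?thesis using False by (simp only: single_def if_False)
  qed
  then show ?thesis by (simp add: P_mult fun_eq_iff)
qed

text \<open>Finite support makes \<open>f\<close> a finite sum of scalar multiples of paths, each of
  them in the support of \<open>f\<close>.\<close>

lemma single_induct:
  assumes f: "f \<in> carrier P" and zero: "\<zero>\<^bsub>P\<^esub> \<in> S" and add: "\<And>g h. g \<in> S \<Longrightarrow> h \<in> S \<Longrightarrow> g \<oplus>\<^bsub>P\<^esub> h \<in> S"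
    and s: "\<And>u p c. (u, p) \<in> qpaths Q \<Longrightarrow> f (u, p) \<noteq> \<zero>\<^bsub>K\<^esub> \<Longrightarrow> c \<in> carrier K \<Longrightarrow> single (u, p) c \<in> S"
  shows "f \<in> S"
proof -
  have "finite T \<Longrightarrow> T \<subseteq> {x. f x \<noteq> \<zero>\<^bsub>K\<^esub>} \<Longrightarrow> (\<lambda>x. if x \<in> T then f x else \<zero>\<^bsub>K\<^esub>) \<in> S" for T
  proof (induction T rule: finite_induct)
    case empty
    then show ?case using zero by (simp add: P_zero)
  next
    case (insert x T)
    obtain u p where x: "x = (u, p)" by fastforce
    have nz: "f (u, p) \<noteq> \<zero>\<^bsub>K\<^esub>" using insert.prems x by simp
    then have q: "(u, p) \<in> qpaths Q" using f unfolding P_carrier by blast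
    have fx: "f x \<in> carrier K" for x using kfunI[OF f] by blast
    have "single x (f x) \<oplus>\<^bsub>P\<^esub> (\<lambda>x. if x \<in> T then f x else \<zero>\<^bsub>K\<^esub>) \<in> S"
      unfolding x using insert s[OF q nz] fx by (intro add) auto
    also have "single x (f x) \<oplus>\<^bsub>P\<^esub> (\<lambda>x. if x \<in> T then f x else \<zero>\<^bsub>K\<^esub>) = (\<lambda>y. if y \<in> insert x T then f y else \<zero>\<^bsub>K\<^esub>)"
      using insert.hyps fx by (auto simp: P_add single_def fun_eq_iff)
    finally show ?case .
  qed
  from this[of "{x. f x \<noteq> \<zero>\<^bsub>K\<^esub>}"] f
  have "(\<lambda>x. if x \<in> {x. f x \<noteq> \<zero>\<^bsub>K\<^esub>} then f x else \<zero>\<^bsub>K\<^esub>) \<in> S" by (simp add: P_carrier)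
  also have "(\<lambda>x. if x \<in> {x. f x \<noteq> \<zero>\<^bsub>K\<^esub>} then f x else \<zero>\<^bsub>K\<^esub>) = f" by (rule ext) simp
  finally show ?thesis .
qed

section \<open>Powers of the arrow ideal as spaces of functions on long paths\<close>

definition L :: "nat \<Rightarrow> ('v \<times> 'e list \<Rightarrow> 'k) set" where
  "L t = {f \<in> carrier P. \<forall>u p. length p < t \<longrightarrow> f (u, p) = \<zero>\<^bsub>K\<^esub>}"

lemma L_mult:
  assumes f: "f \<in> L s" and g: "g \<in> L t"
  shows "f \<otimes>\<^bsub>P\<^esub> g \<in> L (s + t)"
proof -
  have c: "f \<in> carrier P" "g \<in> carrier P" using f g by (simp_all add: L_def)
  have "conv f g u p = \<zero>\<^bsub>K\<^esub>" if p: "length p < s + t" for u p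
    unfolding conv_def
  proof (rule K.finsum_all_zero)
    fix i assume "i \<in> {..length p}"
    then have "length (take i p) < s \<or> length (drop i p) < t" using p by auto
    then have "f (u, take i p) = \<zero>\<^bsub>K\<^esub> \<or> g (awlast u (take i p), drop i p) = \<zero>\<^bsub>K\<^esub>" using f g unfolding L_def by blast
    then show "f (u, take i p) \<otimes>\<^bsub>K\<^esub> g (awlast u (take i p), drop i p) = \<zero>\<^bsub>K\<^esub>"
      using kfunI[OF c(1)] kfunI[OF c(2)] by (elim disjE) simp_all
  qed
  then show ?thesis using P_mult_closed[OF c] by (simp add: L_def P_mult)
qed

lemma L_0: "L 0 = carrier P"
  by (simp add: L_def)

lemma L_add: "f \<in> L t \<Longrightarrow> g \<in> L t \<Longrightarrow> f \<oplus>\<^bsub>P\<^esub> g \<in> L t"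
  by (auto simp: L_def P_add_closed) (simp add: P_add)

lemma L_zero: "\<zero>\<^bsub>P\<^esub> \<in> L t"
  using ring.ring_simprules(2)[OF P_ring] by (simp add: L_def P_zero)

lemma P_minus: "f \<in> carrier P \<Longrightarrow> \<ominus>\<^bsub>P\<^esub> f = (\<lambda>x. \<ominus>\<^bsub>K\<^esub> f x)"
proof -
  assume f: "f \<in> carrier P"
  interpret P: ring P by (rule P_ring)
  have "(\<ominus>\<^bsub>P\<^esub> f) x = \<ominus>\<^bsub>K\<^esub> f x" for x
  proof -
    have "(\<ominus>\<^bsub>P\<^esub> f \<oplus>\<^bsub>P\<^esub> f) x = \<zero>\<^bsub>K\<^esub>" unfolding P.l_neg[OF f] by (simp add: P_zero)
    then show ?thesis
      by (intro K.minus_equality[symmetric]) (simp_all add: P_add P_closed f P.a_inv_closed)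
  qed
  then show ?thesis by blast
qed

lemma L_ideal: "ideal (L t) P"
proof (rule idealI[OF P_ring])
  interpret P: ring P by (rule P_ring)
  show "subgroup (L t) (add_monoid P)"
  proof (rule P.add.subgroupI)
    fix f assume f: "f \<in> L t"
    then have c: "f \<in> carrier P" by (simp add: L_def)
    show "\<ominus>\<^bsub>P\<^esub> f \<in> L t" unfolding L_def using f P.a_inv_closed[OF c] P_minus[OF c] by (simp add: L_def)
  qed (use L_zero L_add in \<open>auto simp: L_def\<close>)
qed (use L_mult[of _ t _ 0] L_mult[of _ 0 _ t] in \<open>simp_all add: L_0\<close>)

lemma arrow_elem_eq: "arrow_elem K Q e = single (tail Q e, [e]) \<one>\<^bsub>K\<^esub>"
  by (simp add: arrow_elem_def single_def)

lemma qpaths_single: "e \<in> arcs Q \<Longrightarrow> (tail Q e, [e]) \<in> qpaths Q"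
  by (auto simp: qpaths_def awalk_Cons_iff awalk_Nil_iff)

lemma arrow_elem_L: "e \<in> arcs Q \<Longrightarrow> arrow_elem K Q e \<in> L 1"
  unfolding L_def using single_closed[OF qpaths_single] by (simp add: arrow_elem_eq) (simp add: single_def)

text \<open>A nontrivial path is its first arrow times a path, so it belongs to every ideal
  containing the arrows; conversely \<open>L 1\<close> is an ideal that contains them.\<close>

lemma arrow_ideal_eq: "arrow_ideal K Q = L 1"
proof
  interpret P: ring P by (rule P_ring)
  have sub: "arrow_elem K Q ` arcs Q \<subseteq> L 1" using arrow_elem_L by blast
  then show "arrow_ideal K Q \<subseteq> L 1" unfolding arrow_ideal_def by (rule P.genideal_minimal[OF L_ideal])
  have car: "arrow_elem K Q ` arcs Q \<subseteq> carrier P" using sub by (auto simp: L_def)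
  interpret J: ideal "arrow_ideal K Q" P unfolding arrow_ideal_def by (rule P.genideal_ideal[OF car])
  show "L 1 \<subseteq> arrow_ideal K Q"
  proof
    fix f assume f: "f \<in> L 1"
    show "f \<in> arrow_ideal K Q"
    proof (rule single_induct)
      fix u p c assume p: "(u, p) \<in> qpaths Q" "f (u, p) \<noteq> \<zero>\<^bsub>K\<^esub>" and c: "c \<in> carrier K"
      then obtain e q where q: "p = [e] @ q" using f by (cases p) (auto simp: L_def)
      have e: "e \<in> arcs Q" "u = tail Q e" using p(1) unfolding q qpaths_def by (auto simp: awalk_Cons_iff)
      have "(awlast u [e], q) \<in> qpaths Q" using p(1) unfolding q qpaths_append by simp
      then have s: "single (awlast u [e], q) c \<in> carrier P" using c by (rule single_closed)
      have "arrow_elem K Q e \<otimes>\<^bsub>P\<^esub> single (awlast u [e], q) c = single (u, p) c"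
        unfolding arrow_elem_eq e(2)[symmetric] using c by (subst single_mult) (simp_all add: q)
      moreover have "arrow_elem K Q e \<in> arrow_ideal K Q"
        unfolding arrow_ideal_def by (rule subsetD[OF P.genideal_self[OF car]]) (use e(1) in simp)
      then have "arrow_elem K Q e \<otimes>\<^bsub>P\<^esub> single (awlast u [e], q) c \<in> arrow_ideal K Q" by (rule J.I_r_closed[OF _ s])
      ultimately show "single (u, p) c \<in> arrow_ideal K Q" by simp
    next
      show "f \<in> carrier P" using f by (simp add: L_def)
    qed (rule J.zero_closed J.a_closed; assumption?)+
  qed
qed

lemma L_Suc: "ideal_prod P (L t) (L 1) = L (Suc t)"
proof
  show "ideal_prod P (L t) (L 1) \<subseteq> L (Suc t)"
  proof
    fix f assume "f \<in> ideal_prod P (L t) (L 1)"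
    then show "f \<in> L (Suc t)"
      by (induction rule: ideal_prod.induct) (use L_mult[of _ t _ 1] L_add in auto)
  qed
  show "L (Suc t) \<subseteq> ideal_prod P (L t) (L 1)"
  proof
    fix f assume f: "f \<in> L (Suc t)"
    show "f \<in> ideal_prod P (L t) (L 1)"
    proof (rule single_induct)
      have "\<zero>\<^bsub>P\<^esub> \<otimes>\<^bsub>P\<^esub> \<zero>\<^bsub>P\<^esub> \<in> ideal_prod P (L t) (L 1)" by (intro ideal_prod.prod L_zero)
      then show "\<zero>\<^bsub>P\<^esub> \<in> ideal_prod P (L t) (L 1)" using ring.ring_simprules(2,24)[OF P_ring] by simp
    next
      fix u p c assume p: "(u, p) \<in> qpaths Q" "f (u, p) \<noteq> \<zero>\<^bsub>K\<^esub>" and c: "c \<in> carrier K"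
      have lp: "length p > t"
      proof (rule ccontr)
        assume "\<not> length p > t"
        then have "length p < Suc t" by simp
        then show False using f p(2) by (simp add: L_def)
      qed
      \<comment> \<open>The last arrow is split off, matching the right factor \<open>L 1\<close> in
        the product of ideals.\<close>
      then obtain q e where q: "p = q @ [e]" by (cases p rule: rev_cases) auto
      have e: "(u, q) \<in> qpaths Q" "(awlast u q, [e]) \<in> qpaths Q" using p(1) unfolding q qpaths_append by simp_all
      then have e': "e \<in> arcs Q" "awlast u q = tail Q e" unfolding qpaths_def by (auto simp: awalk_Cons_iff)
      have "single (u, q) c \<in> L t"
        using single_closed[OF e(1) c] lp q unfolding L_def by (auto simp: single_def)
      then have "single (u, q) c \<otimes>\<^bsub>P\<^esub> arrow_elem K Q e \<in> ideal_prod P (L t) (L 1)"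
        using arrow_elem_L[OF e'(1)] by (rule ideal_prod.prod)
      also have "single (u, q) c \<otimes>\<^bsub>P\<^esub> arrow_elem K Q e = single (u, p) c"
        unfolding arrow_elem_eq e'(2)[symmetric] q using c by (subst single_mult) simp_all
      finally show "single (u, p) c \<in> ideal_prod P (L t) (L 1)" .
    next
      show "f \<in> carrier P" using f by (simp add: L_def)
    qed (rule ideal_prod.sum)
  qed
qed

lemma ideal_power_eq: "ideal_power P (arrow_ideal K Q) k = L k"
  unfolding ideal_power_def arrow_ideal_eq by (induction k) (simp_all add: L_0 L_Suc[unfolded One_nat_def])

lemma truncated_eq: "truncated_path_algebra K Q k = P Quot L k"
  by (simp add: truncated_path_algebra_def ideal_power_eq)

text \<open>Representatives of a coset of \<open>L k\<close> agree on all paths of length below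
  \<open>k\<close>, so the choice does not influence the value.\<close>

definition coset_coeff :: "nat \<Rightarrow> ('v \<times> 'e list \<Rightarrow> 'k) set \<Rightarrow> 'v \<times> 'e list \<Rightarrow> 'k" where
  "coset_coeff k X x = (if length (snd x) < k then (SOME f. f \<in> X) x else \<zero>\<^bsub>K\<^esub>)"

lemma coset_iff:
  assumes f: "f \<in> carrier P" and g: "g \<in> carrier P"
  shows "L k +>\<^bsub>P\<^esub> f = L k +>\<^bsub>P\<^esub> g \<longleftrightarrow> (\<forall>u p. length p < k \<longrightarrow> f (u, p) = g (u, p))"
proof -
  interpret P: ring P by (rule P_ring)
  interpret L: ideal "L k" P by (rule L_ideal)
  have "L k +>\<^bsub>P\<^esub> f = L k +>\<^bsub>P\<^esub> g \<longleftrightarrow> f \<ominus>\<^bsub>P\<^esub> g \<in> L k"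
    using P.quotient_eq_iff_same_a_r_cos[OF L_ideal f g] by (rule sym)
  also have "\<dots> \<longleftrightarrow> (\<forall>u p. length p < k \<longrightarrow> f (u, p) = g (u, p))"
  proof -
    have "(f \<ominus>\<^bsub>P\<^esub> g) x = f x \<ominus>\<^bsub>K\<^esub> g x" for x
      by (simp only: a_minus_def P_add P_minus[OF g])
    note d = this
    have "(f \<ominus>\<^bsub>P\<^esub> g) x = \<zero>\<^bsub>K\<^esub> \<longleftrightarrow> f x = g x" for x
    proof -
      have c: "f x \<in> carrier K" "g x \<in> carrier K" by (simp_all only: P_closed f g)
      have "f x = g x" if "f x \<ominus>\<^bsub>K\<^esub> g x = \<zero>\<^bsub>K\<^esub>"
        using K.minus_equality[of "f x" "\<ominus>\<^bsub>K\<^esub> g x"] that c by (simp add: a_minus_def)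
      then show ?thesis unfolding d using c by (auto simp: a_minus_def K.r_neg)
    qed
    then show ?thesis using P.minus_closed[OF f g] by (simp only: L_def mem_Collect_eq) simp
  qed
  finally show ?thesis .
qed

lemma coset_coeff_coset:
  assumes f: "f \<in> carrier P"
  shows "coset_coeff k (L k +>\<^bsub>P\<^esub> f) (u, p) = (if length p < k then f (u, p) else \<zero>\<^bsub>K\<^esub>)"
proof -
  interpret P: ring P by (rule P_ring)
  interpret L: ideal "L k" P by (rule L_ideal)
  let ?g = "SOME g. g \<in> L k +>\<^bsub>P\<^esub> f"
  have g: "?g \<in> L k +>\<^bsub>P\<^esub> f" using L.a_rcos_self[OF f] by (rule someI[of "\<lambda>g. g \<in> L k +>\<^bsub>P\<^esub> f"])
  then have "L k +>\<^bsub>P\<^esub> f = L k +>\<^bsub>P\<^esub> ?g" using L.a_repr_independence'[OF g f] by simp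
  moreover have "?g \<in> carrier P" using g P.a_r_coset_subset_G[OF L.a_subset f] by blast
  ultimately show ?thesis using coset_iff[OF f, of ?g k] by (simp add: coset_coeff_def)
qed

lemma truncated_coeff_algebra:
  assumes k: "2 \<le> k" and V: "verts Q \<noteq> {}"
  shows "coeff_algebra (truncated_path_algebra K Q k) K Q k (coset_coeff k)"
proof -
  interpret P: ring P by (rule P_ring)
  interpret L: ideal "L k" P by (rule L_ideal)
  interpret A: ring "P Quot L k" by (rule L.quotient_is_ring)
  let ?cl = "\<lambda>f. L k +>\<^bsub>P\<^esub> f"
  have car: "carrier (P Quot L k) = ?cl ` carrier P" unfolding FactRing_def A_RCOSETS_def' by auto
  have add: "?cl f \<oplus>\<^bsub>P Quot L k\<^esub> ?cl g = ?cl (f \<oplus>\<^bsub>P\<^esub> g)"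
    and mult: "?cl f \<otimes>\<^bsub>P Quot L k\<^esub> ?cl g = ?cl (f \<otimes>\<^bsub>P\<^esub> g)"
    if "f \<in> carrier P" "g \<in> carrier P" for f g
    using that by (simp_all add: FactRing_def L.a_rcos_sum L.rcoset_mult_add)
  have one: "\<one>\<^bsub>P Quot L k\<^esub> = ?cl \<one>\<^bsub>P\<^esub>" and zero: "\<zero>\<^bsub>P Quot L k\<^esub> = ?cl \<zero>\<^bsub>P\<^esub>"
    using P.a_coset_join2[OF P.zero_closed L.a_subgroup] L_zero by (simp_all add: FactRing_def)
  note cc = coset_coeff_coset
  have cf_one: "coset_coeff k \<one>\<^bsub>P Quot L k\<^esub> (u, p) = (if u \<in> verts Q \<and> p = [] then \<one>\<^bsub>K\<^esub> else \<zero>\<^bsub>K\<^esub>)" for u p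
    unfolding one cc[OF P.one_closed] using k by (simp add: P_one)
  \<comment> \<open>As there are finitely many short paths, every function on them has finite
    support and comes from the path algebra; this gives surjectivity of the coefficient map.\<close>
  have fin: "finite {x \<in> qpaths Q. length (snd x) < k}"
  proof (rule finite_subset)
    show "{x \<in> qpaths Q. length (snd x) < k} \<subseteq> verts Q \<times> {p. set p \<subseteq> arcs Q \<and> length p \<le> k}"
      by (auto simp: qpaths_def awalk_def)
    show "finite (verts Q \<times> {p. set p \<subseteq> arcs Q \<and> length p \<le> k})"
      by (intro finite_cartesian_product finite_verts finite_lists_length_le finite_arcs)
  qed
  show ?thesis unfolding truncated_eq
  proof unfold_locales
    obtain v where v: "v \<in> verts Q" using V by blast
    have "coset_coeff k \<one>\<^bsub>P Quot L k\<^esub> (v, []) \<noteq> coset_coeff k \<zero>\<^bsub>P Quot L k\<^esub> (v, [])"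
      unfolding cf_one unfolding zero cc[OF P.zero_closed] using v by (simp add: P_zero)
    then show "\<one>\<^bsub>P Quot L k\<^esub> \<noteq> \<zero>\<^bsub>P Quot L k\<^esub>" by metis
  next
    show "bij_betw (coset_coeff k) (carrier (P Quot L k)) {f. (\<forall>x. f x \<in> carrier K) \<and>
          (\<forall>x. x \<notin> {x \<in> qpaths Q. length (snd x) < k} \<longrightarrow> f x = \<zero>\<^bsub>K\<^esub>)}" (is "bij_betw _ _ ?T")
      unfolding bij_betw_def
    proof (intro conjI equalityI subsetI)
      show "inj_on (coset_coeff k) (carrier (P Quot L k))"
      proof (rule inj_onI)
        fix X Y assume "X \<in> carrier (P Quot L k)" "Y \<in> carrier (P Quot L k)" and e: "coset_coeff k X = coset_coeff k Y"
        then obtain f g where fg: "f \<in> carrier P" "X = ?cl f" "g \<in> carrier P" "Y = ?cl g" unfolding car by blast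
        have "f (u, p) = g (u, p)" if "length p < k" for u p
          using fun_cong[OF e, of "(u, p)"] that unfolding fg(2,4) cc[OF fg(1)] cc[OF fg(3)] by simp
        then show "X = Y" unfolding fg(2,4) coset_iff[OF fg(1,3)] by blast
      qed
    next
      fix h assume "h \<in> coset_coeff k ` carrier (P Quot L k)"
      then obtain f where f: "f \<in> carrier P" "h = coset_coeff k (?cl f)" unfolding car by blast
      show "h \<in> ?T" using f(1) unfolding f(2) by (auto simp: cc[OF f(1)] P_carrier)
    next
      fix h assume h: "h \<in> ?T"
      have "finite {x. h x \<noteq> \<zero>\<^bsub>K\<^esub>}" by (rule finite_subset[OF _ fin]) (use h in blast)
      then have hP: "h \<in> carrier P" using h unfolding P_carrier by blast
      have "coset_coeff k (?cl h) = h"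
      proof (rule ext)
        fix x show "coset_coeff k (?cl h) x = h x" using h by (cases x) (auto simp: cc[OF hP])
      qed
      then show "h \<in> coset_coeff k ` carrier (P Quot L k)" unfolding car using hP by (metis imageI)
    qed
  next
    fix X Y x assume "X \<in> carrier (P Quot L k)" "Y \<in> carrier (P Quot L k)"
    then obtain f g where fg: "f \<in> carrier P" "X = ?cl f" "g \<in> carrier P" "Y = ?cl g" unfolding car by blast
    show "coset_coeff k (X \<oplus>\<^bsub>P Quot L k\<^esub> Y) x = coset_coeff k X x \<oplus>\<^bsub>K\<^esub> coset_coeff k Y x"
      unfolding fg(2,4) add[OF fg(1,3)]
      by (cases x) (simp add: cc[OF fg(1)] cc[OF fg(3)] cc[OF P.a_closed[OF fg(1,3)]], simp add: P_add)
  next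
    fix X Y u and p :: "'e list"
    assume "X \<in> carrier (P Quot L k)" "Y \<in> carrier (P Quot L k)" and p: "length p < k"
    then obtain f g where fg: "f \<in> carrier P" "X = ?cl f" "g \<in> carrier P" "Y = ?cl g" unfolding car by blast
    have l: "length (take i p) < k" "length (drop i p) < k" for i using p by simp_all
    have "coset_coeff k (X \<otimes>\<^bsub>P Quot L k\<^esub> Y) (u, p) = conv f g u p"
      unfolding fg(2,4) mult[OF fg(1,3)] cc[OF P.m_closed[OF fg(1,3)]] using p by (simp add: P_mult)
    also have "\<dots> = (\<Oplus>\<^bsub>K\<^esub>i\<in>{..length p}. coset_coeff k X (u, take i p) \<otimes>\<^bsub>K\<^esub> coset_coeff k Y (awlast u (take i p), drop i p))"
      unfolding fg(2,4) cc[OF fg(1)] cc[OF fg(3)] conv_def by (simp only: l if_True)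
    finally show "coset_coeff k (X \<otimes>\<^bsub>P Quot L k\<^esub> Y) (u, p) =
        (\<Oplus>\<^bsub>K\<^esub>i\<in>{..length p}. coset_coeff k X (u, take i p) \<otimes>\<^bsub>K\<^esub> coset_coeff k Y (awlast u (take i p), drop i p))" .
  qed (use k cf_one in auto)
qed

end

theorem corollary4p20:
  fixes K :: "('k, 'm) ring_scheme" and k n :: nat
  assumes "field K" and "k \<ge> 2" and "n \<ge> 1"
  shows "(\<forall>Q :: ('v, 'e) pre_digraph. quiver Q \<and> card (verts Q) = n \<longrightarrow>
             phi_dim (truncated_path_algebra K Q k) \<le> enat (f_bound k n)) \<and>
         (\<exists>Q :: (nat, nat) pre_digraph. quiver Q \<and> card (verts Q) = n \<and>
             phi_dim (truncated_path_algebra K Q k) = enat (f_bound k n))"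
proof (intro conjI allI impI exI[of _ "back_quiver n"])
  fix Q :: "('v, 'e) pre_digraph"
  assume Q: "quiver Q \<and> card (verts Q) = n"
  interpret field K by fact
  interpret fin_digraph Q using Q by (simp add: quiver_def)
  interpret path_alg K Q ..
  have V: "verts Q \<noteq> {}" using Q assms(3) by auto
  interpret coeff_algebra "truncated_path_algebra K Q k" K Q k "coset_coeff k"
    by (rule truncated_coeff_algebra[OF assms(2) V])
  show "phi_dim (truncated_path_algebra K Q k) \<le> enat (f_bound k n)"
    using phi_dim_le[OF V] Q by simp
next
  have n: "0 < n" using assms(3) by simp
  interpret field K by fact
  interpret fin_digraph "back_quiver n" by (rule back_quiver_fin_digraph[OF n])
  interpret path_alg K "back_quiver n" ..
  have V: "verts (back_quiver n) \<noteq> {}" using n by (simp add: lessThan_empty_iff)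
  interpret coeff_algebra "truncated_path_algebra K (back_quiver n) k" K "back_quiver n" k "coset_coeff k"
    by (rule truncated_coeff_algebra[OF assms(2) V])
  interpret back_quiver_algebra "truncated_path_algebra K (back_quiver n) k" K n k "coset_coeff k"
    by unfold_locales (rule n)
  show "phi_dim (truncated_path_algebra K (back_quiver n) k) = enat (f_bound k n)" by (rule attained)
qed (use assms back_quiver_quiver in simp_all)


end
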